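(* Let $\Xi\subset\mathcal V_{\rm nc}$ be a full nc subset, let $\mathcal R,\mathcal U,\mathcal Y,\mathcal E$ be Hilbert spaces, let $Q_0\in\mathcal T(\Xi;\mathcal L(\mathcal R,\mathbb C)_{\rm nc})$, $\mathbb D_{Q_0}=\{Z\in\Xi:\|Q_0(Z)\|<1\}$, and let $k_{Q_0}$ be the associated scalar kernel on $\mathbb D_{Q_0}$ (see context). Let $\Omega\subset\mathbb D_{Q_0}$, $\Omega'=[\Omega]_{\rm full}\cap\mathbb D_{Q_0}$, and let $a\in\mathcal T(\Omega';\mathcal L(\mathcal Y,\mathcal E)_{\rm nc})$, $b\in\mathcal T(\Omega';\mathcal L(\mathcal U,\mathcal E)_{\rm nc})$. Then the following are equivalent: (1) There exists an $S:\mathbb D_{Q_0}\to\mathcal L(\mathcal U,\mathcal Y)_{\rm nc}$ in the contractive multiplier class $\overline{\mathcal B}\mathcal M(k_{Q_0}\otimes I_{\mathcal U},k_{Q_0}\otimes I_{\mathcal Y})$ such that $a(Z)S(Z)=b(Z)$ for all $Z\in\Omega$. (1$'$) $a(Z)a(Z)^*-b(Z)b(Z)^*\succeq0$ for all $Z\in\Omega'$. (2) The generalized de Branges-Rovnyak kernel $$K^{\rm dBR}_{a,b}(Z,W)(P)=a(Z)\big(k_{Q_0}(Z,W)(P)\otimes I_{\mathcal Y}\big)a(W)^*-b(Z)\big(k_{Q_0}(Z,W)(P)\otimes I_{\mathcal U}\big)b(W)^*$$ is a cp nc kernel on $\Omega$. (3) There exist an auxiliary Hilbert space $\mathcal X$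 and a contractive (even unitary) colligation matrix $$\mathbf U=\begin{bmatrix}A&B\\C&D\end{bmatrix}:\begin{bmatrix}\mathcal X\\\mathcal U\end{bmatrix}\to\begin{bmatrix}\mathcal R\otimes\mathcal X\\\mathcal Y\end{bmatrix}$$ so that the function $S$ defined by $$S(Z)=D^{(n)}+C^{(n)}\big(I-(Q_0(Z)\otimes I_{\mathcal X})A^{(n)}\big)^{-1}(Q_0(Z)\otimes I_{\mathcal X})B^{(n)}\qquad(Z\in\Omega_n),$$ with $A^{(n)}=I_n\otimes A$, $B^{(n)}=I_n\otimes B$, $C^{(n)}=I_n\otimes C$, $D^{(n)}=I_n\otimes D$, satisfies $a(Z)S(Z)=b(Z)$ for all $Z\in\Omega$. Moreover, the implications (2) $\Rightarrow$ (3) and (3) $\Rightarrow$ (1) hold under the weaker assumption that $a$ and $b$ are only graded (rather than nc) functions defined only from $\Omega$ to $\mathcal L(\mathcal Y,\mathcal E)_{\rm nc}$ and $\mathcal L(\mathcal U,\mathcal E)_{\rm nc}$ respectively.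
   Context: All vector spaces are over $\mathbb C$; $\mathcal V$ is a vector space. $\mathcal L(\mathcal H,\mathcal K)$ is the space of bounded operators between Hilbert spaces, $\mathcal L(\mathcal H,\mathcal K)^{n\times m}\cong\mathcal L(\mathcal H^m,\mathcal K^n)$. For $P\in\mathbb C^{n\times m}$, $P\otimes I_{\mathcal H}\in\mathcal L(\mathcal H^m,\mathcal H^n)$. For $Z\in\Xi_n$, $Q_0(Z)\in\mathcal L(\mathcal R^n,\mathbb C^n)$ and $Q_0(Z)\otimes I_{\mathcal X}:(\mathcal R\otimes\mathcal X)^n\to\mathcal X^n$. nc functions. $\mathcal V_{\rm nc}=\coprod_{n\ge1}\mathcal V^{n\times n}$, $\Omega_n=\Omega\cap\mathcal V^{n\times n}$. A function $f:\Omega\to\mathcal V_{0,{\rm nc}}$ ($\Omega\subset\mathcal V_{\rm nc}$, $\mathcal V_0$ a vector space) is graded if $f(\Omega_n)\subset\mathcal V_0^{n\times n}$; it is an nc function if it is graded and $Z\in\Omega_n$, $\widetilde Z\in\Omega_m$, $\alpha\in\mathbb C^{m\times n}$, $\alpha Z=\widetilde Z\alpha$ imply $\alpha f(Z)=f(\widetilde Z)\alpha$. $\mathcal T(\Omega;\mathcal V_{0,{\rm nc}})$ is the set of nc functions. Full nc sets. $\Xi\subset\mathcal V_{\rm nc}$ is a full nc subset if it is closed under direct sums ($Z,W\in\Xi\Rightarrow\left[\begin{smallmatrix}Z&0\\0&W\end{smallmatrix}\right]\in\Xi$) and $Z\in\Xi_n$, $\widetilde Z\in\mathcal V^{m\times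 m}$, $\mathcal I\widetilde Z=Z\mathcal I$ with $\mathcal I\in\mathbb C^{n\times m}$ injective imply $\widetilde Z\in\Xi_m$. $[\Omega]_{\rm full}$ is the smallest full nc subset contained in $\Xi$ and containing $\Omega$. cp nc kernels. For a Hilbert space $\mathcal H$, an nc kernel $K:\Omega\times\Omega\to\mathcal L(\mathbb C,\mathcal L(\mathcal H))_{\rm nc}$ assigns to $Z\in\Omega_n,W\in\Omega_m$ a linear map $K(Z,W):\mathbb C^{n\times m}\to\mathcal L(\mathcal H)^{n\times m}$ such that $\alpha K(Z,W)(P)\beta^*=K(\widetilde Z,\widetilde W)(\alpha P\beta^* )$ whenever $\alpha Z=\widetilde Z\alpha$, $\beta W=\widetilde W\beta$ ($Z,\widetilde Z,W,\widetilde W\in\Omega$, $\alpha,\beta$ complex matrices of suitable sizes) and $P\in\mathbb C^{n\times m}$. It is cp (completely positive) if for all $Z^{(i)}\in\Omega_{m_i}$, $i=1,\dots,n$, the map $[P_{ij}]\mapsto[K(Z^{(i)},Z^{(j)})(P_{ij})]$ from $\mathbb C^{N\times N}$ to $\mathcal L(\mathcal H)^{N\times N}$, $N=\sum m_i$, is positive. The kernel $k_{Q_0}$. For $W\in\mathbb D_{Q_0,m}$, $Q_0(W)^*:\mathbb C^m\to\mathbb C^m\otimes\mathcal R\cong\mathcal R^m$. Define $(L_{Q_0(W)^*})^{(0)}=I_{\mathbb C^m}$ and, for $k\ge1$, $(L_{Q_0(W)^*})^{(k)}=(Q_0(W)^*\otimes I_{\mathcal R^{\otimes(k-1)}})\cdots(Q_0(W)^*\otimes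 I_{\mathcal R})Q_0(W)^*:\mathbb C^m\to\mathbb C^m\otimes\mathcal R^{\otimes k}\cong(\mathcal R^{\otimes k})^m$. Then for $Z\in\mathbb D_{Q_0,n}$, $W\in\mathbb D_{Q_0,m}$, $P\in\mathbb C^{n\times m}$, $k_{Q_0}(Z,W)(P)=\sum_{k=0}^\infty(L_{Q_0(Z)^*})^{(k)*}(P\otimes I_{\mathcal R^{\otimes k}})(L_{Q_0(W)^*})^{(k)}\in\mathbb C^{n\times m}$; this is a cp nc kernel. $(k_{Q_0}\otimes I_{\mathcal H})(Z,W)(P)=k_{Q_0}(Z,W)(P)\otimes I_{\mathcal H}$. Multipliers. For a cp nc kernel $K:\mathbb D\times\mathbb D\to\mathcal L(\mathbb C,\mathcal L(\mathcal H))_{\rm nc}$ on an nc set $\mathbb D$ (a set closed under direct sums), $\mathcal H(K)$ is the Hilbert space of nc functions $f:\mathbb D\to\mathcal L(\mathbb C,\mathcal H)_{\rm nc}$ (so $f(Z)\in\mathcal L(\mathbb C^n,\mathcal H^n)$ for $Z\in\mathbb D_n$) that contains the functions $K_{W,v,y}(Z)u=K(Z,W)(uv)y$ ($W\in\mathbb D_m$, $v\in\mathbb C^{1\times m}$, $y\in\mathcal H^m$, $Z\in\mathbb D_n$, $u\in\mathbb C^n$) and satisfies $\langle f(W)v^*,y\rangle_{\mathcal H^m}=\langle f,K_{W,v,y}\rangle_{\mathcal H(K)}$. An nc function $S:\mathbb D\to\mathcal L(\mathcal U,\mathcal Y)_{\rm nc}$ belongs to $\overline{\mathcal B}\mathcal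 M(K',K)$ if $(M_Sf)(W)=S(W)f(W)$ defines an operator $M_S:\mathcal H(K')\to\mathcal H(K)$ with $\|M_S\|\le1$.
   Formalization: The "even unitary" form of (3) is stated only for R ≠ 0; for R = 0 it fails (e.g. a = b = 0, U = ℂ, Y = 0: no unitary from X ⊕ U to 0). The contractive form is stated for all R. *)

theory Defs
  imports
    "Jordan_Normal_Form.Matrix"
    "HOL-Analysis.Euclidean_Space"
    "HOL-Analysis.Infinite_Sum"
    "HOL-Library.FuncSet"
begin

section \<open>Complex vector spaces and complex Hilbert spaces\<close>

class complex_vector = ab_group_add +
  fixes scaleC :: "complex \<Rightarrow> 'a \<Rightarrow> 'a" (infixr "*\<^sub>C" 75)
  assumes scaleC_add_right: "c *\<^sub>C (x + y) = c *\<^sub>C x + c *\<^sub>C y"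
    and scaleC_add_left: "(c + d) *\<^sub>C x = c *\<^sub>C x + d *\<^sub>C x"
    and scaleC_scaleC: "c *\<^sub>C d *\<^sub>C x = (c * d) *\<^sub>C x"
    and scaleC_one: "1 *\<^sub>C x = x"

text \<open>Inner products are linear in the first argument. The real inner product and the norm
  of the library class are those induced by \<open>cinner\<close>.\<close>

class chilbert_space = complex_vector + real_inner + complete_space +
  fixes cinner :: "'a \<Rightarrow> 'a \<Rightarrow> complex"
  assumes scaleR_scaleC: "r *\<^sub>R x = of_real r *\<^sub>C x"
    and cinner_add_left: "cinner (x + y) z = cinner x z + cinner y z"
    and cinner_scaleC_left: "cinner (c *\<^sub>C x) y = c * cinner x y"
    and cinner_commute: "cinner x y = cnj (cinner y x)"
    and inner_eq_Re_cinner: "inner x y = Re (cinner x y)"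

lemma scaleC_zero_right [simp]: "c *\<^sub>C (0::'a::complex_vector) = 0"
  using scaleC_add_right [of c "0::'a" 0] by simp

lemma scaleC_zero_left [simp]: "0 *\<^sub>C (x::'a::complex_vector) = 0"
  using scaleC_add_left [of 0 0 x] by simp

lemma scaleC_minus_right: "c *\<^sub>C (- x) = - (c *\<^sub>C (x::'a::complex_vector))"
  using scaleC_add_right [of c x "- x"] by (simp add: eq_neg_iff_add_eq_0 add.commute)

lemma scaleC_diff_right: "c *\<^sub>C (x - y) = c *\<^sub>C x - c *\<^sub>C (y::'a::complex_vector)"
  using scaleC_add_right [of c x "- y"] by (simp add: scaleC_minus_right)

lemma cinner_self: "cinner x x = complex_of_real ((norm x)\<^sup>2)"
  for x :: "'a::chilbert_space"
proof -
  have "Im (cinner x x) = 0"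
    using arg_cong [OF cinner_commute [of x x], of Im] by simp
  then show ?thesis
    using inner_eq_Re_cinner [of x x] by (simp add: complex_eq_iff power2_norm_eq_inner)
qed

lemma cinner_zero_left [simp]: "cinner 0 y = 0" for y :: "'a::chilbert_space"
  using cinner_add_left [of 0 0 y] by simp

lemma cinner_zero_right [simp]: "cinner y 0 = 0" for y :: "'a::chilbert_space"
  by (subst cinner_commute) simp

lemma cinner_add_right: "cinner x (y + z) = cinner x y + cinner x z"
  for x y z :: "'a::chilbert_space"
  by (metis cinner_add_left cinner_commute complex_cnj_add)

lemma cinner_scaleC_right: "cinner x (c *\<^sub>C y) = cnj c * cinner x y"
  for x y :: "'a::chilbert_space"
  by (metis cinner_scaleC_left cinner_commute complex_cnj_mult)

lemma cinner_minus_left: "cinner (- x) y = - cinner x y" for x y :: "'a::chilbert_space"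
  using cinner_add_left [of x "- x" y] by (simp add: eq_neg_iff_add_eq_0 add.commute)

lemma cinner_diff_left: "cinner (x - z) y = cinner x y - cinner z y"
  for x y z :: "'a::chilbert_space"
  using cinner_add_left [of x "- z" y] by (simp add: cinner_minus_left)

lemma cinner_diff_right: "cinner y (x - z) = cinner y x - cinner y z"
  for x y z :: "'a::chilbert_space"
  by (metis cinner_diff_left cinner_commute complex_cnj_diff)

lemma cinner_sum_left: "cinner (sum f A) y = (\<Sum>i\<in>A. cinner (f i) y)"
  for y :: "'a::chilbert_space"
  by (induction A rule: infinite_finite_induct) (auto simp: cinner_add_left)

lemma cinner_sum_right: "cinner y (sum f A) = (\<Sum>i\<in>A. cinner y (f i))"
  for y :: "'a::chilbert_space"
  by (induction A rule: infinite_finite_induct) (auto simp: cinner_add_right)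

lemma norm_scaleC: "norm (c *\<^sub>C x) = cmod c * norm (x::'a::chilbert_space)"
proof -
  have "complex_of_real ((norm (c *\<^sub>C x))\<^sup>2) = (c * cnj c) * cinner x x"
    by (simp only: cinner_self [symmetric] cinner_scaleC_left cinner_scaleC_right mult_ac)
  also have "\<dots> = complex_of_real ((cmod c * norm x)\<^sup>2)"
    by (simp add: cinner_self complex_norm_square [symmetric] power_mult_distrib)
  finally have "(norm (c *\<^sub>C x))\<^sup>2 = (cmod c * norm x)\<^sup>2"
    using of_real_eq_iff by blast
  then show ?thesis
    by (simp add: power2_eq_iff_nonneg)
qed

lemma Cauchy_Schwarz_cinner: "cmod (cinner x y) \<le> norm x * norm (y::'a::chilbert_space)"
proof (cases "cinner x y = 0")
  case False
  define w where "w = cnj (cinner x y) / cmod (cinner x y)"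
  have w: "cmod w = 1"
    using False by (simp add: w_def norm_divide)
  have "w * cinner x y = cmod (cinner x y)"
    using False by (simp add: w_def complex_norm_square [symmetric] power2_eq_square mult.commute)
  then have "cmod (cinner x y) = inner (w *\<^sub>C x) y"
    by (simp add: inner_eq_Re_cinner cinner_scaleC_left)
  also have "\<dots> \<le> norm (w *\<^sub>C x) * norm y"
    by (rule norm_cauchy_schwarz)
  finally show ?thesis
    by (simp add: norm_scaleC w)
qed simp

instantiation complex :: chilbert_space
begin
definition "scaleC c (x::complex) = c * x"
definition "cinner (x::complex) y = x * cnj y"
instance
  by standard (auto simp: scaleC_complex_def cinner_complex_def inner_complex_def
      algebra_simps scaleR_conv_of_real)
end

instantiation prod :: (complex_vector, complex_vector) complex_vector
begin
definition "scaleC c z = (c *\<^sub>C fst z, c *\<^sub>C snd z)"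
instance
  by standard (auto simp: scaleC_prod_def prod_eq_iff scaleC_add_left scaleC_add_right
      scaleC_scaleC scaleC_one)
end

instantiation prod :: (chilbert_space, chilbert_space) chilbert_space
begin
definition "cinner z w = cinner (fst z) (fst w) + cinner (snd z) (snd w)"
instance
  by standard (auto simp: scaleC_prod_def cinner_prod_def prod_eq_iff cinner_add_left
      cinner_scaleC_left scaleR_scaleC inner_prod_def inner_eq_Re_cinner algebra_simps
      cinner_commute [symmetric])
end

section \<open>Bounded operators\<close>

definition bounded_clinear :: "('a::chilbert_space \<Rightarrow> 'b::chilbert_space) \<Rightarrow> bool" where
  "bounded_clinear f \<longleftrightarrow> bounded_linear f \<and> (\<forall>c x. f (c *\<^sub>C x) = c *\<^sub>C f x)"

typedef (overloaded) ('a::chilbert_space, 'b::chilbert_space) cblinfun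
    ("(_ \<Rightarrow>\<^sub>C\<^sub>L /_)" [22, 21] 21)
  = "{f :: 'a \<Rightarrow> 'b. bounded_clinear f}"
  morphisms cblinfun_apply CBlinfun
  by (rule exI [of _ "\<lambda>_. 0"]) (simp add: bounded_clinear_def)

declare [[coercion "cblinfun_apply"]]

setup_lifting type_definition_cblinfun

lemma cblinfun_eqI: "(\<And>x. f x = g x) \<Longrightarrow> f = g" for f g :: "'a::chilbert_space \<Rightarrow>\<^sub>C\<^sub>L 'b::chilbert_space"
  by transfer auto

instantiation cblinfun :: (chilbert_space, chilbert_space) complex_vector
begin

lift_definition zero_cblinfun :: "'a \<Rightarrow>\<^sub>C\<^sub>L 'b" is "\<lambda>_. 0"
  by (simp add: bounded_clinear_def)

lift_definition plus_cblinfun :: "('a \<Rightarrow>\<^sub>C\<^sub>L 'b) \<Rightarrow> ('a \<Rightarrow>\<^sub>C\<^sub>L 'b) \<Rightarrow> 'a \<Rightarrow>\<^sub>C\<^sub>L 'b"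
  is "\<lambda>f g x. f x + g x"
  by (simp add: bounded_clinear_def bounded_linear_add scaleC_add_right)

lift_definition uminus_cblinfun :: "('a \<Rightarrow>\<^sub>C\<^sub>L 'b) \<Rightarrow> 'a \<Rightarrow>\<^sub>C\<^sub>L 'b" is "\<lambda>f x. - f x"
  by (simp add: bounded_clinear_def bounded_linear_minus scaleC_minus_right)

lift_definition minus_cblinfun :: "('a \<Rightarrow>\<^sub>C\<^sub>L 'b) \<Rightarrow> ('a \<Rightarrow>\<^sub>C\<^sub>L 'b) \<Rightarrow> 'a \<Rightarrow>\<^sub>C\<^sub>L 'b"
  is "\<lambda>f g x. f x - g x"
  by (simp add: bounded_clinear_def bounded_linear_sub scaleC_diff_right)

lift_definition scaleC_cblinfun :: "complex \<Rightarrow> ('a \<Rightarrow>\<^sub>C\<^sub>L 'b) \<Rightarrow> 'a \<Rightarrow>\<^sub>C\<^sub>L 'b"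
  is "\<lambda>c f x. c *\<^sub>C f x"
proof -
  fix c and f :: "'a \<Rightarrow> 'b"
  assume f: "bounded_clinear f"
  then interpret bounded_linear f
    by (simp add: bounded_clinear_def)
  obtain K where K: "\<And>x. norm (f x) \<le> norm x * K"
    using bounded by blast
  have "bounded_linear (\<lambda>x. c *\<^sub>C f x)"
  proof (rule bounded_linear_intro [where K = "cmod c * K"])
    show "c *\<^sub>C f (r *\<^sub>R x) = r *\<^sub>R c *\<^sub>C f x" for r x
      by (simp only: scaleR) (simp add: scaleR_scaleC scaleC_scaleC mult.commute)
    show "norm (c *\<^sub>C f x) \<le> norm x * (cmod c * K)" for x
      using mult_left_mono [OF K [of x], of "cmod c"] by (simp add: norm_scaleC mult_ac)
  qed (simp add: add scaleC_add_right)
  with f show "bounded_clinear (\<lambda>x. c *\<^sub>C f x)"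
    by (simp add: bounded_clinear_def scaleC_scaleC mult.commute)
qed

instance
  by standard (transfer, auto simp: scaleC_add_left scaleC_add_right scaleC_scaleC scaleC_one)+

end

lift_definition cblinfun_id :: "'a::chilbert_space \<Rightarrow>\<^sub>C\<^sub>L 'a" is "\<lambda>x. x"
  by (simp add: bounded_clinear_def)

lift_definition cblinfun_compose ::
    "('b::chilbert_space \<Rightarrow>\<^sub>C\<^sub>L 'c::chilbert_space) \<Rightarrow> ('a::chilbert_space \<Rightarrow>\<^sub>C\<^sub>L 'b) \<Rightarrow> 'a \<Rightarrow>\<^sub>C\<^sub>L 'c"
    (infixl "o\<^sub>C\<^sub>L" 67)
  is "\<lambda>f g x. f (g x)"
  by (auto simp: bounded_clinear_def intro: bounded_linear_compose)

definition cadjoint :: "('a::chilbert_space \<Rightarrow>\<^sub>C\<^sub>L 'b::chilbert_space) \<Rightarrow> 'b \<Rightarrow>\<^sub>C\<^sub>L 'a" where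
  "cadjoint T = (THE T' :: 'b \<Rightarrow>\<^sub>C\<^sub>L 'a. \<forall>x y. cinner (T x) y = cinner x (T' y))"

lift_definition vector_to_cblinfun :: "'h::chilbert_space \<Rightarrow> complex \<Rightarrow>\<^sub>C\<^sub>L 'h"
  is "\<lambda>h c. c *\<^sub>C h"
proof -
  fix h :: 'h
  have "bounded_linear (\<lambda>c. c *\<^sub>C h)"
    by (rule bounded_linear_intro [where K = "norm h"])
      (simp_all add: norm_scaleC scaleC_add_left scaleR_scaleC scaleC_scaleC scaleC_complex_def)
  then show "bounded_clinear (\<lambda>c. c *\<^sub>C h)"
    by (simp add: bounded_clinear_def scaleC_scaleC scaleC_complex_def)
qed

section \<open>Hilbert direct sums, orthonormal bases and tensor powers\<close>

typedef (overloaded) ('i, 'h::chilbert_space) l2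
  = "{f :: 'i \<Rightarrow> 'h. (\<lambda>i. (norm (f i))\<^sup>2) summable_on UNIV}"
  morphisms l2_nth Abs_l2
  by (rule exI [of _ "\<lambda>_. 0"]) simp

setup_lifting type_definition_l2

lemma l2_add_summable:
  fixes f g :: "'i \<Rightarrow> 'h::chilbert_space"
  assumes "(\<lambda>i. (norm (f i))\<^sup>2) summable_on UNIV" "(\<lambda>i. (norm (g i))\<^sup>2) summable_on UNIV"
  shows "(\<lambda>i. (norm (f i + g i))\<^sup>2) summable_on UNIV"
proof (rule summable_on_comparison_test)
  show "(\<lambda>i. 2 * ((norm (f i))\<^sup>2 + (norm (g i))\<^sup>2)) summable_on UNIV"
    by (intro summable_on_cmult_right summable_on_add assms)
  show "(norm (f i + g i))\<^sup>2 \<le> 2 * ((norm (f i))\<^sup>2 + (norm (g i))\<^sup>2)" for i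
  proof -
    have "(norm (f i + g i))\<^sup>2 \<le> (norm (f i) + norm (g i))\<^sup>2"
      by (intro power_mono norm_triangle_ineq) auto
    also have "\<dots> \<le> 2 * ((norm (f i))\<^sup>2 + (norm (g i))\<^sup>2)"
      using sum_squares_bound [of "norm (f i)" "norm (g i)"] by (simp add: power2_sum)
    finally show ?thesis .
  qed
qed simp

lemma l2_scaleC_summable:
  fixes f :: "'i \<Rightarrow> 'h::chilbert_space"
  assumes "(\<lambda>i. (norm (f i))\<^sup>2) summable_on UNIV"
  shows "(\<lambda>i. (norm (c *\<^sub>C f i))\<^sup>2) summable_on UNIV"
  using summable_on_cmult_right [OF assms, of "(cmod c)\<^sup>2"]
  by (simp add: norm_scaleC power_mult_distrib)

lemma l2_cinner_summable:
  fixes f g :: "'i \<Rightarrow> 'h::chilbert_space"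
  assumes "(\<lambda>i. (norm (f i))\<^sup>2) summable_on UNIV" "(\<lambda>i. (norm (g i))\<^sup>2) summable_on UNIV"
  shows "(\<lambda>i. cinner (f i) (g i)) summable_on UNIV"
proof (rule abs_summable_summable, rule abs_summable_on_comparison_test')
  show "(\<lambda>i. (norm (f i))\<^sup>2 + (norm (g i))\<^sup>2) summable_on UNIV"
    by (intro summable_on_add assms)
  show "norm (cinner (f i) (g i)) \<le> (norm (f i))\<^sup>2 + (norm (g i))\<^sup>2" for i
    using Cauchy_Schwarz_cinner [of "f i" "g i"] sum_squares_bound [of "norm (f i)" "norm (g i)"]
      mult_nonneg_nonneg [OF norm_ge_zero [of "f i"] norm_ge_zero [of "g i"]]
    by linarith
qed

instantiation l2 :: (type, chilbert_space) complex_vector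
begin

lift_definition zero_l2 :: "('a, 'b) l2" is "\<lambda>_. 0" by simp

lift_definition plus_l2 :: "('a, 'b) l2 \<Rightarrow> ('a, 'b) l2 \<Rightarrow> ('a, 'b) l2" is "\<lambda>f g i. f i + g i"
  by (rule l2_add_summable)

lift_definition uminus_l2 :: "('a, 'b) l2 \<Rightarrow> ('a, 'b) l2" is "\<lambda>f i. - f i" by simp

lift_definition minus_l2 :: "('a, 'b) l2 \<Rightarrow> ('a, 'b) l2 \<Rightarrow> ('a, 'b) l2" is "\<lambda>f g i. f i - g i"
proof -
  fix f g :: "'a \<Rightarrow> 'b"
  assume "(\<lambda>i. (norm (f i))\<^sup>2) summable_on UNIV" "(\<lambda>i. (norm (g i))\<^sup>2) summable_on UNIV"
  then show "(\<lambda>i. (norm (f i - g i))\<^sup>2) summable_on UNIV"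
    using l2_add_summable [of f "\<lambda>i. - g i"] by simp
qed

lift_definition scaleC_l2 :: "complex \<Rightarrow> ('a, 'b) l2 \<Rightarrow> ('a, 'b) l2" is "\<lambda>c f i. c *\<^sub>C f i"
  by (rule l2_scaleC_summable)

instance
  by standard (transfer, auto simp: scaleC_add_left scaleC_add_right scaleC_scaleC scaleC_one)+

end

lemma l2_eqI: "(\<And>i. l2_nth f i = l2_nth g i) \<Longrightarrow> f = g"
  by transfer auto

lemma l2_nth_summable: "(\<lambda>i. (norm (l2_nth f i))\<^sup>2) summable_on UNIV"
  by transfer

lemma l2_nth_simps [simp]:
  "l2_nth 0 i = 0" "l2_nth (f + g) i = l2_nth f i + l2_nth g i"
  "l2_nth (f - g) i = l2_nth f i - l2_nth g i" "l2_nth (- f) i = - l2_nth f i"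
  "l2_nth (c *\<^sub>C f) i = c *\<^sub>C l2_nth f i"
  by (transfer, simp)+

instantiation l2 :: (type, chilbert_space) real_inner
begin

definition "scaleR r (f :: ('a, 'b) l2) = complex_of_real r *\<^sub>C f"
definition "inner (f :: ('a, 'b) l2) g = Re (\<Sum>\<^sub>\<infinity>i. cinner (l2_nth f i) (l2_nth g i))"
definition "norm (f :: ('a, 'b) l2) = sqrt (inner f f)"
definition "sgn (f :: ('a, 'b) l2) = inverse (norm f) *\<^sub>R f"
definition "dist (f :: ('a, 'b) l2) g = norm (f - g)"
definition [code del]: "(uniformity :: (('a, 'b) l2 \<times> ('a, 'b) l2) filter)
  = (INF e\<in>{0<..}. principal {(x, y). dist x y < e})"
definition [code del]: "open (U :: ('a, 'b) l2 set)
  \<longleftrightarrow> (\<forall>x\<in>U. eventually (\<lambda>(x', y). x' = x \<longrightarrow> y \<in> U) uniformity)"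

lemma l2_inner_self: "inner f f = (\<Sum>\<^sub>\<infinity>i. (norm (l2_nth f i))\<^sup>2)" for f :: "('a, 'b) l2"
proof -
  have "((\<lambda>i. (norm (l2_nth f i))\<^sup>2) has_sum (\<Sum>\<^sub>\<infinity>i. (norm (l2_nth f i))\<^sup>2)) UNIV"
    by (rule has_sum_infsum [OF l2_nth_summable])
  from infsumI [OF has_sum_of_real [OF this, where 'a = complex]] show ?thesis
    by (simp add: inner_l2_def cinner_self)
qed

instance
proof
  fix f g h :: "('a, 'b) l2" and r s :: real
  show "r *\<^sub>R (f + g) = r *\<^sub>R f + r *\<^sub>R g" "(r + s) *\<^sub>R f = r *\<^sub>R f + s *\<^sub>R f"
    "r *\<^sub>R s *\<^sub>R f = (r * s) *\<^sub>R f" "1 *\<^sub>R f = f"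
    by (auto simp: scaleR_l2_def scaleC_add_left scaleC_add_right scaleC_scaleC scaleC_one)
  show "inner f g = inner g f"
  proof -
    have "(\<Sum>\<^sub>\<infinity>i. cinner (l2_nth f i) (l2_nth g i))
        = (\<Sum>\<^sub>\<infinity>i. cnj (cinner (l2_nth g i) (l2_nth f i)))"
      by (simp flip: cinner_commute)
    then show ?thesis
      by (simp add: inner_l2_def infsum_cnj)
  qed
  show "inner (f + g) h = inner f h + inner g h"
    by (simp add: inner_l2_def cinner_add_left infsum_add l2_cinner_summable l2_nth_summable)
  show "inner (r *\<^sub>R f) g = r * inner f g"
    by (simp add: inner_l2_def scaleR_l2_def cinner_scaleC_left infsum_cmult_right
        l2_cinner_summable l2_nth_summable)
  show "0 \<le> inner f f"
    unfolding l2_inner_self by (rule infsum_nonneg) simp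
  show "inner f f = 0 \<longleftrightarrow> f = 0"
  proof
    assume "inner f f = 0"
    then have "(norm (l2_nth f i))\<^sup>2 = 0" for i
      using nonneg_infsum_le_0D [OF _ l2_nth_summable [of f]] by (auto simp: l2_inner_self)
    then show "f = 0"
      by (intro l2_eqI) simp
  qed (simp add: l2_inner_self)
qed (simp_all add: norm_l2_def sgn_l2_def dist_l2_def uniformity_l2_def open_l2_def)

end

lemma norm_l2_power2: "(norm f)\<^sup>2 = (\<Sum>\<^sub>\<infinity>i. (norm (l2_nth f i))\<^sup>2)"
  by (simp add: power2_norm_eq_inner l2_inner_self)

lemma norm_l2_nth_le: "norm (l2_nth f i) \<le> norm f"
proof (rule power2_le_imp_le)
  have "sum (\<lambda>i. (norm (l2_nth f i))\<^sup>2) {i} \<le> (\<Sum>\<^sub>\<infinity>i. (norm (l2_nth f i))\<^sup>2)"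
    by (rule finite_sum_le_infsum [OF l2_nth_summable]) auto
  then show "(norm (l2_nth f i))\<^sup>2 \<le> (norm f)\<^sup>2"
    by (simp add: norm_l2_power2)
qed simp

lemma l2_sum_le: "finite A \<Longrightarrow> (\<Sum>i\<in>A. (norm (l2_nth f i))\<^sup>2) \<le> (norm f)\<^sup>2"
  unfolding norm_l2_power2 by (rule finite_sum_le_infsum [OF l2_nth_summable]) auto

instantiation l2 :: (type, chilbert_space) chilbert_space
begin

definition "cinner (f :: ('a, 'b) l2) g = (\<Sum>\<^sub>\<infinity>i. cinner (l2_nth f i) (l2_nth g i))"

instance
proof
  fix f g h :: "('a, 'b) l2" and r :: real and c :: complex
  show "r *\<^sub>R f = complex_of_real r *\<^sub>C f"
    by (simp add: scaleR_l2_def)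
  show "cinner (f + g) h = cinner f h + cinner g h"
    by (simp add: cinner_l2_def cinner_add_left infsum_add l2_cinner_summable l2_nth_summable)
  show "cinner (c *\<^sub>C f) g = c * cinner f g"
    by (simp add: cinner_l2_def cinner_scaleC_left infsum_cmult_right
        l2_cinner_summable l2_nth_summable)
  show "cinner f g = cnj (cinner g f)"
    by (simp add: cinner_l2_def flip: infsum_cnj cinner_commute)
  show "inner f g = Re (cinner f g)"
    by (simp add: inner_l2_def cinner_l2_def)
next
  fix X :: "nat \<Rightarrow> ('a, 'b) l2"
  assume X: "Cauchy X"
  have "Cauchy (\<lambda>n. l2_nth (X n) i)" for i
  proof (rule metric_CauchyI)
    fix e :: real assume "e > 0"
    then obtain M where M: "\<And>m n. m \<ge> M \<Longrightarrow> n \<ge> M \<Longrightarrow> dist (X m) (X n) < e"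
      using metric_CauchyD [OF X] by blast
    have "dist (l2_nth (X m) i) (l2_nth (X n) i) < e" if "m \<ge> M" "n \<ge> M" for m n
      using norm_l2_nth_le [of "X m - X n" i] M [OF that] by (simp add: dist_norm)
    then show "\<exists>M. \<forall>m\<ge>M. \<forall>n\<ge>M. dist (l2_nth (X m) i) (l2_nth (X n) i) < e"
      by blast
  qed
  then have "\<exists>l. (\<lambda>n. l2_nth (X n) i) \<longlonglongrightarrow> l" for i
    using Cauchy_convergent convergent_def by blast
  then obtain L where L: "\<And>i. (\<lambda>n. l2_nth (X n) i) \<longlonglongrightarrow> L i"
    by metis
  have tail: "\<exists>M. \<forall>m\<ge>M. \<forall>A. finite A \<longrightarrow> (\<Sum>i\<in>A. (norm (l2_nth (X m) i - L i))\<^sup>2) \<le> e\<^sup>2"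
    if "e > 0" for e :: real
  proof -
    obtain M where M: "\<And>m n. m \<ge> M \<Longrightarrow> n \<ge> M \<Longrightarrow> dist (X m) (X n) < e"
      using metric_CauchyD [OF X \<open>e > 0\<close>] by blast
    have "(\<Sum>i\<in>A. (norm (l2_nth (X m) i - L i))\<^sup>2) \<le> e\<^sup>2" if "m \<ge> M" "finite A" for m A
    proof (rule tendsto_upperbound)
      show "(\<lambda>n. \<Sum>i\<in>A. (norm (l2_nth (X m) i - l2_nth (X n) i))\<^sup>2)
          \<longlonglongrightarrow> (\<Sum>i\<in>A. (norm (l2_nth (X m) i - L i))\<^sup>2)"
        by (intro tendsto_intros L)
      have "(\<Sum>i\<in>A. (norm (l2_nth (X m) i - l2_nth (X n) i))\<^sup>2) \<le> e\<^sup>2" if "n \<ge> M" for n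
      proof -
        have "(\<Sum>i\<in>A. (norm (l2_nth (X m) i - l2_nth (X n) i))\<^sup>2) \<le> (norm (X m - X n))\<^sup>2"
          using l2_sum_le [OF \<open>finite A\<close>, of "X m - X n"] by simp
        also have "\<dots> \<le> e\<^sup>2"
          using M [OF \<open>m \<ge> M\<close> that] by (intro power_mono) (auto simp: dist_norm)
        finally show ?thesis .
      qed
      then show "\<forall>\<^sub>F n in sequentially. (\<Sum>i\<in>A. (norm (l2_nth (X m) i - l2_nth (X n) i))\<^sup>2) \<le> e\<^sup>2"
        using eventually_sequentially by blast
    qed simp
    then show ?thesis by blast
  qed
  have diff: "(\<lambda>i. (norm (l2_nth (X m) i - L i))\<^sup>2) summable_on UNIV"
    if "\<And>A. finite A \<Longrightarrow> (\<Sum>i\<in>A. (norm (l2_nth (X m) i - L i))\<^sup>2) \<le> e\<^sup>2" for m and e :: real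
    by (rule nonneg_bdd_above_summable_on) (use that in \<open>auto simp: bdd_above_def\<close>)
  obtain M1 where M1: "\<And>A. finite A \<Longrightarrow> (\<Sum>i\<in>A. (norm (l2_nth (X M1) i - L i))\<^sup>2) \<le> 1\<^sup>2"
    using tail [of 1] by auto
  have "(\<lambda>i. (norm (l2_nth (X M1) i + - (l2_nth (X M1) i - L i)))\<^sup>2) summable_on UNIV"
    by (intro l2_add_summable l2_nth_summable) (use diff [OF M1] in \<open>simp add: norm_minus_commute\<close>)
  then have Ls: "(\<lambda>i. (norm (L i))\<^sup>2) summable_on UNIV"
    by simp
  define Y where "Y = Abs_l2 L"
  have Y: "l2_nth Y = L"
    unfolding Y_def using Ls by (intro Abs_l2_inverse) simp
  have "X \<longlonglongrightarrow> Y"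
  proof (rule metric_LIMSEQ_I)
    fix e :: real assume e: "e > 0"
    then obtain M where M: "\<And>m A. m \<ge> M \<Longrightarrow> finite A \<Longrightarrow>
        (\<Sum>i\<in>A. (norm (l2_nth (X m) i - L i))\<^sup>2) \<le> (e / 2)\<^sup>2"
      using tail [of "e / 2"] by auto
    have "dist (X m) Y < e" if "m \<ge> M" for m
    proof -
      have "(norm (X m - Y))\<^sup>2 \<le> (e / 2)\<^sup>2"
        unfolding norm_l2_power2 l2_nth_simps Y
        by (rule infsum_le_finite_sums [OF diff [OF M [OF that]]]) (auto intro: M [OF that])
      then have "norm (X m - Y) \<le> e / 2"
        using power2_le_imp_le [of "norm (X m - Y)" "e / 2"] e by simp
      then show ?thesis
        using e by (simp add: dist_norm)
    qed
    then show "\<exists>no. \<forall>n\<ge>no. dist (X n) Y < e" by blast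
  qed
  then show "convergent X"
    by (auto simp: convergent_def)
qed

end


definition is_onb :: "'h::chilbert_space set \<Rightarrow> bool" where
  "is_onb B \<longleftrightarrow> (\<forall>x\<in>B. norm x = 1) \<and> (\<forall>x\<in>B. \<forall>y\<in>B. x \<noteq> y \<longrightarrow> cinner x y = 0)
    \<and> (\<forall>x. (\<forall>b\<in>B. cinner x b = 0) \<longrightarrow> x = 0)"

definition onb :: "'h::chilbert_space set" where
  "onb = (SOME B. is_onb B)"

lemma is_onb_onb: "is_onb (onb :: 'h::chilbert_space set)"
proof -
  define \<O> where "\<O> = {B :: 'h set. (\<forall>x\<in>B. norm x = 1) \<and> (\<forall>x\<in>B. \<forall>y\<in>B. x \<noteq> y \<longrightarrow> cinner x y = 0)}"
  have "\<exists>M\<in>\<O>. \<forall>X\<in>\<O>. M \<subseteq> X \<longrightarrow> X = M"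
  proof (rule subset_Zorn')
    fix \<C> assume C: "subset.chain \<O> \<C>"
    have "cinner x y = 0" if "x \<in> \<Union>\<C>" "y \<in> \<Union>\<C>" "x \<noteq> y" for x y
    proof -
      from that obtain X Y where XY: "X \<in> \<C>" "Y \<in> \<C>" "x \<in> X" "y \<in> Y"
        by blast
      then have "X \<subseteq> Y \<or> Y \<subseteq> X"
        using C by (auto simp: subset.chain_def)
      with XY C that show ?thesis
        unfolding subset.chain_def \<O>_def by blast
    qed
    moreover have "norm x = 1" if "x \<in> \<Union>\<C>" for x
      using that C unfolding subset.chain_def \<O>_def by blast
    ultimately show "\<Union>\<C> \<in> \<O>"
      by (simp add: \<O>_def)
  qed
  then obtain M where M: "M \<in> \<O>" and max: "\<And>X. X \<in> \<O> \<Longrightarrow> M \<subseteq> X \<Longrightarrow> X = M"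
    by blast
  have "x = 0" if x: "\<forall>b\<in>M. cinner x b = 0" for x
  proof (rule ccontr)
    assume "x \<noteq> 0"
    define u where "u = (1 / norm x) *\<^sub>R x"
    have "norm u = 1"
      using \<open>x \<noteq> 0\<close> by (simp add: u_def)
    have u: "cinner u b = 0" if "b \<in> M" for b
      using x that by (simp add: u_def scaleR_scaleC cinner_scaleC_left)
    then have u': "cinner b u = 0" if "b \<in> M" for b
      using that by (metis cinner_commute complex_cnj_zero)
    have "insert u M \<in> \<O>"
      using M u u' \<open>norm u = 1\<close> by (auto simp: \<O>_def)
    then have "u \<in> M"
      using max by blast
    then show False
      using u [of u] \<open>norm u = 1\<close> by (simp add: cinner_self)
  qed
  with M have "is_onb M"
    by (auto simp: is_onb_def \<O>_def)
  then show ?thesis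
    unfolding onb_def by (rule someI)
qed

lemma cinner_onb: "a \<in> onb \<Longrightarrow> b \<in> onb \<Longrightarrow> cinner a b = (if a = b then 1 else 0)"
  using is_onb_onb by (auto simp: is_onb_def cinner_self)

lemma cinner_onb_sum:
  assumes "finite F" "F \<subseteq> onb" "b \<in> onb"
  shows "cinner (\<Sum>a\<in>F. c a *\<^sub>C a) b = (if b \<in> F then c b else 0)"
proof -
  have "cinner (\<Sum>a\<in>F. c a *\<^sub>C a) b = (\<Sum>a\<in>F. if a = b then c b else 0)"
    unfolding cinner_sum_left
    by (rule sum.cong) (use assms in \<open>auto simp: cinner_scaleC_left cinner_onb subset_iff\<close>)
  then show ?thesis
    using assms by simp
qed

lemma norm_onb_sum:
  assumes "finite F" "F \<subseteq> onb"
  shows "(norm (\<Sum>b\<in>F. c b *\<^sub>C b))\<^sup>2 = (\<Sum>b\<in>F. (cmod (c b))\<^sup>2)"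
proof -
  let ?y = "\<Sum>b\<in>F. c b *\<^sub>C b"
  have "complex_of_real ((norm ?y)\<^sup>2) = cinner ?y ?y"
    by (simp only: cinner_self)
  also have "\<dots> = (\<Sum>b\<in>F. cnj (c b) * cinner ?y b)"
    by (simp add: cinner_sum_right cinner_scaleC_right)
  also have "\<dots> = (\<Sum>b\<in>F. complex_of_real ((cmod (c b))\<^sup>2))"
    by (rule sum.cong)
      (use assms in \<open>auto simp: cinner_onb_sum subset_iff complex_norm_square mult.commute
        simp del: of_real_power\<close>)
  finally show ?thesis
    using of_real_eq_iff by (simp only: of_real_sum [symmetric]) blast
qed

lemma onb_residual:
  fixes x :: "'h::chilbert_space"
  assumes "finite F" "F \<subseteq> onb"
  shows "(norm (x - (\<Sum>b\<in>F. cinner x b *\<^sub>C b)))\<^sup>2 = (norm x)\<^sup>2 - (\<Sum>b\<in>F. (cmod (cinner x b))\<^sup>2)"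
proof -
  let ?y = "\<Sum>b\<in>F. cinner x b *\<^sub>C b"
  have xy: "cinner x ?y = complex_of_real (\<Sum>b\<in>F. (cmod (cinner x b))\<^sup>2)"
    by (simp add: cinner_sum_right cinner_scaleC_right complex_norm_square mult.commute
        del: of_real_power)
  have yy: "cinner ?y ?y = complex_of_real (\<Sum>b\<in>F. (cmod (cinner x b))\<^sup>2)"
    unfolding cinner_self norm_onb_sum [OF assms] by (rule refl)
  have "complex_of_real ((norm (x - ?y))\<^sup>2) = cinner (x - ?y) (x - ?y)"
    by (simp only: cinner_self)
  also have "\<dots> = cinner x x - cinner x ?y - cnj (cinner x ?y) + cinner ?y ?y"
    by (simp add: cinner_diff_left cinner_diff_right flip: cinner_commute)
  also have "\<dots> = complex_of_real ((norm x)\<^sup>2 - (\<Sum>b\<in>F. (cmod (cinner x b))\<^sup>2))"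
    unfolding xy yy by (simp add: cinner_self)
  finally show ?thesis
    using of_real_eq_iff by blast
qed

lemma onb_Bessel:
  fixes x :: "'h::chilbert_space"
  assumes "finite F" "F \<subseteq> onb"
  shows "(\<Sum>b\<in>F. (cmod (cinner x b))\<^sup>2) \<le> (norm x)\<^sup>2"
  using onb_residual [OF assms, of x] zero_le_power2 [of "norm (x - (\<Sum>b\<in>F. cinner x b *\<^sub>C b))"]
  by linarith

lemma onb_coeff_summable: "(\<lambda>b. (cmod (cinner x b))\<^sup>2) summable_on onb"
  by (rule nonneg_bdd_above_summable_on) (use onb_Bessel in \<open>auto simp: bdd_above_def\<close>)

lemma onb_Parseval:
  fixes x :: "'h::chilbert_space"
  shows "(\<Sum>\<^sub>\<infinity>b\<in>onb. (cmod (cinner x b))\<^sup>2) = (norm x)\<^sup>2"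
proof -
  define D where "D F = (\<Sum>b\<in>F. (cmod (cinner x b))\<^sup>2)" for F
  define y where "y F = (\<Sum>b\<in>F. cinner x b *\<^sub>C b)" for F
  define S where "S = (\<Sum>\<^sub>\<infinity>b\<in>onb. (cmod (cinner x b))\<^sup>2)"
  have le_S: "D F \<le> S" if "finite F" "F \<subseteq> onb" for F
    unfolding D_def S_def by (rule finite_sum_le_infsum [OF onb_coeff_summable that]) simp
  have S_le: "S \<le> (norm x)\<^sup>2"
    unfolding S_def
    by (rule infsum_le_finite_sums [OF onb_coeff_summable]) (rule onb_Bessel)
  have "\<exists>F. finite F \<and> F \<subseteq> onb \<and> S - D F < 1 / Suc n" for n
  proof (rule ccontr)
    assume "\<not> ?thesis"
    then have "D F \<le> S - 1 / Suc n" if "finite F" "F \<subseteq> onb" for F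
      using that by (metis diff_le_eq add.commute not_less le_diff_eq)
    then have "S \<le> S - 1 / Suc n"
      unfolding D_def by (subst (1) S_def) (rule infsum_le_finite_sums [OF onb_coeff_summable])
    then show False by simp
  qed
  then obtain F where F: "\<And>n. finite (F n)" "\<And>n. F n \<subseteq> onb" "\<And>n. S - D (F n) < 1 / Suc n"
    by metis
  define G where "G n = (\<Union>k\<le>n. F k)" for n :: nat
  have G: "finite (G n)" "G n \<subseteq> onb" for n
    using F by (auto simp: G_def)
  have G_mono: "G m \<subseteq> G n" if "m \<le> n" for m n
    using that by (force simp: G_def)
  have SG: "S - D (G n) < 1 / Suc n" for n
  proof -
    have "D (F n) \<le> D (G n)"
      unfolding D_def by (rule sum_mono2) (use G in \<open>auto simp: G_def\<close>)
    then show ?thesis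
      using F(3) [of n] by linarith
  qed
  have SG0: "(\<lambda>n. S - D (G n)) \<longlonglongrightarrow> 0"
  proof (rule tendsto_sandwich)
    show "\<forall>\<^sub>F n in sequentially. 0 \<le> S - D (G n)"
      using le_S [OF G] by simp
    show "\<forall>\<^sub>F n in sequentially. S - D (G n) \<le> 1 / Suc n"
      by (intro always_eventually allI less_imp_le SG)
    show "(\<lambda>n. 1 / real (Suc n)) \<longlonglongrightarrow> 0"
      using LIMSEQ_inverse_real_of_nat by (simp add: inverse_eq_divide)
  qed simp
  have yG: "(norm (y (G n) - y (G m)))\<^sup>2 < 1 / Suc m" if "m \<le> n" for m n
  proof -
    have "y (G n) - y (G m) = y (G n - G m)"
      unfolding y_def using sum_diff [OF G(1) G_mono [OF that]] by metis
    then have "(norm (y (G n) - y (G m)))\<^sup>2 = D (G n - G m)"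
      unfolding y_def D_def using norm_onb_sum [of "G n - G m"] G by auto
    also have "\<dots> = D (G n) - D (G m)"
      unfolding D_def using sum_diff [OF G(1) G_mono [OF that]] by metis
    finally show ?thesis
      using SG [of m] le_S [OF G, of n] by linarith
  qed
  have "Cauchy (\<lambda>n. y (G n))"
  proof (rule metric_CauchyI)
    fix e :: real assume "e > 0"
    then obtain M where M: "1 / real (Suc M) < (e / 2)\<^sup>2"
      using reals_Archimedean [of "(e / 2)\<^sup>2"] by (auto simp: inverse_eq_divide)
    have *: "norm (y (G n) - y (G M)) < e / 2" if "n \<ge> M" for n
      using yG [OF that] M \<open>e > 0\<close>
      by (intro power2_less_imp_less [of "norm (y (G n) - y (G M))" "e / 2"]) auto
    have "dist (y (G m)) (y (G n)) < e" if "m \<ge> M" "n \<ge> M" for m n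
      using * [OF that(1)] * [OF that(2)] dist_triangle_half_l [of "y (G m)" "y (G M)" e "y (G n)"]
      by (simp add: dist_norm)
    then show "\<exists>M. \<forall>m\<ge>M. \<forall>n\<ge>M. dist (y (G m)) (y (G n)) < e"
      by blast
  qed
  then obtain z where z: "(\<lambda>n. y (G n)) \<longlonglongrightarrow> z"
    using Cauchy_convergent convergent_def by blast
  have zb: "cinner (x - z) b = 0" if b: "b \<in> onb" for b
  proof -
    have "(cmod (cinner (x - y (G n)) b))\<^sup>2 \<le> S - D (G n)" for n
    proof (cases "b \<in> G n")
      case True
      then show ?thesis
        using le_S [OF G] G b by (simp add: y_def cinner_diff_left cinner_onb_sum)
    next
      case False
      then have "D (insert b (G n)) = (cmod (cinner x b))\<^sup>2 + D (G n)"
        using G by (simp add: D_def)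
      then show ?thesis
        using le_S [of "insert b (G n)"] G [of n] b False
        by (simp add: y_def cinner_diff_left cinner_onb_sum)
    qed
    then have "(\<lambda>n. (cmod (cinner (x - y (G n)) b))\<^sup>2) \<longlonglongrightarrow> 0"
      by (intro tendsto_sandwich [OF _ _ tendsto_const SG0]) (auto intro!: always_eventually)
    then have "(\<lambda>n. sqrt ((cmod (cinner (x - y (G n)) b))\<^sup>2)) \<longlonglongrightarrow> sqrt 0"
      by (rule tendsto_real_sqrt)
    then have 1: "(\<lambda>n. cmod (cinner (x - y (G n)) b)) \<longlonglongrightarrow> 0"
      by simp
    have 2: "(\<lambda>n. norm (y (G n) - z) * norm b) \<longlonglongrightarrow> 0"
      using tendsto_mult_left_zero [OF tendsto_norm_zero [OF LIM_zero [OF z]]] by simp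
    have le: "cmod (cinner (x - z) b) \<le> cmod (cinner (x - y (G n)) b) + norm (y (G n) - z) * norm b" for n
    proof -
      have "cinner (x - z) b = cinner (x - y (G n)) b + cinner (y (G n) - z) b"
        by (simp add: cinner_diff_left)
      then show ?thesis
        using norm_triangle_ineq [of "cinner (x - y (G n)) b" "cinner (y (G n) - z) b"]
          Cauchy_Schwarz_cinner [of "y (G n) - z" b] by simp
    qed
    have "cmod (cinner (x - z) b) \<le> 0"
      using tendsto_add [OF 1 2] le by (intro tendsto_lowerbound) (auto intro!: always_eventually)
    then show ?thesis by simp
  qed
  then have "x - z = 0"
    using is_onb_onb unfolding is_onb_def by blast
  then have "(\<lambda>n. (norm (x - y (G n)))\<^sup>2) \<longlonglongrightarrow> (norm (x - x))\<^sup>2"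
    using z by (intro tendsto_intros) simp
  moreover have "(norm (x - y (G n)))\<^sup>2 = (norm x)\<^sup>2 - D (G n)" for n
    unfolding y_def D_def by (rule onb_residual [OF G])
  ultimately have "(\<lambda>n. ((norm x)\<^sup>2 - D (G n)) - (S - D (G n))) \<longlonglongrightarrow> 0 - 0"
    by (intro tendsto_diff SG0) simp
  then have "(norm x)\<^sup>2 - S = 0"
    by (simp add: LIMSEQ_const_iff)
  then show ?thesis
    by (simp add: S_def)
qed

lemma onb_expansion:
  fixes x :: "'h::chilbert_space"
  shows "((\<lambda>b. cinner x b *\<^sub>C b) has_sum x) onb"
proof -
  have "((\<lambda>F. sqrt ((norm x)\<^sup>2 - (\<Sum>b\<in>F. (cmod (cinner x b))\<^sup>2))) \<longlongrightarrow> sqrt ((norm x)\<^sup>2 - (norm x)\<^sup>2))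
      (finite_subsets_at_top onb)"
    using has_sum_infsum [OF onb_coeff_summable [of x]] unfolding has_sum_def onb_Parseval
    by (intro tendsto_intros)
  moreover have "\<forall>\<^sub>F F in finite_subsets_at_top onb.
      sqrt ((norm x)\<^sup>2 - (\<Sum>b\<in>F. (cmod (cinner x b))\<^sup>2)) = norm (x - (\<Sum>b\<in>F. cinner x b *\<^sub>C b))"
    by (rule eventually_finite_subsets_at_top_weakI) (simp flip: onb_residual)
  ultimately have "((\<lambda>F. norm (x - (\<Sum>b\<in>F. cinner x b *\<^sub>C b))) \<longlongrightarrow> 0) (finite_subsets_at_top onb)"
    using tendsto_cong by fastforce
  then show ?thesis
    unfolding has_sum_def
    by (subst tendsto_dist_iff) (simp add: dist_norm norm_minus_commute)
qed

lemma onb_Parseval_cinner: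
  fixes x y :: "'h::chilbert_space"
  shows "((\<lambda>b. cinner x b * cnj (cinner y b)) has_sum cinner x y) onb"
proof -
  have lin: "bounded_linear (\<lambda>u. cinner u y)"
    by (rule bounded_linear_intro [where K = "norm y"])
      (simp_all add: cinner_add_left scaleR_scaleC cinner_scaleC_left scaleC_complex_def
        Cauchy_Schwarz_cinner)
  have "((\<lambda>b. cinner (cinner x b *\<^sub>C b) y) has_sum cinner x y) onb"
    using has_sum_bounded_linear [OF lin onb_expansion [of x]] by (simp add: o_def)
  then show ?thesis
    by (simp add: cinner_scaleC_left flip: cinner_commute)
qed

text \<open>The full Fock space \<open>\<Oplus>\<^sub>k R\<^sup>\<otimes>\<^sup>k\<close>, in coordinates with respect to \<open>onb\<close>: the summand
  \<open>R\<^sup>\<otimes>\<^sup>k\<close> is the space of square-summable functions supported on the lists of length \<open>k\<close>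
  over \<open>onb\<close>, with \<open>r\<^sub>1 \<otimes> \<dots> \<otimes> r\<^sub>k\<close> represented by
  \<open>[b\<^sub>1, \<dots>, b\<^sub>k] \<mapsto> \<langle>r\<^sub>1, b\<^sub>1\<rangle> \<cdots> \<langle>r\<^sub>k, b\<^sub>k\<rangle>\<close>.\<close>

type_synonym 'r fock = "('r list, complex) l2"

text \<open>\<open>tensor_left r\<close> is \<open>\<xi> \<mapsto> r \<otimes> \<xi>\<close>; it maps \<open>R\<^sup>\<otimes>\<^sup>k\<close> into \<open>R\<^sup>\<otimes>\<^sup>(\<^sup>k\<^sup>+\<^sup>1\<^sup>)\<close>.\<close>

fun tensor_left_fun :: "'r::chilbert_space \<Rightarrow> ('r list \<Rightarrow> complex) \<Rightarrow> 'r list \<Rightarrow> complex" where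
  "tensor_left_fun r f [] = 0"
| "tensor_left_fun r f (b # bs) = (if b \<in> onb then cinner r b * f bs else 0)"

lemma tensor_left_fun_sum_le:
  fixes r :: "'r::chilbert_space" and f :: "'r fock"
  assumes "finite F"
  shows "(\<Sum>bs\<in>F. (cmod (tensor_left_fun r (l2_nth f) bs))\<^sup>2) \<le> (norm r)\<^sup>2 * (norm f)\<^sup>2"
proof -
  define A where "A = hd ` F \<inter> onb"
  define C where "C = tl ` F"
  have fin: "finite A" "finite C" "A \<subseteq> onb"
    using assms by (auto simp: A_def C_def)
  let ?G = "(\<lambda>(b, bs). b # bs) ` (A \<times> C)"
  have sub: "tensor_left_fun r (l2_nth f) bs = 0" if "bs \<in> F - ?G" for bs
  proof (cases bs)
    case (Cons b cs)
    have "b \<notin> onb"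
    proof
      assume "b \<in> onb"
      then have "(b, cs) \<in> A \<times> C"
        using that Cons by (force simp: A_def C_def)
      then show False
        using that Cons by force
    qed
    then show ?thesis by (simp add: Cons)
  qed simp
  have "(\<Sum>bs\<in>F. (cmod (tensor_left_fun r (l2_nth f) bs))\<^sup>2)
      = (\<Sum>bs\<in>F \<inter> ?G. (cmod (tensor_left_fun r (l2_nth f) bs))\<^sup>2)"
    by (rule sum.mono_neutral_right) (use assms sub in auto)
  also have "\<dots> \<le> (\<Sum>bs\<in>?G. (cmod (tensor_left_fun r (l2_nth f) bs))\<^sup>2)"
    by (rule sum_mono2) (use fin in auto)
  also have "\<dots> = (\<Sum>(b, bs)\<in>A \<times> C. (cmod (tensor_left_fun r (l2_nth f) (b # bs)))\<^sup>2)"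
    by (subst sum.reindex) (auto simp: inj_on_def case_prod_unfold)
  also have "\<dots> = (\<Sum>(b, bs)\<in>A \<times> C. (cmod (cinner r b))\<^sup>2 * (cmod (l2_nth f bs))\<^sup>2)"
    by (rule sum.cong) (use fin in \<open>auto simp: norm_mult power_mult_distrib\<close>)
  also have "\<dots> = (\<Sum>b\<in>A. (cmod (cinner r b))\<^sup>2) * (\<Sum>bs\<in>C. (cmod (l2_nth f bs))\<^sup>2)"
    by (simp add: sum_product sum.cartesian_product)
  also have "\<dots> \<le> (norm r)\<^sup>2 * (norm f)\<^sup>2"
    using fin l2_sum_le [of C f] onb_Bessel [of A r] by (intro mult_mono) (auto intro: sum_nonneg)
  finally show ?thesis .
qed

lift_definition tensor_left_l2 :: "'r::chilbert_space \<Rightarrow> 'r fock \<Rightarrow> 'r fock" is tensor_left_fun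
proof -
  fix r :: 'r and f :: "'r list \<Rightarrow> complex"
  assume "(\<lambda>i. (norm (f i))\<^sup>2) summable_on UNIV"
  then have "l2_nth (Abs_l2 f) = f"
    by (intro Abs_l2_inverse) simp
  then have le: "(\<Sum>bs\<in>F. (cmod (tensor_left_fun r f bs))\<^sup>2) \<le> (norm r)\<^sup>2 * (norm (Abs_l2 f))\<^sup>2"
    if "finite F" for F
    using tensor_left_fun_sum_le [OF that, of r "Abs_l2 f"] by simp
  show "(\<lambda>i. (norm (tensor_left_fun r f i))\<^sup>2) summable_on UNIV"
    by (rule nonneg_bdd_above_summable_on) (use le in \<open>auto simp: bdd_above_def\<close>)
qed

lemma norm_tensor_left_l2_le: "norm (tensor_left_l2 r f) \<le> norm r * norm f"
proof -
  have "(norm (tensor_left_l2 r f))\<^sup>2 \<le> (norm r * norm f)\<^sup>2"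
    unfolding norm_l2_power2 [of "tensor_left_l2 r f"]
    by (rule infsum_le_finite_sums [OF l2_nth_summable])
      (use tensor_left_fun_sum_le in \<open>simp add: tensor_left_l2.rep_eq power_mult_distrib\<close>)
  then show ?thesis
    using power2_le_imp_le by fastforce
qed

lift_definition tensor_left :: "'r::chilbert_space \<Rightarrow> 'r fock \<Rightarrow>\<^sub>C\<^sub>L 'r fock" is tensor_left_l2
proof -
  fix r :: 'r
  have add: "tensor_left_l2 r (f + g) = tensor_left_l2 r f + tensor_left_l2 r g" for f g
  proof (rule l2_eqI)
    show "l2_nth (tensor_left_l2 r (f + g)) bs = l2_nth (tensor_left_l2 r f + tensor_left_l2 r g) bs"
      for bs
      by (cases bs) (simp_all add: tensor_left_l2.rep_eq algebra_simps)
  qed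
  have scale: "tensor_left_l2 r (c *\<^sub>C f) = c *\<^sub>C tensor_left_l2 r f" for c f
  proof (rule l2_eqI)
    show "l2_nth (tensor_left_l2 r (c *\<^sub>C f)) bs = l2_nth (c *\<^sub>C tensor_left_l2 r f) bs" for bs
      by (cases bs) (simp_all add: tensor_left_l2.rep_eq scaleC_complex_def)
  qed
  have "bounded_linear (tensor_left_l2 r)"
    by (rule bounded_linear_intro [where K = "norm r"])
      (use norm_tensor_left_l2_le in \<open>simp_all add: add scale scaleR_scaleC mult.commute\<close>)
  then show "bounded_clinear (tensor_left_l2 r)"
    by (simp add: bounded_clinear_def scale)
qed

lemma tensor_left_l2_cinner:
  fixes r s :: "'r::chilbert_space" and f g :: "'r fock"
  shows "cinner (tensor_left_l2 r f) (tensor_left_l2 s g) = cinner r s * cinner f g"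
proof -
  let ?h = "\<lambda>bs. cinner (l2_nth (tensor_left_l2 r f) bs) (l2_nth (tensor_left_l2 s g) bs)"
  let ?c = "\<lambda>(b::'r, bs). b # bs"
  let ?T = "(onb :: 'r set) \<times> (UNIV :: 'r list set)"
  have inj: "inj_on ?c ?T"
    by (auto simp: inj_on_def)
  have sum: "?h summable_on UNIV"
    by (rule l2_cinner_summable) (rule l2_nth_summable)+
  have "cinner (tensor_left_l2 r f) (tensor_left_l2 s g) = infsum ?h (?c ` ?T)"
    unfolding cinner_l2_def
  proof (rule infsum_cong_neutral)
    fix bs assume bs: "bs \<in> UNIV - ?c ` ?T"
    show "?h bs = 0"
    proof (cases bs)
      case (Cons b cs)
      then have "b \<notin> onb"
        using bs by force
      then show ?thesis
        by (simp add: Cons tensor_left_l2.rep_eq)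
    qed (simp add: tensor_left_l2.rep_eq)
  qed auto
  also have "\<dots> = infsum (?h \<circ> ?c) ?T"
    by (rule infsum_reindex [OF inj])
  also have "\<dots> = (\<Sum>\<^sub>\<infinity>b\<in>onb. \<Sum>\<^sub>\<infinity>bs. (?h \<circ> ?c) (b, bs))"
  proof (rule infsum_Sigma_banach [symmetric])
    have "?h summable_on ?c ` ?T"
      by (rule summable_on_subset_banach [OF sum]) simp
    then show "(?h \<circ> ?c) summable_on ?T"
      by (simp add: summable_on_reindex [OF inj])
  qed
  also have "\<dots> = (\<Sum>\<^sub>\<infinity>b\<in>onb. \<Sum>\<^sub>\<infinity>bs. (cinner r b * cnj (cinner s b)) * cinner (l2_nth f bs) (l2_nth g bs))"
    by (intro infsum_cong) (simp add: tensor_left_l2.rep_eq cinner_complex_def)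
  also have "\<dots> = (\<Sum>\<^sub>\<infinity>b\<in>onb. (cinner r b * cnj (cinner s b)) * cinner f g)"
    by (simp add: infsum_cmult_right' cinner_l2_def)
  also have "\<dots> = cinner r s * cinner f g"
    using infsumI [OF onb_Parseval_cinner [of r s]] by (simp add: infsum_cmult_left')
  finally show ?thesis .
qed

text \<open>The identification of \<open>\<complex>\<close> with \<open>R\<^sup>\<otimes>\<^sup>0\<close>.\<close>

lift_definition vacuum :: "'r fock" is "\<lambda>bs. if bs = [] then 1 else 0"
proof -
  have "(\<lambda>i::'r list. (norm (if i = [] then 1 else 0 :: complex))\<^sup>2) summable_on UNIV
    \<longleftrightarrow> (\<lambda>i::'r list. (norm (if i = [] then 1 else 0 :: complex))\<^sup>2) summable_on {[]}"
    by (rule summable_on_cong_neutral) auto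
  then show "(\<lambda>i::'r list. (norm (if i = [] then 1 else 0 :: complex))\<^sup>2) summable_on UNIV"
    by simp
qed

section \<open>Matrices over complex vector spaces and operator matrices\<close>

text \<open>Left and right multiplication of a matrix over a complex vector space by scalar matrices.\<close>

definition cmat_times_left :: "complex mat \<Rightarrow> 'v::complex_vector mat \<Rightarrow> 'v mat" (infixr "\<bullet>\<^sub>l" 70) where
  "\<alpha> \<bullet>\<^sub>l Z = mat (dim_row \<alpha>) (dim_col Z) (\<lambda>(i, j). \<Sum>k<dim_row Z. \<alpha> $$ (i, k) *\<^sub>C Z $$ (k, j))"

definition cmat_times_right :: "'v::complex_vector mat \<Rightarrow> complex mat \<Rightarrow> 'v mat" (infixl "\<bullet>\<^sub>r" 71) where
  "Z \<bullet>\<^sub>r \<beta> = mat (dim_row Z) (dim_col \<beta>) (\<lambda>(i, j). \<Sum>k<dim_col Z. \<beta> $$ (k, j) *\<^sub>C Z $$ (i, k))"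

definition conj_transpose :: "complex mat \<Rightarrow> complex mat" where
  "conj_transpose \<beta> = map_mat cnj (transpose_mat \<beta>)"

text \<open>An element of \<open>\<L>(H\<^sup>m, K\<^sup>n)\<close> is represented by its \<open>n \<times> m\<close> matrix over \<open>\<L>(H, K)\<close>,
  an element of \<open>H\<^sup>m\<close> by a vector over \<open>H\<close> of dimension \<open>m\<close>.\<close>

definition vec_cinner :: "'h::chilbert_space vec \<Rightarrow> 'h vec \<Rightarrow> complex" where
  "vec_cinner x y = (\<Sum>i<dim_vec x. cinner (x $ i) (y $ i))"

definition vec_norm :: "'h::chilbert_space vec \<Rightarrow> real" where
  "vec_norm x = sqrt (\<Sum>i<dim_vec x. (norm (x $ i))\<^sup>2)"

definition op_apply :: "('h::chilbert_space \<Rightarrow>\<^sub>C\<^sub>L 'k::chilbert_space) mat \<Rightarrow> 'h vec \<Rightarrow> 'k vec" where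
  "op_apply M x = vec (dim_row M) (\<lambda>i. \<Sum>j<dim_col M. (M $$ (i, j)) (x $ j))"

definition op_norm :: "('h::chilbert_space \<Rightarrow>\<^sub>C\<^sub>L 'k::chilbert_space) mat \<Rightarrow> real" where
  "op_norm M = (SUP x\<in>{x \<in> carrier_vec (dim_col M). vec_norm x \<le> 1}. vec_norm (op_apply M x))"

definition op_times :: "('h::chilbert_space \<Rightarrow>\<^sub>C\<^sub>L 'k::chilbert_space) mat
    \<Rightarrow> ('g::chilbert_space \<Rightarrow>\<^sub>C\<^sub>L 'h) mat \<Rightarrow> ('g \<Rightarrow>\<^sub>C\<^sub>L 'k) mat" (infixl "\<odot>" 70) where
  "M \<odot> N = mat (dim_row M) (dim_col N) (\<lambda>(i, j). \<Sum>k<dim_row N. M $$ (i, k) o\<^sub>C\<^sub>L N $$ (k, j))"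

definition op_adjoint :: "('h::chilbert_space \<Rightarrow>\<^sub>C\<^sub>L 'k::chilbert_space) mat \<Rightarrow> ('k \<Rightarrow>\<^sub>C\<^sub>L 'h) mat" where
  "op_adjoint M = map_mat cadjoint (transpose_mat M)"

text \<open>\<open>P \<otimes> I\<^sub>H\<close> for a scalar matrix \<open>P\<close>, and \<open>I\<^sub>n \<otimes> A\<close> for an operator \<open>A\<close>.\<close>

definition mat_tensor_id :: "complex mat \<Rightarrow> ('h::chilbert_space \<Rightarrow>\<^sub>C\<^sub>L 'h) mat" where
  "mat_tensor_id P = map_mat (\<lambda>c. c *\<^sub>C cblinfun_id) P"

definition id_tensor :: "nat \<Rightarrow> ('h::chilbert_space \<Rightarrow>\<^sub>C\<^sub>L 'k::chilbert_space) \<Rightarrow> ('h \<Rightarrow>\<^sub>C\<^sub>L 'k) mat" where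
  "id_tensor n A = mat n n (\<lambda>(i, j). if i = j then A else 0)"

definition op_inverse :: "('h::chilbert_space \<Rightarrow>\<^sub>C\<^sub>L 'h) mat \<Rightarrow> ('h \<Rightarrow>\<^sub>C\<^sub>L 'h) mat" where
  "op_inverse M = (THE N. N \<in> carrier_mat (dim_row M) (dim_row M)
     \<and> M \<odot> N = id_tensor (dim_row M) cblinfun_id \<and> N \<odot> M = id_tensor (dim_row M) cblinfun_id)"

text \<open>Positivity; \<open>0 \<le> z\<close> for a complex number includes that \<open>z\<close> is real.
  In \<open>block_psd n d M\<close>, \<open>M i j\<close> (for \<open>i, j < n\<close>) is the block of size \<open>d i \<times> d j\<close> of a
  square matrix of size \<open>d 0 + \<dots> + d (n - 1)\<close>.\<close>

definition op_psd :: "('h::chilbert_space \<Rightarrow>\<^sub>C\<^sub>L 'h) mat \<Rightarrow> bool" where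
  "op_psd M \<longleftrightarrow> square_mat M \<and> (\<forall>x\<in>carrier_vec (dim_row M). 0 \<le> vec_cinner (op_apply M x) x)"

definition block_psd :: "nat \<Rightarrow> (nat \<Rightarrow> nat) \<Rightarrow> (nat \<Rightarrow> nat \<Rightarrow> ('h::chilbert_space \<Rightarrow>\<^sub>C\<^sub>L 'h) mat) \<Rightarrow> bool" where
  "block_psd n d M \<longleftrightarrow>
     (\<forall>i<n. \<forall>j<n. M i j \<in> carrier_mat (d i) (d j)) \<and>
     (\<forall>x. (\<forall>i<n. x i \<in> carrier_vec (d i)) \<longrightarrow>
       0 \<le> (\<Sum>i<n. \<Sum>j<n. vec_cinner (op_apply (M i j) (x j)) (x i)))"

section \<open>Noncommutative sets, functions and kernels\<close>

text \<open>The disjoint union of the \<open>V\<^sup>n\<^sup>\<times>\<^sup>n\<close> over \<open>n \<ge> 1\<close>; the level of a point \<open>Z\<close> is \<open>dim_row Z\<close>.\<close>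

definition nc_space :: "'v::complex_vector mat set" where
  "nc_space = {Z. square_mat Z \<and> dim_row Z \<ge> 1}"

definition direct_sum :: "'v::complex_vector mat \<Rightarrow> 'v mat \<Rightarrow> 'v mat" where
  "direct_sum Z W = four_block_mat Z (0\<^sub>m (dim_row Z) (dim_col W)) (0\<^sub>m (dim_row W) (dim_col Z)) W"

definition full_nc_subset :: "'v::complex_vector mat set \<Rightarrow> bool" where
  "full_nc_subset \<Xi> \<longleftrightarrow> \<Xi> \<subseteq> nc_space
     \<and> (\<forall>Z\<in>\<Xi>. \<forall>W\<in>\<Xi>. direct_sum Z W \<in> \<Xi>)
     \<and> (\<forall>Z\<in>\<Xi>. \<forall>Z'\<in>nc_space. \<forall>\<I>\<in>carrier_mat (dim_row Z) (dim_row Z').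
          inj_on (\<lambda>x. \<I> *\<^sub>v x) (carrier_vec (dim_row Z')) \<and> \<I> \<bullet>\<^sub>l Z' = Z \<bullet>\<^sub>r \<I> \<longrightarrow> Z' \<in> \<Xi>)"

definition full_nc_hull :: "'v::complex_vector mat set \<Rightarrow> 'v mat set \<Rightarrow> 'v mat set" where
  "full_nc_hull \<Xi> \<Omega> = \<Inter>{\<Phi>. full_nc_subset \<Phi> \<and> \<Omega> \<subseteq> \<Phi> \<and> \<Phi> \<subseteq> \<Xi>}"

definition graded_function :: "'v::complex_vector mat set \<Rightarrow> ('v mat \<Rightarrow> 'w::complex_vector mat) \<Rightarrow> bool" where
  "graded_function \<Omega> f \<longleftrightarrow> (\<forall>Z\<in>\<Omega>. f Z \<in> carrier_mat (dim_row Z) (dim_row Z))"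

definition nc_function :: "'v::complex_vector mat set \<Rightarrow> ('v mat \<Rightarrow> 'w::complex_vector mat) \<Rightarrow> bool" where
  "nc_function \<Omega> f \<longleftrightarrow> graded_function \<Omega> f
     \<and> (\<forall>Z\<in>\<Omega>. \<forall>Z'\<in>\<Omega>. \<forall>\<alpha>\<in>carrier_mat (dim_row Z') (dim_row Z).
          \<alpha> \<bullet>\<^sub>l Z = Z' \<bullet>\<^sub>r \<alpha> \<longrightarrow> \<alpha> \<bullet>\<^sub>l f Z = f Z' \<bullet>\<^sub>r \<alpha>)"

type_synonym ('v, 'h) nc_kern = "'v mat \<Rightarrow> 'v mat \<Rightarrow> complex mat \<Rightarrow> ('h \<Rightarrow>\<^sub>C\<^sub>L 'h) mat"

definition nc_kernel :: "'v::complex_vector mat set \<Rightarrow> ('v, 'h::chilbert_space) nc_kern \<Rightarrow> bool" where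
  "nc_kernel \<Omega> K \<longleftrightarrow>
     (\<forall>Z\<in>\<Omega>. \<forall>W\<in>\<Omega>. \<forall>P\<in>carrier_mat (dim_row Z) (dim_row W).
        K Z W P \<in> carrier_mat (dim_row Z) (dim_row W)
        \<and> (\<forall>P'\<in>carrier_mat (dim_row Z) (dim_row W). K Z W (P + P') = K Z W P + K Z W P')
        \<and> (\<forall>c. K Z W (c \<cdot>\<^sub>m P) = map_mat ((*\<^sub>C) c) (K Z W P)))
     \<and> (\<forall>Z\<in>\<Omega>. \<forall>Z'\<in>\<Omega>. \<forall>W\<in>\<Omega>. \<forall>W'\<in>\<Omega>.
        \<forall>\<alpha>\<in>carrier_mat (dim_row Z') (dim_row Z). \<forall>\<beta>\<in>carrier_mat (dim_row W') (dim_row W).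
        \<forall>P\<in>carrier_mat (dim_row Z) (dim_row W).
        \<alpha> \<bullet>\<^sub>l Z = Z' \<bullet>\<^sub>r \<alpha> \<and> \<beta> \<bullet>\<^sub>l W = W' \<bullet>\<^sub>r \<beta> \<longrightarrow>
        \<alpha> \<bullet>\<^sub>l K Z W P \<bullet>\<^sub>r conj_transpose \<beta> = K Z' W' (\<alpha> * P * conj_transpose \<beta>))"

text \<open>Positivity of a scalar block matrix is that of the operator it induces on a direct sum of
  copies of \<open>\<complex>\<close>.\<close>

definition cp_nc_kernel :: "'v::complex_vector mat set \<Rightarrow> ('v, 'h::chilbert_space) nc_kern \<Rightarrow> bool" where
  "cp_nc_kernel \<Omega> K \<longleftrightarrow> nc_kernel \<Omega> K
     \<and> (\<forall>n Z P. (\<forall>i<n. Z i \<in> \<Omega>)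
          \<and> (\<forall>i<n. \<forall>j<n. P i j \<in> carrier_mat (dim_row (Z i)) (dim_row (Z j)))
          \<and> block_psd n (\<lambda>i. dim_row (Z i)) (\<lambda>i j. mat_tensor_id (P i j) :: (complex \<Rightarrow>\<^sub>C\<^sub>L complex) mat)
          \<longrightarrow> block_psd n (\<lambda>i. dim_row (Z i)) (\<lambda>i j. K (Z i) (Z j) (P i j)))"

section \<open>The ball and the scalar kernel of \<open>Q\<^sub>0\<close>\<close>

definition nc_ball :: "'v::complex_vector mat set \<Rightarrow> ('v mat \<Rightarrow> ('r::chilbert_space \<Rightarrow>\<^sub>C\<^sub>L complex) mat) \<Rightarrow> 'v mat set" where
  "nc_ball \<Xi> Q\<^sub>0 = {Z \<in> \<Xi>. op_norm (Q\<^sub>0 Z) < 1}"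

text \<open>\<open>L_pow Q k\<close> is \<open>(L\<^sub>Q\<^sub>*)\<^sup>(\<^sup>k\<^sup>) : \<complex>\<^sup>m \<rightarrow> (R\<^sup>\<otimes>\<^sup>k)\<^sup>m\<close>, its entries having range in the summand
  \<open>R\<^sup>\<otimes>\<^sup>k\<close> of the Fock space. The entries \<open>T\<close> of \<open>Q\<^sup>*\<close> lie in \<open>\<L>(\<complex>, R)\<close>, so that
  \<open>T \<otimes> I\<close> is tensoring on the left with the vector \<open>T 1\<close>.\<close>

primrec L_pow :: "('r::chilbert_space \<Rightarrow>\<^sub>C\<^sub>L complex) mat \<Rightarrow> nat \<Rightarrow> (complex \<Rightarrow>\<^sub>C\<^sub>L 'r fock) mat" where
  "L_pow Q 0 = id_tensor (dim_row Q) (vector_to_cblinfun vacuum)"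
| "L_pow Q (Suc k) = map_mat (\<lambda>T :: complex \<Rightarrow>\<^sub>C\<^sub>L 'r. tensor_left (T 1)) (op_adjoint Q) \<odot> L_pow Q k"

definition k_kernel :: "('v::complex_vector mat \<Rightarrow> ('r::chilbert_space \<Rightarrow>\<^sub>C\<^sub>L complex) mat)
    \<Rightarrow> 'v mat \<Rightarrow> 'v mat \<Rightarrow> complex mat \<Rightarrow> complex mat" where
  "k_kernel Q\<^sub>0 Z W P = mat (dim_row Z) (dim_row W) (\<lambda>(i, j).
     \<Sum>k. ((op_adjoint (L_pow (Q\<^sub>0 Z) k) \<odot> mat_tensor_id P \<odot> L_pow (Q\<^sub>0 W) k) $$ (i, j)) 1)"

definition k_kernel_tensor_id :: "('v::complex_vector mat \<Rightarrow> ('r::chilbert_space \<Rightarrow>\<^sub>C\<^sub>L complex) mat)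
    \<Rightarrow> ('v, 'h::chilbert_space) nc_kern" where
  "k_kernel_tensor_id Q\<^sub>0 Z W P = mat_tensor_id (k_kernel Q\<^sub>0 Z W P)"

definition dBR_kernel :: "('v::complex_vector mat \<Rightarrow> ('r::chilbert_space \<Rightarrow>\<^sub>C\<^sub>L complex) mat)
    \<Rightarrow> ('v mat \<Rightarrow> ('y::chilbert_space \<Rightarrow>\<^sub>C\<^sub>L 'e::chilbert_space) mat)
    \<Rightarrow> ('v mat \<Rightarrow> ('u::chilbert_space \<Rightarrow>\<^sub>C\<^sub>L 'e) mat) \<Rightarrow> ('v, 'e) nc_kern" where
  "dBR_kernel Q\<^sub>0 a b Z W P =
     a Z \<odot> mat_tensor_id (k_kernel Q\<^sub>0 Z W P) \<odot> op_adjoint (a W)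
     - b Z \<odot> mat_tensor_id (k_kernel Q\<^sub>0 Z W P) \<odot> op_adjoint (b W)"

section \<open>Noncommutative reproducing kernel Hilbert spaces and multipliers\<close>

text \<open>A function on \<open>D\<close> is represented by its extension that is undefined off \<open>D\<close>.\<close>

type_synonym ('v, 'h) nc_fun = "'v mat \<Rightarrow> (complex \<Rightarrow>\<^sub>C\<^sub>L 'h) mat"

definition fun_add :: "'v mat set \<Rightarrow> ('v, 'h::chilbert_space) nc_fun \<Rightarrow> ('v, 'h) nc_fun \<Rightarrow> ('v, 'h) nc_fun" where
  "fun_add D f g = (\<lambda>Z\<in>D. f Z + g Z)"

definition fun_scale :: "'v mat set \<Rightarrow> complex \<Rightarrow> ('v, 'h::chilbert_space) nc_fun \<Rightarrow> ('v, 'h) nc_fun" where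
  "fun_scale D c f = (\<lambda>Z\<in>D. map_mat ((*\<^sub>C) c) (f Z))"

definition fun_zero :: "'v mat set \<Rightarrow> ('v, 'h::chilbert_space) nc_fun" where
  "fun_zero D = (\<lambda>Z\<in>D. 0\<^sub>m (dim_row Z) (dim_row Z))"

definition fun_dist :: "'v mat set \<Rightarrow> (('v, 'h::chilbert_space) nc_fun \<Rightarrow> ('v, 'h) nc_fun \<Rightarrow> complex)
    \<Rightarrow> ('v, 'h) nc_fun \<Rightarrow> ('v, 'h) nc_fun \<Rightarrow> real" where
  "fun_dist D ip f g = (let d = fun_add D f (fun_scale D (-1) g) in sqrt (Re (ip d d)))"

definition hilbert_space_of_nc_functions :: "'v::complex_vector mat set \<Rightarrow> ('v, 'h::chilbert_space) nc_fun set
    \<Rightarrow> (('v, 'h) nc_fun \<Rightarrow> ('v, 'h) nc_fun \<Rightarrow> complex) \<Rightarrow> bool" where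
  "hilbert_space_of_nc_functions D H ip \<longleftrightarrow>
     (\<forall>f\<in>H. nc_function D f \<and> f \<in> extensional D)
     \<and> fun_zero D \<in> H
     \<and> (\<forall>f\<in>H. \<forall>g\<in>H. fun_add D f g \<in> H)
     \<and> (\<forall>c. \<forall>f\<in>H. fun_scale D c f \<in> H)
     \<and> (\<forall>f\<in>H. \<forall>g\<in>H. \<forall>h\<in>H. ip (fun_add D f g) h = ip f h + ip g h)
     \<and> (\<forall>c. \<forall>f\<in>H. \<forall>g\<in>H. ip (fun_scale D c f) g = c * ip f g)
     \<and> (\<forall>f\<in>H. \<forall>g\<in>H. ip f g = cnj (ip g f))
     \<and> (\<forall>f\<in>H. 0 \<le> ip f f \<and> (ip f f = 0 \<longrightarrow> f = fun_zero D))
     \<and> (\<forall>s. (\<forall>k. s k \<in> H) \<and> (\<forall>e>0. \<exists>N. \<forall>k\<ge>N. \<forall>l\<ge>N. fun_dist D ip (s k) (s l) < e)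
          \<longrightarrow> (\<exists>f\<in>H. (\<lambda>k. fun_dist D ip (s k) f) \<longlonglongrightarrow> 0))"

text \<open>The function \<open>K\<^sub>W\<^sub>,\<^sub>v\<^sub>,\<^sub>y\<close>, given by \<open>K\<^sub>W\<^sub>,\<^sub>v\<^sub>,\<^sub>y(Z) u = K(Z, W)(u v) y\<close>: column \<open>j\<close> of the matrix
  of \<open>K\<^sub>W\<^sub>,\<^sub>v\<^sub>,\<^sub>y(Z)\<close> is its value at the \<open>j\<close>-th unit vector.\<close>

definition kernel_fun :: "'v::complex_vector mat set \<Rightarrow> ('v, 'h::chilbert_space) nc_kern
    \<Rightarrow> 'v mat \<Rightarrow> complex mat \<Rightarrow> 'h vec \<Rightarrow> ('v, 'h) nc_fun" where
  "kernel_fun D K W v y = (\<lambda>Z\<in>D. mat (dim_row Z) (dim_row Z) (\<lambda>(i, j).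
     vector_to_cblinfun (op_apply (K Z W (mat_of_cols (dim_row Z) [unit_vec (dim_row Z) j] * v)) y $ i)))"

text \<open>\<open>is_nc_rkhs D K H ip\<close>: the space \<open>H\<close> with inner product \<open>ip\<close> is \<open>\<H>(K)\<close>. The reproducing
  property determines \<open>H\<close>, and \<open>ip\<close> on \<open>H\<close>.\<close>

definition is_nc_rkhs :: "'v::complex_vector mat set \<Rightarrow> ('v, 'h::chilbert_space) nc_kern
    \<Rightarrow> ('v, 'h) nc_fun set \<Rightarrow> (('v, 'h) nc_fun \<Rightarrow> ('v, 'h) nc_fun \<Rightarrow> complex) \<Rightarrow> bool" where
  "is_nc_rkhs D K H ip \<longleftrightarrow> hilbert_space_of_nc_functions D H ip
     \<and> (\<forall>W\<in>D. \<forall>v\<in>carrier_mat 1 (dim_row W). \<forall>y\<in>carrier_vec (dim_row W).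
          kernel_fun D K W v y \<in> H
          \<and> (\<forall>f\<in>H. vec_cinner (op_apply (f W) (col (conj_transpose v) 0)) y = ip f (kernel_fun D K W v y)))"

definition contractive_multiplier :: "'v::complex_vector mat set
    \<Rightarrow> ('v, 'u::chilbert_space) nc_kern \<Rightarrow> ('v, 'y::chilbert_space) nc_kern
    \<Rightarrow> ('v mat \<Rightarrow> ('u \<Rightarrow>\<^sub>C\<^sub>L 'y) mat) \<Rightarrow> bool" where
  "contractive_multiplier D K' K S \<longleftrightarrow> nc_function D S
     \<and> (\<exists>H' ip' H ip. is_nc_rkhs D K' H' ip' \<and> is_nc_rkhs D K H ip
          \<and> (\<forall>f\<in>H'. (\<lambda>W\<in>D. S W \<odot> f W) \<in> H
               \<and> Re (ip (\<lambda>W\<in>D. S W \<odot> f W) (\<lambda>W\<in>D. S W \<odot> f W)) \<le> Re (ip' f f)))"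

definition has_multiplier_solution :: "'v::complex_vector mat set \<Rightarrow> 'v mat set
    \<Rightarrow> ('v mat \<Rightarrow> ('r::chilbert_space \<Rightarrow>\<^sub>C\<^sub>L complex) mat)
    \<Rightarrow> ('v mat \<Rightarrow> ('y::chilbert_space \<Rightarrow>\<^sub>C\<^sub>L 'e::chilbert_space) mat)
    \<Rightarrow> ('v mat \<Rightarrow> ('u::chilbert_space \<Rightarrow>\<^sub>C\<^sub>L 'e) mat) \<Rightarrow> bool" where
  "has_multiplier_solution D \<Omega> Q\<^sub>0 a b \<longleftrightarrow>
     (\<exists>S. contractive_multiplier D (k_kernel_tensor_id Q\<^sub>0) (k_kernel_tensor_id Q\<^sub>0) S
        \<and> (\<forall>Z\<in>\<Omega>. a Z \<odot> S Z = b Z))"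

section \<open>Colligations and transfer functions\<close>

text \<open>\<open>t\<close> exhibits \<open>'t\<close> as the Hilbert space tensor product of \<open>'r\<close> and \<open>'x\<close>. The set of simple
  tensors is closed under complex multiples, so its real span is its complex span.\<close>

definition hilbert_tensor :: "('r::chilbert_space \<Rightarrow> 'x::chilbert_space \<Rightarrow> 't::chilbert_space) \<Rightarrow> bool" where
  "hilbert_tensor t \<longleftrightarrow>
     (\<forall>r s x. t (r + s) x = t r x + t s x) \<and> (\<forall>r x y. t r (x + y) = t r x + t r y)
     \<and> (\<forall>c r x. t (c *\<^sub>C r) x = c *\<^sub>C t r x \<and> t r (c *\<^sub>C x) = c *\<^sub>C t r x)
     \<and> (\<forall>r s x y. cinner (t r x) (t s y) = cinner r s * cinner x y)
     \<and> closure (span {t r x | r x. True}) = UNIV"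

text \<open>\<open>q \<otimes> I : R \<otimes> X \<rightarrow> X\<close> for \<open>q : R \<rightarrow> \<complex>\<close>, and entrywise for a matrix of such \<open>q\<close>.\<close>

definition tensor_id :: "('r::chilbert_space \<Rightarrow> 'x::chilbert_space \<Rightarrow> 't::chilbert_space)
    \<Rightarrow> ('r \<Rightarrow>\<^sub>C\<^sub>L complex) \<Rightarrow> 't \<Rightarrow>\<^sub>C\<^sub>L 'x" where
  "tensor_id t q = (THE G :: 't \<Rightarrow>\<^sub>C\<^sub>L 'x. \<forall>r x. G (t r x) = q r *\<^sub>C x)"

definition colligation :: "('x::chilbert_space \<Rightarrow>\<^sub>C\<^sub>L 't::chilbert_space) \<Rightarrow> ('u::chilbert_space \<Rightarrow>\<^sub>C\<^sub>L 't)
    \<Rightarrow> ('x \<Rightarrow>\<^sub>C\<^sub>L 'y::chilbert_space) \<Rightarrow> ('u \<Rightarrow>\<^sub>C\<^sub>L 'y) \<Rightarrow> 'x \<times> 'u \<Rightarrow> 't \<times> 'y" where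
  "colligation A B C D = (\<lambda>(x, u). (A x + B u, C x + D u))"

definition contractive :: "('a::chilbert_space \<Rightarrow> 'b::chilbert_space) \<Rightarrow> bool" where
  "contractive U \<longleftrightarrow> (\<forall>z. norm (U z) \<le> norm z)"

definition unitary :: "('a::chilbert_space \<Rightarrow> 'b::chilbert_space) \<Rightarrow> bool" where
  "unitary U \<longleftrightarrow> surj U \<and> (\<forall>z w. cinner (U z) (U w) = cinner z w)"

text \<open>The value at a point \<open>Z\<close> with \<open>Q\<^sub>0(Z) = Q\<close>.\<close>

definition transfer_function :: "('r::chilbert_space \<Rightarrow> 'x::chilbert_space \<Rightarrow> 't::chilbert_space)
    \<Rightarrow> ('x \<Rightarrow>\<^sub>C\<^sub>L 't) \<Rightarrow> ('u::chilbert_space \<Rightarrow>\<^sub>C\<^sub>L 't) \<Rightarrow> ('x \<Rightarrow>\<^sub>C\<^sub>L 'y::chilbert_space) \<Rightarrow> ('u \<Rightarrow>\<^sub>C\<^sub>L 'y)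
    \<Rightarrow> ('r \<Rightarrow>\<^sub>C\<^sub>L complex) mat \<Rightarrow> ('u \<Rightarrow>\<^sub>C\<^sub>L 'y) mat" where
  "transfer_function t A B C D Q =
     (let n = dim_row Q; QI = map_mat (tensor_id t) Q in
      id_tensor n D + id_tensor n C
        \<odot> op_inverse (id_tensor n cblinfun_id - QI \<odot> id_tensor n A) \<odot> QI \<odot> id_tensor n B)"

text \<open>Solvability of \<open>a S = b\<close> on \<open>\<Omega>\<close> by the transfer function of a contractive (unitary) colligation
  with state space \<open>'x\<close>, where \<open>'t\<close> is a tensor product of \<open>'r\<close> and \<open>'x\<close>.\<close>

definition contractive_realization :: "'x::chilbert_space itself \<Rightarrow> 't::chilbert_space itself
    \<Rightarrow> 'v::complex_vector mat set \<Rightarrow> ('v mat \<Rightarrow> ('r::chilbert_space \<Rightarrow>\<^sub>C\<^sub>L complex) mat)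
    \<Rightarrow> ('v mat \<Rightarrow> ('y::chilbert_space \<Rightarrow>\<^sub>C\<^sub>L 'e::chilbert_space) mat)
    \<Rightarrow> ('v mat \<Rightarrow> ('u::chilbert_space \<Rightarrow>\<^sub>C\<^sub>L 'e) mat) \<Rightarrow> bool" where
  "contractive_realization _ _ \<Omega> Q\<^sub>0 a b \<longleftrightarrow>
     (\<exists>(t :: 'r \<Rightarrow> 'x \<Rightarrow> 't) A B C D. hilbert_tensor t \<and> contractive (colligation A B C D)
        \<and> (\<forall>Z\<in>\<Omega>. a Z \<odot> transfer_function t A B C D (Q\<^sub>0 Z) = b Z))"

definition unitary_realization :: "'x::chilbert_space itself \<Rightarrow> 't::chilbert_space itself
    \<Rightarrow> 'v::complex_vector mat set \<Rightarrow> ('v mat \<Rightarrow> ('r::chilbert_space \<Rightarrow>\<^sub>C\<^sub>L complex) mat)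
    \<Rightarrow> ('v mat \<Rightarrow> ('y::chilbert_space \<Rightarrow>\<^sub>C\<^sub>L 'e::chilbert_space) mat)
    \<Rightarrow> ('v mat \<Rightarrow> ('u::chilbert_space \<Rightarrow>\<^sub>C\<^sub>L 'e) mat) \<Rightarrow> bool" where
  "unitary_realization _ _ \<Omega> Q\<^sub>0 a b \<longleftrightarrow>
     (\<exists>(t :: 'r \<Rightarrow> 'x \<Rightarrow> 't) A B C D. hilbert_tensor t \<and> unitary (colligation A B C D)
        \<and> (\<forall>Z\<in>\<Omega>. a Z \<odot> transfer_function t A B C D (Q\<^sub>0 Z) = b Z))"

text \<open>A quantifier over all Hilbert spaces cannot be written inside a formula. Implications from the
  existence of a realization are stated for arbitrary types of state spaces, those to the existence
  of a realization with the state space \<open>\<ell>\<^sup>2(I)\<close>, for an index type \<open>I\<close> that is infinite and no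
  smaller than the spaces involved, and with \<open>R \<otimes> \<ell>\<^sup>2(I)\<close> in the form \<open>\<ell>\<^sup>2(I, R)\<close>.\<close>

type_synonym ('v, 'e, 'r, 'u, 'y) state_index = "'v mat \<times> nat \<times> 'e \<times> 'r \<times> 'u \<times> 'y"
type_synonym ('v, 'e, 'r, 'u, 'y) state_space = "(('v, 'e, 'r, 'u, 'y) state_index, complex) l2"
type_synonym ('v, 'e, 'r, 'u, 'y) tensor_state_space = "(('v, 'e, 'r, 'u, 'y) state_index, 'r) l2"

end

theory Submission
  imports Defs "HOL-Analysis.Elementary_Metric_Spaces" "HOL-Analysis.L2_Norm" "HOL-Library.Nat_Bijection"
    "Jordan_Normal_Form.Determinant"
begin

text \<open>The kernel \<open>k\<close> is a Gram kernel, and it satisfies the Stein equation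
  \<open>k(Z, W)(P) - k(Z, W)(Q\<^sub>0(Z) (P \<otimes> I) Q\<^sub>0(W)\<^sup>*) = P\<close>.

  (2) implies (3): a Gram factorization \<open>x\<close> of the positive kernel \<open>K\<close> turns the Stein equation
  into \<open>\<langle>(Q\<^sub>0\<^sup>* \<otimes> I) x, (Q\<^sub>0\<^sup>* \<otimes> I) x\<rangle> + \<langle>a\<^sup>*, a\<^sup>*\<rangle> = \<langle>x, x\<rangle> + \<langle>b\<^sup>*, b\<^sup>*\<rangle>\<close>. The isometry behind this identity
  extends to \<open>U\<^sup>*\<close> for a contractive or unitary colligation \<open>U\<close>.

  (3) implies (1): \<open>S(Z)\<^sup>* y\<close> is the second component of \<open>U\<^sup>*\<close> on a vector determined by \<open>y\<close>, so that
  contractivity of \<open>U\<close> and the Stein equation bound the adjoint of the multiplier on kernel vectors.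

  (1) implies (1'): \<open>a S = b\<close> persists on \<open>\<Omega>'\<close>, as its points embed into direct sums of points of \<open>\<Omega>\<close>,
  and a contractive multiplier is pointwise contractive because \<open>k(Z, Z)(I - Q\<^sub>0(Z) Q\<^sub>0(Z)\<^sup>*) = I\<close>.

  (1') implies (2): for \<open>P > 0\<close> one has \<open>k(Z, Z)(P) = J J\<^sup>*\<close> with \<open>J\<close> invertible, and by the Stein equation
  the point \<open>J\<^sup>-\<^sup>1 Z J\<close> is again in the ball. Hence \<open>K(Z, Z)(P) = J (a a\<^sup>* - b b\<^sup>*)(J\<^sup>-\<^sup>1 Z J) J\<^sup>*\<close> is positive;
  several points are treated through their direct sum.\<close>

section \<open>Hilbert spaces\<close>

text \<open>Hilbert spaces are types, so a space that depends on the data, such as a completion, a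
  closed span or the space of a kernel, cannot be formed inside an argument. Each is replaced by a
  family of vectors in a fixed \<ell>^2 space, and each operator by the inner products it must have
  with such a family: existence comes from minimizing over the closed span, linearity from
  uniqueness there. Tuples of length n become finite sums for the same reason. The series of k can
  be unrolled at either end, which gives two Stein equations. The one in which
  \<open>Q\<^sub>0\<close> acts on P before k does serves the realization and the pointwise
  contractivity of multipliers; the one in which it acts on the value of k serves the contractivity
  of transfer functions and the conjugation of points. Strict positivity of P makes the Gram factor
  invertible; semidefinite P are reached by adding \<epsilon> I. The unitary completion needs room
  in both defect spaces; for R = 0 the space R \<otimes> X is zero, and the completion fails, for
  instance, when also Y = 0.\<close>

lemma bounded_linear_cinner_left: "bounded_linear (\<lambda>x. cinner x (y::'h::chilbert_space))"
  by (rule bounded_linear_intro [where K = "norm y"])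
    (simp_all add: cinner_add_left scaleR_scaleC cinner_scaleC_left scaleC_complex_def
      Cauchy_Schwarz_cinner)

lemma cinner_eqI: "(\<And>z. cinner x z = cinner y z) \<Longrightarrow> x = (y::'h::chilbert_space)"
proof -
  assume "\<And>z. cinner x z = cinner y z"
  then have "cinner (x - y) (x - y) = 0"
    by (simp add: cinner_diff_left)
  then show "x = y"
    by (simp add: cinner_self)
qed

lemma cinner_eqI_right: "(\<And>z. cinner z x = cinner z y) \<Longrightarrow> x = (y::'h::chilbert_space)"
  by (rule cinner_eqI) (metis cinner_commute)

lemma bounded_clinearI:
  fixes f :: "'a::chilbert_space \<Rightarrow> 'b::chilbert_space"
  assumes "\<And>x y. f (x + y) = f x + f y" "\<And>c x. f (c *\<^sub>C x) = c *\<^sub>C f x"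
    and "\<And>x. norm (f x) \<le> K * norm x"
  shows "bounded_clinear f"
  unfolding bounded_clinear_def
proof
  show "bounded_linear f"
    by (rule bounded_linear_intro [where K = K])
      (use assms in \<open>simp_all add: scaleR_scaleC mult.commute\<close>)
qed (use assms in simp)

lemma bounded_clinear_apply: "bounded_clinear (cblinfun_apply T)"
  using cblinfun_apply by blast

lemma CBlinfun_apply: "bounded_clinear f \<Longrightarrow> cblinfun_apply (CBlinfun f) = f"
  by (simp add: CBlinfun_inverse)

lemma cblinfun_apply_linear:
  fixes T :: "'a::chilbert_space \<Rightarrow>\<^sub>C\<^sub>L 'b::chilbert_space"
  shows cblinfun_add: "T (x + y) = T x + T y"
    and cblinfun_scale: "T (c *\<^sub>C x) = c *\<^sub>C T x"
    and cblinfun_zero: "T 0 = 0"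
    and cblinfun_diff: "T (x - y) = T x - T y"
    and cblinfun_sum: "T (sum f A) = (\<Sum>i\<in>A. T (f i))"
proof -
  interpret bounded_linear T
    using bounded_clinear_apply [of T] by (simp add: bounded_clinear_def)
  show "T (x + y) = T x + T y" "T 0 = 0" "T (x - y) = T x - T y"
    "T (sum f A) = (\<Sum>i\<in>A. T (f i))" "T (c *\<^sub>C x) = c *\<^sub>C T x"
    using bounded_clinear_apply [of T]
    by (simp_all add: add zero diff sum bounded_clinear_def)
qed

lemma cblinfun_bound:
  fixes T :: "'a::chilbert_space \<Rightarrow>\<^sub>C\<^sub>L 'b::chilbert_space"
  obtains K where "K \<ge> 0" "\<And>x. norm (T x) \<le> K * norm x"
proof -
  interpret bounded_linear T
    using bounded_clinear_apply [of T] by (simp add: bounded_clinear_def)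
  show ?thesis
    using nonneg_bounded that by (metis mult.commute)
qed

lemma cblinfun_apply_simps [simp]:
  "(0 :: 'a::chilbert_space \<Rightarrow>\<^sub>C\<^sub>L 'b::chilbert_space) x = 0" "(S + T) x = S x + T x"
  "(S - T) x = S x - T x" "(- S) x = - S x" "(c *\<^sub>C S) x = c *\<^sub>C S x" "cblinfun_id y = y"
  "(S o\<^sub>C\<^sub>L R) z = S (R z)" "vector_to_cblinfun h c = c *\<^sub>C h"
  for S T :: "'a::chilbert_space \<Rightarrow>\<^sub>C\<^sub>L 'b::chilbert_space"
  by (transfer, simp)+

lemma cblinfun_apply_sum [simp]:
  "(sum f A :: 'a::chilbert_space \<Rightarrow>\<^sub>C\<^sub>L 'b::chilbert_space) x = (\<Sum>i\<in>A. f i x)"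
  by (induction A rule: infinite_finite_induct) auto

lemma norm_add_square:
  "(norm (x + y))\<^sup>2 = (norm x)\<^sup>2 + 2 * Re (cinner x y) + (norm y)\<^sup>2" for x y :: "'h::chilbert_space"
  by (simp add: power2_norm_eq_inner inner_add_left inner_add_right inner_commute
      flip: inner_eq_Re_cinner)

section \<open>Finite combinations, closed spans and the moment problem\<close>

lemma sum_scaleC_right: "(\<Sum>i\<in>A. c *\<^sub>C f i) = c *\<^sub>C (\<Sum>i\<in>A. f i :: 'a::complex_vector)"
  by (induction A rule: infinite_finite_induct) (auto simp: scaleC_add_right)

lemma sum_scaleC_left: "(\<Sum>i\<in>A. c i *\<^sub>C f) = (\<Sum>i\<in>A. c i) *\<^sub>C (f :: 'a::complex_vector)"
  by (induction A rule: infinite_finite_induct) (auto simp: scaleC_add_left)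

text \<open>Complex combinations as coefficient lists: concatenating lists adds combinations and
  mapping over a list scales them, so the range of \<open>lincomb p\<close> is the complex span of
  the family, with no collecting of equal terms.\<close>

definition lincomb :: "('j \<Rightarrow> 'h::complex_vector) \<Rightarrow> (complex \<times> 'j) list \<Rightarrow> 'h" where
  "lincomb p cs = (\<Sum>(c, j)\<leftarrow>cs. c *\<^sub>C p j)"

lemma lincomb_simps [simp]:
  "lincomb p [] = 0" "lincomb p ((c, j) # cs) = c *\<^sub>C p j + lincomb p cs"
  "lincomb p (cs @ ds) = lincomb p cs + lincomb p ds"
  by (simp_all add: lincomb_def)

lemma lincomb_scale: "lincomb p (map (apfst ((*) a)) cs) = a *\<^sub>C lincomb p cs"
  by (induction cs) (auto simp: scaleC_add_right scaleC_scaleC)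

lemma cinner_sum_sum:
  fixes f :: "'i \<Rightarrow> 'h::chilbert_space"
  shows "cinner (\<Sum>s\<in>A. c s *\<^sub>C f s) (\<Sum>t\<in>B. d t *\<^sub>C g t)
    = (\<Sum>s\<in>A. \<Sum>t\<in>B. c s * cnj (d t) * cinner (f s) (g t))"
  by (subst cinner_sum_left)
    (simp add: cinner_sum_right cinner_scaleC_left cinner_scaleC_right sum_distrib_left mult_ac)

lemma lincomb_eq_sum:
  "lincomb p cs = (\<Sum>s<length cs. fst (cs ! s) *\<^sub>C p (snd (cs ! s)))"
  by (simp add: lincomb_def sum_list_sum_nth atLeast0LessThan case_prod_unfold)

text \<open>The linear functional \<open>p j \<mapsto> \<phi> j\<close> is represented by the minimizer of
  \<open>\<parallel>v\<parallel>\<^sup>2 - 2 Re \<phi>(v)\<close> over the closed span of the \<open>p j\<close>.\<close>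

lemma moment_problem:
  fixes p :: "'j \<Rightarrow> 'h::chilbert_space" and \<phi> :: "'j \<Rightarrow> complex"
  assumes C: "C \<ge> 0" and bound: "\<And>cs. cmod (lincomb \<phi> cs) \<le> C * norm (lincomb p cs)"
  obtains \<xi> where "\<xi> \<in> closure (range (lincomb p))" "norm \<xi> \<le> C" "\<And>j. cinner (p j) \<xi> = \<phi> j"
proof -
  define F where "F cs = (norm (lincomb p cs))\<^sup>2 - 2 * Re (lincomb \<phi> cs)" for cs
  have F_ge: "- C\<^sup>2 \<le> F cs" for cs
  proof -
    have "Re (lincomb \<phi> cs) \<le> C * norm (lincomb p cs)"
      using bound [of cs] complex_Re_le_cmod order_trans by blast
    moreover have "0 \<le> (norm (lincomb p cs) - C)\<^sup>2"
      by simp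
    ultimately show ?thesis
      by (simp add: F_def power2_diff mult.commute)
  qed
  define m where "m = (INF cs. F cs)"
  have bdd: "bdd_below (range F)"
    by (rule bdd_belowI2 [of _ "- C\<^sup>2"]) (rule F_ge)
  have m_le: "m \<le> F cs" for cs
    unfolding m_def by (rule cINF_lower [OF bdd]) simp
  have "\<exists>cs. F cs < m + 1 / Suc n" for n
  proof (rule ccontr)
    assume "\<not> ?thesis"
    then have "m + 1 / Suc n \<le> m"
      by (subst (2) m_def) (auto intro!: cINF_greatest simp: not_less)
    then show False by simp
  qed
  then obtain s where s: "\<And>n. F (s n) < m + 1 / Suc n"
    by metis
  define v where "v n = lincomb p (s n)" for n
  \<comment> \<open>Parallelogram law: the midpoint of two almost minimal combinations is again a
    combination, so \<open>F\<close> is at least \<open>m\<close> there, and this bounds the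
    distance of the two.\<close>
  have par: "(norm (v n - v k))\<^sup>2 < 2 / Suc n + 2 / Suc k" for n k
  proof -
    let ?h = "map (apfst ((*) (1/2))) (s n @ s k)"
    have h: "lincomb p ?h = (1/2) *\<^sub>C (v n + v k)"
      "lincomb \<phi> ?h = (1/2) * (lincomb \<phi> (s n) + lincomb \<phi> (s k))"
      by (simp_all only: lincomb_scale lincomb_simps v_def scaleC_complex_def)
    have "4 * F ?h = (norm (v n + v k))\<^sup>2 - 4 * Re (lincomb \<phi> (s n)) - 4 * Re (lincomb \<phi> (s k))"
      unfolding F_def h norm_scaleC by (simp add: power_mult_distrib power2_eq_square field_simps)
    moreover have "(norm (v n - v k))\<^sup>2 = 2 * (norm (v n))\<^sup>2 + 2 * (norm (v k))\<^sup>2 - (norm (v n + v k))\<^sup>2"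
      by (simp add: power2_norm_eq_inner inner_add_left inner_add_right inner_diff_left
          inner_diff_right inner_commute)
    moreover have "m \<le> F ?h"
      by (rule m_le)
    ultimately show ?thesis
      using s [of n] s [of k] by (simp add: F_def v_def)
  qed
  have "Cauchy v"
  proof (rule metric_CauchyI)
    fix e :: real assume "e > 0"
    then obtain M where M: "1 / real (Suc M) < e\<^sup>2 / 4"
      using reals_Archimedean [of "e\<^sup>2 / 4"] by (auto simp: inverse_eq_divide)
    have "dist (v n) (v k) < e" if "n \<ge> M" "k \<ge> M" for n k
    proof -
      have "1 / Suc n \<le> 1 / Suc M" "1 / Suc k \<le> 1 / Suc M"
        using that by (auto intro!: divide_left_mono)
      then have "(norm (v n - v k))\<^sup>2 < e\<^sup>2"
        using par [of n k] M by simp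
      then show ?thesis
        using power2_less_imp_less [of "norm (v n - v k)" e] \<open>e > 0\<close> by (simp add: dist_norm)
    qed
    then show "\<exists>M. \<forall>n\<ge>M. \<forall>k\<ge>M. dist (v n) (v k) < e" by blast
  qed
  then obtain \<xi> where \<xi>: "v \<longlonglongrightarrow> \<xi>"
    using Cauchy_convergent convergent_def by blast
  have lim0: "(\<lambda>n. - (1 / real (Suc n))) \<longlonglongrightarrow> 0"
    using tendsto_minus [OF LIMSEQ_inverse_real_of_nat] by (simp add: inverse_eq_divide)
  \<comment> \<open>First variation at the limit: \<open>s n @ cs\<close> competes with
    \<open>s n\<close> and can lower \<open>F\<close> by at most 1 / (n + 1). The difference
    involves \<phi> only at \<open>cs\<close>, so the limit requires nothing but the convergence of
    \<open>v\<close>.\<close>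
  have var: "0 \<le> 2 * Re (cinner \<xi> (lincomb p cs)) + (norm (lincomb p cs))\<^sup>2 - 2 * Re (lincomb \<phi> cs)"
    for cs
  proof (rule tendsto_le [OF _ _ lim0])
    show "(\<lambda>n. 2 * Re (cinner (v n) (lincomb p cs)) + (norm (lincomb p cs))\<^sup>2 - 2 * Re (lincomb \<phi> cs))
       \<longlonglongrightarrow> 2 * Re (cinner \<xi> (lincomb p cs)) + (norm (lincomb p cs))\<^sup>2 - 2 * Re (lincomb \<phi> cs)"
      by (intro tendsto_intros bounded_linear.tendsto [OF bounded_linear_cinner_left] \<xi>)
    have "- (1 / Suc n) \<le> 2 * Re (cinner (v n) (lincomb p cs)) + (norm (lincomb p cs))\<^sup>2
        - 2 * Re (lincomb \<phi> cs)" for n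
      using m_le [of "s n @ cs"] s [of n] by (simp add: F_def norm_add_square v_def)
    then show "\<forall>\<^sub>F n in sequentially. - (1 / Suc n) \<le> 2 * Re (cinner (v n) (lincomb p cs))
        + (norm (lincomb p cs))\<^sup>2 - 2 * Re (lincomb \<phi> cs)"
      by (intro always_eventually allI)
  qed simp
  have le: "Re (lincomb \<phi> cs) \<le> Re (cinner (lincomb p cs) \<xi>)" for cs
  proof (rule field_le_epsilon)
    fix e :: real assume e: "e > 0"
    \<comment> \<open>After replacing \<open>cs\<close> by its multiple by \<open>t\<close> and
      dividing by \<open>t\<close>, the second-order term is \<open>t\<close> times a squared norm;
      this choice keeps it below \<open>2 * e\<close>, and the added 1 covers the zero
      vector.\<close>
    define t where "t = 2 * e / ((norm (lincomb p cs))\<^sup>2 + 1)"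
    have t: "t > 0"
      unfolding t_def using e by (intro divide_pos_pos) (auto intro: add_nonneg_pos)
    have "t * (norm (lincomb p cs))\<^sup>2 \<le> t * ((norm (lincomb p cs))\<^sup>2 + 1)"
      using t by (intro mult_left_mono) auto
    also have "\<dots> = 2 * e"
      using zero_le_power2 [of "norm (lincomb p cs)"] unfolding t_def
      by (simp add: add_nonneg_eq_0_iff)
    finally have te: "t * (norm (lincomb p cs))\<^sup>2 \<le> 2 * e" .
    have "0 \<le> t * (2 * Re (cinner \<xi> (lincomb p cs)) + t * (norm (lincomb p cs))\<^sup>2
        - 2 * Re (lincomb \<phi> cs))"
      using var [of "map (apfst ((*) (complex_of_real t))) cs"] t
      unfolding lincomb_scale norm_scaleC
      by (simp add: cinner_scaleC_right scaleC_complex_def power_mult_distrib power2_eq_square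
          algebra_simps)
    then have "0 \<le> 2 * Re (cinner \<xi> (lincomb p cs)) + t * (norm (lincomb p cs))\<^sup>2
        - 2 * Re (lincomb \<phi> cs)"
      using t by (simp add: zero_le_mult_iff)
    moreover have "Re (cinner \<xi> (lincomb p cs)) = Re (cinner (lincomb p cs) \<xi>)"
      by (metis inner_commute inner_eq_Re_cinner)
    ultimately show "Re (lincomb \<phi> cs) \<le> Re (cinner (lincomb p cs) \<xi>) + e"
      using te by simp
  qed
  \<comment> \<open>The one-sided estimate at the negative of \<open>cs\<close> gives equality of
    the real parts; equality of the imaginary parts then follows by passing to the multiple by
    \<i>.\<close>
  have re: "Re (lincomb \<phi> cs) = Re (cinner (lincomb p cs) \<xi>)" for cs
    using le [of cs] le [of "map (apfst ((*) (-1))) cs"]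
    unfolding lincomb_scale by (simp add: cinner_scaleC_left scaleC_complex_def)
  have eq: "cinner (lincomb p cs) \<xi> = lincomb \<phi> cs" for cs
    using re [of cs] re [of "map (apfst ((*) \<i>)) cs"]
    unfolding lincomb_scale by (simp add: cinner_scaleC_left scaleC_complex_def complex_eq_iff)
  show thesis
  proof
    show "\<xi> \<in> closure (range (lincomb p))"
      unfolding closure_sequential using \<xi> by (intro exI [of _ v]) (auto simp: v_def)
    show "cinner (p j) \<xi> = \<phi> j" for j
      using eq [of "[(1, j)]"] by (simp add: scaleC_complex_def scaleC_one)
    \<comment> \<open>The inner product of \<open>v n\<close> with \<xi> is the value of \<phi> on
      \<open>s n\<close>, hence at most \<open>C * norm (v n)\<close>; in the limit one factor
      \<parallel>\<xi>\<parallel> cancels.\<close>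
    have "cmod (cinner \<xi> \<xi>) \<le> C * norm \<xi>"
    proof (rule tendsto_le)
      show "(\<lambda>n. cmod (cinner (v n) \<xi>)) \<longlonglongrightarrow> cmod (cinner \<xi> \<xi>)"
        by (intro tendsto_intros bounded_linear.tendsto [OF bounded_linear_cinner_left] \<xi>)
      show "(\<lambda>n. C * norm (v n)) \<longlonglongrightarrow> C * norm \<xi>"
        by (intro tendsto_intros \<xi>)
    qed (use eq bound in \<open>simp_all add: v_def\<close>)
    then have "norm \<xi> * norm \<xi> \<le> C * norm \<xi>"
      by (simp add: cinner_self power2_eq_square norm_mult)
    then show "norm \<xi> \<le> C"
      using C by (metis mult_right_le_imp_le norm_ge_zero order_le_less)
  qed
qed

text \<open>\<xi> is a limit of combinations that are all orthogonal to \<xi>, hence orthogonal to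
  itself. This is the counterpart of \<open>moment_problem\<close>: the representing vector is
  unique inside the closed span, which is how linearity of the maps built from it is proved.\<close>

lemma closure_span_unique:
  fixes p :: "'j \<Rightarrow> 'h::chilbert_space"
  assumes "\<xi> \<in> closure (range (lincomb p))" "\<And>j. cinner (p j) \<xi> = 0"
  shows "\<xi> = 0"
proof -
  have z: "cinner (lincomb p cs) \<xi> = 0" for cs
    by (induction cs) (auto simp: cinner_add_left cinner_scaleC_left assms)
  obtain v where v: "\<And>n. v n \<in> range (lincomb p)" "v \<longlonglongrightarrow> \<xi>"
    using assms(1) unfolding closure_sequential by blast
  have "(\<lambda>n. cinner (v n) \<xi>) \<longlonglongrightarrow> cinner \<xi> \<xi>"
    by (intro bounded_linear.tendsto [OF bounded_linear_cinner_left] v)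
  moreover have "cinner (v n) \<xi> = 0" for n
    using v(1) [of n] z by auto
  ultimately have "cinner \<xi> \<xi> = 0"
    by (simp add: LIMSEQ_const_iff)
  then show ?thesis
    by (simp add: cinner_self)
qed

lemma closure_span_linear:
  fixes p :: "'j \<Rightarrow> 'h::chilbert_space"
  assumes "\<xi> \<in> closure (range (lincomb p))" "\<eta> \<in> closure (range (lincomb p))"
  shows closure_span_add: "\<xi> + \<eta> \<in> closure (range (lincomb p))"
    and closure_span_scale: "c *\<^sub>C \<xi> \<in> closure (range (lincomb p))"
    and closure_span_diff: "\<xi> - \<eta> \<in> closure (range (lincomb p))"
proof -
  obtain v w where v: "\<And>n. v n \<in> range (lincomb p)" "v \<longlonglongrightarrow> \<xi>"
    and w: "\<And>n. w n \<in> range (lincomb p)" "w \<longlonglongrightarrow> \<eta>"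
    using assms unfolding closure_sequential by blast
  have 1: "x + y \<in> range (lincomb p)" if "x \<in> range (lincomb p)" "y \<in> range (lincomb p)" for x y
    using that by (auto simp flip: lincomb_simps(3))
  have 2: "c *\<^sub>C x \<in> range (lincomb p)" if "x \<in> range (lincomb p)" for x c
    using that by (auto simp flip: lincomb_scale)
  have bl: "bounded_linear (\<lambda>x::'h. c *\<^sub>C x)" for c
    by (rule bounded_linear_intro [where K = "cmod c"])
      (simp_all add: scaleC_add_right norm_scaleC scaleR_scaleC scaleC_scaleC mult.commute)
  show add: "\<xi> + \<eta> \<in> closure (range (lincomb p))"
    unfolding closure_sequential
    by (rule exI [of _ "\<lambda>n. v n + w n"]) (auto intro!: tendsto_add 1 v w)
  show "c *\<^sub>C \<xi> \<in> closure (range (lincomb p))" for c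
    unfolding closure_sequential
    by (rule exI [of _ "\<lambda>n. c *\<^sub>C v n"]) (auto intro!: bounded_linear.tendsto [OF bl] 2 v)
  have "\<xi> - \<eta> = \<xi> + (-1) *\<^sub>C \<eta>"
    using scaleC_minus_right [of 1 \<eta>] scaleR_scaleC [of "-1" \<eta>] by simp
  moreover have "(-1) *\<^sub>C \<eta> \<in> closure (range (lincomb p))"
    unfolding closure_sequential
    by (rule exI [of _ "\<lambda>n. (-1) *\<^sub>C w n"]) (auto intro!: bounded_linear.tendsto [OF bl] 2 w)
  moreover have "\<xi> + (-1) *\<^sub>C \<eta> \<in> closure (range (lincomb p))"
    unfolding closure_sequential
    by (rule exI [of _ "\<lambda>n. v n + (-1) *\<^sub>C w n"])
      (auto intro!: tendsto_add bounded_linear.tendsto [OF bl] 1 2 v w)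
  ultimately show "\<xi> - \<eta> \<in> closure (range (lincomb p))" by metis
qed

lemma lincomb_image:
  assumes "\<And>x y. \<phi> (x + y) = \<phi> x + \<phi> y" "\<And>c x. \<phi> (c *\<^sub>C x) = c *\<^sub>C \<phi> x"
  shows "lincomb (\<lambda>j. \<phi> (p j)) cs = \<phi> (lincomb p cs :: 'h::complex_vector)"
proof (induction cs)
  case Nil
  then show ?case using assms(2) [of 0 0] by simp
qed (auto simp: assms)

section \<open>Riesz representation and adjoints\<close>

lemma Riesz_representation:
  fixes \<phi> :: "'h::chilbert_space \<Rightarrow> complex"
  assumes "\<And>x y. \<phi> (x + y) = \<phi> x + \<phi> y" "\<And>c x. \<phi> (c *\<^sub>C x) = c *\<^sub>C \<phi> x"
    and "\<And>x. cmod (\<phi> x) \<le> C * norm x" "C \<ge> 0"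
  obtains \<xi> where "\<And>x. \<phi> x = cinner x \<xi>" "norm \<xi> \<le> C"
proof (rule moment_problem [of C \<phi> "\<lambda>x. x"])
  show "cmod (lincomb \<phi> cs) \<le> C * norm (lincomb (\<lambda>x. x) cs)" for cs
    using lincomb_image [of \<phi> "\<lambda>x. x", OF assms(1,2)] assms(3) by simp
qed (use assms that in \<open>simp_all, metis\<close>)

text \<open>\<open>cadjoint\<close> is a definite description, so an adjoint must be produced, here
  from Riesz representation. The estimate is quantified over every bound \<open>K\<close> of
  \<open>T\<close>, so that the bound 1 of a contraction passes to the adjoint with the same
  constant.\<close>

lemma cadjoint_exists:
  fixes T :: "'a::chilbert_space \<Rightarrow>\<^sub>C\<^sub>L 'b::chilbert_space"
  obtains T' :: "'b \<Rightarrow>\<^sub>C\<^sub>L 'a" where "\<And>x y. cinner (T x) y = cinner x (T' y)"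
    "\<And>K y. K \<ge> 0 \<Longrightarrow> (\<And>x. norm (T x) \<le> K * norm x) \<Longrightarrow> norm (T' y) \<le> K * norm y"
proof -
  have ex: "\<exists>\<xi>. (\<forall>x. cinner (T x) y = cinner x \<xi>) \<and> norm \<xi> \<le> K * norm y"
    if "K \<ge> 0" "\<And>x. norm (T x) \<le> K * norm x" for y K
  proof (rule Riesz_representation [of "\<lambda>x. cinner (T x) y" "K * norm y"])
    show "cmod (cinner (T x) y) \<le> K * norm y * norm x" for x
      using mult_right_mono [OF that(2) [of x], of "norm y"] Cauchy_Schwarz_cinner [of "T x" y]
      by (simp add: mult_ac)
  qed (use that in \<open>auto simp: cblinfun_apply_linear cinner_add_left cinner_scaleC_left scaleC_complex_def\<close>)
  obtain K where K: "K \<ge> 0" "\<And>x. norm (T x) \<le> K * norm x"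
    using cblinfun_bound by blast
  obtain f where f: "\<And>x y. cinner (T x) y = cinner x (f y)"
    using ex [OF K] by metis
  have f_le: "norm (f y) \<le> K * norm y" if "K \<ge> 0" "\<And>x. norm (T x) \<le> K * norm x" for K y
    using ex [OF that, of y] f cinner_eqI_right by metis
  have "bounded_clinear f"
  proof (rule bounded_clinearI)
    show "f (x + y) = f x + f y" for x y
      by (rule cinner_eqI_right) (simp add: cinner_add_right flip: f)
    show "f (c *\<^sub>C x) = c *\<^sub>C f x" for c x
      by (rule cinner_eqI_right) (simp add: cinner_scaleC_right flip: f)
  qed (rule f_le [OF K])
  then show thesis
    using that [of "CBlinfun f"] f f_le by (simp add: CBlinfun_apply)
qed

lemma cadjoint_eqI:
  fixes T :: "'a::chilbert_space \<Rightarrow>\<^sub>C\<^sub>L 'b::chilbert_space"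
  assumes "\<And>x y. cinner (T x) y = cinner x (cblinfun_apply T' y)"
  shows "cadjoint T = T'"
  unfolding cadjoint_def
proof (rule the_equality)
  fix S :: "'b \<Rightarrow>\<^sub>C\<^sub>L 'a"
  assume S: "\<forall>x y. cinner (T x) y = cinner x (S y)"
  have "S y = T' y" for y
    by (rule cinner_eqI_right) (simp flip: S assms)
  then show "S = T'"
    by (rule cblinfun_eqI)
qed (use assms in simp)

lemma cinner_cadjoint: "cinner (T x) y = cinner x (cadjoint T y)"
  for T :: "'a::chilbert_space \<Rightarrow>\<^sub>C\<^sub>L 'b::chilbert_space"
proof (rule cadjoint_exists [of T])
  fix T' :: "'b \<Rightarrow>\<^sub>C\<^sub>L 'a"
  assume T': "\<And>x y. cinner (T x) y = cinner x (T' y)"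
  show ?thesis
    unfolding cadjoint_eqI [OF T'] by (rule T')
qed

lemma cinner_cadjoint_left: "cinner (cadjoint T y) x = cinner y (T x)"
  for T :: "'a::chilbert_space \<Rightarrow>\<^sub>C\<^sub>L 'b::chilbert_space"
  by (metis cinner_cadjoint cinner_commute)

lemma norm_cadjoint_le:
  fixes T :: "'a::chilbert_space \<Rightarrow>\<^sub>C\<^sub>L 'b::chilbert_space"
  assumes "K \<ge> 0" "\<And>x. norm (T x) \<le> K * norm x"
  shows "norm (cadjoint T y) \<le> K * norm y"
proof (rule cadjoint_exists [of T])
  fix T' :: "'b \<Rightarrow>\<^sub>C\<^sub>L 'a"
  assume T': "\<And>x y. cinner (T x) y = cinner x (T' y)"
    and le: "\<And>K y. K \<ge> 0 \<Longrightarrow> (\<And>x. norm (T x) \<le> K * norm x) \<Longrightarrow> norm (T' y) \<le> K * norm y"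
  show ?thesis
    unfolding cadjoint_eqI [OF T'] by (rule le [OF assms])
qed

lemma cadjoint_cadjoint [simp]: "cadjoint (cadjoint T) = T"
  by (rule cadjoint_eqI) (rule cinner_cadjoint_left)

lemma cadjoint_add: "cadjoint (S + T) = cadjoint S + cadjoint T"
  by (rule cadjoint_eqI) (simp add: cinner_add_left cinner_add_right cinner_cadjoint)

lemma cadjoint_scale: "cadjoint (c *\<^sub>C S) = cnj c *\<^sub>C cadjoint S"
  by (rule cadjoint_eqI) (simp add: cinner_scaleC_left cinner_scaleC_right cinner_cadjoint)

lemma cadjoint_zero [simp]: "cadjoint 0 = 0"
  using cadjoint_scale [of 0 0] by simp

lemma cadjoint_sum: "cadjoint (sum f A) = (\<Sum>i\<in>A. cadjoint (f i))"
  by (induction A rule: infinite_finite_induct) (auto simp: cadjoint_add)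

section \<open>Vectors with a prescribed Gram matrix\<close>

lift_definition l2_single :: "'i \<Rightarrow> 'h::chilbert_space \<Rightarrow> ('i, 'h) l2" is "\<lambda>i h j. if j = i then h else 0"
proof -
  fix i :: 'i and h :: 'h
  have "(\<lambda>j. (norm (if j = i then h else 0))\<^sup>2) summable_on UNIV
    \<longleftrightarrow> (\<lambda>j. (norm (if j = i then h else 0))\<^sup>2) summable_on {i}"
    by (rule summable_on_cong_neutral) auto
  then show "(\<lambda>j. (norm (if j = i then h else 0))\<^sup>2) summable_on UNIV"
    by simp
qed

lemma l2_nth_single [simp]: "l2_nth (l2_single i h) j = (if j = i then h else 0)"
  by transfer simp

lemma infsum_single:
  fixes f :: "'i \<Rightarrow> 'a::{comm_monoid_add, t2_space}"
  assumes "\<And>j. j \<noteq> i \<Longrightarrow> f j = 0"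
  shows "infsum f UNIV = f i"
proof -
  have "infsum f UNIV = infsum f {i}"
    by (rule infsum_cong_neutral) (use assms in auto)
  then show ?thesis by simp
qed

lemma cinner_l2_single: "cinner (l2_single i h) f = cinner h (l2_nth f i)"
  "cinner f (l2_single i h) = cinner (l2_nth f i) h"
  unfolding cinner_l2_def by (subst infsum_single [where i = i]; auto)+

text \<open>Each coordinate is read off by inner products with \<open>l2_single i h\<close>, so the
  set is an intersection of zero sets of continuous functionals.\<close>

lemma closed_l2_supported: "closed {f :: ('i, 'h::chilbert_space) l2. \<forall>i\<in>A. l2_nth f i = 0}"
proof -
  have "{f :: ('i, 'h) l2. \<forall>i\<in>A. l2_nth f i = 0}
      = (\<Inter>i\<in>A. \<Inter>h. {f. cinner f (l2_single i h) = 0})"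
  proof (intro equalityI subsetI)
    fix f :: "('i, 'h) l2"
    assume f: "f \<in> (\<Inter>i\<in>A. \<Inter>h. {f. cinner f (l2_single i h) = 0})"
    have "l2_nth f i = 0" if "i \<in> A" for i
      by (rule cinner_eqI) (use f that in \<open>simp add: cinner_l2_single\<close>)
    then show "f \<in> {f. \<forall>i\<in>A. l2_nth f i = 0}" by simp
  qed (auto simp: cinner_l2_single)
  also have "closed \<dots>"
    by (intro closed_INT ballI closed_Collect_eq continuous_intros
      bounded_linear.continuous_on [OF bounded_linear_cinner_left])
  finally show ?thesis .
qed

text \<open>For a Gram kernel \<open>\<kappa> x y = cinner (f x) (f y)\<close> the sum is the
  squared norm of the combination of the \<open>f (j s)\<close> with coefficients
  \<open>c s\<close>; repetitions among the points \<open>j s\<close> are allowed.\<close>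

definition psd_kernel :: "('j \<Rightarrow> 'j \<Rightarrow> complex) \<Rightarrow> bool" where
  "psd_kernel \<kappa> \<longleftrightarrow> (\<forall>(n::nat) c j. 0 \<le> (\<Sum>s<n. \<Sum>t<n. c s * cnj (c t) * \<kappa> (j s) (j t)))"

lemma psd_kernelD: "psd_kernel \<kappa> \<Longrightarrow> 0 \<le> (\<Sum>s<n. \<Sum>t<n. c s * cnj (c t) * \<kappa> (j s) (j t))"
  for n :: nat
  by (simp add: psd_kernel_def)

text \<open>Nonnegative complex numbers are real. Testing the two-point form with the coefficients
  1, 1 and with 1, \<i> forces the off-diagonal entries to be conjugate.\<close>

lemma psd_kernel_hermitian:
  assumes "psd_kernel \<kappa>"
  shows "\<kappa> x y = cnj (\<kappa> y x)" "0 \<le> \<kappa> x x"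
proof -
  have pos: "0 \<le> c * cnj c * \<kappa> x x + c * cnj d * \<kappa> x y + (d * cnj c * \<kappa> y x + d * cnj d * \<kappa> y y)"
    for c d x y
    using psd_kernelD [OF assms, of "\<lambda>s. if s = 0 then c else d" "\<lambda>s. if s = 0 then x else y" 2]
    by (simp add: numeral_2_eq_2)
  show "0 \<le> \<kappa> x x" for x
    using pos [of 1 x 0] by simp
  then have "Im (\<kappa> x x) = 0" "Im (\<kappa> y y) = 0"
    by (simp_all add: less_eq_complex_def)
  then show "\<kappa> x y = cnj (\<kappa> y x)"
    using pos [of 1 x 1 y] pos [of 1 x \<i> y] by (simp add: less_eq_complex_def complex_eq_iff)
qed

text \<open>Adjoin the point \<open>x\<close> with a free coefficient \<open>d\<close> to the given
  combination and let \<open>d\<close> be a negative multiple of \<phi>; positivity becomes a real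
  quadratic inequality in that multiple.\<close>

lemma psd_kernel_Cauchy_Schwarz:
  fixes n :: nat
  assumes "psd_kernel \<kappa>"
  shows "(cmod (\<Sum>s<n. c s * \<kappa> (j s) x))\<^sup>2
    \<le> Re (\<Sum>s<n. \<Sum>t<n. c s * cnj (c t) * \<kappa> (j s) (j t)) * Re (\<kappa> x x)"
proof -
  define N where "N = (\<Sum>s<n. \<Sum>t<n. c s * cnj (c t) * \<kappa> (j s) (j t))"
  define \<phi> where "\<phi> = (\<Sum>s<n. c s * \<kappa> (j s) x)"
  have 0: "0 \<le> N + cnj d * \<phi> + d * cnj \<phi> + d * cnj d * \<kappa> x x" for d
  proof -
    let ?c = "\<lambda>s. if s < n then c s else d" and ?j = "\<lambda>s. if s < n then j s else x"
    have "(\<Sum>s<Suc n. \<Sum>t<Suc n. ?c s * cnj (?c t) * \<kappa> (?j s) (?j t))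
      = N + (\<Sum>s<n. c s * cnj d * \<kappa> (j s) x) + ((\<Sum>t<n. d * cnj (c t) * \<kappa> x (j t)) + d * cnj d * \<kappa> x x)"
      by (simp add: N_def sum.distrib)
    also have "(\<Sum>t<n. d * cnj (c t) * \<kappa> x (j t)) = d * cnj \<phi>"
      unfolding \<phi>_def
      by (simp add: sum_distrib_left psd_kernel_hermitian(1) [OF assms, of x] mult_ac)
    also have "(\<Sum>s<n. c s * cnj d * \<kappa> (j s) x) = cnj d * \<phi>"
      unfolding \<phi>_def by (simp add: sum_distrib_left mult_ac)
    finally show ?thesis
      using psd_kernelD [OF assms, of ?c ?j "Suc n"] by (simp add: add_ac)
  qed
  have *: "0 \<le> Re N - 2 * t * (cmod \<phi>)\<^sup>2 + t\<^sup>2 * (cmod \<phi>)\<^sup>2 * Re (\<kappa> x x)" for t :: real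
  proof -
    have nn: "\<phi> * cnj \<phi> = of_real ((cmod \<phi>)\<^sup>2)"
      by (metis complex_norm_square)
    have "0 \<le> N - of_real (2 * t) * (\<phi> * cnj \<phi>) + of_real (t\<^sup>2) * (\<phi> * cnj \<phi>) * \<kappa> x x"
      using 0 [of "- of_real t * \<phi>"] by (simp add: power2_eq_square algebra_simps)
    then show ?thesis
      unfolding nn by (simp add: less_eq_complex_def flip: of_real_mult del: of_real_power)
  qed
  have N: "0 \<le> Re N"
    using * [of 0] by simp
  have "(cmod \<phi>)\<^sup>2 \<le> Re N * Re (\<kappa> x x)"
  proof (cases "Re (\<kappa> x x) = 0")
    case True
    have "(cmod \<phi>)\<^sup>2 = 0"
    proof (rule ccontr)
      assume "(cmod \<phi>)\<^sup>2 \<noteq> 0"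
      \<comment> \<open>With a vanishing diagonal entry the inequality is affine in
        \<open>t\<close>; this \<open>t\<close> turns it into 0 \<le> - Re N - 2, against Re N \<ge>
        0.\<close>
      then show False
        using * [of "(Re N + 1) / (cmod \<phi>)\<^sup>2"] N by (simp add: True)
    qed
    then show ?thesis by (simp add: True)
  next
    case False
    then have pos: "Re (\<kappa> x x) > 0"
      using psd_kernel_hermitian(2) [OF assms, of x] by (simp add: less_eq_complex_def)
    then show ?thesis
      using * [of "1 / Re (\<kappa> x x)"] by (simp add: power2_eq_square field_simps)
  qed
  then show ?thesis
    by (simp add: N_def \<phi>_def)
qed

text \<open>Cholesky decomposition along a well-ordering of the index type.\<close>

lemma gram_realization:
  fixes \<kappa> :: "'j \<Rightarrow> 'j \<Rightarrow> complex"
  assumes psd: "psd_kernel \<kappa>" and wf: "wf R" and trans: "trans R"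
    and total: "\<And>x y. x \<noteq> y \<Longrightarrow> (x, y) \<in> R \<or> (y, x) \<in> R"
  obtains f :: "'j \<Rightarrow> ('j, complex) l2"
  where "\<And>x y. cinner (f x) (f y) = \<kappa> x y"
    and "\<And>x i. i \<noteq> x \<Longrightarrow> (i, x) \<notin> R \<Longrightarrow> l2_nth (f x) i = 0"
proof -
  \<comment> \<open>Triangularity is part of the invariant: the vector of an index has coordinates
    only at that index and below it. This keeps coordinate \<open>x\<close> free for the diagonal
    entry and makes the factorization finite when the order is that of the natural numbers.\<close>
  define P where "P f x r \<longleftrightarrow> (\<forall>y. (y, x) \<in> R \<longrightarrow> cinner (f y) r = \<kappa> y x) \<and> cinner r r = \<kappa> x x
      \<and> (\<forall>i\<in>{i. i \<noteq> x \<and> (i, x) \<notin> R}. l2_nth r i = 0)" for f :: "'j \<Rightarrow> ('j, complex) l2" and x r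
  have gram: "cinner (f y) (f z) = \<kappa> y z" if "P f y (f y)" "P f z (f z)" for f y z
  proof (cases "y = z")
    case False
    from total [OF this] show ?thesis
    proof
      assume "(z, y) \<in> R"
      then have "cinner (f z) (f y) = \<kappa> z y"
        using that by (simp add: P_def)
      then show ?thesis
        using cinner_commute [of "f y" "f z"] psd_kernel_hermitian(1) [OF psd, of y z] by simp
    qed (use that in \<open>simp add: P_def\<close>)
  qed (use that in \<open>simp add: P_def\<close>)
  have "\<exists>f. \<forall>x. P f x (f x)"
  proof (rule dependent_wf_choice [OF wf])
    fix f g :: "'j \<Rightarrow> ('j, complex) l2" and x r
    assume "\<And>z. (z, x) \<in> R \<Longrightarrow> f z = g z"
    then show "P f x r = P g x r"
      by (simp add: P_def)
  next
    fix f :: "'j \<Rightarrow> ('j, complex) l2" and x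
    assume IH: "\<And>y. (y, x) \<in> R \<Longrightarrow> P f y (f y)"
    define p where "p y = (if (y, x) \<in> R then f y else 0)" for y
    define \<phi> where "\<phi> y = (if (y, x) \<in> R then \<kappa> y x else 0)" for y
    define k where "k = Re (\<kappa> x x)"
    have k: "\<kappa> x x = of_real k" "k \<ge> 0"
      using psd_kernel_hermitian(2) [OF psd, of x] by (simp_all add: k_def less_eq_complex_def complex_eq_iff)
    \<comment> \<open>Cauchy-Schwarz for \<kappa>: the inner products prescribed with the earlier
      vectors are bounded by the square root of the diagonal entry.\<close>
    have bound: "cmod (lincomb \<phi> cs) \<le> sqrt k * norm (lincomb p cs)" for cs
    proof -
      define n where "n = length cs"
      define j where "j s = snd (cs ! s)" for s
      define c where "c s = (if (j s, x) \<in> R then fst (cs ! s) else 0)" for s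
      have 1: "lincomb \<phi> cs = (\<Sum>s<n. c s * \<kappa> (j s) x)"
        unfolding lincomb_eq_sum n_def
        by (rule sum.cong) (auto simp: c_def j_def \<phi>_def scaleC_complex_def)
      have 2: "lincomb p cs = (\<Sum>s<n. c s *\<^sub>C p (j s))"
        unfolding lincomb_eq_sum n_def by (rule sum.cong) (auto simp: c_def j_def p_def)
      have "cinner (lincomb p cs) (lincomb p cs)
          = (\<Sum>s<n. \<Sum>t<n. c s * (cnj (c t) * cinner (p (j s)) (p (j t))))"
        unfolding 2 cinner_sum_sum by (simp add: mult.assoc)
      also have "\<dots> = (\<Sum>s<n. \<Sum>t<n. c s * cnj (c t) * \<kappa> (j s) (j t))"
        by (intro sum.cong) (auto simp: c_def p_def gram IH)
      finally have "(norm (lincomb p cs))\<^sup>2 = Re (\<Sum>s<n. \<Sum>t<n. c s * cnj (c t) * \<kappa> (j s) (j t))"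
        by (metis Re_complex_of_real cinner_self)
      then have "(cmod (lincomb \<phi> cs))\<^sup>2 \<le> (sqrt k * norm (lincomb p cs))\<^sup>2"
        using psd_kernel_Cauchy_Schwarz [OF psd, of c j x n] k(2)
        unfolding 1 power_mult_distrib by (simp add: mult.commute flip: k_def)
      then show ?thesis
        by (rule power2_le_imp_le) (use k in simp)
    qed
    obtain \<xi> where \<xi>: "\<xi> \<in> closure (range (lincomb p))" "norm \<xi> \<le> sqrt k"
      "\<And>y. cinner (p y) \<xi> = \<phi> y"
      by (rule moment_problem [of "sqrt k" \<phi> p, OF _ bound]) (use k in auto)
    let ?S = "{f :: ('j, complex) l2. \<forall>i\<in>{i. (i, x) \<notin> R}. l2_nth f i = 0}"
    have pS: "p y \<in> ?S" for y
    proof (cases "(y, x) \<in> R")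
      case True
      then have "\<forall>i\<in>{i. i \<noteq> y \<and> (i, y) \<notin> R}. l2_nth (f y) i = 0"
        using IH by (simp add: P_def)
      with True show ?thesis
        using trans by (auto simp: p_def trans_def)
    qed (simp add: p_def)
    have "lincomb p cs \<in> ?S" for cs
      by (induction cs) (use pS in auto)
    then have "closure (range (lincomb p)) \<subseteq> ?S"
      by (intro closure_minimal closed_l2_supported) auto
    with \<xi> have \<xi>S: "\<xi> \<in> ?S" by blast
    have irr: "(x, x) \<notin> R"
      using wf by simp
    \<comment> \<open>\<xi> lies in the closed span of the earlier vectors and has the prescribed
      inner products with them; \<open>d\<close> is the square root of the Schur complement and goes
      to coordinate \<open>x\<close>, where \<xi> and all earlier vectors vanish.\<close>
    define d where "d = sqrt (k - (norm \<xi>)\<^sup>2)"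
    have "(norm \<xi>)\<^sup>2 \<le> (sqrt k)\<^sup>2"
      using \<xi>(2) by (intro power_mono) auto
    then have d2: "d\<^sup>2 = k - (norm \<xi>)\<^sup>2"
      using k by (simp add: d_def)
    define r where "r = \<xi> + l2_single x (complex_of_real d)"
    have "cinner (f y) r = \<kappa> y x" if "(y, x) \<in> R" for y
      using that \<xi>(3) [of y] pS [of y] irr
      by (simp add: r_def p_def \<phi>_def cinner_add_right cinner_l2_single)
    moreover have "cinner r r = \<kappa> x x"
    proof -
      have "cinner r r = cinner \<xi> \<xi> + of_real (d\<^sup>2)"
        using \<xi>S irr by (simp add: r_def cinner_add_left cinner_add_right cinner_l2_single
          cinner_complex_def power2_eq_square)
      then show ?thesis
        by (simp add: d2 k cinner_self)
    qed
    ultimately have "P f x r"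
      using \<xi>S by (auto simp: P_def r_def)
    then show "\<exists>r. P f x r" by blast
  qed
  then obtain f where f: "\<And>x. P f x (f x)" by blast
  show thesis
  proof
    show "cinner (f x) (f y) = \<kappa> x y" for x y
      by (rule gram [OF f f])
    show "i \<noteq> x \<Longrightarrow> (i, x) \<notin> R \<Longrightarrow> l2_nth (f x) i = 0" for x i
      using f [of x] by (simp add: P_def)
  qed
qed

lemma gram_realization_ex:
  fixes \<kappa> :: "'j \<Rightarrow> 'j \<Rightarrow> complex"
  assumes "psd_kernel \<kappa>"
  obtains f :: "'j \<Rightarrow> ('j, complex) l2" where "\<And>x y. cinner (f x) (f y) = \<kappa> x y"
proof -
  obtain r :: "'j rel" where r: "well_order_on UNIV r"
    using well_order_on by blast
  then have "wf (r - Id)" "trans (r - Id)"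
    by (auto simp: well_order_on_def linear_order_on_def partial_order_on_def preorder_on_def
      intro: trans_diff_Id)
  moreover have "(x, y) \<in> r - Id \<or> (y, x) \<in> r - Id" if "x \<noteq> y" for x y
    using r that by (auto simp: well_order_on_def linear_order_on_def total_on_def)
  ultimately show thesis
    by (rule gram_realization [OF assms, of "r - Id"]) (use that in blast)+
qed

text \<open>Along the natural order the Gram vector of \<open>i\<close> is supported on coordinates
  up to \<open>i\<close>, so the \<ell>^2 inner product is a sum over s < n, and the matrix is J J^*
  with a square factor.\<close>

lemma psd_factorization:
  fixes \<kappa> :: "nat \<Rightarrow> nat \<Rightarrow> complex"
  assumes psd: "\<And>c. 0 \<le> (\<Sum>i<n. \<Sum>j<n. c i * cnj (c j) * \<kappa> i j)"
  obtains J :: "nat \<Rightarrow> nat \<Rightarrow> complex"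
  where "\<And>i j. i < n \<Longrightarrow> j < n \<Longrightarrow> \<kappa> i j = (\<Sum>s<n. J i s * cnj (J j s))"
proof -
  define k where "k i j = (if i < n \<and> j < n then \<kappa> i j else 0)" for i j
  have "psd_kernel k"
    unfolding psd_kernel_def
  proof (intro allI)
    fix N :: nat and c :: "nat \<Rightarrow> complex" and j :: "nat \<Rightarrow> nat"
    \<comment> \<open>Coefficients of repeated points are collected, and points from
      \<open>n\<close> on contribute nothing; this turns a form over arbitrary points into one over
      the indices below \<open>n\<close>.\<close>
    define d where "d i = (\<Sum>s<N. if j s = i then c s else 0)" for i
    have group: "(\<Sum>s<N. c s * G (j s)) = (\<Sum>i<n. d i * G i)" if "\<And>i. i \<ge> n \<Longrightarrow> G i = 0" for G
    proof -
      have "(\<Sum>i<n. d i * G i) = (\<Sum>i<n. \<Sum>s<N. if j s = i then c s * G i else 0)"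
        unfolding d_def sum_distrib_right by (intro sum.cong) auto
      also have "\<dots> = (\<Sum>s<N. \<Sum>i<n. if j s = i then c s * G i else 0)"
        by (rule sum.swap)
      also have "\<dots> = (\<Sum>s<N. c s * G (j s))"
        by (intro sum.cong) (use that in \<open>auto simp: not_less\<close>)
      finally show ?thesis by simp
    qed
    have "(\<Sum>s<N. \<Sum>t<N. c s * cnj (c t) * k (j s) (j t))
        = (\<Sum>s<N. c s * cnj (\<Sum>t<N. c t * cnj (k (j s) (j t))))"
      by (simp add: sum_distrib_left mult.assoc)
    also have "\<dots> = (\<Sum>s<N. c s * cnj (\<Sum>l<n. d l * cnj (k (j s) l)))"
      by (subst group) (auto simp: k_def)
    also have "\<dots> = (\<Sum>i<n. d i * cnj (\<Sum>l<n. d l * cnj (k i l)))"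
      by (rule group) (auto simp: k_def)
    also have "\<dots> = (\<Sum>i<n. \<Sum>l<n. d i * cnj (d l) * \<kappa> i l)"
      by (simp add: k_def sum_distrib_left mult.assoc)
    finally show "0 \<le> (\<Sum>s<N. \<Sum>t<N. c s * cnj (c t) * k (j s) (j t))"
      using psd [of d] by simp
  qed
  then obtain f :: "nat \<Rightarrow> (nat, complex) l2" where f: "\<And>x y. cinner (f x) (f y) = k x y"
    "\<And>x i. i \<noteq> x \<Longrightarrow> (i, x) \<notin> less_than \<Longrightarrow> l2_nth (f x) i = 0"
    by (rule gram_realization [of k less_than]) (auto simp: trans_less_than)
  show thesis
  proof
    fix i j assume ij: "i < n" "j < n"
    have "\<kappa> i j = (\<Sum>\<^sub>\<infinity>s. l2_nth (f i) s * cnj (l2_nth (f j) s))"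
      using f(1) [of i j] ij by (simp add: k_def cinner_l2_def cinner_complex_def)
    also have "\<dots> = (\<Sum>\<^sub>\<infinity>s\<in>{..<n}. l2_nth (f i) s * cnj (l2_nth (f j) s))"
      by (rule infsum_cong_neutral) (use f(2) [of _ i] ij in auto)
    finally show "\<kappa> i j = (\<Sum>s<n. l2_nth (f i) s * cnj (l2_nth (f j) s))"
      by simp
  qed
qed

section \<open>Tensor products\<close>

lemma l2_nth_sum: "l2_nth (sum f A) i = (\<Sum>s\<in>A. l2_nth (f s) i)"
  by (induction A rule: infinite_finite_induct) auto

lift_definition l2_tensor :: "'h::chilbert_space \<Rightarrow> ('i, complex) l2 \<Rightarrow> ('i, 'h) l2"
  is "\<lambda>h g i. g i *\<^sub>C h"
  by (simp add: norm_scaleC power_mult_distrib summable_on_cmult_left)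

lemma l2_nth_tensor [simp]: "l2_nth (l2_tensor h g) i = l2_nth g i *\<^sub>C h"
  by transfer simp

lemma cinner_l2_tensor: "cinner (l2_tensor h g) (l2_tensor k f) = cinner h k * cinner g f"
  by (simp add: cinner_l2_def cinner_scaleC_left cinner_scaleC_right cinner_complex_def
      infsum_cmult_right' flip: mult.assoc)
    (simp add: mult_ac infsum_cmult_right' flip: infsum_cmult_right')?

text \<open>The inner product identity of a tensor product without density of the simple tensors. It
  covers a given tensor product, the concrete \<open>l2_tensor\<close>, and
  \<open>tensor_left\<close> on Fock space, whose range is orthogonal to the vacuum.\<close>

definition pretensor :: "('r::chilbert_space \<Rightarrow> 'x::chilbert_space \<Rightarrow> 't::chilbert_space) \<Rightarrow> bool" where
  "pretensor t \<longleftrightarrow> (\<forall>r s x y. cinner (t r x) (t s y) = cinner r s * cinner x y)"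

lemma pretensor_cinner: "pretensor t \<Longrightarrow> cinner (t r x) (t s y) = cinner r s * cinner x y"
  by (simp add: pretensor_def)

text \<open>Bilinearity is forced by the inner products: each defect of additivity or homogeneity
  has norm 0 once its square is expanded.\<close>

lemma pretensor_linear:
  assumes "pretensor t"
  shows pretensor_add_left: "t (r + s) x = t r x + t s x"
    and pretensor_add_right: "t r (x + y) = t r x + t r y"
    and pretensor_scale_left: "t (c *\<^sub>C r) x = c *\<^sub>C t r x"
    and pretensor_scale_right: "t r (c *\<^sub>C x) = c *\<^sub>C t r x"
proof -
  note simps = pretensor_cinner [OF assms] cinner_add_left cinner_add_right cinner_diff_left
    cinner_diff_right cinner_scaleC_left cinner_scaleC_right algebra_simps
  have "cinner (t (r + s) x - (t r x + t s x)) (t (r + s) x - (t r x + t s x)) = 0"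
    "cinner (t r (x + y) - (t r x + t r y)) (t r (x + y) - (t r x + t r y)) = 0"
    "cinner (t (c *\<^sub>C r) x - c *\<^sub>C t r x) (t (c *\<^sub>C r) x - c *\<^sub>C t r x) = 0"
    "cinner (t r (c *\<^sub>C x) - c *\<^sub>C t r x) (t r (c *\<^sub>C x) - c *\<^sub>C t r x) = 0"
    by (simp_all add: simps)
  then show "t (r + s) x = t r x + t s x" "t r (x + y) = t r x + t r y"
    "t (c *\<^sub>C r) x = c *\<^sub>C t r x" "t r (c *\<^sub>C x) = c *\<^sub>C t r x"
    by (simp_all add: cinner_self)
qed

lemma pretensor_zero:
  assumes "pretensor t"
  shows "t 0 x = 0" "t r 0 = 0"
  using pretensor_scale_left [OF assms, of 0 0 x] pretensor_scale_right [OF assms, of r 0 0] by simp_all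

lemma pretensor_sum_left: "pretensor t \<Longrightarrow> t (sum f A) x = (\<Sum>i\<in>A. t (f i) x)"
  by (induction A rule: infinite_finite_induct) (auto simp: pretensor_zero pretensor_add_left)

lemma pretensor_sum_right: "pretensor t \<Longrightarrow> t r (sum f A) = (\<Sum>i\<in>A. t r (f i))"
  by (induction A rule: infinite_finite_induct) (auto simp: pretensor_zero pretensor_add_right)

lemma norm_pretensor: "pretensor t \<Longrightarrow> norm (t r x) = norm r * norm x"
proof -
  assume "pretensor t"
  then have "complex_of_real ((norm (t r x))\<^sup>2) = complex_of_real ((norm r * norm x)\<^sup>2)"
    by (simp only: cinner_self [symmetric] pretensor_cinner)
      (simp add: cinner_self power_mult_distrib)
  then have "(norm (t r x))\<^sup>2 = (norm r * norm x)\<^sup>2"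
    using of_real_eq_iff by blast
  then show ?thesis
    by (simp add: power2_eq_iff_nonneg)
qed

lemma pretensor_bounded_clinear: "pretensor t \<Longrightarrow> bounded_clinear (t r)"
  by (rule bounded_clinearI [where K = "norm r"])
    (simp_all add: pretensor_add_right pretensor_scale_right norm_pretensor)

lemma cinner_pretensor_sum:
  assumes "pretensor t"
  shows "cinner (\<Sum>i\<in>A. t (r i) (x i)) (\<Sum>j\<in>B. t (s j) (y j))
    = (\<Sum>i\<in>A. \<Sum>j\<in>B. cinner (r i) (s j) * cinner (x i) (y j))"
  by (subst cinner_sum_left) (simp add: cinner_sum_right pretensor_cinner [OF assms])

lemma pretensor_l2_tensor: "pretensor l2_tensor"
  by (simp add: pretensor_def cinner_l2_tensor)

lemma pretensor_tensor_left: "pretensor (\<lambda>r. cblinfun_apply (tensor_left r))"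
  by (simp add: pretensor_def tensor_left.rep_eq tensor_left_l2_cinner)

lemma pretensor_hilbert_tensor: "hilbert_tensor t \<Longrightarrow> pretensor t"
  by (simp add: hilbert_tensor_def pretensor_def)

text \<open>For density, each \<open>l2_single i r\<close> is a simple tensor. Solving the moment
  problem for the coordinates of \<open>f\<close> inside the closed span of these vectors returns a
  vector with the same coordinates, that is, \<open>f\<close> itself.\<close>

lemma hilbert_tensor_l2_tensor:
  "hilbert_tensor (l2_tensor :: 'r::chilbert_space \<Rightarrow> ('i, complex) l2 \<Rightarrow> ('i, 'r) l2)"
proof -
  let ?S = "{l2_tensor r x |(r::'r) (x::('i, complex) l2). True}"
  define p where "p = (\<lambda>(i::'i, r::'r). l2_single i r)"
  have p: "p (i, r) = l2_tensor r (l2_single i 1)" for i r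
    by (rule l2_eqI) (simp add: p_def scaleC_one)
  have sub: "lincomb p cs \<in> span ?S" for cs
  proof (induction cs)
    case (Cons cj cs)
    obtain c i r where cj: "cj = (c, (i, r))"
      by (metis prod.exhaust)
    have "c *\<^sub>C p (i, r) = l2_tensor (c *\<^sub>C r) (l2_single i 1)"
      by (simp add: p pretensor_scale_left [OF pretensor_l2_tensor])
    then have "c *\<^sub>C p (i, r) \<in> span ?S"
      by (metis (mono_tags, lifting) mem_Collect_eq span_base)
    with Cons show ?case
      by (simp add: cj span_add)
  qed (simp add: span_zero)
  have "f \<in> closure (span ?S)" for f :: "('i, 'r) l2"
  proof -
    have \<phi>: "lincomb (\<lambda>j. cinner (p j) f) cs = cinner (lincomb p cs) f" for cs
      by (induction cs) (auto simp: cinner_add_left cinner_scaleC_left scaleC_complex_def)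
    obtain \<xi> where \<xi>: "\<xi> \<in> closure (range (lincomb p))" "\<And>j. cinner (p j) \<xi> = cinner (p j) f"
      by (rule moment_problem [of "norm f" "\<lambda>j. cinner (p j) f" p])
        (simp_all add: \<phi> Cauchy_Schwarz_cinner mult.commute [of "norm f"])
    have "l2_nth \<xi> i = l2_nth f i" for i
      by (rule cinner_eqI_right) (use \<xi>(2) [of "(i, _)"] in \<open>simp add: p_def cinner_l2_single\<close>)
    then have "\<xi> = f"
      by (rule l2_eqI)
    moreover have "closure (range (lincomb p)) \<subseteq> closure (span ?S)"
      by (rule closure_mono) (use sub in auto)
    ultimately show ?thesis
      using \<xi>(1) by blast
  qed
  then have "closure (span ?S) = UNIV"
    by blast
  then show ?thesis
    unfolding hilbert_tensor_def
    by (simp add: pretensor_linear [OF pretensor_l2_tensor] cinner_l2_tensor)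
qed

section \<open>Functionals on R, their Riesz vectors, and q \<otimes> I\<close>

definition riesz :: "('h::chilbert_space \<Rightarrow>\<^sub>C\<^sub>L complex) \<Rightarrow> 'h" where
  "riesz q = cadjoint q 1"

lemma riesz: "q r = cinner r (riesz q)" for q :: "'h::chilbert_space \<Rightarrow>\<^sub>C\<^sub>L complex"
  using cinner_cadjoint [of q r 1] by (simp add: riesz_def cinner_complex_def)

text \<open>Conjugate-linearity in \<open>q\<close> is the source of the conjugates on the entries
  of \<alpha> in the intertwining relations for vectors.\<close>

lemma riesz_scale: "riesz (c *\<^sub>C q) = cnj c *\<^sub>C riesz q"
  by (simp add: riesz_def cadjoint_scale)

lemma riesz_sum: "riesz (sum f A) = (\<Sum>i\<in>A. riesz (f i))"
  by (simp add: riesz_def cadjoint_sum)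

lemma cblinfun_eq_on_dense:
  fixes G H :: "'t::chilbert_space \<Rightarrow>\<^sub>C\<^sub>L 'x::chilbert_space"
  assumes "\<And>z. z \<in> S \<Longrightarrow> G z = H z" "closure (span S) = UNIV"
  shows "G = H"
proof -
  have bl: "bounded_linear G" "bounded_linear H"
    using bounded_clinear_apply by (auto simp: bounded_clinear_def)
  have "closed {z. G z = H z}"
    by (intro closed_Collect_eq bounded_linear.continuous_on [OF bl(1)]
        bounded_linear.continuous_on [OF bl(2)] continuous_on_id)
  moreover have "span S \<subseteq> {z. G z = H z}"
    by (rule span_minimal)
      (use assms(1) in \<open>auto simp: subspace_def cblinfun_apply_linear scaleR_scaleC\<close>)
  ultimately have "closure (span S) \<subseteq> {z. G z = H z}"
    by (intro closure_minimal)
  then show ?thesis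
    using assms(2) by (intro cblinfun_eqI) auto
qed

text \<open>The adjoint of \<open>t (riesz q)\<close> has the required values on simple tensors, and
  density makes it the only such operator, so it is the one that the definite description in
  \<open>tensor_id\<close> denotes.\<close>

lemma tensor_id:
  fixes t :: "'r::chilbert_space \<Rightarrow> 'x::chilbert_space \<Rightarrow> 't::chilbert_space"
  assumes t: "hilbert_tensor t"
  shows cinner_tensor_id: "cinner (tensor_id t q z) x = cinner z (t (riesz q) x)"
proof -
  have pt: "pretensor t"
    by (rule pretensor_hilbert_tensor [OF t])
  define G where "G = cadjoint (CBlinfun (t (riesz q)))"
  have G: "cinner (G z) x = cinner z (t (riesz q) x)" for z x
    unfolding G_def cinner_cadjoint_left by (simp add: CBlinfun_apply pretensor_bounded_clinear [OF pt])
  have Gt: "G (t r x) = q r *\<^sub>C x" for r x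
    by (rule cinner_eqI) (simp add: G pretensor_cinner [OF pt] cinner_scaleC_left flip: riesz)
  have "tensor_id t q = G"
    unfolding tensor_id_def
  proof (rule the_equality)
    fix H :: "'t \<Rightarrow>\<^sub>C\<^sub>L 'x"
    assume H: "\<forall>r x. H (t r x) = q r *\<^sub>C x"
    show "H = G"
      by (rule cblinfun_eq_on_dense [of "{t r x |r x. True}"])
        (use H Gt t in \<open>auto simp: hilbert_tensor_def\<close>)
  qed (simp add: Gt)
  then show ?thesis
    by (simp add: G)
qed

section \<open>Positivity and contractions\<close>

lemma sum_swap_mult: "(\<Sum>i\<in>A. \<Sum>j\<in>B. \<Sum>s\<in>C. f i j s) = (\<Sum>s\<in>C. \<Sum>i\<in>A. \<Sum>j\<in>B. f i j s)"
  by (subst (2) sum.swap, intro sum.cong refl, rule sum.swap)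

lemma factorized_sum_cinner:
  assumes "\<And>i j. i < n \<Longrightarrow> j < n \<Longrightarrow> \<kappa> i j = (\<Sum>s<m. J i s * cnj (J j s))"
  shows "(\<Sum>i<n. \<Sum>j<n. \<kappa> i j * cinner (G i) (G j))
    = complex_of_real (\<Sum>s<m. (norm (\<Sum>i<n. J i s *\<^sub>C G i))\<^sup>2)"
proof -
  have "(\<Sum>i<n. \<Sum>j<n. \<kappa> i j * cinner (G i) (G j))
      = (\<Sum>i<n. \<Sum>j<n. \<Sum>s<m. J i s * cnj (J j s) * cinner (G i) (G j))"
    by (intro sum.cong refl) (simp add: assms sum_distrib_right)
  also have "\<dots> = (\<Sum>s<m. \<Sum>i<n. \<Sum>j<n. J i s * cnj (J j s) * cinner (G i) (G j))"
    by (rule sum_swap_mult)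
  also have "\<dots> = (\<Sum>s<m. cinner (\<Sum>i<n. J i s *\<^sub>C G i) (\<Sum>i<n. J i s *\<^sub>C G i))"
    unfolding cinner_sum_sum by simp
  finally show ?thesis
    by (simp add: cinner_self)
qed

text \<open>After factoring \<kappa> = J J^* the sum splits into squared norms. In this way
  positivity of a scalar matrix is amplified to vectors in any Hilbert space.\<close>

lemma psd_sum_cinner:
  fixes \<kappa> :: "nat \<Rightarrow> nat \<Rightarrow> complex" and G :: "nat \<Rightarrow> 'h::chilbert_space"
  assumes "\<And>c. 0 \<le> (\<Sum>i<n. \<Sum>j<n. c i * cnj (c j) * \<kappa> i j)"
  shows "0 \<le> (\<Sum>i<n. \<Sum>j<n. \<kappa> i j * cinner (G i) (G j))"
proof -
  obtain J where J: "\<And>i j. i < n \<Longrightarrow> j < n \<Longrightarrow> \<kappa> i j = (\<Sum>s<n. J i s * cnj (J j s))"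
    by (rule psd_factorization [OF assms]) blast
  have "(\<Sum>i<n. \<Sum>j<n. \<kappa> i j * cinner (G i) (G j))
      = complex_of_real (\<Sum>s<n. (norm (\<Sum>i<n. J i s *\<^sub>C G i))\<^sup>2)"
    by (rule factorized_sum_cinner) (rule J)
  then show ?thesis
    by (simp only: less_eq_complex_def) (simp add: sum_nonneg del: of_real_sum)
qed

text \<open>For \<open>\<rho> = riesz_mat Q\<close> the inner sum is component \<open>j\<close> of
  Q^* c, so for q \<ge> 0 the condition is \<parallel>Q^*\<parallel> \<le> q. The adjoint is
  preferred because its components lie in R and can be tensored with further vectors.\<close>

definition column_bound :: "nat \<Rightarrow> (nat \<Rightarrow> nat \<Rightarrow> 'r::chilbert_space) \<Rightarrow> real \<Rightarrow> bool" where
  "column_bound n \<rho> q \<longleftrightarrow>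
     (\<forall>c. (\<Sum>j<n. (norm (\<Sum>i<n. c i *\<^sub>C \<rho> i j))\<^sup>2) \<le> q\<^sup>2 * (\<Sum>i<n. (cmod (c i))\<^sup>2))"

text \<open>Q^* \<otimes> I obeys the bound of Q^* because \<kappa>, up to transposition q^2 I - Q
  Q^* , is a positive scalar matrix, and pairing it with the Gram matrix of the \<open>x i\<close>
  gives the amplified estimate.\<close>

lemma column_bound_tensor:
  assumes t: "pretensor t" and q: "column_bound n \<rho> q"
  shows "(\<Sum>j<n. (norm (\<Sum>i<n. t (\<rho> i j) (x i)))\<^sup>2) \<le> q\<^sup>2 * (\<Sum>i<n. (norm (x i))\<^sup>2)"
proof -
  define \<kappa> where "\<kappa> i i' = (if i = i' then of_real (q\<^sup>2) else 0) - (\<Sum>j<n. cinner (\<rho> i j) (\<rho> i' j))" for i i'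
  have diag: "(\<Sum>i<n. \<Sum>i'<n. \<kappa> i i' * f i i') = of_real (q\<^sup>2) * (\<Sum>i<n. f i i)
      - (\<Sum>j<n. \<Sum>i<n. \<Sum>i'<n. cinner (\<rho> i j) (\<rho> i' j) * f i i')" for f
  proof -
    have "(\<Sum>i<n. \<Sum>i'<n. \<kappa> i i' * f i i') = (\<Sum>i<n. \<Sum>i'<n. (if i = i' then of_real (q\<^sup>2) * f i i' else 0))
      - (\<Sum>i<n. \<Sum>i'<n. \<Sum>j<n. cinner (\<rho> i j) (\<rho> i' j) * f i i')"
      unfolding sum_subtractf [symmetric]
      by (intro sum.cong refl) (simp add: \<kappa>_def left_diff_distrib sum_distrib_right)
    also have "(\<Sum>i<n. \<Sum>i'<n. (if i = i' then of_real (q\<^sup>2) * f i i' else 0)) = of_real (q\<^sup>2) * (\<Sum>i<n. f i i)"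
      by (simp add: sum_distrib_left)
    also have "(\<Sum>i<n. \<Sum>i'<n. \<Sum>j<n. cinner (\<rho> i j) (\<rho> i' j) * f i i')
        = (\<Sum>j<n. \<Sum>i<n. \<Sum>i'<n. cinner (\<rho> i j) (\<rho> i' j) * f i i')"
      by (rule sum_swap_mult)
    finally show ?thesis .
  qed
  have "0 \<le> (\<Sum>i<n. \<Sum>i'<n. c i * cnj (c i') * \<kappa> i i')" for c
  proof -
    have "(\<Sum>i<n. \<Sum>i'<n. c i * cnj (c i') * \<kappa> i i') = (\<Sum>i<n. \<Sum>i'<n. \<kappa> i i' * (c i * cnj (c i')))"
      by (simp add: mult_ac)
    also have "\<dots> = of_real (q\<^sup>2 * (\<Sum>i<n. (cmod (c i))\<^sup>2))
        - (\<Sum>j<n. cinner (\<Sum>i<n. c i *\<^sub>C \<rho> i j) (\<Sum>i<n. c i *\<^sub>C \<rho> i j))"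
      unfolding diag cinner_sum_sum by (simp add: complex_norm_square mult_ac del: of_real_power)
    also have "\<dots> = of_real (q\<^sup>2 * (\<Sum>i<n. (cmod (c i))\<^sup>2) - (\<Sum>j<n. (norm (\<Sum>i<n. c i *\<^sub>C \<rho> i j))\<^sup>2))"
      by (simp add: cinner_self)
    finally show ?thesis
      using q by (simp add: column_bound_def less_eq_complex_def del: of_real_diff)
  qed
  then have "0 \<le> (\<Sum>i<n. \<Sum>i'<n. \<kappa> i i' * cinner (x i) (x i'))"
    by (rule psd_sum_cinner)
  also have "\<dots> = of_real (q\<^sup>2) * (\<Sum>i<n. cinner (x i) (x i))
      - (\<Sum>j<n. cinner (\<Sum>i<n. t (\<rho> i j) (x i)) (\<Sum>i<n. t (\<rho> i j) (x i)))"
    unfolding diag cinner_pretensor_sum [OF t] by simp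
  also have "\<dots> = of_real (q\<^sup>2 * (\<Sum>i<n. (norm (x i))\<^sup>2) - (\<Sum>j<n. (norm (\<Sum>i<n. t (\<rho> i j) (x i)))\<^sup>2))"
    by (simp add: cinner_self)
  finally show ?thesis
    by (simp add: less_eq_complex_def del: of_real_diff)
qed

text \<open>\<open>V\<close> acts on the first tensor factor, that is, on each coordinate of an
  \<ell>^2 sequence separately, so the estimate holds coordinate by coordinate.\<close>

lemma norm_tensor_contraction:
  fixes V :: "'a::chilbert_space \<Rightarrow> 'b::chilbert_space"
  assumes lin: "\<And>x y. V (x + y) = V x + V y" "\<And>c x. V (c *\<^sub>C x) = c *\<^sub>C V x"
    and contr: "\<And>x. norm (V x) \<le> norm x"
  shows "norm (\<Sum>s\<in>A. l2_tensor (V (h s)) (g s)) \<le> norm (\<Sum>s\<in>A. l2_tensor (h s) (g s))"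
proof -
  have V0: "V 0 = 0"
    using lin(2) [of 0 0] by simp
  have Vsum: "V (sum f A) = (\<Sum>s\<in>A. V (f s))" for f
    by (induction A rule: infinite_finite_induct) (auto simp: lin V0)
  have "(norm (\<Sum>s\<in>A. l2_tensor (V (h s)) (g s)))\<^sup>2 \<le> (norm (\<Sum>s\<in>A. l2_tensor (h s) (g s)))\<^sup>2"
    unfolding norm_l2_power2
  proof (rule infsum_mono [OF l2_nth_summable l2_nth_summable])
    fix i
    have "l2_nth (\<Sum>s\<in>A. l2_tensor (V (h s)) (g s)) i = V (l2_nth (\<Sum>s\<in>A. l2_tensor (h s) (g s)) i)"
      by (simp add: l2_nth_sum Vsum lin)
    then show "(norm (l2_nth (\<Sum>s\<in>A. l2_tensor (V (h s)) (g s)) i))\<^sup>2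
        \<le> (norm (l2_nth (\<Sum>s\<in>A. l2_tensor (h s) (g s)) i))\<^sup>2"
      by (auto intro!: power_mono contr)
  qed
  then show ?thesis
    by (rule power2_le_imp_le) simp
qed

text \<open>Set to 0 off the basis because the index is the whole type. It is an isometry onto
  scalar sequences, the form that the second argument of \<open>l2_tensor\<close> must have.\<close>

lift_definition coord :: "'g::chilbert_space \<Rightarrow> ('g, complex) l2"
  is "\<lambda>g b. if b \<in> onb then cinner g b else 0"
proof -
  fix g :: 'g
  have "(\<lambda>b. (norm (if b \<in> onb then cinner g b else 0))\<^sup>2) summable_on UNIV
    \<longleftrightarrow> (\<lambda>b. (cmod (cinner g b))\<^sup>2) summable_on onb"
    by (rule summable_on_cong_neutral) auto
  then show "(\<lambda>b. (norm (if b \<in> onb then cinner g b else 0))\<^sup>2) summable_on UNIV"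
    using onb_coeff_summable by blast
qed

lemma cinner_coord [simp]: "cinner (coord g) (coord h) = cinner g h"
proof -
  have "cinner (coord g) (coord h) = (\<Sum>\<^sub>\<infinity>b\<in>onb. cinner g b * cnj (cinner h b))"
    unfolding cinner_l2_def coord.rep_eq
    by (rule infsum_cong_neutral) (auto simp: cinner_complex_def)
  then show ?thesis
    using infsumI [OF onb_Parseval_cinner] by simp
qed

lemma coord_linear:
  shows coord_add: "coord (g + h) = coord g + coord h"
    and coord_scale: "coord (c *\<^sub>C g) = c *\<^sub>C coord g"
  by (rule l2_eqI; simp add: coord.rep_eq cinner_add_left cinner_scaleC_left scaleC_complex_def)+

lemma coord_sum: "coord (sum f A) = (\<Sum>i\<in>A. coord (f i))"
proof -
  have "coord 0 = 0"
    using coord_scale [of 0 0] by simp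
  then show ?thesis
    by (induction A rule: infinite_finite_induct) (auto simp: coord_add)
qed

lemma norm_sum_single:
  "(norm (\<Sum>i<n. l2_single i (f i)))\<^sup>2 = (\<Sum>i<n. (norm (f i))\<^sup>2)" for n :: nat
proof -
  have "cinner (\<Sum>i<n. l2_single i (f i)) (\<Sum>i<n. l2_single i (f i)) = (\<Sum>i<n. cinner (f i) (f i))"
    by (simp add: cinner_sum_left cinner_l2_single l2_nth_sum)
  then have "complex_of_real ((norm (\<Sum>i<n. l2_single i (f i)))\<^sup>2) = of_real (\<Sum>i<n. (norm (f i))\<^sup>2)"
    by (simp add: cinner_self)
  then show ?thesis
    using of_real_eq_iff by blast
qed

text \<open>Banach's fixed point theorem asks for a complete space as a type. The tuples of length
  \<open>n\<close> are placed in \<ell>^2 over \<open>nat\<close>: the map \<open>T\<close> sends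
  every sequence to one that vanishes from \<open>n\<close> on.\<close>

lemma strict_contraction_solve:
  fixes F :: "(nat \<Rightarrow> 'x::chilbert_space) \<Rightarrow> nat \<Rightarrow> 'x"
  assumes q: "0 \<le> q" "q < 1"
    and contr: "\<And>x x'. (\<Sum>i<n. (norm (F x i - F x' i))\<^sup>2) \<le> q\<^sup>2 * (\<Sum>i<n. (norm (x i - x' i))\<^sup>2)"
  obtains x where "\<And>i. i < n \<Longrightarrow> x i = y i + F x i"
proof -
  define T where "T \<xi> = (\<Sum>i<n. l2_single i (y i + F (l2_nth \<xi>) i))" for \<xi> :: "(nat, 'x) l2"
  have "dist (T \<xi>) (T \<eta>) \<le> q * dist \<xi> \<eta>" for \<xi> \<eta>
  proof -
    have single: "l2_single i h - l2_single i k = l2_single i (h - k)" for i :: nat and h k :: 'x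
      by (rule l2_eqI) auto
    have "T \<xi> - T \<eta> = (\<Sum>i<n. l2_single i (F (l2_nth \<xi>) i - F (l2_nth \<eta>) i))"
      by (simp add: T_def single flip: sum_subtractf)
    then have "(norm (T \<xi> - T \<eta>))\<^sup>2 = (\<Sum>i<n. (norm (F (l2_nth \<xi>) i - F (l2_nth \<eta>) i))\<^sup>2)"
      by (simp add: norm_sum_single)
    also have "\<dots> \<le> q\<^sup>2 * (\<Sum>i<n. (norm (l2_nth \<xi> i - l2_nth \<eta> i))\<^sup>2)"
      by (rule contr)
    also have "\<dots> \<le> q\<^sup>2 * (norm (\<xi> - \<eta>))\<^sup>2"
      using l2_sum_le [of "{..<n}" "\<xi> - \<eta>"] by (intro mult_left_mono) auto
    finally show ?thesis
      using power2_le_imp_le [of "norm (T \<xi> - T \<eta>)" "q * norm (\<xi> - \<eta>)"] q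
      by (simp add: power_mult_distrib dist_norm)
  qed
  then have "\<exists>!\<xi>. T \<xi> = \<xi>"
    using banach_fix_type [of q T] q by auto
  then obtain \<xi> where \<xi>: "T \<xi> = \<xi>" by blast
  have "l2_nth (T \<xi>) i = y i + F (l2_nth \<xi>) i" if "i < n" for i
    using that by (simp add: T_def l2_nth_sum)
  then show thesis
    using that [of "l2_nth \<xi>"] \<xi> by simp
qed

section \<open>Operator matrices\<close>

lemma dim_op [simp]:
  "dim_row (M \<odot> N) = dim_row M" "dim_col (M \<odot> N) = dim_col N"
  "dim_row (op_adjoint M) = dim_col M" "dim_col (op_adjoint M) = dim_row M"
  "dim_row (id_tensor n A) = n" "dim_col (id_tensor n A) = n"
  "dim_row (mat_tensor_id P) = dim_row P" "dim_col (mat_tensor_id P) = dim_col P"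
  "dim_vec (op_apply M x) = dim_row M"
  by (simp_all add: op_times_def op_adjoint_def id_tensor_def mat_tensor_id_def op_apply_def)

lemma cblinfun_apply_if [simp]:
  "cblinfun_apply (if b then T else 0) x = (if b then T x else 0)"
  "cblinfun_apply T (if b then x else 0) = (if b then T x else 0)"
  by (simp_all add: cblinfun_zero)

lemma index_op_times:
  "i < dim_row M \<Longrightarrow> j < dim_col N \<Longrightarrow> (M \<odot> N) $$ (i, j) = (\<Sum>k<dim_row N. M $$ (i, k) o\<^sub>C\<^sub>L N $$ (k, j))"
  by (simp add: op_times_def)

lemma index_op_adjoint [simp]:
  "i < dim_col M \<Longrightarrow> j < dim_row M \<Longrightarrow> op_adjoint M $$ (i, j) = cadjoint (M $$ (j, i))"
  by (simp add: op_adjoint_def)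

lemma index_id_tensor [simp]:
  "i < n \<Longrightarrow> j < n \<Longrightarrow> id_tensor n A $$ (i, j) = (if i = j then A else 0)"
  by (simp add: id_tensor_def)

lemma index_mat_tensor_id [simp]:
  "i < dim_row P \<Longrightarrow> j < dim_col P \<Longrightarrow> mat_tensor_id P $$ (i, j) = (P $$ (i, j)) *\<^sub>C cblinfun_id"
  by (simp add: mat_tensor_id_def)

lemma index_op_apply [simp]:
  "i < dim_row M \<Longrightarrow> op_apply M x $ i = (\<Sum>j<dim_col M. (M $$ (i, j)) (x $ j))"
  by (simp add: op_apply_def)

lemma id_tensor_times:
  assumes "dim_row M = n"
  shows "id_tensor n C \<odot> M = mat n (dim_col M) (\<lambda>(i, j). C o\<^sub>C\<^sub>L M $$ (i, j))"
proof (rule eq_matI)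
  fix i j assume "i < dim_row (mat n (dim_col M) (\<lambda>(i, j). C o\<^sub>C\<^sub>L M $$ (i, j)))"
    "j < dim_col (mat n (dim_col M) (\<lambda>(i, j). C o\<^sub>C\<^sub>L M $$ (i, j)))"
  then have ij: "i < n" "j < dim_col M" by simp_all
  have "((id_tensor n C \<odot> M) $$ (i, j)) x = C ((M $$ (i, j)) x)" for x
    using ij assms by (simp add: index_op_times)
  then show "(id_tensor n C \<odot> M) $$ (i, j) = mat n (dim_col M) (\<lambda>(i, j). C o\<^sub>C\<^sub>L M $$ (i, j)) $$ (i, j)"
    using ij by (intro cblinfun_eqI) simp
qed simp_all

lemma times_id_tensor:
  assumes "dim_col M = n"
  shows "M \<odot> id_tensor n C = mat (dim_row M) n (\<lambda>(i, j). M $$ (i, j) o\<^sub>C\<^sub>L C)"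
proof (rule eq_matI)
  fix i j assume "i < dim_row (mat (dim_row M) n (\<lambda>(i, j). M $$ (i, j) o\<^sub>C\<^sub>L C))"
    "j < dim_col (mat (dim_row M) n (\<lambda>(i, j). M $$ (i, j) o\<^sub>C\<^sub>L C))"
  then have ij: "i < dim_row M" "j < n" by simp_all
  have "((M \<odot> id_tensor n C) $$ (i, j)) x = (M $$ (i, j)) (C x)" for x
    using ij assms by (simp add: index_op_times)
  then show "(M \<odot> id_tensor n C) $$ (i, j) = mat (dim_row M) n (\<lambda>(i, j). M $$ (i, j) o\<^sub>C\<^sub>L C) $$ (i, j)"
    using ij by (intro cblinfun_eqI) simp
qed simp_all

lemma op_times_assoc:
  assumes "dim_col L = dim_row M" "dim_col M = dim_row N"
  shows "(L \<odot> M) \<odot> N = L \<odot> (M \<odot> N)"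
proof (rule eq_matI)
  fix i j assume "i < dim_row (L \<odot> (M \<odot> N))" "j < dim_col (L \<odot> (M \<odot> N))"
  then have ij: "i < dim_row L" "j < dim_col N" by simp_all
  have "(((L \<odot> M) \<odot> N) $$ (i, j)) x = ((L \<odot> (M \<odot> N)) $$ (i, j)) x" for x
    using ij assms by (simp add: index_op_times cblinfun_sum) (rule sum.swap)
  then show "((L \<odot> M) \<odot> N) $$ (i, j) = (L \<odot> (M \<odot> N)) $$ (i, j)"
    by (rule cblinfun_eqI)
qed simp_all

lemma id_tensor_id_times [simp]: "dim_row M = n \<Longrightarrow> id_tensor n cblinfun_id \<odot> M = M"
  by (subst id_tensor_times) (auto intro!: eq_matI cblinfun_eqI)

lemma times_id_tensor_id [simp]: "dim_col M = n \<Longrightarrow> M \<odot> id_tensor n cblinfun_id = M"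
  by (subst times_id_tensor) (auto intro!: eq_matI cblinfun_eqI)

lemma op_inverse_eqI:
  assumes "M \<in> carrier_mat n n" "N \<in> carrier_mat n n"
    and "M \<odot> N = id_tensor n cblinfun_id" "N \<odot> M = id_tensor n cblinfun_id"
  shows "op_inverse M = N"
  unfolding op_inverse_def
proof (rule the_equality)
  fix N' assume N': "N' \<in> carrier_mat (dim_row M) (dim_row M)
    \<and> M \<odot> N' = id_tensor (dim_row M) cblinfun_id \<and> N' \<odot> M = id_tensor (dim_row M) cblinfun_id"
  have carr: "N' \<in> carrier_mat n n"
    using assms N' by auto
  have "N' = N' \<odot> (M \<odot> N)"
    using carr by (simp add: assms(3))
  also have "\<dots> = (N' \<odot> M) \<odot> N"
    by (rule op_times_assoc [symmetric]) (use assms N' in auto)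
  also have "\<dots> = N"
    using assms N' by simp
  finally show "N' = N" .
qed (use assms in auto)

section \<open>Operator norms and strict row contractions\<close>

lemma sum_cinner_le:
  fixes x y :: "'i \<Rightarrow> 'h::chilbert_space"
  shows "cmod (\<Sum>i\<in>A. cinner (x i) (y i)) \<le> L2_set (\<lambda>i. norm (x i)) A * L2_set (\<lambda>i. norm (y i)) A"
proof -
  have "cmod (\<Sum>i\<in>A. cinner (x i) (y i)) \<le> (\<Sum>i\<in>A. \<bar>norm (x i)\<bar> * \<bar>norm (y i)\<bar>)"
    by (rule order_trans [OF norm_sum]) (auto intro!: sum_mono Cauchy_Schwarz_cinner)
  also have "\<dots> \<le> L2_set (\<lambda>i. norm (x i)) A * L2_set (\<lambda>i. norm (y i)) A"
    by (rule L2_set_mult_ineq)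
  finally show ?thesis .
qed

lemma L2_set_power2: "(L2_set f A)\<^sup>2 = (\<Sum>i\<in>A. (f i)\<^sup>2)"
  by (simp add: L2_set_def sum_nonneg)

text \<open>An operator and its adjoint have the same norm: for z = T x and w = T^* z the hypotheses
  give \<parallel>z\<parallel>^2 = \<langle>x, w\<rangle> \<le> q \<parallel>x\<parallel>
  \<parallel>z\<parallel>, and a factor \<parallel>z\<parallel> cancels.\<close>

lemma adjoint_bound:
  fixes z :: "'i \<Rightarrow> 'h::chilbert_space" and x w :: "'j \<Rightarrow> 'k::chilbert_space"
  assumes eq: "(\<Sum>i\<in>A. cinner (z i) (z i)) = (\<Sum>j\<in>B. cinner (x j) (w j))" and q: "0 \<le> q"
    and w: "(\<Sum>j\<in>B. (norm (w j))\<^sup>2) \<le> q\<^sup>2 * (\<Sum>i\<in>A. (norm (z i))\<^sup>2)"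
  shows "(\<Sum>i\<in>A. (norm (z i))\<^sup>2) \<le> q\<^sup>2 * (\<Sum>j\<in>B. (norm (x j))\<^sup>2)"
proof -
  let ?z = "L2_set (\<lambda>i. norm (z i)) A" and ?x = "L2_set (\<lambda>i. norm (x i)) B"
    and ?w = "L2_set (\<lambda>i. norm (w i)) B"
  have "?w\<^sup>2 \<le> (q * ?z)\<^sup>2"
    using w by (simp add: L2_set_power2 power_mult_distrib)
  then have "?w \<le> q * ?z"
    by (rule power2_le_imp_le) (simp add: q L2_set_nonneg)
  moreover have "?z\<^sup>2 \<le> ?x * ?w"
  proof -
    have "complex_of_real (?z\<^sup>2) = (\<Sum>j\<in>B. cinner (x j) (w j))"
      unfolding L2_set_power2 eq [symmetric] by (simp add: cinner_self)
    then have "?z\<^sup>2 = cmod (\<Sum>j\<in>B. cinner (x j) (w j))"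
      by (metis abs_of_nonneg norm_of_real zero_le_power2)
    then show ?thesis
      using sum_cinner_le [of x w B] by simp
  qed
  ultimately have "?z * ?z \<le> (q * ?x) * ?z"
    using mult_left_mono [of ?w "q * ?z" ?x] by (simp add: L2_set_nonneg power2_eq_square mult_ac)
  then have "?z \<le> q * ?x"
    by (metis L2_set_nonneg less_eq_real_def mult_nonneg_nonneg mult_right_le_imp_le q)
  then have "?z\<^sup>2 \<le> (q * ?x)\<^sup>2"
    by (intro power_mono L2_set_nonneg)
  then show ?thesis
    by (simp add: L2_set_power2 power_mult_distrib)
qed

lemma vec_norm_L2_set: "vec_norm x = L2_set (\<lambda>i. norm (x $ i)) {..<dim_vec x}"
  by (simp add: vec_norm_def L2_set_def)

text \<open>\<open>op_norm\<close> is a supremum of reals; this crude bound by the sum of entry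
  bounds shows that the set is bounded above.\<close>

lemma op_apply_bounded:
  obtains K where "\<And>x. x \<in> carrier_vec (dim_col M) \<Longrightarrow> vec_norm x \<le> 1 \<Longrightarrow> vec_norm (op_apply M x) \<le> K"
proof -
  have "\<exists>K. \<forall>x. K \<ge> 0 \<and> norm ((M $$ (i, j)) x) \<le> K * norm x" for i j
    using cblinfun_bound by metis
  then obtain K where K: "\<And>i j. K i j \<ge> 0" "\<And>i j x. norm ((M $$ (i, j)) x) \<le> K i j * norm x"
    by metis
  have "vec_norm (op_apply M x) \<le> (\<Sum>i<dim_row M. \<Sum>j<dim_col M. K i j)"
    if x: "x \<in> carrier_vec (dim_col M)" "vec_norm x \<le> 1" for x
  proof -
    have x1: "norm (x $ j) \<le> 1" if "j < dim_col M" for j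
      using member_le_L2_set [of "{..<dim_vec x}" j "\<lambda>i. norm (x $ i)"] x that
      by (auto simp: vec_norm_L2_set)
    have "vec_norm (op_apply M x) \<le> (\<Sum>i<dim_row M. norm (op_apply M x $ i))"
      unfolding vec_norm_L2_set by (rule order_trans [OF L2_set_le_sum]) auto
    also have "\<dots> \<le> (\<Sum>i<dim_row M. \<Sum>j<dim_col M. K i j)"
    proof (rule sum_mono)
      fix i assume "i \<in> {..<dim_row M}"
      then have "norm (op_apply M x $ i) \<le> (\<Sum>j<dim_col M. norm ((M $$ (i, j)) (x $ j)))"
        by (simp add: norm_sum)
      also have "\<dots> \<le> (\<Sum>j<dim_col M. K i j)"
      proof (rule sum_mono)
        fix j assume "j \<in> {..<dim_col M}"
        then have "K i j * norm (x $ j) \<le> K i j"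
          using mult_left_mono [OF x1, of j "K i j"] K(1) by simp
        then show "norm ((M $$ (i, j)) (x $ j)) \<le> K i j"
          using K(2) order_trans by blast
      qed
      finally show "norm (op_apply M x $ i) \<le> (\<Sum>j<dim_col M. K i j)" .
    qed
    finally show ?thesis .
  qed
  then show thesis
    using that by blast
qed

lemma vec_norm_op_apply_le:
  assumes "x \<in> carrier_vec (dim_col M)" "vec_norm x \<le> 1"
  shows "vec_norm (op_apply M x) \<le> op_norm M"
proof -
  obtain K where K: "\<And>x. x \<in> carrier_vec (dim_col M) \<Longrightarrow> vec_norm x \<le> 1 \<Longrightarrow> vec_norm (op_apply M x) \<le> K"
    using op_apply_bounded by blast
  show ?thesis
    unfolding op_norm_def
    by (rule cSUP_upper) (use assms K in \<open>auto intro!: bdd_aboveI2 [where M = K]\<close>)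
qed

lemma op_norm_nonneg: "0 \<le> op_norm M"
proof -
  have "vec_norm (0\<^sub>v (dim_col M) :: 'a vec) \<le> 1"
    by (simp add: vec_norm_def)
  then have "vec_norm (op_apply M (0\<^sub>v (dim_col M))) \<le> op_norm M"
    by (intro vec_norm_op_apply_le) auto
  then show ?thesis
    using order_trans [rotated] by (fastforce simp: vec_norm_def sum_nonneg)
qed

lemma op_norm_sum_le:
  fixes f :: "nat \<Rightarrow> 'h::chilbert_space" and M :: "('h \<Rightarrow>\<^sub>C\<^sub>L 'k::chilbert_space) mat"
  assumes M: "M \<in> carrier_mat n m"
  shows "(\<Sum>i<n. (norm (\<Sum>j<m. (M $$ (i, j)) (f j)))\<^sup>2) \<le> (op_norm M)\<^sup>2 * (\<Sum>j<m. (norm (f j))\<^sup>2)"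
proof (cases "\<forall>j<m. f j = 0")
  case True
  then show ?thesis
    by (simp add: cblinfun_zero)
next
  case False
  define s where "s = L2_set (\<lambda>j. norm (f j)) {..<m}"
  have s2: "s\<^sup>2 = (\<Sum>j<m. (norm (f j))\<^sup>2)"
    by (simp add: s_def L2_set_power2)
  have "s \<noteq> 0"
    using False by (auto simp: s_def L2_set_eq_0_iff)
  then have s: "s > 0"
    using L2_set_nonneg [of "\<lambda>j. norm (f j)" "{..<m}"] by (simp add: s_def order_less_le)
  define x where "x = vec m (\<lambda>j. complex_of_real (1 / s) *\<^sub>C f j)"
  have "(vec_norm x)\<^sup>2 = (\<Sum>j<m. (1 / s)\<^sup>2 * (norm (f j))\<^sup>2)"
    by (simp add: vec_norm_L2_set L2_set_power2 x_def norm_scaleC power_mult_distrib norm_divide power_divide)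
  also have "\<dots> = (1 / s)\<^sup>2 * s\<^sup>2"
    by (simp add: s2 sum_distrib_left)
  finally have "(vec_norm x)\<^sup>2 = 1\<^sup>2"
    using s by (simp add: power_divide)
  then have "(vec_norm x)\<^sup>2 \<le> 1\<^sup>2"
    by simp
  then have "vec_norm x \<le> 1"
    by (rule power2_le_imp_le) simp
  then have "vec_norm (op_apply M x) \<le> op_norm M"
    using M by (intro vec_norm_op_apply_le) (auto simp: x_def)
  then have "(vec_norm (op_apply M x))\<^sup>2 \<le> (op_norm M)\<^sup>2"
    by (intro power_mono) (auto simp: vec_norm_L2_set L2_set_nonneg)
  moreover have "(vec_norm (op_apply M x))\<^sup>2 = (1 / s)\<^sup>2 * (\<Sum>i<n. (norm (\<Sum>j<m. (M $$ (i, j)) (f j)))\<^sup>2)"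
    using M by (simp add: vec_norm_L2_set L2_set_power2 x_def cblinfun_scale sum_scaleC_right norm_scaleC
       power_mult_distrib sum_distrib_left norm_divide power_divide)
  ultimately show ?thesis
    using s by (simp add: s2 [symmetric] power_divide field_simps)
qed

definition riesz_mat :: "('r::chilbert_space \<Rightarrow>\<^sub>C\<^sub>L complex) mat \<Rightarrow> nat \<Rightarrow> nat \<Rightarrow> 'r" where
  "riesz_mat Q i j = riesz (Q $$ (i, j))"

text \<open>For a square matrix this is \<open>op_norm Q < 1\<close>, by the next two lemmas: the
  supremum gives way to an explicit bound \<open>q\<close> for the adjoint.\<close>

definition strict_row_contraction :: "nat \<Rightarrow> ('r::chilbert_space \<Rightarrow>\<^sub>C\<^sub>L complex) mat \<Rightarrow> bool" where
  "strict_row_contraction n Q \<longleftrightarrow>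
     Q \<in> carrier_mat n n \<and> (\<exists>q. 0 \<le> q \<and> q < 1 \<and> column_bound n (riesz_mat Q) q)"

lemma strict_row_contractionI:
  assumes Q: "Q \<in> carrier_mat n n" and q: "op_norm Q < 1"
  shows "strict_row_contraction n Q"
proof -
  have "column_bound n (riesz_mat Q) (op_norm Q)"
    unfolding column_bound_def
  proof
    fix c :: "nat \<Rightarrow> complex"
    define z where "z j = (\<Sum>i<n. c i *\<^sub>C riesz_mat Q i j)" for j
    have "(\<Sum>j<n. (norm (z j))\<^sup>2) \<le> (op_norm Q)\<^sup>2 * (\<Sum>i<n. (norm (cnj (c i)))\<^sup>2)"
    proof (rule adjoint_bound)
      have "(\<Sum>j<n. cinner (z j) (z j)) = (\<Sum>j<n. \<Sum>i<n. cnj (c i) * cinner (z j) (riesz_mat Q i j))"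
        by (intro sum.cong refl) (subst (2) z_def, simp add: cinner_sum_right cinner_scaleC_right)
      also have "\<dots> = (\<Sum>i<n. \<Sum>j<n. cnj (c i) * cinner (z j) (riesz_mat Q i j))"
        by (rule sum.swap)
      also have "\<dots> = (\<Sum>i<n. cinner (cnj (c i)) (cnj (\<Sum>j<n. (Q $$ (i, j)) (z j))))"
        by (simp add: cinner_complex_def sum_distrib_left riesz riesz_mat_def)
      finally show "(\<Sum>j<n. cinner (z j) (z j)) = (\<Sum>i<n. cinner (cnj (c i)) (cnj (\<Sum>j<n. (Q $$ (i, j)) (z j))))" .
      show "(\<Sum>i<n. (norm (cnj (\<Sum>j<n. (Q $$ (i, j)) (z j))))\<^sup>2) \<le> (op_norm Q)\<^sup>2 * (\<Sum>j<n. (norm (z j))\<^sup>2)"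
        using op_norm_sum_le [OF Q, of z] by (simp del: cnj_sum)
    qed (rule op_norm_nonneg)
    then show "(\<Sum>j<n. (norm (\<Sum>i<n. c i *\<^sub>C riesz_mat Q i j))\<^sup>2) \<le> (op_norm Q)\<^sup>2 * (\<Sum>i<n. (cmod (c i))\<^sup>2)"
      by (simp add: z_def)
  qed
  then show ?thesis
    using Q q op_norm_nonneg unfolding strict_row_contraction_def by blast
qed

lemma op_norm_less_1:
  assumes "strict_row_contraction n Q"
  shows "op_norm Q < 1"
proof -
  obtain q where Q: "Q \<in> carrier_mat n n" and q: "0 \<le> q" "q < 1" "column_bound n (riesz_mat Q) q"
    using assms by (auto simp: strict_row_contraction_def)
  have "vec_norm (op_apply Q x) \<le> q" if x: "x \<in> carrier_vec (dim_col Q)" "vec_norm x \<le> 1" for x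
  proof -
    define y where "y i = (\<Sum>j<n. (Q $$ (i, j)) (x $ j))" for i
    have "(\<Sum>i<n. (norm (y i))\<^sup>2) \<le> q\<^sup>2 * (\<Sum>j<n. (norm (x $ j))\<^sup>2)"
    proof (rule adjoint_bound)
      have "(\<Sum>i<n. cinner (y i) (y i)) = (\<Sum>i<n. \<Sum>j<n. cnj (y i) * cinner (x $ j) (riesz_mat Q i j))"
        by (intro sum.cong refl)
          (subst (1) y_def, simp add: cinner_complex_def riesz riesz_mat_def sum_distrib_left mult.commute)
      also have "\<dots> = (\<Sum>j<n. \<Sum>i<n. cnj (y i) * cinner (x $ j) (riesz_mat Q i j))"
        by (rule sum.swap)
      also have "\<dots> = (\<Sum>j<n. cinner (x $ j) (\<Sum>i<n. y i *\<^sub>C riesz_mat Q i j))"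
        by (simp add: cinner_sum_right cinner_scaleC_right)
      finally show "(\<Sum>i<n. cinner (y i) (y i)) = (\<Sum>j<n. cinner (x $ j) (\<Sum>i<n. y i *\<^sub>C riesz_mat Q i j))" .
      show "(\<Sum>j<n. (norm (\<Sum>i<n. y i *\<^sub>C riesz_mat Q i j))\<^sup>2) \<le> q\<^sup>2 * (\<Sum>i<n. (norm (y i))\<^sup>2)"
        using q(3) by (simp add: column_bound_def)
    qed (rule q)
    also have "\<dots> = q\<^sup>2 * (vec_norm x)\<^sup>2"
      using x Q by (simp add: vec_norm_L2_set L2_set_power2)
    also have "\<dots> \<le> q\<^sup>2 * 1\<^sup>2"
      using x by (intro mult_left_mono power_mono) (auto simp: vec_norm_L2_set L2_set_nonneg)
    finally have "(vec_norm (op_apply Q x))\<^sup>2 \<le> q\<^sup>2"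
      using Q by (simp add: vec_norm_L2_set L2_set_power2 y_def)
    then show ?thesis
      by (rule power2_le_imp_le) (rule q)
  qed
  then have "op_norm Q \<le> q"
    unfolding op_norm_def
    by (intro cSUP_least) (auto intro!: exI [of _ "0\<^sub>v (dim_col Q)"] simp: vec_norm_def)
  then show ?thesis
    using q by simp
qed

section \<open>Inverting \<open>I - M\<close> for a strict contraction \<open>M\<close>\<close>

text \<open>\<open>op_inverse\<close> is a definite description, so a two-sided inverse with bounded
  entries has to be exhibited. Its column \<open>j\<close> is the solution operator of x = y + M x
  for right-hand sides y concentrated at \<open>j\<close>.\<close>

lemma op_inverse_strict_contraction:
  fixes M :: "('x::chilbert_space \<Rightarrow>\<^sub>C\<^sub>L 'x) mat"
  assumes M: "M \<in> carrier_mat n n" and q: "0 \<le> q" "q < 1"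
    and contr: "\<And>x. (\<Sum>i<n. (norm (\<Sum>j<n. (M $$ (i, j)) (x j)))\<^sup>2) \<le> q\<^sup>2 * (\<Sum>j<n. (norm (x j))\<^sup>2)"
  defines "N \<equiv> op_inverse (id_tensor n cblinfun_id - M)"
  shows "N \<in> carrier_mat n n"
    "(id_tensor n cblinfun_id - M) \<odot> N = id_tensor n cblinfun_id"
proof -
  define F where "F x i = (\<Sum>j<n. (M $$ (i, j)) (x j))" for x i
  have F_diff: "F x i - F x' i = F (\<lambda>j. x j - x' j) i" for x x' i
    by (simp add: F_def cblinfun_diff sum_subtractf)
  have contrF: "(\<Sum>i<n. (norm (F x i - F x' i))\<^sup>2) \<le> q\<^sup>2 * (\<Sum>j<n. (norm (x j - x' j))\<^sup>2)" for x x'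
    unfolding F_diff using contr [of "\<lambda>j. x j - x' j"] by (simp add: F_def)
  \<comment> \<open>The difference of two solutions is fixed by M, which shrinks norms by the factor
    q. This uniqueness yields the linearity of \<open>sol\<close> and later the left
    inverse.\<close>
  have unique: "x i = x' i" if "i < n" "\<And>i. i < n \<Longrightarrow> x i = y i + F x i" "\<And>i. i < n \<Longrightarrow> x' i = y i + F x' i"
    for x x' y i
  proof -
    have "(\<Sum>j<n. (norm (x j - x' j))\<^sup>2) = (\<Sum>i<n. (norm (F x i - F x' i))\<^sup>2)"
      by (intro sum.cong refl) (simp add: that(2,3))
    then have le: "(\<Sum>j<n. (norm (x j - x' j))\<^sup>2) \<le> q\<^sup>2 * (\<Sum>j<n. (norm (x j - x' j))\<^sup>2)"
      using contrF [of x x'] by simp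
    have "q\<^sup>2 < 1"
      using q by (simp add: power_less_one_iff abs_square_less_1)
    moreover have "(1 - q\<^sup>2) * (\<Sum>j<n. (norm (x j - x' j))\<^sup>2) \<le> 0"
      using le by (simp add: left_diff_distrib)
    ultimately have "(\<Sum>j<n. (norm (x j - x' j))\<^sup>2) \<le> 0"
      by (auto simp: mult_le_0_iff)
    moreover have "(norm (x i - x' i))\<^sup>2 \<le> (\<Sum>j<n. (norm (x j - x' j))\<^sup>2)"
      by (rule member_le_sum [where f = "\<lambda>j. (norm (x j - x' j))\<^sup>2"]) (use that(1) in auto)
    ultimately have "(norm (x i - x' i))\<^sup>2 \<le> 0"
      by linarith
    then show ?thesis by simp
  qed
  have "\<exists>x. \<forall>i<n. x i = y i + F x i" for y
    by (rule strict_contraction_solve [OF q contrF, of y]) blast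
  then obtain sol where sol: "\<And>y i. i < n \<Longrightarrow> sol y i = y i + F (sol y) i"
    by metis
  have F_add: "F (\<lambda>i. x i + x' i) i = F x i + F x' i" for x x' i
    by (simp add: F_def cblinfun_add sum.distrib)
  have F_scale: "F (\<lambda>i. c *\<^sub>C x i) i = c *\<^sub>C F x i" for c x i
    by (simp add: F_def cblinfun_scale sum_scaleC_right)
  have sol_add: "sol (\<lambda>i. y i + y' i) i = sol y i + sol y' i" if "i < n" for y y' i
  proof (rule unique [OF that])
    show "sol y i + sol y' i = (y i + y' i) + F (\<lambda>i. sol y i + sol y' i) i" if "i < n" for i
      using sol [OF that, of y] sol [OF that, of y'] by (simp add: F_add)
  qed (rule sol)
  have sol_scale: "sol (\<lambda>i. c *\<^sub>C y i) i = c *\<^sub>C sol y i" if "i < n" for c y i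
  proof (rule unique [OF that])
    show "c *\<^sub>C sol y i = c *\<^sub>C y i + F (\<lambda>i. c *\<^sub>C sol y i) i" if "i < n" for i
      using sol [OF that, of y] by (simp add: F_scale flip: scaleC_add_right)
  qed (rule sol)
  \<comment> \<open>\<parallel>x\<parallel> \<le> \<parallel>y\<parallel> + q
    \<parallel>x\<parallel>, which is the bound of the Neumann series.\<close>
  have sol_bound: "norm (sol y i) \<le> 1 / (1 - q) * L2_set (\<lambda>i. norm (y i)) {..<n}" if "i < n" for y i
  proof -
    let ?s = "L2_set (\<lambda>i. norm (sol y i)) {..<n}" and ?y = "L2_set (\<lambda>i. norm (y i)) {..<n}"
    have "?s \<le> L2_set (\<lambda>i. norm (y i) + norm (F (sol y) i)) {..<n}"
    proof (rule L2_set_mono)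
      fix i assume "i \<in> {..<n}"
      then show "norm (sol y i) \<le> norm (y i) + norm (F (sol y) i)"
        using sol [of i y] norm_triangle_ineq [of "y i" "F (sol y) i"] by simp
    qed simp
    also have "\<dots> \<le> ?y + L2_set (\<lambda>i. norm (F (sol y) i)) {..<n}"
      by (rule L2_set_triangle_ineq)
    also have "L2_set (\<lambda>i. norm (F (sol y) i)) {..<n} \<le> q * ?s"
    proof (rule power2_le_imp_le)
      show "(L2_set (\<lambda>i. norm (F (sol y) i)) {..<n})\<^sup>2 \<le> (q * ?s)\<^sup>2"
        unfolding power_mult_distrib L2_set_power2 using contr [of "sol y"] by (simp add: F_def)
    qed (simp add: q L2_set_nonneg)
    finally have "(1 - q) * ?s \<le> ?y"
      by (simp add: algebra_simps)
    then have "?s \<le> 1 / (1 - q) * ?y"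
      using q by (simp add: field_simps)
    moreover have "norm (sol y i) \<le> ?s"
      using that by (intro member_le_L2_set [of "{..<n}" i "\<lambda>i. norm (sol y i)", simplified])
    ultimately show ?thesis by simp
  qed
  have bcl: "bounded_clinear (\<lambda>\<zeta>. sol (\<lambda>i. if i = j then \<zeta> else 0) i)" if "i < n" "j < n" for i j
  proof (rule bounded_clinearI)
    show "sol (\<lambda>i. if i = j then x + y else 0) i
        = sol (\<lambda>i. if i = j then x else 0) i + sol (\<lambda>i. if i = j then y else 0) i" for x y
      unfolding sol_add [OF that(1), symmetric] by (rule arg_cong [of _ _ "\<lambda>y. sol y i"]) auto
    show "sol (\<lambda>i. if i = j then c *\<^sub>C x else 0) i = c *\<^sub>C sol (\<lambda>i. if i = j then x else 0) i" for c x
      unfolding sol_scale [OF that(1), symmetric] by (rule arg_cong [of _ _ "\<lambda>y. sol y i"]) auto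
    have "L2_set (\<lambda>i. norm (if i = j then x else 0)) {..<n} = norm x" for x :: 'x
    proof -
      have "L2_set (\<lambda>i. norm (if i = j then x else 0)) {..<n} = sqrt (\<Sum>i<n. if i = j then (norm x)\<^sup>2 else 0)"
        unfolding L2_set_def by (intro arg_cong [of _ _ sqrt] sum.cong) auto
      then show ?thesis using that by simp
    qed
    then show "norm (sol (\<lambda>i. if i = j then x else 0) i) \<le> 1 / (1 - q) * norm x" for x
      using sol_bound [OF that(1), of "\<lambda>i. if i = j then x else 0"] by simp
  qed
  define N' where "N' = mat n n (\<lambda>(i, j). CBlinfun (\<lambda>\<zeta>. sol (\<lambda>i. if i = j then \<zeta> else 0) i))"
  have N': "(N' $$ (i, j)) \<zeta> = sol (\<lambda>i. if i = j then \<zeta> else 0) i" if "i < n" "j < n" for i j \<zeta>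
    using that by (simp add: N'_def CBlinfun_apply [OF bcl])
  let ?I = "id_tensor n (cblinfun_id :: 'x \<Rightarrow>\<^sub>C\<^sub>L 'x)"
  have dims: "dim_row N' = n" "dim_col N' = n" "dim_row M = n" "dim_col M = n"
    using M by (auto simp: N'_def)
  have delta: "(\<Sum>k<n. (if i = k then f k else (0::'x))) = f i" if "i < n" for i f
    using that by simp
  have right: "(?I - M) \<odot> N' = ?I"
  proof (rule eq_matI)
    fix i j assume "i < dim_row ?I" "j < dim_col ?I"
    then have ij: "i < n" "j < n" by simp_all
    have "(((?I - M) \<odot> N') $$ (i, j)) \<zeta> = (?I $$ (i, j)) \<zeta>" for \<zeta>
    proof -
      let ?s = "sol (\<lambda>i. if i = j then \<zeta> else 0)"
      have "(((?I - M) \<odot> N') $$ (i, j)) \<zeta> = (\<Sum>k<n. (if i = k then ?s k else 0) - (M $$ (i, k)) (?s k))"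
        using ij by (auto simp: index_op_times dims N' intro!: sum.cong)
      also have "\<dots> = ?s i - F ?s i"
        unfolding sum_subtractf F_def using ij by simp
      also have "\<dots> = (if i = j then \<zeta> else 0)"
        using sol [OF ij(1), of "\<lambda>i. if i = j then \<zeta> else 0"] by simp
      finally show ?thesis
        using ij by simp
    qed
    then show "((?I - M) \<odot> N') $$ (i, j) = ?I $$ (i, j)"
      by (rule cblinfun_eqI)
  qed (simp_all add: dims)
  have sol_zero: "sol (\<lambda>i. 0) i = 0" if "i < n" for i
    using sol_scale [OF that, of 0 "\<lambda>i. 0"] by simp
  have sol_sum: "sol (\<lambda>i. \<Sum>k\<in>A. f k i) i = (\<Sum>k\<in>A. sol (f k) i)" if "i < n" for i f and A :: "nat set"
    by (induction A rule: infinite_finite_induct) (simp_all add: sol_zero sol_add that)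
  \<comment> \<open>A tuple x solves the equation with right-hand side x - M x, so
    \<open>sol\<close> returns it by uniqueness.\<close>
  have left: "N' \<odot> (?I - M) = ?I"
  proof (rule eq_matI)
    fix i j assume "i < dim_row ?I" "j < dim_col ?I"
    then have ij: "i < n" "j < n" by simp_all
    have "((N' \<odot> (?I - M)) $$ (i, j)) \<zeta> = (?I $$ (i, j)) \<zeta>" for \<zeta>
    proof -
      define x where "x i = (if i = j then \<zeta> else 0)" for i
      have F: "F x k = (M $$ (k, j)) \<zeta>" for k
      proof -
        have "F x k = (\<Sum>l<n. if l = j then (M $$ (k, l)) \<zeta> else 0)"
          unfolding F_def by (intro sum.cong) (auto simp: x_def cblinfun_zero)
        then show ?thesis using ij by simp
      qed
      have entry: "((?I - M) $$ (k, j)) \<zeta> = x k - F x k" if "k < n" for k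
        using that ij by (simp add: x_def F dims)
      have "((N' \<odot> (?I - M)) $$ (i, j)) \<zeta> = (\<Sum>k<n. (N' $$ (i, k)) (((?I - M) $$ (k, j)) \<zeta>))"
        using ij by (subst index_op_times) (simp_all add: dims)
      also have "\<dots> = (\<Sum>k<n. (N' $$ (i, k)) (x k - F x k))"
        by (intro sum.cong refl) (simp only: entry lessThan_iff)
      also have "\<dots> = (\<Sum>k<n. sol (\<lambda>i. if i = k then x k - F x k else 0) i)"
        using ij by (simp add: N')
      also have "\<dots> = sol (\<lambda>i. \<Sum>k<n. if i = k then x k - F x k else 0) i"
        by (rule sol_sum [OF ij(1), symmetric])
      also have "\<dots> = x i"
      proof (rule unique [OF ij(1)])
        show "sol (\<lambda>i. \<Sum>k<n. if i = k then x k - F x k else 0) i = (x i - F x i)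
          + F (sol (\<lambda>i. \<Sum>k<n. if i = k then x k - F x k else 0)) i" if "i < n" for i
          by (subst sol [OF that]) (simp add: that delta)
      qed simp
      finally show ?thesis
        using ij by (simp add: x_def)
    qed
    then show "(N' \<odot> (?I - M)) $$ (i, j) = ?I $$ (i, j)"
      by (rule cblinfun_eqI)
  qed (simp_all add: dims)
  have "N = N'"
    unfolding N_def by (rule op_inverse_eqI [OF _ _ right left]) (auto simp: dims)
  then show "N \<in> carrier_mat n n" "(?I - M) \<odot> N = ?I"
    using right dims by auto
qed

section \<open>Transfer functions\<close>

lemma sum_cinner_swap:
  assumes "\<And>i j. i \<in> A \<Longrightarrow> j \<in> B \<Longrightarrow> cinner (f i j) (z i) = cinner (x j) (g i j)"
  shows "(\<Sum>i\<in>A. cinner (\<Sum>j\<in>B. f i j) (z i)) = (\<Sum>j\<in>B. cinner (x j) (\<Sum>i\<in>A. g i j))"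
proof -
  have "(\<Sum>i\<in>A. cinner (\<Sum>j\<in>B. f i j) (z i)) = (\<Sum>i\<in>A. \<Sum>j\<in>B. cinner (x j) (g i j))"
    by (simp add: cinner_sum_left assms)
  also have "\<dots> = (\<Sum>j\<in>B. \<Sum>i\<in>A. cinner (x j) (g i j))"
    by (rule sum.swap)
  finally show ?thesis
    by (simp add: cinner_sum_right)
qed

lemma sum_tensor_id:
  assumes "hilbert_tensor t"
  shows "(\<Sum>i<n. cinner (\<Sum>j<n. tensor_id t (Q $$ (i, j)) (x j)) (z i))
    = (\<Sum>j<n. cinner (x j) (\<Sum>i<n. t (riesz_mat Q i j) (z i)))"
  by (rule sum_cinner_swap) (simp add: cinner_tensor_id [OF assms] riesz_mat_def)

lemma tensor_id_bound:
  assumes t: "hilbert_tensor t" and q: "0 \<le> q" "column_bound n (riesz_mat Q) q"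
  shows "(\<Sum>i<n. (norm (\<Sum>j<n. tensor_id t (Q $$ (i, j)) (x j)))\<^sup>2) \<le> q\<^sup>2 * (\<Sum>j<n. (norm (x j))\<^sup>2)"
  by (rule adjoint_bound [OF sum_tensor_id [OF t] q(1)])
    (rule column_bound_tensor [OF pretensor_hilbert_tensor [OF t] q(2)])

text \<open>State form of the transfer function, with Q for Q \<otimes> I: \<zeta> = (I - Q A)^{-1}
  Q B v satisfies \<zeta> = Q (A \<zeta> + B v), and then S v = D v + C \<zeta>. From here on the
  argument runs on these equations and no longer on \<open>op_inverse\<close>.\<close>

lemma transfer_function_apply:
  fixes t :: "'r::chilbert_space \<Rightarrow> 'x::chilbert_space \<Rightarrow> 't::chilbert_space"
    and A :: "'x \<Rightarrow>\<^sub>C\<^sub>L 't" and B :: "'u::chilbert_space \<Rightarrow>\<^sub>C\<^sub>L 't"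
    and C :: "'x \<Rightarrow>\<^sub>C\<^sub>L 'y::chilbert_space" and D :: "'u \<Rightarrow>\<^sub>C\<^sub>L 'y"
  assumes t: "hilbert_tensor t" and A: "\<And>x. norm (A x) \<le> norm x"
    and Q: "strict_row_contraction n Q"
  shows "transfer_function t A B C D Q \<in> carrier_mat n n"
    and "\<exists>\<zeta>. \<forall>i<n. \<zeta> i = (\<Sum>k<n. tensor_id t (Q $$ (i, k)) (A (\<zeta> k) + B (v k)))
      \<and> (\<Sum>j<n. (transfer_function t A B C D Q $$ (i, j)) (v j)) = D (v i) + C (\<zeta> i)"
proof -
  obtain q where Qc: "Q \<in> carrier_mat n n" and q: "0 \<le> q" "q < 1" "column_bound n (riesz_mat Q) q"
    using Q by (auto simp: strict_row_contraction_def)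
  define QI where "QI = map_mat (tensor_id t) Q"
  have QI: "dim_row QI = n" "dim_col QI = n" "\<And>i j. i < n \<Longrightarrow> j < n \<Longrightarrow> QI $$ (i, j) = tensor_id t (Q $$ (i, j))"
    using Qc by (auto simp: QI_def)
  define M where "M = QI \<odot> id_tensor n A"
  have M: "M \<in> carrier_mat n n" "\<And>i j. i < n \<Longrightarrow> j < n \<Longrightarrow> M $$ (i, j) = tensor_id t (Q $$ (i, j)) o\<^sub>C\<^sub>L A"
    by (auto simp: M_def QI times_id_tensor)
  have contr: "(\<Sum>i<n. (norm (\<Sum>j<n. (M $$ (i, j)) (x j)))\<^sup>2) \<le> q\<^sup>2 * (\<Sum>j<n. (norm (x j))\<^sup>2)" for x
  proof -
    have "(\<Sum>i<n. (norm (\<Sum>j<n. (M $$ (i, j)) (x j)))\<^sup>2)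
        = (\<Sum>i<n. (norm (\<Sum>j<n. tensor_id t (Q $$ (i, j)) (A (x j))))\<^sup>2)"
      by (simp add: M(2))
    also have "\<dots> \<le> q\<^sup>2 * (\<Sum>j<n. (norm (A (x j)))\<^sup>2)"
      by (rule tensor_id_bound [OF t q(1) q(3)])
    also have "\<dots> \<le> q\<^sup>2 * (\<Sum>j<n. (norm (x j))\<^sup>2)"
      by (intro mult_left_mono sum_mono power_mono A) auto
    finally show ?thesis .
  qed
  define N where "N = op_inverse (id_tensor n cblinfun_id - M)"
  have N: "N \<in> carrier_mat n n" "(id_tensor n cblinfun_id - M) \<odot> N = id_tensor n cblinfun_id"
    unfolding N_def by (rule op_inverse_strict_contraction [OF M(1) q(1,2) contr])+
  define S where "S = transfer_function t A B C D Q"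
  have S: "S = id_tensor n D + id_tensor n C \<odot> N \<odot> QI \<odot> id_tensor n B"
    using Qc by (simp add: S_def transfer_function_def Let_def N_def M_def QI_def)
  then show "S \<in> carrier_mat n n" by auto
  have Sv: "(S $$ (i, j)) x = (if i = j then D x else 0)
      + C (\<Sum>k<n. (N $$ (i, k)) ((QI $$ (k, j)) (B x)))" if "i < n" "j < n" for i j x
  proof -
    have "(S $$ (i, j)) x = (if i = j then D x else 0) + ((id_tensor n C \<odot> N \<odot> QI \<odot> id_tensor n B) $$ (i, j)) x"
      using that by (simp add: S)
    also have "((id_tensor n C \<odot> N \<odot> QI \<odot> id_tensor n B) $$ (i, j)) x
        = C (\<Sum>k<n. (N $$ (i, k)) ((QI $$ (k, j)) (B x)))"
      using that N(1) QI by (simp add: id_tensor_times times_id_tensor index_op_times cblinfun_sum)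
    finally show ?thesis .
  qed
  define g where "g k = (\<Sum>j<n. (QI $$ (k, j)) (B (v j)))" for k
  define \<zeta> where "\<zeta> i = (\<Sum>k<n. (N $$ (i, k)) (g k))" for i
  have "\<zeta> i = (\<Sum>k<n. tensor_id t (Q $$ (i, k)) (A (\<zeta> k) + B (v k)))" if i: "i < n" for i
  proof -
    have inv: "(N $$ (i, l)) h - (\<Sum>k<n. (M $$ (i, k)) ((N $$ (k, l)) h)) = (if i = l then h else 0)"
      if "l < n" for l h
    proof -
      have "(((id_tensor n cblinfun_id - M) \<odot> N) $$ (i, l)) h = (if i = l then h else 0)"
        unfolding N(2) using i that by simp
      moreover have "(((id_tensor n cblinfun_id - M) \<odot> N) $$ (i, l)) h
          = (\<Sum>k<n. (if i = k then (N $$ (k, l)) h else 0) - (M $$ (i, k)) ((N $$ (k, l)) h))"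
        using i that N(1) M(1) by (subst index_op_times) (auto intro!: sum.cong)
      ultimately show ?thesis
        using i by (simp add: sum_subtractf)
    qed
    have "(\<Sum>k<n. (M $$ (i, k)) (\<zeta> k)) = (\<Sum>l<n. \<Sum>k<n. (M $$ (i, k)) ((N $$ (k, l)) (g l)))"
      unfolding \<zeta>_def cblinfun_sum by (rule sum.swap)
    then have "\<zeta> i - (\<Sum>k<n. (M $$ (i, k)) (\<zeta> k))
        = (\<Sum>l<n. (N $$ (i, l)) (g l) - (\<Sum>k<n. (M $$ (i, k)) ((N $$ (k, l)) (g l))))"
      by (simp add: \<zeta>_def sum_subtractf)
    also have "\<dots> = (\<Sum>l<n. if i = l then g l else 0)"
      by (intro sum.cong refl) (simp add: inv)
    also have "\<dots> = g i"
      using i by simp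
    finally have "\<zeta> i = g i + (\<Sum>k<n. (M $$ (i, k)) (\<zeta> k))"
      by (simp add: algebra_simps)
    then show ?thesis
      using i by (simp add: g_def QI M(2) cblinfun_add sum.distrib add.commute)
  qed
  moreover have "(\<Sum>j<n. (S $$ (i, j)) (v j)) = D (v i) + C (\<zeta> i)" if i: "i < n" for i
  proof -
    have "(\<Sum>j<n. (S $$ (i, j)) (v j)) = (\<Sum>j<n. if i = j then D (v j) else 0)
        + (\<Sum>j<n. C (\<Sum>k<n. (N $$ (i, k)) ((QI $$ (k, j)) (B (v j)))))"
      unfolding sum.distrib [symmetric] by (intro sum.cong refl) (simp add: Sv i)
    also have "(\<Sum>j<n. C (\<Sum>k<n. (N $$ (i, k)) ((QI $$ (k, j)) (B (v j))))) = C (\<zeta> i)"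
      unfolding cblinfun_sum [symmetric] \<zeta>_def g_def
      by (rule arg_cong [of _ _ C]) (simp add: cblinfun_sum, rule sum.swap)
    finally show ?thesis
      using i by simp
  qed
  ultimately show "\<exists>\<zeta>. \<forall>i<n. \<zeta> i = (\<Sum>k<n. tensor_id t (Q $$ (i, k)) (A (\<zeta> k) + B (v k)))
      \<and> (\<Sum>j<n. (S $$ (i, j)) (v j)) = D (v i) + C (\<zeta> i)"
    by blast
qed

text \<open>The action of \<open>S\<^sup>*\<close>: it maps \<open>y\<close> to \<open>u\<close> when \<open>U\<^sup>*(t\<^sub>i, y\<^sub>i) = (x\<^sub>i, u\<^sub>i)\<close>
  with \<open>t = (Q\<^sup>* \<otimes> I) x\<close>.\<close>

lemma transfer_function_adjoint:
  fixes t :: "'r::chilbert_space \<Rightarrow> 'x::chilbert_space \<Rightarrow> 't::chilbert_space"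
    and A :: "'x \<Rightarrow>\<^sub>C\<^sub>L 't" and B :: "'u::chilbert_space \<Rightarrow>\<^sub>C\<^sub>L 't"
    and C :: "'x \<Rightarrow>\<^sub>C\<^sub>L 'y::chilbert_space" and D :: "'u \<Rightarrow>\<^sub>C\<^sub>L 'y"
  assumes t: "hilbert_tensor t" and A: "\<And>x. norm (A x) \<le> norm x"
    and Q: "strict_row_contraction n Q"
    and U: "\<And>i z w. i < n \<Longrightarrow>
      cinner (colligation A B C D (z, w)) (\<Sum>l<n. t (riesz_mat Q l i) (x l), y i) = cinner (z, w) (x i, u i)"
  shows "(\<Sum>i<n. cinner (\<Sum>j<n. (transfer_function t A B C D Q $$ (i, j)) (v j)) (y i))
    = (\<Sum>i<n. cinner (v i) (u i))"
proof -
  define T where "T i = (\<Sum>l<n. t (riesz_mat Q l i) (x l))" for i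
  obtain \<zeta> where \<zeta>: "\<And>i. i < n \<Longrightarrow> \<zeta> i = (\<Sum>k<n. tensor_id t (Q $$ (i, k)) (A (\<zeta> k) + B (v k)))"
    "\<And>i. i < n \<Longrightarrow> (\<Sum>j<n. (transfer_function t A B C D Q $$ (i, j)) (v j)) = D (v i) + C (\<zeta> i)"
    using transfer_function_apply(2) [OF t A Q, where v = v] by blast
  \<comment> \<open>Moving Q \<otimes> I to the other side turns \<langle>\<zeta>, x\<rangle> into
    \<langle>A \<zeta> + B v, T\<rangle>; these two state terms cancel when the identities
    \<open>U\<close> are summed over i.\<close>
  have "(\<Sum>i<n. cinner (\<zeta> i) (x i)) = (\<Sum>i<n. cinner (\<Sum>k<n. tensor_id t (Q $$ (i, k)) (A (\<zeta> k) + B (v k))) (x i))"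
    using \<zeta>(1) by simp
  also have "\<dots> = (\<Sum>k<n. cinner (A (\<zeta> k) + B (v k)) (T k))"
    unfolding T_def by (rule sum_tensor_id [OF t])
  finally have 1: "(\<Sum>i<n. cinner (\<zeta> i) (x i)) = (\<Sum>k<n. cinner (A (\<zeta> k) + B (v k)) (T k))" .
  have "cinner (D (v i) + C (\<zeta> i)) (y i)
      = cinner (\<zeta> i) (x i) + cinner (v i) (u i) - cinner (A (\<zeta> i) + B (v i)) (T i)" if "i < n" for i
    using U [OF that, of "\<zeta> i" "v i"]
    by (simp add: colligation_def cinner_prod_def T_def algebra_simps)
  then have "(\<Sum>i<n. cinner (D (v i) + C (\<zeta> i)) (y i)) = (\<Sum>i<n. cinner (v i) (u i))"
    using 1 by (simp add: sum_subtractf sum.distrib)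
  then show ?thesis
    using \<zeta>(2) by simp
qed

lemma norm_fst_le': "norm (fst p) \<le> norm p"
  by (cases p) (simp add: norm_fst_le)

lemma bounded_clinear_colligation: "contractive (colligation A B C D) \<Longrightarrow> bounded_clinear (colligation A B C D)"
  by (rule bounded_clinearI [where K = 1])
    (auto simp: contractive_def colligation_def cblinfun_apply_linear scaleC_prod_def scaleC_add_right)

lemma contractive_colligation_state:
  fixes A :: "'x::chilbert_space \<Rightarrow>\<^sub>C\<^sub>L 't::chilbert_space" and B :: "'u::chilbert_space \<Rightarrow>\<^sub>C\<^sub>L 't"
    and C :: "'x \<Rightarrow>\<^sub>C\<^sub>L 'y::chilbert_space" and D :: "'u \<Rightarrow>\<^sub>C\<^sub>L 'y"
  assumes "contractive (colligation A B C D)"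
  shows "norm (A x) \<le> norm x"
proof -
  have "norm (colligation A B C D (x, 0)) \<le> norm (x, 0::'u)"
    using assms unfolding contractive_def by blast
  then have "norm (A x, C x) \<le> norm x"
    by (simp add: colligation_def cblinfun_zero norm_Pair)
  then show ?thesis
    using norm_fst_le [of "A x" "C x"] by linarith
qed

definition colligation_adjoint :: "('x::chilbert_space \<Rightarrow>\<^sub>C\<^sub>L 't::chilbert_space) \<Rightarrow> ('u::chilbert_space \<Rightarrow>\<^sub>C\<^sub>L 't)
    \<Rightarrow> ('x \<Rightarrow>\<^sub>C\<^sub>L 'y::chilbert_space) \<Rightarrow> ('u \<Rightarrow>\<^sub>C\<^sub>L 'y) \<Rightarrow> ('t \<times> 'y) \<Rightarrow>\<^sub>C\<^sub>L ('x \<times> 'u)" where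
  "colligation_adjoint A B C D = cadjoint (CBlinfun (colligation A B C D))"

lemma colligation_adjoint:
  assumes "contractive (colligation A B C D)"
  shows "cinner (colligation A B C D z) w = cinner z (colligation_adjoint A B C D w)"
    and "norm (colligation_adjoint A B C D w) \<le> norm w"
proof -
  note b = CBlinfun_apply [OF bounded_clinear_colligation [OF assms]]
  show "cinner (colligation A B C D z) w = cinner z (colligation_adjoint A B C D w)"
    using cinner_cadjoint [of "CBlinfun (colligation A B C D)" z w] by (simp add: b colligation_adjoint_def)
  show "norm (colligation_adjoint A B C D w) \<le> norm w"
    using norm_cadjoint_le [of 1 "CBlinfun (colligation A B C D)" w] assms
    by (simp only: b colligation_adjoint_def contractive_def mult_1 zero_le_one)
qed

text \<open>The first component of the argument of U^* is itself built from the unknown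
  \<open>x\<close>. The resulting equation for \<open>x\<close> has Lipschitz constant
  \<open>q\<close>, as U^* and the projection are contractions and Q^* \<otimes> I has norm at most
  \<open>q\<close>.\<close>

lemma colligation_adjoint_solve:
  assumes t: "hilbert_tensor t" and U: "contractive (colligation A B C D)"
    and Q: "strict_row_contraction n Q"
  obtains x u where "\<And>i. i < n \<Longrightarrow>
    colligation_adjoint A B C D (\<Sum>l<n. t (riesz_mat Q l i) (x l), y i) = (x i, u i)"
proof -
  obtain q where q: "0 \<le> q" "q < 1" "column_bound n (riesz_mat Q) q"
    using Q by (auto simp: strict_row_contraction_def)
  let ?V = "colligation_adjoint A B C D"
  note pt = pretensor_hilbert_tensor [OF t]
  define F where "F x i = fst (?V (\<Sum>l<n. t (riesz_mat Q l i) (x l), 0))" for x i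
  have contr: "(\<Sum>i<n. (norm (F x i - F x' i))\<^sup>2) \<le> q\<^sup>2 * (\<Sum>i<n. (norm (x i - x' i))\<^sup>2)" for x x'
  proof -
    have tdiff: "t r (a - b) = t r a - t r b" for r a b
      using pretensor_add_right [OF pt, of r "a - b" b] by simp
    have le: "norm (F x i - F x' i) \<le> norm (\<Sum>l<n. t (riesz_mat Q l i) (x l - x' l))" for i
    proof -
      have "F x i - F x' i = fst (?V (\<Sum>l<n. t (riesz_mat Q l i) (x l - x' l), 0))"
        unfolding F_def fst_diff [symmetric] cblinfun_diff [symmetric] by (simp add: tdiff sum_subtractf)
      also have "norm \<dots> \<le> norm (?V (\<Sum>l<n. t (riesz_mat Q l i) (x l - x' l), 0))"
        by (rule norm_fst_le')
      also have "\<dots> \<le> norm (\<Sum>l<n. t (riesz_mat Q l i) (x l - x' l))"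
        using colligation_adjoint(2) [OF U, of "(\<Sum>l<n. t (riesz_mat Q l i) (x l - x' l), 0)"]
        by (simp add: norm_Pair)
      finally show ?thesis .
    qed
    have "(\<Sum>i<n. (norm (F x i - F x' i))\<^sup>2) \<le> (\<Sum>i<n. (norm (\<Sum>l<n. t (riesz_mat Q l i) (x l - x' l)))\<^sup>2)"
      by (intro sum_mono power_mono le) simp
    also have "\<dots> \<le> q\<^sup>2 * (\<Sum>i<n. (norm (x i - x' i))\<^sup>2)"
      by (rule column_bound_tensor [OF pt q(3)])
    finally show ?thesis .
  qed
  obtain x where x: "\<And>i. i < n \<Longrightarrow> x i = fst (?V (0, y i)) + F x i"
    by (rule strict_contraction_solve [OF q(1,2) contr, of "\<lambda>i. fst (?V (0, y i))"]) blast
  define u where "u i = snd (?V (\<Sum>l<n. t (riesz_mat Q l i) (x l), y i))" for i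
  have "?V (\<Sum>l<n. t (riesz_mat Q l i) (x l), y i) = (x i, u i)" if "i < n" for i
  proof -
    have "?V (\<Sum>l<n. t (riesz_mat Q l i) (x l), y i)
        = ?V (0, y i) + ?V (\<Sum>l<n. t (riesz_mat Q l i) (x l), 0)"
      by (simp flip: cblinfun_add)
    then show ?thesis
      using x [OF that] by (simp add: prod_eq_iff F_def u_def)
  qed
  then show thesis
    using that by blast
qed

section \<open>The kernel of \<open>Q\<close>\<close>

lemma cblinfun_complex_apply: "T c = c *\<^sub>C T 1" for T :: "complex \<Rightarrow>\<^sub>C\<^sub>L 'h::chilbert_space"
  using cblinfun_scale [of T c 1] by (simp add: scaleC_complex_def)

lemma cadjoint_complex_apply: "cadjoint T \<xi> = cinner \<xi> (T 1)" for T :: "complex \<Rightarrow>\<^sub>C\<^sub>L 'h::chilbert_space"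
  using cinner_cadjoint_left [of T \<xi> 1] by (simp add: cinner_complex_def)

definition fock_vec :: "('r::chilbert_space \<Rightarrow>\<^sub>C\<^sub>L complex) mat \<Rightarrow> nat \<Rightarrow> nat \<Rightarrow> nat \<Rightarrow> 'r fock" where
  "fock_vec Q k i j = (L_pow Q k $$ (i, j)) 1"

lemma L_pow_carrier: "Q \<in> carrier_mat n n \<Longrightarrow> L_pow Q k \<in> carrier_mat n n"
  by (induction k) auto

lemma fock_vec_0:
  "Q \<in> carrier_mat n n \<Longrightarrow> i < n \<Longrightarrow> j < n \<Longrightarrow> fock_vec Q 0 i j = (if i = j then vacuum else 0)"
  by (auto simp: fock_vec_def scaleC_one)

lemma fock_vec_Suc:
  assumes "Q \<in> carrier_mat n n" "i < n" "j < n"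
  shows "fock_vec Q (Suc k) i j = (\<Sum>l<n. tensor_left (riesz_mat Q l i) (fock_vec Q k l j))"
  using assms L_pow_carrier [OF assms(1), of k]
  by (simp add: fock_vec_def index_op_times riesz_mat_def riesz_def)

lemma cinner_vacuum [simp]: "cinner (vacuum :: 'r::chilbert_space fock) vacuum = 1"
proof -
  have v: "(vacuum :: 'r fock) = l2_single [] 1"
    by (rule l2_eqI) (simp add: vacuum.rep_eq)
  show ?thesis
    unfolding v cinner_l2_single by (simp add: cinner_complex_def)
qed

lemma sum_delta2:
  fixes n m :: nat
  assumes "j < n" "i < m"
  shows "(\<Sum>l<n. \<Sum>l'<m. if l = j then if l' = i then f l l' else 0 else 0) = (f j i :: 'a::comm_monoid_add)"
proof -
  have "(\<Sum>l<n. \<Sum>l'<m. if l = j then if l' = i then f l l' else 0 else 0)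
      = (\<Sum>l<n. if l = j then (\<Sum>l'<m. if l' = i then f l l' else 0) else 0)"
    by (intro sum.cong refl) simp
  then show ?thesis
    using assms by simp
qed

text \<open>Each further tensor factor multiplies the norm by at most q, by the amplified bound;
  this makes the kernel series converge geometrically.\<close>

lemma fock_vec_bound:
  assumes Q: "Q \<in> carrier_mat n n" and q: "column_bound n (riesz_mat Q) q" and j: "j < n"
  shows "(\<Sum>i<n. (norm (fock_vec Q k i j))\<^sup>2) \<le> (q\<^sup>2) ^ k"
proof (induction k)
  case 0
  have "norm (vacuum :: 'a fock) = 1"
  proof -
    have "cinner (vacuum :: 'a fock) vacuum = 1"
      by simp
    then have "complex_of_real ((norm (vacuum :: 'a fock))\<^sup>2) = of_real 1"
      unfolding cinner_self by simp
    then have "(norm (vacuum :: 'a fock))\<^sup>2 = 1"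
      using of_real_eq_iff by blast
    then show ?thesis
      by (simp add: power2_eq_1_iff) (metis norm_ge_zero neg_0_le_iff_le not_one_le_zero)
  qed
  then have "(\<Sum>i<n. (norm (fock_vec Q 0 i j))\<^sup>2) = (\<Sum>i<n. if i = j then 1 else 0)"
    by (intro sum.cong refl) (simp add: fock_vec_0 [OF Q] j)
  then show ?case
    using j by simp
next
  case (Suc k)
  have "(\<Sum>i<n. (norm (fock_vec Q (Suc k) i j))\<^sup>2)
      = (\<Sum>i<n. (norm (\<Sum>l<n. tensor_left (riesz_mat Q l i) (fock_vec Q k l j)))\<^sup>2)"
    by (simp add: fock_vec_Suc [OF Q] j)
  also have "\<dots> \<le> q\<^sup>2 * (\<Sum>l<n. (norm (fock_vec Q k l j))\<^sup>2)"
    by (rule column_bound_tensor [OF pretensor_tensor_left q])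
  also have "\<dots> \<le> q\<^sup>2 * (q\<^sup>2) ^ k"
    by (intro mult_left_mono Suc) simp
  finally show ?case by simp
qed

lemma fock_vec_summable:
  assumes Q: "strict_row_contraction n Q" and "i < n" "j < n"
  shows "(\<lambda>k. (norm (fock_vec Q k i j))\<^sup>2) summable_on UNIV"
proof -
  obtain q where Qc: "Q \<in> carrier_mat n n" and q: "0 \<le> q" "q < 1" "column_bound n (riesz_mat Q) q"
    using Q by (auto simp: strict_row_contraction_def)
  have le: "(norm (fock_vec Q k i j))\<^sup>2 \<le> (q\<^sup>2) ^ k" for k
    using member_le_sum [of i "{..<n}" "\<lambda>i. (norm (fock_vec Q k i j))\<^sup>2"] assms(2)
      fock_vec_bound [OF Qc q(3) assms(3), of k] by simp
  have "summable (\<lambda>k. (q\<^sup>2) ^ k)"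
    using q by (intro summable_geometric) (simp add: abs_square_less_1)
  then have "summable (\<lambda>k. (norm (fock_vec Q k i j))\<^sup>2)"
    by (rule summable_comparison_test' [where N = 0]) (use le in simp)
  then show ?thesis
    by (subst summable_on_UNIV_nonneg_real_iff) auto
qed

text \<open>By \<open>k_kernel_index\<close>, \<open>k\<close> is the Gram kernel of these vectors. Passing to coordinates puts their
  tensor products with a space \<open>H\<close> into \<open>\<ell>\<^sup>2\<close> with values in \<open>H\<close>.\<close>

definition kvec :: "('r::chilbert_space \<Rightarrow>\<^sub>C\<^sub>L complex) mat \<Rightarrow> nat \<Rightarrow> nat \<Rightarrow> ((nat, 'r fock) l2, complex) l2" where
  "kvec Q i j = coord (Abs_l2 (\<lambda>k. fock_vec Q k i j))"

text \<open>The degree \<open>k\<close> is a coordinate of its own in \<open>kvec\<close>, so the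
  series over \<open>k\<close> that defines the kernel is the \<ell>^2 inner product itself.\<close>

lemma cinner_kvec_sums:
  assumes "strict_row_contraction n Q" "i < n" "j < n" "strict_row_contraction m R" "a < m" "b < m"
  shows "(\<lambda>k. cinner (fock_vec Q k i j) (fock_vec R k a b)) sums cinner (kvec Q i j) (kvec R a b)"
proof -
  note sum = fock_vec_summable [OF assms(1-3)] fock_vec_summable [OF assms(4-6)]
  have *: "l2_nth (Abs_l2 (\<lambda>k. fock_vec Q k i j)) = (\<lambda>k. fock_vec Q k i j)"
    "l2_nth (Abs_l2 (\<lambda>k. fock_vec R k a b)) = (\<lambda>k. fock_vec R k a b)"
    using sum by (intro Abs_l2_inverse; simp)+
  have "cinner (kvec Q i j) (kvec R a b) = (\<Sum>\<^sub>\<infinity>k. cinner (fock_vec Q k i j) (fock_vec R k a b))"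
    unfolding kvec_def cinner_coord by (subst cinner_l2_def) (simp add: *)
  then show ?thesis
    using has_sum_imp_sums [OF has_sum_infsum [OF l2_cinner_summable [OF sum]]] by simp
qed

lemma k_kernel_index:
  assumes Z: "strict_row_contraction n (Q\<^sub>0 Z)" "dim_row Z = n"
    and W: "strict_row_contraction m (Q\<^sub>0 W)" "dim_row W = m"
    and P: "P \<in> carrier_mat n m" and ij: "i < n" "j < m"
  shows "k_kernel Q\<^sub>0 Z W P $$ (i, j)
    = (\<Sum>a<n. \<Sum>b<m. P $$ (a, b) * cinner (kvec (Q\<^sub>0 W) b j) (kvec (Q\<^sub>0 Z) a i))"
proof -
  have QZ: "Q\<^sub>0 Z \<in> carrier_mat n n" and QW: "Q\<^sub>0 W \<in> carrier_mat m m"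
    using Z W by (auto simp: strict_row_contraction_def)
  note LZ = L_pow_carrier [OF QZ] and LW = L_pow_carrier [OF QW]
  have trm: "((op_adjoint (L_pow (Q\<^sub>0 Z) k) \<odot> mat_tensor_id P \<odot> L_pow (Q\<^sub>0 W) k) $$ (i, j)) 1
      = (\<Sum>a<n. \<Sum>b<m. P $$ (a, b) * cinner (fock_vec (Q\<^sub>0 W) k b j) (fock_vec (Q\<^sub>0 Z) k a i))" for k
  proof -
    have "((op_adjoint (L_pow (Q\<^sub>0 Z) k) \<odot> mat_tensor_id P \<odot> L_pow (Q\<^sub>0 W) k) $$ (i, j)) 1
      = (\<Sum>b<m. \<Sum>a<n. P $$ (a, b) * cinner (fock_vec (Q\<^sub>0 W) k b j) (fock_vec (Q\<^sub>0 Z) k a i))"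
      using LZ [of k] LW [of k] P ij
      by (simp add: index_op_times cblinfun_scale cadjoint_complex_apply fock_vec_def scaleC_complex_def)
    then show ?thesis
      by (simp only: sum.swap [of _ "{..<m}" "{..<n}"])
  qed
  have "(\<lambda>k. \<Sum>a<n. \<Sum>b<m. P $$ (a, b) * cinner (fock_vec (Q\<^sub>0 W) k b j) (fock_vec (Q\<^sub>0 Z) k a i))
     sums (\<Sum>a<n. \<Sum>b<m. P $$ (a, b) * cinner (kvec (Q\<^sub>0 W) b j) (kvec (Q\<^sub>0 Z) a i))"
    by (intro sums_sum sums_mult cinner_kvec_sums [OF W(1) _ _ Z(1)]) (use ij in auto)
  then show ?thesis
    using ij Z(2) W(2) by (simp add: k_kernel_def trm sums_unique [symmetric])
qed

section \<open>Recursions at both ends of the tensor powers, and the Stein equations\<close>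

lemma fock_vec_cinner_Suc:
  assumes Q: "Q \<in> carrier_mat n n" and R: "R \<in> carrier_mat m m"
    and "b < n" "j < n" "a < m" "i < m"
  shows "cinner (fock_vec Q (Suc k) b j) (fock_vec R (Suc k) a i)
    = (\<Sum>l<n. \<Sum>l'<m. cinner (riesz_mat Q l b) (riesz_mat R l' a) * cinner (fock_vec Q k l j) (fock_vec R k l' i))"
  unfolding fock_vec_Suc [OF Q assms(3,4)] fock_vec_Suc [OF R assms(5,6)]
  by (rule cinner_pretensor_sum [OF pretensor_tensor_left])

text \<open>\<open>L_pow\<close> grows at the left end by definition; here a factor is split off at
  the other end. Working with inner products avoids tensoring from the right: unfold at the left,
  apply the induction hypothesis, fold at the left again.\<close>

lemma fock_vec_cinner_Suc':
  assumes Q: "Q \<in> carrier_mat n n" and R: "R \<in> carrier_mat m m"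
    and "b < n" "j < n" "a < m" "i < m"
  shows "cinner (fock_vec Q (Suc k) b j) (fock_vec R (Suc k) a i)
    = (\<Sum>l<n. \<Sum>l'<m. cinner (fock_vec Q k b l) (fock_vec R k a l') * cinner (riesz_mat Q j l) (riesz_mat R i l'))"
  using assms(3-)
proof (induction k arbitrary: a b i j)
  case 0
  have v: "cinner (fock_vec Q 0 l j) (fock_vec R 0 l' i) = (if l = j then if l' = i then 1 else 0 else 0)"
    if "l < n" "l' < m" "j < n" "i < m" for l l' i j
    using that by (simp add: fock_vec_0 [OF Q] fock_vec_0 [OF R])
  have "cinner (fock_vec Q (Suc 0) b j) (fock_vec R (Suc 0) a i)
    = (\<Sum>l<n. \<Sum>l'<m. if l = j then if l' = i then cinner (riesz_mat Q l b) (riesz_mat R l' a) else 0 else 0)"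
    unfolding fock_vec_cinner_Suc [OF Q R 0] by (intro sum.cong refl) (simp add: v 0)
  also have "\<dots> = cinner (riesz_mat Q j b) (riesz_mat R i a)"
    using 0 by (simp only: sum_delta2)
  also have "\<dots> = (\<Sum>l<n. \<Sum>l'<m. if l = b then if l' = a then cinner (riesz_mat Q j l) (riesz_mat R i l') else 0 else 0)"
    using 0 by (simp only: sum_delta2)
  also have "\<dots> = (\<Sum>l<n. \<Sum>l'<m. cinner (fock_vec Q 0 b l) (fock_vec R 0 a l') * cinner (riesz_mat Q j l) (riesz_mat R i l'))"
    by (intro sum.cong refl) (simp add: v 0)
  finally show ?case .
next
  case (Suc k)
  let ?r = "\<lambda>l b l' a. cinner (riesz_mat Q l b) (riesz_mat R l' a)"
  let ?f = "\<lambda>k l j l' i. cinner (fock_vec Q k l j) (fock_vec R k l' i)"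
  have "?f (Suc (Suc k)) b j a i = (\<Sum>p<n. \<Sum>p'<m. ?r p b p' a * ?f (Suc k) p j p' i)"
    by (rule fock_vec_cinner_Suc [OF Q R Suc.prems])
  also have "\<dots> = (\<Sum>p<n. \<Sum>p'<m. \<Sum>l<n. \<Sum>l'<m. ?r p b p' a * ?f k p l p' l' * ?r j l i l')"
    by (intro sum.cong refl) (simp add: Suc sum_distrib_left mult.assoc)
  also have "\<dots> = (\<Sum>l<n. \<Sum>p<n. \<Sum>p'<m. \<Sum>l'<m. ?r p b p' a * ?f k p l p' l' * ?r j l i l')"
    by (rule sum_swap_mult)
  also have "\<dots> = (\<Sum>l<n. \<Sum>l'<m. \<Sum>p<n. \<Sum>p'<m. ?r p b p' a * ?f k p l p' l' * ?r j l i l')"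
    by (rule sum.cong [OF refl], rule sum_swap_mult)
  also have "\<dots> = (\<Sum>l<n. \<Sum>l'<m. ?f (Suc k) b l a l' * ?r j l i l')"
    by (intro sum.cong refl) (use Suc.prems in \<open>simp add: fock_vec_cinner_Suc [OF Q R] sum_distrib_right\<close>)
  finally show ?case .
qed

text \<open>The two Stein equations: with \<open>\<Psi>(P) = Q(Z) (P \<otimes> I) Q(W)\<^sup>*\<close>, both \<open>k(\<Psi>(P))\<close> and
  \<open>\<Psi>(k(P))\<close> are \<open>k(P) - P\<close>.\<close>

lemma kvec_Stein:
  assumes Q: "strict_row_contraction n Q" and R: "strict_row_contraction m R"
    and ix: "b < n" "j < n" "a < m" "i < m"
  shows "cinner (kvec Q b j) (kvec R a i) = (if b = j \<and> a = i then 1 else 0)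
      + (\<Sum>l<n. \<Sum>l'<m. cinner (riesz_mat Q l b) (riesz_mat R l' a) * cinner (kvec Q l j) (kvec R l' i))"
    and "cinner (kvec Q b j) (kvec R a i) = (if b = j \<and> a = i then 1 else 0)
      + (\<Sum>l<n. \<Sum>l'<m. cinner (kvec Q b l) (kvec R a l') * cinner (riesz_mat Q j l) (riesz_mat R i l'))"
proof -
  have Qc: "Q \<in> carrier_mat n n" and Rc: "R \<in> carrier_mat m m"
    using Q R by (auto simp: strict_row_contraction_def)
  let ?f = "\<lambda>k. cinner (fock_vec Q k b j) (fock_vec R k a i)"
  have 0: "?f 0 = (if b = j \<and> a = i then 1 else 0)"
    using ix by (simp add: fock_vec_0 [OF Qc] fock_vec_0 [OF Rc])
  have s: "?f sums cinner (kvec Q b j) (kvec R a i)"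
    by (rule cinner_kvec_sums [OF Q _ _ R]) (use ix in auto)
  have "(\<lambda>k. ?f (Suc k)) sums
      (\<Sum>l<n. \<Sum>l'<m. cinner (riesz_mat Q l b) (riesz_mat R l' a) * cinner (kvec Q l j) (kvec R l' i))"
    unfolding fock_vec_cinner_Suc [OF Qc Rc ix]
    by (intro sums_sum sums_mult cinner_kvec_sums [OF Q _ _ R]) (use ix in auto)
  from sums_unique2 [OF s sums_Suc [OF this]]
  show "cinner (kvec Q b j) (kvec R a i) = (if b = j \<and> a = i then 1 else 0)
      + (\<Sum>l<n. \<Sum>l'<m. cinner (riesz_mat Q l b) (riesz_mat R l' a) * cinner (kvec Q l j) (kvec R l' i))"
    by (simp add: 0 add.commute)
  have "(\<lambda>k. ?f (Suc k)) sums
      (\<Sum>l<n. \<Sum>l'<m. cinner (kvec Q b l) (kvec R a l') * cinner (riesz_mat Q j l) (riesz_mat R i l'))"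
    unfolding fock_vec_cinner_Suc' [OF Qc Rc ix]
    by (intro sums_sum sums_mult2 cinner_kvec_sums [OF Q _ _ R]) (use ix in auto)
  from sums_unique2 [OF s sums_Suc [OF this]]
  show "cinner (kvec Q b j) (kvec R a i) = (if b = j \<and> a = i then 1 else 0)
      + (\<Sum>l<n. \<Sum>l'<m. cinner (kvec Q b l) (kvec R a l') * cinner (riesz_mat Q j l) (riesz_mat R i l'))"
    by (simp add: 0 add.commute)
qed

section \<open>Intertwining\<close>

text \<open>Entry (i, k) of \<alpha> Q = R \<alpha> under the conjugate-linear map
  \<open>riesz\<close>.\<close>

lemma riesz_mat_intertwine:
  assumes Q: "Q \<in> carrier_mat n n" and R: "R \<in> carrier_mat m m" and \<alpha>: "\<alpha> \<in> carrier_mat m n"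
    and eq: "\<alpha> \<bullet>\<^sub>l Q = R \<bullet>\<^sub>r \<alpha>" and ix: "k < n" "i < m"
  shows "(\<Sum>l<n. cnj (\<alpha> $$ (i, l)) *\<^sub>C riesz_mat Q l k) = (\<Sum>j<m. cnj (\<alpha> $$ (j, k)) *\<^sub>C riesz_mat R i j)"
proof -
  have "(\<Sum>l<n. \<alpha> $$ (i, l) *\<^sub>C Q $$ (l, k)) = (\<alpha> \<bullet>\<^sub>l Q) $$ (i, k)"
    using Q \<alpha> ix by (simp add: cmat_times_left_def)
  also have "\<dots> = (\<Sum>j<m. \<alpha> $$ (j, k) *\<^sub>C R $$ (i, j))"
    unfolding eq using R \<alpha> ix by (simp add: cmat_times_right_def)
  finally show ?thesis
    by (simp add: riesz_mat_def flip: riesz_scale riesz_sum)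
qed

text \<open>Induction on the degree: \<alpha> passes one tensor factor by the relation for
  \<open>riesz_mat\<close> and the rest by the induction hypothesis. In passing, \<alpha> moves from
  the column index on the left to the row index on the right.\<close>

lemma fock_vec_intertwine:
  assumes Q: "Q \<in> carrier_mat n n" and R: "R \<in> carrier_mat m m" and \<alpha>: "\<alpha> \<in> carrier_mat m n"
    and eq: "\<alpha> \<bullet>\<^sub>l Q = R \<bullet>\<^sub>r \<alpha>" and ix: "k < n" "i < m"
  shows "(\<Sum>l<n. cnj (\<alpha> $$ (i, l)) *\<^sub>C fock_vec Q p k l) = (\<Sum>j<m. cnj (\<alpha> $$ (j, k)) *\<^sub>C fock_vec R p j i)"
  using ix(1)
proof (induction p arbitrary: k)
  case 0
  have "(\<Sum>l<n. cnj (\<alpha> $$ (i, l)) *\<^sub>C fock_vec Q 0 k l) = (\<Sum>l<n. if k = l then cnj (\<alpha> $$ (i, l)) *\<^sub>C vacuum else 0)"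
    by (intro sum.cong refl) (simp add: fock_vec_0 [OF Q] 0)
  also have "\<dots> = (\<Sum>j<m. if j = i then cnj (\<alpha> $$ (j, k)) *\<^sub>C vacuum else 0)"
    using 0 ix by simp
  also have "\<dots> = (\<Sum>j<m. cnj (\<alpha> $$ (j, k)) *\<^sub>C fock_vec R 0 j i)"
    by (intro sum.cong refl) (simp add: fock_vec_0 [OF R] ix)
  finally show ?case .
next
  case (Suc p)
  note pt = pretensor_tensor_left
  let ?t = "\<lambda>r. cblinfun_apply (tensor_left r)"
  have "(\<Sum>l<n. cnj (\<alpha> $$ (i, l)) *\<^sub>C fock_vec Q (Suc p) k l)
      = (\<Sum>l<n. \<Sum>s<n. ?t (riesz_mat Q s k) (cnj (\<alpha> $$ (i, l)) *\<^sub>C fock_vec Q p s l))"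
    by (simp add: fock_vec_Suc [OF Q] Suc.prems cblinfun_scale sum_scaleC_right)
  also have "\<dots> = (\<Sum>s<n. \<Sum>l<n. ?t (riesz_mat Q s k) (cnj (\<alpha> $$ (i, l)) *\<^sub>C fock_vec Q p s l))"
    by (rule sum.swap)
  also have "\<dots> = (\<Sum>s<n. \<Sum>j<m. ?t (riesz_mat Q s k) (cnj (\<alpha> $$ (j, s)) *\<^sub>C fock_vec R p j i))"
    by (rule sum.cong [OF refl]) (simp add: Suc.IH flip: cblinfun_sum)
  also have "\<dots> = (\<Sum>j<m. \<Sum>s<n. ?t (riesz_mat Q s k) (cnj (\<alpha> $$ (j, s)) *\<^sub>C fock_vec R p j i))"
    by (rule sum.swap)
  also have "\<dots> = (\<Sum>j<m. ?t (\<Sum>s<n. cnj (\<alpha> $$ (j, s)) *\<^sub>C riesz_mat Q s k) (fock_vec R p j i))"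
    by (simp add: pretensor_sum_left [OF pt] pretensor_scale_left [OF pt] cblinfun_scale)
  also have "\<dots> = (\<Sum>j<m. ?t (\<Sum>c<m. cnj (\<alpha> $$ (c, k)) *\<^sub>C riesz_mat R j c) (fock_vec R p j i))"
    by (intro sum.cong refl) (simp add: riesz_mat_intertwine [OF Q R \<alpha> eq Suc.prems])
  also have "\<dots> = (\<Sum>j<m. \<Sum>c<m. cnj (\<alpha> $$ (c, k)) *\<^sub>C ?t (riesz_mat R j c) (fock_vec R p j i))"
    by (simp add: pretensor_sum_left [OF pt] pretensor_scale_left [OF pt])
  also have "\<dots> = (\<Sum>c<m. \<Sum>j<m. cnj (\<alpha> $$ (c, k)) *\<^sub>C ?t (riesz_mat R j c) (fock_vec R p j i))"
    by (rule sum.swap)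
  also have "\<dots> = (\<Sum>c<m. cnj (\<alpha> $$ (c, k)) *\<^sub>C fock_vec R (Suc p) c i)"
    by (simp add: fock_vec_Suc [OF R] ix sum_scaleC_right)
  finally show ?case .
qed

lemma kvec_intertwine:
  assumes Q: "strict_row_contraction n Q" and R: "strict_row_contraction m R" and \<alpha>: "\<alpha> \<in> carrier_mat m n"
    and eq: "\<alpha> \<bullet>\<^sub>l Q = R \<bullet>\<^sub>r \<alpha>" and ix: "k < n" "i < m"
  shows "(\<Sum>l<n. cnj (\<alpha> $$ (i, l)) *\<^sub>C kvec Q k l) = (\<Sum>j<m. cnj (\<alpha> $$ (j, k)) *\<^sub>C kvec R j i)"
proof -
  have Qc: "Q \<in> carrier_mat n n" and Rc: "R \<in> carrier_mat m m"
    using Q R by (auto simp: strict_row_contraction_def)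
  have nth: "l2_nth (Abs_l2 (\<lambda>p. fock_vec Q p i j)) = (\<lambda>p. fock_vec Q p i j)"
    if "strict_row_contraction n Q" "i < n" "j < n" for n i j and Q :: "('a \<Rightarrow>\<^sub>C\<^sub>L complex) mat"
    using fock_vec_summable [OF that] by (intro Abs_l2_inverse) simp
  have "(\<Sum>l<n. cnj (\<alpha> $$ (i, l)) *\<^sub>C Abs_l2 (\<lambda>p. fock_vec Q p k l))
      = (\<Sum>j<m. cnj (\<alpha> $$ (j, k)) *\<^sub>C Abs_l2 (\<lambda>p. fock_vec R p j i))"
    by (rule l2_eqI) (use ix in \<open>simp add: l2_nth_sum nth [OF Q] nth [OF R]
      fock_vec_intertwine [OF Qc Rc \<alpha> eq ix]\<close>)
  then have "coord (\<Sum>l<n. cnj (\<alpha> $$ (i, l)) *\<^sub>C Abs_l2 (\<lambda>p. fock_vec Q p k l))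
      = coord (\<Sum>j<m. cnj (\<alpha> $$ (j, k)) *\<^sub>C Abs_l2 (\<lambda>p. fock_vec R p j i))"
    by simp
  then show ?thesis
    by (simp only: coord_sum coord_scale kvec_def)
qed

unbundle cardinal_syntax

section \<open>Contractions and unitary operators with prescribed values\<close>

lemma lincomb_cinner: "lincomb (\<lambda>j. cinner (p j) z) cs = cinner (lincomb p cs) z"
  by (induction cs) (auto simp: cinner_add_left cinner_scaleC_left scaleC_complex_def)

lemma norm_lincomb_eq:
  assumes "\<And>i j. cinner (p i) (p j) = cinner (q i) (q j)"
  shows "norm (lincomb p cs) = norm (lincomb q cs)"
proof -
  have "cinner (lincomb p cs) (lincomb p cs) = cinner (lincomb q cs) (lincomb q cs)"
    unfolding lincomb_eq_sum cinner_sum_sum assms ..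
  then show ?thesis
    by (simp add: cinner_self power2_eq_iff_nonneg flip: of_real_power)
qed

text \<open>\<open>U\<close> is the adjoint of the partial isometry \<open>p j \<mapsto> q j\<close>.\<close>

lemma contraction_of_gram:
  fixes p :: "'j \<Rightarrow> 'a::chilbert_space" and q :: "'j \<Rightarrow> 'b::chilbert_space"
  assumes gram: "\<And>i j. cinner (p i) (p j) = cinner (q i) (q j)"
  obtains U :: "'b \<Rightarrow> 'a" where "bounded_clinear U" "contractive U"
    "\<And>z j. cinner (U z) (p j) = cinner z (q j)"
proof -
  \<comment> \<open>Choosing \<open>U z\<close> inside the closed span of the \<open>p j\<close>
    makes it unique and hence linear in \<open>z\<close>; the equality of the Gram matrices gives
    the norm bound.\<close>
  have "\<exists>\<xi>. \<xi> \<in> closure (range (lincomb p)) \<and> norm \<xi> \<le> norm z \<and> (\<forall>j. cinner (p j) \<xi> = cinner (q j) z)" for z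
  proof (rule moment_problem [of "norm z" "\<lambda>j. cinner (q j) z" p])
    show "cmod (lincomb (\<lambda>j. cinner (q j) z) cs) \<le> norm z * norm (lincomb p cs)" for cs
      unfolding lincomb_cinner norm_lincomb_eq [OF gram]
      using Cauchy_Schwarz_cinner [of "lincomb q cs" z] by (simp add: mult.commute)
  qed auto
  then obtain U where U: "\<And>z. U z \<in> closure (range (lincomb p))" "\<And>z. norm (U z) \<le> norm z"
    "\<And>z j. cinner (p j) (U z) = cinner (q j) z"
    by metis
  have "bounded_clinear U"
  proof (rule bounded_clinearI [where K = 1])
    fix x y c
    have "U (x + y) - (U x + U y) = 0"
      by (rule closure_span_unique [of _ p])
        (intro closure_span_diff closure_span_add U, simp add: cinner_diff_right cinner_add_right U)
    then show "U (x + y) = U x + U y" by simp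
    have "U (c *\<^sub>C x) - c *\<^sub>C U x = 0"
      by (rule closure_span_unique [of _ p])
        (intro closure_span_diff closure_span_scale [OF _ U(1)] U, simp add: cinner_diff_right cinner_scaleC_right U)
    then show "U (c *\<^sub>C x) = c *\<^sub>C U x" by simp
  qed (simp add: U)
  moreover have "cinner (U z) (p j) = cinner z (q j)" for z j
    using U(3) [of j z] by (metis cinner_commute)
  ultimately show thesis
    using that U(2) by (auto simp: contractive_def)
qed

lemma colligation_exists:
  fixes U :: "'x::chilbert_space \<times> 'u::chilbert_space \<Rightarrow> 't::chilbert_space \<times> 'y::chilbert_space"
  assumes "bounded_clinear U"
  obtains A B C D where "U = colligation A B C D"
proof -
  define V where "V = CBlinfun U"
  have V: "cblinfun_apply V = U"
    by (simp add: V_def CBlinfun_apply [OF assms])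
  obtain K where K: "K \<ge> 0" "\<And>z. norm (V z) \<le> K * norm z"
    using cblinfun_bound by blast
  have 1: "bounded_clinear (\<lambda>x. fst (V (x, 0)))" "bounded_clinear (\<lambda>x. snd (V (x, 0)))"
    "bounded_clinear (\<lambda>u. fst (V (0, u)))" "bounded_clinear (\<lambda>u. snd (V (0, u)))"
  proof -
    have add: "V (x + x', 0) = V (x, 0) + V (x', 0)" "V (0, u + u') = V (0, u) + V (0, u')"
      and scale: "V (c *\<^sub>C x, 0) = c *\<^sub>C V (x, 0)" "V (0, c *\<^sub>C u) = c *\<^sub>C V (0, u)" for x x' u u' c
      using cblinfun_add [of V "(x, 0)" "(x', 0)"] cblinfun_add [of V "(0, u)" "(0, u')"]
        cblinfun_scale [of V c "(x, 0)"] cblinfun_scale [of V c "(0, u)"]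
      by (simp_all add: scaleC_prod_def)
    have bnd: "norm (V (x, 0)) \<le> K * norm x" "norm (V (0, u)) \<le> K * norm u" for x u
      using K(2) [of "(x, 0)"] K(2) [of "(0, u)"] by (simp_all add: norm_Pair)
    have le: "norm (fst w) \<le> norm w" "norm (snd w) \<le> norm w" for w :: "'t \<times> 'y"
      by (cases w, simp add: norm_fst_le norm_snd_le)+
    show "bounded_clinear (\<lambda>x. fst (V (x, 0)))" "bounded_clinear (\<lambda>x. snd (V (x, 0)))"
      "bounded_clinear (\<lambda>u. fst (V (0, u)))" "bounded_clinear (\<lambda>u. snd (V (0, u)))"
      by (rule bounded_clinearI [where K = K];
          use le bnd order_trans in \<open>(simp add: add scale scaleC_prod_def | blast)\<close>)+
  qed
  have "U = colligation (CBlinfun (\<lambda>x. fst (V (x, 0)))) (CBlinfun (\<lambda>u. fst (V (0, u))))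
     (CBlinfun (\<lambda>x. snd (V (x, 0)))) (CBlinfun (\<lambda>u. snd (V (0, u))))"
  proof (rule ext, clarify)
    fix x u
    have "V (x, u) = V (x, 0) + V (0, u)"
      by (simp flip: cblinfun_add)
    then show "U (x, u) = colligation (CBlinfun (\<lambda>x. fst (V (x, 0)))) (CBlinfun (\<lambda>u. fst (V (0, u))))
     (CBlinfun (\<lambda>x. snd (V (x, 0)))) (CBlinfun (\<lambda>u. snd (V (0, u)))) (x, u)"
      by (simp add: colligation_def CBlinfun_apply 1 [unfolded V] V prod_eq_iff)
  qed
  then show thesis by (rule that)
qed

section \<open>Orthonormal sets: Bessel's inequality, extension and cardinality\<close>

definition orthonormal :: "'h::chilbert_space set \<Rightarrow> bool" where
  "orthonormal B \<longleftrightarrow> (\<forall>x\<in>B. \<forall>y\<in>B. cinner x y = (if x = y then 1 else 0))"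

lemma orthonormal_Bessel:
  assumes B: "orthonormal B" and F: "finite F" "F \<subseteq> B"
  shows "(\<Sum>b\<in>F. (cmod (cinner x b))\<^sup>2) \<le> (norm x)\<^sup>2"
proof -
  let ?y = "\<Sum>b\<in>F. cinner x b *\<^sub>C b"
  let ?s = "\<Sum>b\<in>F. (cmod (cinner x b))\<^sup>2"
  have sq: "cnj (cinner x b) * cinner x b = of_real ((cmod (cinner x b))\<^sup>2)" for b
    by (metis complex_norm_square mult.commute)
  have xy: "cinner x ?y = of_real ?s"
    by (simp add: cinner_sum_right cinner_scaleC_right sq del: of_real_power)
  have "cinner ?y ?y = (\<Sum>b\<in>F. \<Sum>c\<in>F. if b = c then cnj (cinner x b) * cinner x b else 0)"
    unfolding cinner_sum_sum using B F(2)
    by (intro sum.cong refl) (auto simp: orthonormal_def subset_iff)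
  also have "\<dots> = of_real ?s"
    using F(1) by (simp add: sq del: of_real_power)
  finally have yy: "cinner ?y ?y = of_real ?s" .
  have "cinner (x - ?y) (x - ?y) = cinner x x - cinner x ?y - cnj (cinner x ?y) + cinner ?y ?y"
    by (simp add: cinner_diff_left cinner_diff_right flip: cinner_commute)
  then have "complex_of_real ((norm (x - ?y))\<^sup>2) = of_real ((norm x)\<^sup>2 - ?s)"
    unfolding xy yy by (simp add: cinner_self)
  then have "(norm (x - ?y))\<^sup>2 = (norm x)\<^sup>2 - ?s"
    using of_real_eq_iff by blast
  then show ?thesis
    using zero_le_power2 [of "norm (x - ?y)"] by linarith
qed

text \<open>By Bessel's inequality only finitely many coefficients have square at least 1 / (n + 1);
  the set is the union of these finite sets over \<open>n\<close>.\<close>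

lemma orthonormal_countable:
  assumes B: "orthonormal B"
  shows "countable {b \<in> B. cinner x b \<noteq> 0}"
proof -
  have "finite {b \<in> B. (cmod (cinner x b))\<^sup>2 \<ge> 1 / Suc n}" (is "finite ?C") for n
  proof (rule ccontr)
    assume inf: "infinite ?C"
    obtain k :: nat where k: "real k > Suc n * (norm x)\<^sup>2"
      using reals_Archimedean2 by blast
    obtain F where F: "finite F" "card F = k" "F \<subseteq> ?C"
      using infinite_arbitrarily_large [OF inf] by blast
    have "real k * (1 / Suc n) = (\<Sum>b\<in>F. 1 / Suc n)"
      by (simp add: F)
    also have "\<dots> \<le> (\<Sum>b\<in>F. (cmod (cinner x b))\<^sup>2)"
      using F by (intro sum_mono) auto
    also have "\<dots> \<le> (norm x)\<^sup>2"
      by (rule orthonormal_Bessel [OF B F(1)]) (use F in auto)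
    finally show False
      using k by (simp add: field_simps)
  qed
  moreover have "{b \<in> B. cinner x b \<noteq> 0} \<subseteq> (\<Union>n. {b \<in> B. (cmod (cinner x b))\<^sup>2 \<ge> 1 / Suc n})"
  proof
    fix b assume "b \<in> {b \<in> B. cinner x b \<noteq> 0}"
    then obtain n where "inverse (real (Suc n)) < (cmod (cinner x b))\<^sup>2" "b \<in> B"
      using reals_Archimedean [of "(cmod (cinner x b))\<^sup>2"] by auto
    then have "b \<in> {b \<in> B. (cmod (cinner x b))\<^sup>2 \<ge> 1 / Suc n}"
      by (simp add: inverse_eq_divide)
    then show "b \<in> (\<Union>n. {b \<in> B. (cmod (cinner x b))\<^sup>2 \<ge> 1 / Suc n})"
      by blast
  qed
  ultimately show ?thesis
    by (meson countable_UN countable_finite countable_subset uncountable_def countableI_type)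
qed

text \<open>Zorn's lemma: \<open>B\<close> is an orthonormal basis of the orthogonal complement of
  the \<open>p j\<close> that extends \<open>E\<close>. A large \<open>E\<close> inside the
  complement thus forces a large basis.\<close>

lemma maximal_orthonormal:
  fixes p :: "'j \<Rightarrow> 'h::chilbert_space"
  assumes E: "orthonormal E" "\<And>b j. b \<in> E \<Longrightarrow> cinner b (p j) = 0"
  obtains B where "E \<subseteq> B" "orthonormal B" "\<And>b j. b \<in> B \<Longrightarrow> cinner b (p j) = 0"
    "\<And>z. (\<And>j. cinner z (p j) = 0) \<Longrightarrow> (\<And>b. b \<in> B \<Longrightarrow> cinner z b = 0) \<Longrightarrow> z = 0"
proof -
  define \<O> where "\<O> = {B. E \<subseteq> B \<and> orthonormal B \<and> (\<forall>b\<in>B. \<forall>j. cinner b (p j) = 0)}"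
  have "\<exists>M\<in>\<O>. \<forall>X\<in>\<O>. M \<subseteq> X \<longrightarrow> X = M"
  proof (rule subset_Zorn_nonempty)
    show "\<O> \<noteq> {}"
      using E by (auto simp: \<O>_def)
    fix \<C> assume C: "\<C> \<noteq> {}" "subset.chain \<O> \<C>"
    have sub: "X \<in> \<O>" if "X \<in> \<C>" for X
      using C(2) that by (auto simp: subset.chain_def)
    have "orthonormal (\<Union>\<C>)"
      unfolding orthonormal_def
    proof (intro ballI)
      fix x y assume "x \<in> \<Union>\<C>" "y \<in> \<Union>\<C>"
      then obtain X Y where XY: "X \<in> \<C>" "Y \<in> \<C>" "x \<in> X" "y \<in> Y"
        by blast
      then have "X \<subseteq> Y \<or> Y \<subseteq> X"
        using C by (auto simp: subset.chain_def)
      then obtain Z where "Z \<in> \<C>" "x \<in> Z" "y \<in> Z"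
        using XY by blast
      then show "cinner x y = (if x = y then 1 else 0)"
        using sub [of Z] by (simp add: \<O>_def orthonormal_def)
    qed
    moreover have "\<forall>b\<in>\<Union>\<C>. \<forall>j. cinner b (p j) = 0"
      using sub by (auto simp: \<O>_def)
    moreover have "E \<subseteq> \<Union>\<C>"
    proof -
      obtain X where "X \<in> \<C>"
        using C(1) by blast
      then show ?thesis
        using sub [of X] by (auto simp: \<O>_def)
    qed
    ultimately show "\<Union>\<C> \<in> \<O>"
      by (simp add: \<O>_def)
  qed
  then obtain B where B: "B \<in> \<O>" and max: "\<And>X. X \<in> \<O> \<Longrightarrow> B \<subseteq> X \<Longrightarrow> X = B"
    by blast
  have "z = 0" if z: "\<And>j. cinner z (p j) = 0" "\<And>b. b \<in> B \<Longrightarrow> cinner z b = 0" for z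
  proof (rule ccontr)
    assume "z \<noteq> 0"
    define u where "u = complex_of_real (1 / norm z) *\<^sub>C z"
    have "norm u = 1"
      using \<open>z \<noteq> 0\<close> by (simp add: u_def norm_scaleC norm_divide)
    then have uu: "cinner u u = 1"
      by (simp add: cinner_self)
    have ub: "cinner u b = 0" if "b \<in> B" for b
      using z that by (simp add: u_def cinner_scaleC_left)
    then have bu: "cinner b u = 0" if "b \<in> B" for b
      using that by (metis cinner_commute complex_cnj_zero)
    have "u \<notin> B"
      using ub [of u] uu by auto
    then have "insert u B \<in> \<O>"
      using B ub bu uu z by (auto simp: \<O>_def orthonormal_def u_def cinner_scaleC_left)
    then show False
      using max [of "insert u B"] \<open>u \<notin> B\<close> by blast
  qed
  with B show thesis
    by (intro that [of B]) (auto simp: \<O>_def)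
qed

text \<open>Each \<open>d i\<close> has a nonzero inner product with only countably many members of
  \<open>B\<close>, and every member is met by some \<open>d i\<close> because the family is
  total.\<close>

lemma orthonormal_card_le:
  fixes d :: "'d \<Rightarrow> 'h::chilbert_space" and B :: "'h set"
  assumes B: "orthonormal B" and d: "\<And>z. (\<And>i. cinner (d i) z = 0) \<Longrightarrow> z = 0"
    and le: "|UNIV :: 'd set| \<le>o |UNIV :: 'i set|" and inf: "infinite (UNIV :: 'i set)"
  shows "|B| \<le>o |UNIV :: 'i set|"
proof -
  define C where "C i = {b \<in> B. cinner (d i) b \<noteq> 0}" for i
  have "|C i| \<le>o |UNIV :: 'i set|" for i
  proof -
    have "countable (C i)"
      unfolding C_def by (rule orthonormal_countable [OF B])
    then have "|C i| \<le>o |UNIV :: nat set|"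
      unfolding card_of_ordLeq [symmetric] countable_def by auto
    moreover have "|UNIV :: nat set| \<le>o |UNIV :: 'i set|"
      using inf infinite_iff_card_of_nat by blast
    ultimately show ?thesis
      by (rule ordLeq_transitive)
  qed
  then have "|\<Union>i. C i| \<le>o |UNIV :: 'i set|"
    by (intro card_of_UNION_ordLeq_infinite [OF inf le] ballI)
  moreover have "B \<subseteq> (\<Union>i. C i)"
  proof
    fix b assume b: "b \<in> B"
    then have "b \<noteq> 0"
      using B by (force simp: orthonormal_def)
    then obtain i where "cinner (d i) b \<noteq> 0"
      using d by blast
    with b show "b \<in> (\<Union>i. C i)"
      by (auto simp: C_def)
  qed
  ultimately show ?thesis
    using card_of_mono1 ordLeq_transitive by blast
qed

text \<open>An isometry between closed spans extends to a unitary operator when the complements have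
  equal dimension. Both complements receive bases of cardinality exactly that of the type
  \<open>'i\<close>: at least, since they contain the families \<open>e\<close> and
  \<open>f\<close>; at most, by the total families \<open>d\<close> and \<open>d'\<close>.\<close>

lemma unitary_of_gram:
  fixes p :: "'j \<Rightarrow> 'a::chilbert_space" and q :: "'j \<Rightarrow> 'b::chilbert_space"
    and e :: "'i \<Rightarrow> 'a" and f :: "'i \<Rightarrow> 'b" and d :: "'d \<Rightarrow> 'a" and d' :: "'e \<Rightarrow> 'b"
  assumes gram: "\<And>i j. cinner (p i) (p j) = cinner (q i) (q j)"
    and inf: "infinite (UNIV :: 'i set)"
    and e: "\<And>i j. cinner (e i) (e j) = (if i = j then 1 else 0)" "\<And>i j. cinner (e i) (p j) = 0"
    and f: "\<And>i j. cinner (f i) (f j) = (if i = j then 1 else 0)" "\<And>i j. cinner (f i) (q j) = 0"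
    and d: "\<And>z. (\<And>i. cinner (d i) z = 0) \<Longrightarrow> z = 0" "|UNIV :: 'd set| \<le>o |UNIV :: 'i set|"
    and d': "\<And>z. (\<And>i. cinner (d' i) z = 0) \<Longrightarrow> z = 0" "|UNIV :: 'e set| \<le>o |UNIV :: 'i set|"
  obtains U :: "'b \<Rightarrow> 'a" where "bounded_clinear U" "unitary U"
    "\<And>z j. cinner (U z) (p j) = cinner z (q j)"
proof -
  have e_range: "orthonormal (range e)" "inj e"
    using e(1) by (auto simp: orthonormal_def inj_def) (metis zero_neq_one)+
  have f_range: "orthonormal (range f)" "inj f"
    using f(1) by (auto simp: orthonormal_def inj_def) (metis zero_neq_one)+
  obtain B1 where B1: "range e \<subseteq> B1" "orthonormal B1" "\<And>b j. b \<in> B1 \<Longrightarrow> cinner b (p j) = 0"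
    "\<And>z. (\<And>j. cinner z (p j) = 0) \<Longrightarrow> (\<And>b. b \<in> B1 \<Longrightarrow> cinner z b = 0) \<Longrightarrow> z = 0"
    by (rule maximal_orthonormal [OF e_range(1), of p]) (use e in auto)
  obtain B2 where B2: "range f \<subseteq> B2" "orthonormal B2" "\<And>b j. b \<in> B2 \<Longrightarrow> cinner b (q j) = 0"
    "\<And>z. (\<And>j. cinner z (q j) = 0) \<Longrightarrow> (\<And>b. b \<in> B2 \<Longrightarrow> cinner z b = 0) \<Longrightarrow> z = 0"
    by (rule maximal_orthonormal [OF f_range(1), of q]) (use f in auto)
  have "|UNIV :: 'i set| \<le>o |B1|" "|UNIV :: 'i set| \<le>o |B2|"
    using e_range(2) B1(1) f_range(2) B2(1) card_of_ordLeq by blast+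
  moreover have "|B1| \<le>o |UNIV :: 'i set|"
    using orthonormal_card_le [of B1 d] B1(2) d inf by blast
  moreover have "|B2| \<le>o |UNIV :: 'i set|"
    using orthonormal_card_le [of B2 d'] B2(2) d' inf by blast
  ultimately have "|B2| =o |B1|"
    by (meson ordIso_iff_ordLeq ordLeq_transitive)
  then obtain h where h: "bij_betw h B2 B1"
    using card_of_ordIso by blast
  \<comment> \<open>The isometry is completed by a bijection of the two bases. The second index runs
    over the whole type \<open>'b\<close>, so indices outside \<open>B2\<close> are sent to 0 in
    both families.\<close>
  define P where "P = case_sum p (\<lambda>b. if b \<in> B2 then h b else 0)"
  define R where "R = case_sum q (\<lambda>b. if b \<in> B2 then b else 0)"
  have hB: "h b \<in> B1" if "b \<in> B2" for b
    using h that by (auto simp: bij_betw_def)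
  have sym: "cinner (p j) b = 0" if "b \<in> B1" for b j
    using B1(3) [OF that, of j] by (metis cinner_commute complex_cnj_zero)
  have sym': "cinner (q j) b = 0" if "b \<in> B2" for b j
    using B2(3) [OF that, of j] by (metis cinner_commute complex_cnj_zero)
  have gram': "cinner (P i) (P j) = cinner (R i) (R j)" for i j
  proof -
    have "cinner (h b) (h c) = cinner b c" if "b \<in> B2" "c \<in> B2" for b c
      using B1(2) B2(2) that hB h by (auto simp: orthonormal_def bij_betw_def inj_on_def)
    then show ?thesis
      by (cases i; cases j) (auto simp: P_def R_def gram B1(3) B2(3) sym sym' hB)
  qed
  have totP: "z = 0" if "\<And>j. cinner z (P j) = 0" for z
  proof (rule B1(4))
    show "cinner z (p j) = 0" for j
      using that [of "Inl j"] by (simp add: P_def)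
    fix b assume "b \<in> B1"
    then obtain c where "c \<in> B2" "b = h c"
      using h by (auto simp: bij_betw_def)
    then show "cinner z b = 0"
      using that [of "Inr c"] by (simp add: P_def)
  qed
  have totR: "z = 0" if "\<And>j. cinner z (R j) = 0" for z
  proof (rule B2(4))
    show "cinner z (q j) = 0" for j
      using that [of "Inl j"] by (simp add: R_def)
    show "cinner z b = 0" if "b \<in> B2" for b
      using that \<open>\<And>j. cinner z (R j) = 0\<close> [of "Inr b"] by (simp add: R_def)
  qed
  obtain U where U: "bounded_clinear U" "\<And>z j. cinner (U z) (P j) = cinner z (R j)"
    by (rule contraction_of_gram [of P R, OF gram']) blast
  \<comment> \<open>The same construction in the other direction gives a right inverse of
    \<open>U\<close>, as \<open>P\<close> is total.\<close>
  obtain U' where U': "bounded_clinear U'" "\<And>z j. cinner (U' z) (R j) = cinner z (P j)"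
    by (rule contraction_of_gram [of R P, OF gram' [symmetric]]) blast
  have "U (U' w) - w = 0" for w
    by (rule totP) (simp add: cinner_diff_left U U')
  then have UU': "U (U' w) = w" for w
    by simp
  have UR: "U (R j) = P j" for j
  proof -
    have "U (R j) - P j = 0"
      by (rule totP) (simp add: cinner_diff_left U gram')
    then show ?thesis by simp
  qed
  define V where "V = CBlinfun U"
  have V: "cblinfun_apply V = U"
    by (simp add: V_def CBlinfun_apply U)
  \<comment> \<open>U^* U = I is tested on the total family \<open>R\<close>: \<langle>U^* U z, R
    j\<rangle> = \<langle>U z, P j\<rangle> = \<langle>z, R j\<rangle>.\<close>
  have "cadjoint V (U z) - z = 0" for z
    by (rule totR) (simp add: cinner_diff_left cinner_cadjoint_left V UR U)
  then have "cinner (U z) (U w) = cinner z w" for z w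
    using cinner_cadjoint_left [of V "U z" w] by (simp add: V)
  then have "unitary U"
    unfolding unitary_def using UU' by (metis surjI)
  moreover have "cinner (U z) (p j) = cinner z (q j)" for z j
    using U(2) [of z "Inl j"] by (simp add: P_def R_def)
  ultimately show thesis
    using that U(1) by blast
qed

lemma unitary_contractive: "unitary U \<Longrightarrow> contractive U"
proof -
  assume U: "unitary U"
  have "norm (U z) \<le> norm z" for z
  proof -
    have "complex_of_real ((norm (U z))\<^sup>2) = of_real ((norm z)\<^sup>2)"
      using U unfolding unitary_def cinner_self [symmetric] by blast
    then have "(norm (U z))\<^sup>2 = (norm z)\<^sup>2"
      using of_real_eq_iff by blast
    then show ?thesis
      by (simp add: power2_eq_iff_nonneg)
  qed
  then show ?thesis
    by (simp add: contractive_def)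
qed

section \<open>From a completely positive kernel to a realization\<close>

text \<open>The equation a S = b is checked in adjoint form, row by row: for y i = a(j, i)^* e the
  hypothesis identifies the second component of U^* as b(j, i)^* e, and
  \<open>transfer_function_adjoint\<close> turns this into S^* a^* e = b^* e.\<close>

lemma realization_solves:
  fixes t :: "'r::chilbert_space \<Rightarrow> 'x::chilbert_space \<Rightarrow> 't::chilbert_space"
    and A :: "'x \<Rightarrow>\<^sub>C\<^sub>L 't" and B :: "'u::chilbert_space \<Rightarrow>\<^sub>C\<^sub>L 't"
    and C :: "'x \<Rightarrow>\<^sub>C\<^sub>L 'y::chilbert_space" and D :: "'u \<Rightarrow>\<^sub>C\<^sub>L 'y"
    and a :: "('y \<Rightarrow>\<^sub>C\<^sub>L 'e::chilbert_space) mat" and b :: "('u \<Rightarrow>\<^sub>C\<^sub>L 'e) mat"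
  assumes t: "hilbert_tensor t" and A: "\<And>x. norm (A x) \<le> norm x" and Q: "strict_row_contraction n Q"
    and ab: "a \<in> carrier_mat n n" "b \<in> carrier_mat n n"
    and x: "\<And>j e i z w. j < n \<Longrightarrow> i < n \<Longrightarrow>
      cinner (colligation A B C D (z, w)) (\<Sum>l<n. t (riesz_mat Q l i) (x j e l), cadjoint (a $$ (j, i)) e)
        = cinner (z, w) (x j e i, cadjoint (b $$ (j, i)) e)"
  shows "a \<odot> transfer_function t A B C D Q = b"
proof (rule eq_matI)
  note S = transfer_function_apply(1) [OF t A Q, of B C D]
  show "dim_row (a \<odot> transfer_function t A B C D Q) = dim_row b"
    "dim_col (a \<odot> transfer_function t A B C D Q) = dim_col b"
    using S ab by auto
  fix j k assume "j < dim_row b" "k < dim_col b"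
  then have jk: "j < n" "k < n"
    using ab by auto
  have "((a \<odot> transfer_function t A B C D Q) $$ (j, k)) v = (b $$ (j, k)) v" for v
  proof (rule cinner_eqI)
    fix e
    let ?v = "\<lambda>m. if m = k then v else 0"
    have v: "(\<Sum>m<n. (T m) (?v m)) = T k v" for T :: "nat \<Rightarrow> 'u \<Rightarrow>\<^sub>C\<^sub>L 'y"
    proof -
      have "(\<Sum>m<n. (T m) (?v m)) = (\<Sum>m<n. if m = k then T m v else 0)"
        by (intro sum.cong refl) (simp add: cblinfun_zero)
      then show ?thesis using jk by simp
    qed
    have "cinner (((a \<odot> transfer_function t A B C D Q) $$ (j, k)) v) e
        = (\<Sum>i<n. cinner (\<Sum>m<n. (transfer_function t A B C D Q $$ (i, m)) (?v m)) (cadjoint (a $$ (j, i)) e))"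
      using S ab jk by (simp add: index_op_times cinner_sum_left cinner_cadjoint v)
    also have "\<dots> = (\<Sum>i<n. cinner (?v i) (cadjoint (b $$ (j, i)) e))"
      by (rule transfer_function_adjoint [OF t A Q]) (rule x [OF jk(1)])
    also have "\<dots> = (\<Sum>i<n. if i = k then cinner v (cadjoint (b $$ (j, i)) e) else 0)"
      by (intro sum.cong refl) simp
    also have "\<dots> = cinner ((b $$ (j, k)) v) e"
      using jk by (simp add: cinner_cadjoint)
    finally show "cinner (((a \<odot> transfer_function t A B C D Q) $$ (j, k)) v) e = cinner ((b $$ (j, k)) v) e" .
  qed
  then show "(a \<odot> transfer_function t A B C D Q) $$ (j, k) = b $$ (j, k)"
    by (rule cblinfun_eqI)
qed

section \<open>Quadratic forms of the kernel and positivity on matrix units\<close>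

lemma cinner_sandwich:
  assumes A: "A \<in> carrier_mat n n'" and K: "K \<in> carrier_mat n' m'" and B: "B \<in> carrier_mat m m'"
    and ix: "l < n" "j < m"
  shows "cinner (((A \<odot> mat_tensor_id K \<odot> op_adjoint B) $$ (l, j)) e) f
    = (\<Sum>p<n'. \<Sum>q<m'. K $$ (p, q) * cinner (cadjoint (B $$ (j, q)) e) (cadjoint (A $$ (l, p)) f))"
proof -
  have "cinner (((A \<odot> mat_tensor_id K \<odot> op_adjoint B) $$ (l, j)) e) f
    = (\<Sum>q<m'. \<Sum>p<n'. K $$ (p, q) * cinner (cadjoint (B $$ (j, q)) e) (cadjoint (A $$ (l, p)) f))"
    using assms by (simp add: index_op_times cblinfun_scale cinner_sum_left cinner_scaleC_left cinner_cadjoint)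
  also have "\<dots> = (\<Sum>p<n'. \<Sum>q<m'. K $$ (p, q) * cinner (cadjoint (B $$ (j, q)) e) (cadjoint (A $$ (l, p)) f))"
    by (rule sum.swap)
  finally show ?thesis .
qed

lemma dBR_kernel_carrier:
  assumes "a Z \<in> carrier_mat n n" "b Z \<in> carrier_mat n n" "a W \<in> carrier_mat m m" "b W \<in> carrier_mat m m"
  shows "dBR_kernel Q\<^sub>0 a b Z W P \<in> carrier_mat n m"
  using assms by (auto simp: dBR_kernel_def)

lemma dBR_kernel_form:
  assumes Z: "dim_row Z = n" "a Z \<in> carrier_mat n n" "b Z \<in> carrier_mat n n"
    and W: "dim_row W = m" "a W \<in> carrier_mat m m" "b W \<in> carrier_mat m m"
    and ix: "l < n" "j < m"
  shows "cinner ((dBR_kernel Q\<^sub>0 a b Z W P $$ (l, j)) e) f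
    = (\<Sum>p<n. \<Sum>q<m. k_kernel Q\<^sub>0 Z W P $$ (p, q)
        * (cinner (cadjoint (a W $$ (j, q)) e) (cadjoint (a Z $$ (l, p)) f)
           - cinner (cadjoint (b W $$ (j, q)) e) (cadjoint (b Z $$ (l, p)) f)))"
proof -
  have k: "k_kernel Q\<^sub>0 Z W P \<in> carrier_mat n m"
    using Z W by (simp add: k_kernel_def)
  show ?thesis
    unfolding dBR_kernel_def
    using Z W ix cinner_sandwich [OF Z(2) k W(2) ix, of e f] cinner_sandwich [OF Z(3) k W(3) ix, of e f]
    by (simp add: cinner_diff_left right_diff_distrib sum_subtractf)
qed

text \<open>Matrix units. On these the value of k consists of plain inner products of kernel
  vectors, and they label the Gram kernel that is factored below.\<close>

definition elem_mat :: "nat \<Rightarrow> nat \<Rightarrow> nat \<Rightarrow> nat \<Rightarrow> complex mat" where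
  "elem_mat n m k i = mat n m (\<lambda>(p, q). if p = k \<and> q = i then 1 else 0)"

lemma elem_mat_carrier [simp]: "elem_mat n m k i \<in> carrier_mat n m"
  by (simp add: elem_mat_def)

lemma sum_elem_mat:
  fixes f :: "nat \<Rightarrow> nat \<Rightarrow> complex"
  assumes "k < n" "i < m"
  shows "(\<Sum>p<n. \<Sum>q<m. elem_mat n m k i $$ (p, q) * f p q) = f k i"
proof -
  have "(\<Sum>p<n. \<Sum>q<m. elem_mat n m k i $$ (p, q) * f p q)
      = (\<Sum>p<n. \<Sum>q<m. if p = k then if q = i then f p q else 0 else 0)"
    by (intro sum.cong refl) (simp add: elem_mat_def)
  then show ?thesis
    using sum_delta2 [OF assms, of f] by simp
qed

lemma k_kernel_elem_mat:
  assumes "strict_row_contraction n (Q\<^sub>0 Z)" "dim_row Z = n" "strict_row_contraction m (Q\<^sub>0 W)" "dim_row W = m"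
    and "k < n" "i < m" "p < n" "q < m"
  shows "k_kernel Q\<^sub>0 Z W (elem_mat n m k i) $$ (p, q) = cinner (kvec (Q\<^sub>0 W) i q) (kvec (Q\<^sub>0 Z) k p)"
  by (subst k_kernel_index [OF assms(1-4) elem_mat_carrier]) (simp_all add: assms sum_elem_mat)

text \<open>The Gram construction runs over a whole type, while the kernel is positive over
  admissible indices; extension by 0 amounts to dropping the other points from each sum.\<close>

lemma psd_kernel_extend:
  assumes psd: "\<And>n (c :: nat \<Rightarrow> complex) j. (\<And>s. s < n \<Longrightarrow> j s \<in> S) \<Longrightarrow>
    0 \<le> (\<Sum>s<n. \<Sum>t<n. c s * cnj (c t) * \<kappa> (j s) (j t))"
  shows "psd_kernel (\<lambda>x y. if x \<in> S \<and> y \<in> S then \<kappa> x y else 0)"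
  unfolding psd_kernel_def
proof (intro allI)
  fix n :: nat and c :: "nat \<Rightarrow> complex" and j :: "nat \<Rightarrow> 'a"
  define I where "I = {s \<in> {..<n}. j s \<in> S}"
  have fin: "finite I" by (simp add: I_def)
  obtain h where h: "bij_betw h {..<card I} I"
    using ex_bij_betw_nat_finite [OF fin] by (auto simp: atLeast0LessThan)
  have restr: "(\<Sum>s<n. if j s \<in> S then g s else 0) = (\<Sum>s\<in>I. g s)" for g :: "nat \<Rightarrow> complex"
    unfolding I_def by (rule sum.mono_neutral_cong_right) auto
  have "(\<Sum>s<n. \<Sum>t<n. c s * cnj (c t) * (if j s \<in> S \<and> j t \<in> S then \<kappa> (j s) (j t) else 0))
      = (\<Sum>s<n. if j s \<in> S then (\<Sum>t<n. if j t \<in> S then c s * cnj (c t) * \<kappa> (j s) (j t) else 0) else 0)"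
    by (intro sum.cong refl) (auto intro!: sum.cong)
  also have "\<dots> = (\<Sum>s\<in>I. \<Sum>t\<in>I. c s * cnj (c t) * \<kappa> (j s) (j t))"
    by (simp add: restr)
  also have "\<dots> = (\<Sum>s<card I. \<Sum>t<card I. c (h s) * cnj (c (h t)) * \<kappa> (j (h s)) (j (h t)))"
    by (simp add: sum.reindex_bij_betw [OF h, symmetric])
  also have "0 \<le> \<dots>"
    by (rule psd [of "card I" "\<lambda>s. j (h s)" "\<lambda>s. c (h s)"]) (use h in \<open>auto simp: bij_betw_def I_def\<close>)
  finally show "0 \<le> (\<Sum>s<n. \<Sum>t<n. c s * cnj (c t) * (if j s \<in> S \<and> j t \<in> S then \<kappa> (j s) (j t) else 0))" .
qed

lemma cinner_if_right: "cinner x (if b then y else 0) = (if b then cinner x y else 0)"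
  by simp

lemma vec_cinner_op_apply_single:
  assumes "M \<in> carrier_mat n m" "l < n" "j < m"
  shows "vec_cinner (op_apply M (vec m (\<lambda>q. if q = j then x else 0))) (vec n (\<lambda>p. if p = l then y else 0))
    = cinner ((M $$ (l, j)) x) y"
proof -
  have "vec_cinner (op_apply M (vec m (\<lambda>q. if q = j then x else 0))) (vec n (\<lambda>p. if p = l then y else 0))
      = (\<Sum>p<n. if p = l then cinner ((M $$ (p, j)) x) y else 0)"
    using assms by (simp add: vec_cinner_def cinner_if_right if_distrib [of "\<lambda>f. f _"] cong: if_cong)
  then show ?thesis
    using assms by simp
qed

text \<open>The matrix units with row \<open>i s\<close> and column \<open>i t\<close> are the
  blocks of a rank-one positive matrix, formed from the stacked unit vectors, so complete positivity
  applies. Test vectors supported at coordinate \<open>j s\<close> isolate the required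
  entries.\<close>

lemma cp_nc_kernel_psd:
  fixes K :: "('v::complex_vector, 'e::chilbert_space) nc_kern" and n :: nat
  assumes cp: "cp_nc_kernel \<Omega> K"
    and s: "\<And>s. s < n \<Longrightarrow> W s \<in> \<Omega>" "\<And>s. s < n \<Longrightarrow> i s < dim_row (W s)" "\<And>s. s < n \<Longrightarrow> j s < dim_row (W s)"
  shows "0 \<le> (\<Sum>s<n. \<Sum>t<n. c s * cnj (c t) * cinner ((K (W t) (W s)
    (elem_mat (dim_row (W t)) (dim_row (W s)) (i t) (i s)) $$ (j t, j s)) (e s)) (e t))"
proof -
  define P where "P s t = elem_mat (dim_row (W s)) (dim_row (W t)) (i s) (i t)" for s t
  have "block_psd n (\<lambda>s. dim_row (W s)) (\<lambda>s t. mat_tensor_id (P s t) :: (complex \<Rightarrow>\<^sub>C\<^sub>L complex) mat)"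
    unfolding block_psd_def
  proof (intro conjI allI impI)
    show "mat_tensor_id (P s t) \<in> carrier_mat (dim_row (W s)) (dim_row (W t))" for s t
      by (auto simp: P_def elem_mat_def)
    fix x :: "nat \<Rightarrow> complex vec"
    assume x: "\<forall>s<n. x s \<in> carrier_vec (dim_row (W s))"
    have "vec_cinner (op_apply (mat_tensor_id (P s t)) (x t)) (x s) = (x t $ i t) * cnj (x s $ i s)"
      if "s < n" "t < n" for s t
    proof -
      have "vec_cinner (op_apply (mat_tensor_id (P s t)) (x t)) (x s)
          = (\<Sum>p<dim_row (W s). \<Sum>q<dim_row (W t). P s t $$ (p, q) * ((x t $ q) * cnj (x s $ p)))"
        using x that by (simp add: vec_cinner_def P_def elem_mat_def scaleC_complex_def cinner_complex_def
          sum_distrib_right mult.assoc)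
      then show ?thesis
        unfolding P_def by (subst (asm) sum_elem_mat) (use s that in auto)
    qed
    then have "(\<Sum>s<n. \<Sum>t<n. vec_cinner (op_apply (mat_tensor_id (P s t)) (x t)) (x s))
        = (\<Sum>s<n. \<Sum>t<n. x t $ i t * cnj (x s $ i s))"
      by simp
    also have "\<dots> = (\<Sum>t<n. \<Sum>s<n. x t $ i t * cnj (x s $ i s))"
      by (rule sum.swap)
    also have "\<dots> = (\<Sum>t<n. x t $ i t) * cnj (\<Sum>s<n. x s $ i s)"
      by (simp add: sum_product)
    also have "\<dots> = of_real ((cmod (\<Sum>t<n. x t $ i t))\<^sup>2)"
      by (metis complex_norm_square)
    finally show "0 \<le> (\<Sum>s<n. \<Sum>t<n. vec_cinner (op_apply (mat_tensor_id (P s t)) (x t)) (x s))"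
      by (simp add: less_eq_complex_def)
  qed
  then have psd: "block_psd n (\<lambda>s. dim_row (W s)) (\<lambda>s t. K (W s) (W t) (P s t))"
    using cp s unfolding cp_nc_kernel_def by (auto simp: P_def)
  define x where "x s = vec (dim_row (W s)) (\<lambda>q. if q = j s then c s *\<^sub>C e s else 0)" for s
  have "0 \<le> (\<Sum>s<n. \<Sum>t<n. vec_cinner (op_apply (K (W s) (W t) (P s t)) (x t)) (x s))"
    using psd unfolding block_psd_def by (simp add: x_def)
  also have "\<dots> = (\<Sum>s<n. \<Sum>t<n. c t * cnj (c s) * cinner ((K (W s) (W t) (P s t) $$ (j s, j t)) (e t)) (e s))"
  proof (intro sum.cong refl)
    fix r t assume rt: "r \<in> {..<n}" "t \<in> {..<n}"
    then have "K (W r) (W t) (P r t) \<in> carrier_mat (dim_row (W r)) (dim_row (W t))"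
      using psd by (simp add: block_psd_def)
    then show "vec_cinner (op_apply (K (W r) (W t) (P r t)) (x t)) (x r)
        = c t * cnj (c r) * cinner ((K (W r) (W t) (P r t) $$ (j r, j t)) (e t)) (e r)"
      unfolding x_def using rt s
      by (subst vec_cinner_op_apply_single) (auto simp: cblinfun_scale cinner_scaleC_left cinner_scaleC_right)
  qed
  also have "\<dots> = (\<Sum>t<n. \<Sum>s<n. c t * cnj (c s) * cinner ((K (W s) (W t) (P s t) $$ (j s, j t)) (e t)) (e s))"
    by (rule sum.swap)
  finally show ?thesis
    by (simp add: P_def)
qed

text \<open>Sequences are moved along \<open>g\<close> and padded with 0 off its range; this puts
  the Gram vectors into the prescribed state space.\<close>

definition l2_embed :: "('j \<Rightarrow> 'i) \<Rightarrow> ('j, 'h::chilbert_space) l2 \<Rightarrow> ('i, 'h) l2" where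
  "l2_embed g f = Abs_l2 (\<lambda>i. if i \<in> range g then l2_nth f (inv_into UNIV g i) else 0)"

lemma l2_embed_nth:
  assumes "inj g"
  shows "l2_nth (l2_embed g f) i = (if i \<in> range g then l2_nth f (inv_into UNIV g i) else 0)"
proof -
  have "(\<lambda>i. (norm (if i \<in> range g then l2_nth f (inv_into UNIV g i) else 0))\<^sup>2) summable_on UNIV
    \<longleftrightarrow> (\<lambda>i. (norm (l2_nth f (inv_into UNIV g i)))\<^sup>2) summable_on range g"
    by (rule summable_on_cong_neutral) auto
  also have "\<dots> \<longleftrightarrow> ((\<lambda>i. (norm (l2_nth f (inv_into UNIV g i)))\<^sup>2) \<circ> g) summable_on UNIV"
    by (rule summable_on_reindex [OF assms])
  also have "(\<lambda>i. (norm (l2_nth f (inv_into UNIV g i)))\<^sup>2) \<circ> g = (\<lambda>j. (norm (l2_nth f j))\<^sup>2)"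
    using assms by (auto simp: o_def)
  finally show ?thesis
    unfolding l2_embed_def by (subst Abs_l2_inverse) (simp_all add: l2_nth_summable)
qed

lemma cinner_l2_embed:
  assumes "inj g"
  shows "cinner (l2_embed g f) (l2_embed g h) = cinner f h"
proof -
  have "cinner (l2_embed g f) (l2_embed g h)
      = (\<Sum>\<^sub>\<infinity>i\<in>range g. cinner (l2_nth f (inv_into UNIV g i)) (l2_nth h (inv_into UNIV g i)))"
    unfolding cinner_l2_def by (rule infsum_cong_neutral) (auto simp: l2_embed_nth [OF assms])
  also have "\<dots> = (\<Sum>\<^sub>\<infinity>j. cinner (l2_nth f j) (l2_nth h j))"
    using assms by (subst infsum_reindex) (auto simp: o_def)
  finally show ?thesis
    by (simp add: cinner_l2_def)
qed

text \<open>The coordinates with odd \<open>n\<close> are kept free, so that both defect spaces are large enough to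
  complete the isometry to a unitary operator.\<close>

lemma state_vectors_exist:
  fixes Q\<^sub>0 :: "'v::complex_vector mat \<Rightarrow> ('r::chilbert_space \<Rightarrow>\<^sub>C\<^sub>L complex) mat"
    and a :: "'v mat \<Rightarrow> ('y::chilbert_space \<Rightarrow>\<^sub>C\<^sub>L 'e::chilbert_space) mat"
    and b :: "'v mat \<Rightarrow> ('u::chilbert_space \<Rightarrow>\<^sub>C\<^sub>L 'e) mat"
  assumes cp: "cp_nc_kernel \<Omega> (dBR_kernel Q\<^sub>0 a b)"
    and ab: "graded_function \<Omega> a" "graded_function \<Omega> b"
    and Q: "\<And>Z. Z \<in> \<Omega> \<Longrightarrow> strict_row_contraction (dim_row Z) (Q\<^sub>0 Z)"
  shows "\<exists>x :: 'v mat \<Rightarrow> nat \<Rightarrow> nat \<Rightarrow> 'e \<Rightarrow> ('v, 'e, 'r, 'u, 'y) state_space.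
    (\<forall>W\<in>\<Omega>. \<forall>Z\<in>\<Omega>. \<forall>i<dim_row W. \<forall>j<dim_row W. \<forall>k<dim_row Z. \<forall>l<dim_row Z. \<forall>e f.
      cinner (\<Sum>m<dim_row W. l2_tensor (riesz_mat (Q\<^sub>0 W) m i) (x W m j e))
         (\<Sum>m<dim_row Z. l2_tensor (riesz_mat (Q\<^sub>0 Z) m k) (x Z m l f))
        + cinner (cadjoint (a W $$ (j, i)) e) (cadjoint (a Z $$ (l, k)) f)
      = cinner (x W i j e) (x Z k l f) + cinner (cadjoint (b W $$ (j, i)) e) (cadjoint (b Z $$ (l, k)) f))
    \<and> (\<forall>W i j e V n s. odd n \<longrightarrow> l2_nth (x W i j e) (V, n, s) = 0)"
proof -
  define S where "S = {(W, i, j, e :: 'e). W \<in> \<Omega> \<and> i < dim_row W \<and> j < dim_row W}"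
  \<comment> \<open>Kolmogorov factorization of K on matrix units. The first index of a label comes
    from the matrix unit and the second from the entry of K; \<open>Q\<^sub>0\<close> will act on
    the first.\<close>
  define \<kappa> where "\<kappa> = (\<lambda>(W, i, j, e) (Z, k, l, f). cinner ((dBR_kernel Q\<^sub>0 a b Z W
    (elem_mat (dim_row Z) (dim_row W) k i) $$ (l, j)) e) f)"
  have "psd_kernel (\<lambda>x y. if x \<in> S \<and> y \<in> S then \<kappa> x y else 0)"
  proof (rule psd_kernel_extend)
    fix n :: nat and c :: "nat \<Rightarrow> complex" and j :: "nat \<Rightarrow> 'v mat \<times> nat \<times> nat \<times> 'e"
    assume j: "\<And>s. s < n \<Longrightarrow> j s \<in> S"
    have "0 \<le> (\<Sum>s<n. \<Sum>t<n. c s * cnj (c t) * cinner ((dBR_kernel Q\<^sub>0 a b (fst (j t)) (fst (j s))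
        (elem_mat (dim_row (fst (j t))) (dim_row (fst (j s))) (fst (snd (j t))) (fst (snd (j s))))
        $$ (fst (snd (snd (j t))), fst (snd (snd (j s))))) (snd (snd (snd (j s))))) (snd (snd (snd (j t)))))"
      by (rule cp_nc_kernel_psd [OF cp]) (use j in \<open>force simp: S_def\<close>)+
    then show "0 \<le> (\<Sum>s<n. \<Sum>t<n. c s * cnj (c t) * \<kappa> (j s) (j t))"
      by (simp add: \<kappa>_def case_prod_unfold)
  qed
  then obtain v where v: "\<And>x y. cinner (v x :: ('v mat \<times> nat \<times> nat \<times> 'e, complex) l2) (v y)
      = (if x \<in> S \<and> y \<in> S then \<kappa> x y else 0)"
    using gram_realization_ex by blast
  \<comment> \<open>The factor 2 keeps all state vectors on even second components. The components
    in \<open>'r\<close>, \<open>'u\<close> and \<open>'y\<close> make the index type large and are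
    set to 0.\<close>
  define g :: "'v mat \<times> nat \<times> nat \<times> 'e \<Rightarrow> ('v, 'e, 'r, 'u, 'y) state_index"
    where "g = (\<lambda>(W, i, j, e). (W, 2 * prod_encode (i, j), e, 0, 0, 0))"
  have g: "inj g"
    by (auto simp: g_def inj_def)
  define x where "x W i j e = l2_embed g (v (W, i, j, e))" for W i j e
  show ?thesis
  proof (intro exI [of _ x] conjI ballI allI impI)
    show "l2_nth (x W i j e) (V, n, s) = 0" if "odd n" for W i j e V n s
    proof -
      have "(V, n, s) \<notin> range g"
        using that by (auto simp: g_def)
      then show ?thesis
        by (simp add: x_def l2_embed_nth [OF g])
    qed
    fix W Z i j k l e f
    assume WZ: "W \<in> \<Omega>" "Z \<in> \<Omega>" and ix: "i < dim_row W" "j < dim_row W" "k < dim_row Z" "l < dim_row Z"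
    let ?m = "dim_row W" and ?n = "dim_row Z"
    define T where "T p q = cinner (cadjoint (a W $$ (j, q)) e) (cadjoint (a Z $$ (l, p)) f)
           - cinner (cadjoint (b W $$ (j, q)) e) (cadjoint (b Z $$ (l, p)) f)" for p q
    have carr: "a Z \<in> carrier_mat ?n ?n" "b Z \<in> carrier_mat ?n ?n" "a W \<in> carrier_mat ?m ?m" "b W \<in> carrier_mat ?m ?m"
      using ab WZ by (auto simp: graded_function_def)
    have xx: "cinner (x W i' j e) (x Z k' l f)
        = (\<Sum>p<?n. \<Sum>q<?m. cinner (kvec (Q\<^sub>0 W) i' q) (kvec (Q\<^sub>0 Z) k' p) * T p q)"
      if ix': "i' < ?m" "k' < ?n" for i' k'
    proof -
      have "(W, i', j, e) \<in> S" "(Z, k', l, f) \<in> S"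
        using ix ix' WZ by (auto simp: S_def)
      then have "cinner (x W i' j e) (x Z k' l f) = \<kappa> (W, i', j, e) (Z, k', l, f)"
        by (simp add: x_def cinner_l2_embed [OF g] v)
      also have "\<dots> = (\<Sum>p<?n. \<Sum>q<?m. k_kernel Q\<^sub>0 Z W (elem_mat ?n ?m k' i') $$ (p, q) * T p q)"
        unfolding \<kappa>_def T_def prod.case by (rule dBR_kernel_form) (use carr ix in auto)
      also have "\<dots> = (\<Sum>p<?n. \<Sum>q<?m. cinner (kvec (Q\<^sub>0 W) i' q) (kvec (Q\<^sub>0 Z) k' p) * T p q)"
        by (intro sum.cong refl) (simp add: k_kernel_elem_mat Q WZ ix')
      finally show ?thesis .
    qed
    have "cinner (\<Sum>m<?m. l2_tensor (riesz_mat (Q\<^sub>0 W) m i) (x W m j e))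
        (\<Sum>m<?n. l2_tensor (riesz_mat (Q\<^sub>0 Z) m k) (x Z m l f))
      = (\<Sum>i'<?m. \<Sum>k'<?n. cinner (riesz_mat (Q\<^sub>0 W) i' i) (riesz_mat (Q\<^sub>0 Z) k' k) * cinner (x W i' j e) (x Z k' l f))"
      by (rule cinner_pretensor_sum [OF pretensor_l2_tensor])
    also have "\<dots> = (\<Sum>i'<?m. \<Sum>k'<?n. \<Sum>p<?n. \<Sum>q<?m. cinner (riesz_mat (Q\<^sub>0 W) i' i) (riesz_mat (Q\<^sub>0 Z) k' k)
        * cinner (kvec (Q\<^sub>0 W) i' q) (kvec (Q\<^sub>0 Z) k' p) * T p q)"
      by (intro sum.cong refl) (simp add: xx sum_distrib_left mult.assoc)
    also have "\<dots> = (\<Sum>p<?n. \<Sum>i'<?m. \<Sum>k'<?n. \<Sum>q<?m. cinner (riesz_mat (Q\<^sub>0 W) i' i) (riesz_mat (Q\<^sub>0 Z) k' k)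
        * cinner (kvec (Q\<^sub>0 W) i' q) (kvec (Q\<^sub>0 Z) k' p) * T p q)"
      by (rule sum_swap_mult)
    also have "\<dots> = (\<Sum>p<?n. \<Sum>q<?m. \<Sum>i'<?m. \<Sum>k'<?n. cinner (riesz_mat (Q\<^sub>0 W) i' i) (riesz_mat (Q\<^sub>0 Z) k' k)
        * cinner (kvec (Q\<^sub>0 W) i' q) (kvec (Q\<^sub>0 Z) k' p) * T p q)"
      by (rule sum.cong [OF refl], rule sum_swap_mult)
    \<comment> \<open>First Stein equation weighted with \<open>T\<close>: the amplified Gram sum is
      the original one minus the contribution \<open>T k i\<close> of the identity term.\<close>
    also have "\<dots> = (\<Sum>p<?n. \<Sum>q<?m. cinner (kvec (Q\<^sub>0 W) i q) (kvec (Q\<^sub>0 Z) k p) * T p q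
        - (if p = k then if q = i then T p q else 0 else 0))"
    proof (intro sum.cong refl)
      fix p q assume "p \<in> {..<?n}" "q \<in> {..<?m}"
      then have "cinner (kvec (Q\<^sub>0 W) i q) (kvec (Q\<^sub>0 Z) k p) = (if i = q \<and> k = p then 1 else 0)
        + (\<Sum>i'<?m. \<Sum>k'<?n. cinner (riesz_mat (Q\<^sub>0 W) i' i) (riesz_mat (Q\<^sub>0 Z) k' k)
          * cinner (kvec (Q\<^sub>0 W) i' q) (kvec (Q\<^sub>0 Z) k' p))"
        using ix WZ by (intro kvec_Stein(1) Q) auto
      then show "(\<Sum>i'<?m. \<Sum>k'<?n. cinner (riesz_mat (Q\<^sub>0 W) i' i) (riesz_mat (Q\<^sub>0 Z) k' k)
          * cinner (kvec (Q\<^sub>0 W) i' q) (kvec (Q\<^sub>0 Z) k' p) * T p q)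
        = cinner (kvec (Q\<^sub>0 W) i q) (kvec (Q\<^sub>0 Z) k p) * T p q - (if p = k then if q = i then T p q else 0 else 0)"
        by (simp add: distrib_right flip: sum_distrib_right)
    qed
    also have "\<dots> = cinner (x W i j e) (x Z k l f) - T k i"
      using ix by (simp only: sum_subtractf sum_delta2 xx)
    finally show "cinner (\<Sum>m<dim_row W. l2_tensor (riesz_mat (Q\<^sub>0 W) m i) (x W m j e))
         (\<Sum>m<dim_row Z. l2_tensor (riesz_mat (Q\<^sub>0 Z) m k) (x Z m l f))
        + cinner (cadjoint (a W $$ (j, i)) e) (cadjoint (a Z $$ (l, k)) f)
      = cinner (x W i j e) (x Z k l f) + cinner (cadjoint (b W $$ (j, i)) e) (cadjoint (b Z $$ (l, k)) f)"
      by (simp add: T_def)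
  qed
qed

text \<open>Two nested pairings encode the data into the infinite type, and the distinct tags
  \<open>A\<close> and \<open>B\<close> keep the two summands apart.\<close>

lemma card_of_sum_Times_le:
  fixes g :: "'c \<Rightarrow> 'i" and h :: "'y \<Rightarrow> 'i"
  assumes inf: "infinite (UNIV :: 'i set)" and inj: "inj g" "inj h"
  shows "|UNIV :: ('i \<times> 'c + 'y) set| \<le>o |UNIV :: 'i set|"
proof -
  have "|(UNIV :: 'i set) \<times> (UNIV :: 'i set)| =o |UNIV :: 'i set|"
    by (rule card_of_Times_same_infinite [OF inf])
  then obtain \<beta> :: "'i \<times> 'i \<Rightarrow> 'i" where \<beta>: "inj \<beta>"
    unfolding card_of_ordIso [symmetric] by (auto simp: bij_betw_def)
  obtain A :: 'i where True by blast
  obtain B :: 'i where B: "B \<noteq> A"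
    using inf by (metis ex_new_if_finite finite.emptyI finite_insert singletonI)
  have "inj (case_sum (\<lambda>(i, c). \<beta> (\<beta> (i, g c), A)) (\<lambda>y. \<beta> (\<beta> (h y, A), B)))"
    using B inj by (auto simp: inj_def split: sum.splits dest!: injD [OF \<beta>])
  then show ?thesis
    unfolding card_of_ordLeq [symmetric] by blast
qed

text \<open>The identity for the state vectors says that the families \<open>p\<close> and
  \<open>q\<close> have the same Gram matrix, so there is a contraction or unitary U with U^* p = q.
  The unitary case asks for a nonzero vector of R, as this supplies the free dimensions in the
  target R \<otimes> X.\<close>

theorem cp_imp_realization:
  fixes Q\<^sub>0 :: "'v::complex_vector mat \<Rightarrow> ('r::chilbert_space \<Rightarrow>\<^sub>C\<^sub>L complex) mat"
    and a :: "'v mat \<Rightarrow> ('y::chilbert_space \<Rightarrow>\<^sub>C\<^sub>L 'e::chilbert_space) mat"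
    and b :: "'v mat \<Rightarrow> ('u::chilbert_space \<Rightarrow>\<^sub>C\<^sub>L 'e) mat"
  assumes cp: "cp_nc_kernel \<Omega> (dBR_kernel Q\<^sub>0 a b)"
    and ab: "graded_function \<Omega> a" "graded_function \<Omega> b"
    and Q: "\<And>Z. Z \<in> \<Omega> \<Longrightarrow> strict_row_contraction (dim_row Z) (Q\<^sub>0 Z)"
  shows "contractive_realization TYPE(('v, 'e, 'r, 'u, 'y) state_space)
        TYPE(('v, 'e, 'r, 'u, 'y) tensor_state_space) \<Omega> Q\<^sub>0 a b"
    and "\<exists>r::'r. r \<noteq> 0 \<Longrightarrow> unitary_realization TYPE(('v, 'e, 'r, 'u, 'y) state_space)
        TYPE(('v, 'e, 'r, 'u, 'y) tensor_state_space) \<Omega> Q\<^sub>0 a b"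
proof -
  obtain x :: "'v mat \<Rightarrow> nat \<Rightarrow> nat \<Rightarrow> 'e \<Rightarrow> ('v, 'e, 'r, 'u, 'y) state_space"
    where x: "(\<forall>W\<in>\<Omega>. \<forall>Z\<in>\<Omega>. \<forall>i<dim_row W. \<forall>j<dim_row W. \<forall>k<dim_row Z. \<forall>l<dim_row Z. \<forall>e f.
      cinner (\<Sum>m<dim_row W. l2_tensor (riesz_mat (Q\<^sub>0 W) m i) (x W m j e))
         (\<Sum>m<dim_row Z. l2_tensor (riesz_mat (Q\<^sub>0 Z) m k) (x Z m l f))
        + cinner (cadjoint (a W $$ (j, i)) e) (cadjoint (a Z $$ (l, k)) f)
      = cinner (x W i j e) (x Z k l f) + cinner (cadjoint (b W $$ (j, i)) e) (cadjoint (b Z $$ (l, k)) f))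
    \<and> (\<forall>W i j e V n s. odd n \<longrightarrow> l2_nth (x W i j e) (V, n, s) = 0)"
    by (rule exE [OF state_vectors_exist [OF cp ab Q]]) (assumption, rule that)
  define S where "S = {(W, i, j, e :: 'e). W \<in> \<Omega> \<and> i < dim_row W \<and> j < dim_row W}"
  define p where "p s = (case s of (W, i, j, e) \<Rightarrow> if s \<in> S
    then (\<Sum>m<dim_row W. l2_tensor (riesz_mat (Q\<^sub>0 W) m i) (x W m j e), cadjoint (a W $$ (j, i)) e) else 0)" for s
  define q where "q s = (case s of (W, i, j, e) \<Rightarrow> if s \<in> S
    then (x W i j e, cadjoint (b W $$ (j, i)) e) else 0)" for s
  have gram: "cinner (p s) (p t) = cinner (q s) (q t)" for s t
    by (cases s; cases t) (use x in \<open>auto simp: p_def q_def S_def cinner_prod_def\<close>)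
  have solves: "a Z \<odot> transfer_function l2_tensor A B C D (Q\<^sub>0 Z) = b Z"
    if U: "contractive (colligation A B C D)" "\<And>z s. cinner (colligation A B C D z) (p s) = cinner z (q s)"
      and Z: "Z \<in> \<Omega>"
    for A B C D Z
  proof (rule realization_solves [OF hilbert_tensor_l2_tensor _ Q [OF Z], where x = "\<lambda>j e i. x Z i j e"])
    show "norm (A x) \<le> norm x" for x
      by (rule contractive_colligation_state [OF U(1)])
    show "a Z \<in> carrier_mat (dim_row Z) (dim_row Z)" "b Z \<in> carrier_mat (dim_row Z) (dim_row Z)"
      using ab Z by (auto simp: graded_function_def)
    show "cinner (colligation A B C D (z, w)) (\<Sum>l<dim_row Z. l2_tensor (riesz_mat (Q\<^sub>0 Z) l i) (x Z l j e),
        cadjoint (a Z $$ (j, i)) e) = cinner (z, w) (x Z i j e, cadjoint (b Z $$ (j, i)) e)"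
      if "j < dim_row Z" "i < dim_row Z" for j e i z w
      using U(2) [of "(z, w)" "(Z, i, j, e)"] that Z by (simp add: p_def q_def S_def)
  qed
  show "contractive_realization TYPE(('v, 'e, 'r, 'u, 'y) state_space)
        TYPE(('v, 'e, 'r, 'u, 'y) tensor_state_space) \<Omega> Q\<^sub>0 a b"
  proof (rule contraction_of_gram [OF gram])
    fix U assume U: "bounded_clinear U" "contractive U" "\<And>z j. cinner (U z) (p j) = cinner z (q j)"
    obtain A B C D where ABCD: "U = colligation A B C D"
      using colligation_exists [OF U(1)] by blast
    show ?thesis
      unfolding contractive_realization_def
      using U solves [of A B C D] hilbert_tensor_l2_tensor unfolding ABCD by blast
  qed
  assume "\<exists>r::'r. r \<noteq> 0"
  then obtain r :: 'r where "r \<noteq> 0" by blast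
  define r0 where "r0 = complex_of_real (1 / norm r) *\<^sub>C r"
  have "norm r0 = 1"
    using \<open>r \<noteq> 0\<close> by (simp add: r0_def norm_scaleC norm_divide)
  then have r0: "cinner r0 r0 = 1"
    by (simp add: cinner_self)
  \<comment> \<open>An injection into the indices with odd second component, where every state
    vector vanishes: the unit vectors placed at \<open>h i\<close> are orthonormal and lie in the
    defect spaces.\<close>
  define h :: "('v, 'e, 'r, 'u, 'y) state_index \<Rightarrow> ('v, 'e, 'r, 'u, 'y) state_index"
    where "h = (\<lambda>(W, n, s). (W, 2 * n + 1, s))"
  have h: "h i = h j \<longleftrightarrow> i = j" for i j
    by (auto simp: h_def split: prod.splits)
  have xh: "l2_nth (x W i j e) (h s) = 0" for W i j e s
    using x by (auto simp: h_def split: prod.splits)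
  have inf: "infinite (UNIV :: ('v, 'e, 'r, 'u, 'y) state_index set)"
  proof
    assume "finite (UNIV :: ('v, 'e, 'r, 'u, 'y) state_index set)"
    then have "finite (range (\<lambda>n. (undefined, n, 0, 0, 0, 0) :: ('v, 'e, 'r, 'u, 'y) state_index))"
      by (rule finite_subset [rotated]) simp
    then show False
      by (rule finite_imageD [THEN infinite_UNIV_nat [THEN notE]]) (auto simp: inj_def)
  qed
  \<comment> \<open>Total families whose index types inject into the state index; they bound the
    dimensions of the two spaces from above.\<close>
  define d :: "('v, 'e, 'r, 'u, 'y) state_index \<times> 'r + 'y \<Rightarrow> ('v, 'e, 'r, 'u, 'y) tensor_state_space \<times> 'y"
    where "d = case_sum (\<lambda>(i, r). (l2_single i r, 0)) (\<lambda>y. (0, y))"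
  define d' :: "('v, 'e, 'r, 'u, 'y) state_index \<times> unit + 'u \<Rightarrow> ('v, 'e, 'r, 'u, 'y) state_space \<times> 'u"
    where "d' = case_sum (\<lambda>(i, _). (l2_single i 1, 0)) (\<lambda>u. (0, u))"
  show "unitary_realization TYPE(('v, 'e, 'r, 'u, 'y) state_space)
        TYPE(('v, 'e, 'r, 'u, 'y) tensor_state_space) \<Omega> Q\<^sub>0 a b"
  proof (rule unitary_of_gram [OF gram inf, where e = "\<lambda>i. (l2_single (h i) r0, 0)"
      and f = "\<lambda>i. (l2_single (h i) 1, 0)" and d = d and d' = d'])
    show "cinner (l2_single (h i) r0, 0::'y) (l2_single (h j) r0, 0) = (if i = j then 1 else 0)" for i j
      by (simp add: cinner_prod_def cinner_l2_single h r0)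
    show "cinner (l2_single (h i) 1, 0::'u) (l2_single (h j) (1::complex), 0) = (if i = j then 1 else 0)" for i j
      by (simp add: cinner_prod_def cinner_l2_single h cinner_complex_def)
    show "cinner (l2_single (h i) r0, 0) (p j) = 0" for i j
      by (cases j) (simp add: p_def cinner_prod_def cinner_l2_single l2_nth_sum xh)
    show "cinner (l2_single (h i) 1, 0) (q j) = 0" for i j
      by (cases j) (simp add: q_def cinner_prod_def cinner_l2_single xh)
    show "z = 0" if z: "\<And>i. cinner (d i) z = 0" for z
    proof -
      have "l2_nth (fst z) i = 0" for i
        by (rule cinner_eqI_right) (use z [of "Inl (i, _)"] in \<open>simp add: d_def cinner_prod_def cinner_l2_single\<close>)
      moreover have "snd z = 0"
        by (rule cinner_eqI_right) (use z [of "Inr _"] in \<open>simp add: d_def cinner_prod_def\<close>)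
      ultimately show ?thesis
        by (auto simp: prod_eq_iff intro: l2_eqI)
    qed
    show "z = 0" if z: "\<And>i. cinner (d' i) z = 0" for z
    proof -
      have "l2_nth (fst z) i = 0" for i
        using z [of "Inl (i, ())"] by (simp add: d'_def cinner_prod_def cinner_l2_single cinner_complex_def)
      moreover have "snd z = 0"
        by (rule cinner_eqI_right) (use z [of "Inr _"] in \<open>simp add: d'_def cinner_prod_def\<close>)
      ultimately show ?thesis
        by (auto simp: prod_eq_iff intro: l2_eqI)
    qed
    show "|UNIV :: (('v, 'e, 'r, 'u, 'y) state_index \<times> 'r + 'y) set|
        \<le>o |UNIV :: ('v, 'e, 'r, 'u, 'y) state_index set|"
      by (rule card_of_sum_Times_le [OF inf, where g = "\<lambda>r. (undefined, 0, 0, r, 0, 0)"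
          and h = "\<lambda>y. (undefined, 0, 0, 0, 0, y)"]) (auto simp: inj_def)
    show "|UNIV :: (('v, 'e, 'r, 'u, 'y) state_index \<times> unit + 'u) set|
        \<le>o |UNIV :: ('v, 'e, 'r, 'u, 'y) state_index set|"
      by (rule card_of_sum_Times_le [OF inf, where g = "\<lambda>_. undefined"
          and h = "\<lambda>u. (undefined, 0, 0, 0, u, 0)"]) (auto simp: inj_def)
    fix U assume U: "bounded_clinear U" "unitary U" "\<And>z j. cinner (U z) (p j) = cinner z (q j)"
    obtain A B C D where ABCD: "U = colligation A B C D"
      using colligation_exists [OF U(1)] by blast
    show ?thesis
      unfolding unitary_realization_def
      using U solves [of A B C D] unitary_contractive [OF U(2)] hilbert_tensor_l2_tensor
      unfolding ABCD by blast
  qed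
qed

section \<open>The reproducing kernel Hilbert space of \<open>k \<otimes> I\<close>\<close>

text \<open>Partial inner product with \<open>g\<close> in the scalar factor, obtained as an
  adjoint. It is conjugate-linear in \<open>g\<close>, which absorbs the conjugates of
  \<open>kvec_intertwine\<close>.\<close>

definition contract :: "('i, complex) l2 \<Rightarrow> ('i, 'h::chilbert_space) l2 \<Rightarrow>\<^sub>C\<^sub>L 'h" where
  "contract g = cadjoint (CBlinfun (\<lambda>y. l2_tensor y g))"

lemma cinner_contract: "cinner (contract g \<xi>) y = cinner \<xi> (l2_tensor y g)"
  for \<xi> :: "('i, 'h::chilbert_space) l2"
proof -
  have "bounded_clinear (\<lambda>y::'h. l2_tensor y g)"
    by (rule bounded_clinearI [where K = "norm g"])
      (simp_all add: pretensor_linear [OF pretensor_l2_tensor] norm_pretensor [OF pretensor_l2_tensor])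
  then show ?thesis
    unfolding contract_def cinner_cadjoint_left by (simp add: CBlinfun_apply)
qed

lemma contract_sum:
  "(\<Sum>k\<in>A. c k *\<^sub>C contract (g k) \<xi>) = contract (\<Sum>k\<in>A. cnj (c k) *\<^sub>C g k) \<xi>"
  by (rule cinner_eqI)
    (simp add: cinner_sum_left cinner_scaleC_left cinner_contract cinner_sum_right cinner_scaleC_right
      pretensor_sum_right [OF pretensor_l2_tensor] pretensor_scale_right [OF pretensor_l2_tensor])

lemma contract_l2_tensor: "contract g (l2_tensor y f) = cinner f g *\<^sub>C y"
  by (rule cinner_eqI) (simp add: cinner_contract cinner_l2_tensor cinner_scaleC_left mult.commute)

lemma vector_to_cblinfun_linear:
  "vector_to_cblinfun (x + y) = vector_to_cblinfun x + vector_to_cblinfun y"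
  "vector_to_cblinfun (c *\<^sub>C x) = c *\<^sub>C vector_to_cblinfun x"
  by (rule cblinfun_eqI, simp add: scaleC_add_right scaleC_scaleC mult.commute)+

lemma cblinfun_complex_eqI: "S 1 = T 1 \<Longrightarrow> S = T" for S T :: "complex \<Rightarrow>\<^sub>C\<^sub>L 'h::chilbert_space"
  by (rule cblinfun_eqI) (metis cblinfun_complex_apply)

text \<open>\<open>\<H>(k \<otimes> I)\<close> is realized as the closed span \<open>rk_space\<close> of the vectors \<open>y \<otimes> kvec\<close>; the function
  of \<open>\<xi>\<close> records its inner products with these vectors.\<close>

definition rk_fun :: "'v::complex_vector mat set \<Rightarrow> ('v mat \<Rightarrow> ('r::chilbert_space \<Rightarrow>\<^sub>C\<^sub>L complex) mat)
    \<Rightarrow> ((nat, 'r fock) l2, 'h::chilbert_space) l2 \<Rightarrow> ('v, 'h) nc_fun" where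
  "rk_fun D Q\<^sub>0 \<xi> = (\<lambda>Z\<in>D. mat (dim_row Z) (dim_row Z)
     (\<lambda>(i, j). vector_to_cblinfun (contract (kvec (Q\<^sub>0 Z) j i) \<xi>)))"

definition rk_vec :: "'v::complex_vector mat set \<Rightarrow> ('v mat \<Rightarrow> ('r::chilbert_space \<Rightarrow>\<^sub>C\<^sub>L complex) mat)
    \<Rightarrow> 'v mat \<times> nat \<times> nat \<times> 'h::chilbert_space \<Rightarrow> ((nat, 'r fock) l2, 'h) l2" where
  "rk_vec D Q\<^sub>0 = (\<lambda>(W, i, j, y). if W \<in> D \<and> i < dim_row W \<and> j < dim_row W
     then l2_tensor y (kvec (Q\<^sub>0 W) i j) else 0)"

definition rk_space :: "'v::complex_vector mat set \<Rightarrow> ('v mat \<Rightarrow> ('r::chilbert_space \<Rightarrow>\<^sub>C\<^sub>L complex) mat)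
    \<Rightarrow> ((nat, 'r fock) l2, 'h::chilbert_space) l2 set" where
  "rk_space D Q\<^sub>0 = closure (range (lincomb (rk_vec D Q\<^sub>0)))"

definition rk_inner :: "'v::complex_vector mat set \<Rightarrow> ('v mat \<Rightarrow> ('r::chilbert_space \<Rightarrow>\<^sub>C\<^sub>L complex) mat)
    \<Rightarrow> ('v, 'h::chilbert_space) nc_fun \<Rightarrow> ('v, 'h) nc_fun \<Rightarrow> complex" where
  "rk_inner D Q\<^sub>0 f g = cinner (inv_into (rk_space D Q\<^sub>0) (rk_fun D Q\<^sub>0) f) (inv_into (rk_space D Q\<^sub>0) (rk_fun D Q\<^sub>0) g)"

lemma rk_fun_add: "rk_fun D Q\<^sub>0 (\<xi> + \<eta>) = fun_add D (rk_fun D Q\<^sub>0 \<xi>) (rk_fun D Q\<^sub>0 \<eta>)"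
  unfolding rk_fun_def fun_add_def
  by (rule restrict_ext) (auto simp: cblinfun_add vector_to_cblinfun_linear intro!: eq_matI)

lemma rk_fun_scale: "rk_fun D Q\<^sub>0 (c *\<^sub>C \<xi>) = fun_scale D c (rk_fun D Q\<^sub>0 \<xi>)"
  unfolding rk_fun_def fun_scale_def
  by (rule restrict_ext) (auto simp: cblinfun_scale vector_to_cblinfun_linear intro!: eq_matI)

lemma rk_fun_zero: "rk_fun D Q\<^sub>0 0 = fun_zero D"
  unfolding rk_fun_def fun_zero_def
  by (rule restrict_ext) (auto simp: cblinfun_zero intro!: eq_matI cblinfun_eqI)

text \<open>The nc property is inherited from the kernel vectors: contracting \<xi> against both
  sides of \<open>kvec_intertwine\<close> gives the intertwining of the values.\<close>

lemma rk_fun_nc_function: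
  assumes Q: "\<And>Z. Z \<in> D \<Longrightarrow> strict_row_contraction (dim_row Z) (Q\<^sub>0 Z)" and nc: "nc_function D Q\<^sub>0"
  shows "nc_function D (rk_fun D Q\<^sub>0 \<xi>)"
  unfolding nc_function_def
proof (intro conjI ballI impI)
  show "graded_function D (rk_fun D Q\<^sub>0 \<xi>)"
    by (simp add: graded_function_def rk_fun_def)
  fix Z Z' \<alpha>
  assume Z: "Z \<in> D" "Z' \<in> D" and \<alpha>: "\<alpha> \<in> carrier_mat (dim_row Z') (dim_row Z)" "\<alpha> \<bullet>\<^sub>l Z = Z' \<bullet>\<^sub>r \<alpha>"
  then have eq: "\<alpha> \<bullet>\<^sub>l Q\<^sub>0 Z = Q\<^sub>0 Z' \<bullet>\<^sub>r \<alpha>"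
    using nc by (auto simp: nc_function_def)
  show "\<alpha> \<bullet>\<^sub>l rk_fun D Q\<^sub>0 \<xi> Z = rk_fun D Q\<^sub>0 \<xi> Z' \<bullet>\<^sub>r \<alpha>"
  proof (rule eq_matI)
    fix i j assume "i < dim_row (rk_fun D Q\<^sub>0 \<xi> Z' \<bullet>\<^sub>r \<alpha>)" "j < dim_col (rk_fun D Q\<^sub>0 \<xi> Z' \<bullet>\<^sub>r \<alpha>)"
    then have ij: "i < dim_row Z'" "j < dim_row Z"
      using Z \<alpha> by (auto simp: cmat_times_right_def rk_fun_def)
    show "(\<alpha> \<bullet>\<^sub>l rk_fun D Q\<^sub>0 \<xi> Z) $$ (i, j) = (rk_fun D Q\<^sub>0 \<xi> Z' \<bullet>\<^sub>r \<alpha>) $$ (i, j)"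
    proof (rule cblinfun_complex_eqI)
      have "((\<alpha> \<bullet>\<^sub>l rk_fun D Q\<^sub>0 \<xi> Z) $$ (i, j)) 1 = (\<Sum>k<dim_row Z. \<alpha> $$ (i, k) *\<^sub>C contract (kvec (Q\<^sub>0 Z) j k) \<xi>)"
        using ij Z \<alpha> by (simp add: cmat_times_left_def rk_fun_def scaleC_one)
      also have "\<dots> = (\<Sum>l<dim_row Z'. \<alpha> $$ (l, j) *\<^sub>C contract (kvec (Q\<^sub>0 Z') l i) \<xi>)"
        unfolding contract_sum kvec_intertwine [OF Q [OF Z(1)] Q [OF Z(2)] \<alpha>(1) eq ij(2) ij(1)] ..
      also have "\<dots> = ((rk_fun D Q\<^sub>0 \<xi> Z' \<bullet>\<^sub>r \<alpha>) $$ (i, j)) 1"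
        using ij Z \<alpha> by (simp add: cmat_times_right_def rk_fun_def scaleC_one)
      finally show "((\<alpha> \<bullet>\<^sub>l rk_fun D Q\<^sub>0 \<xi> Z) $$ (i, j)) 1 = ((rk_fun D Q\<^sub>0 \<xi> Z' \<bullet>\<^sub>r \<alpha>) $$ (i, j)) 1" .
    qed
  qed (use Z \<alpha> in \<open>auto simp: cmat_times_left_def cmat_times_right_def rk_fun_def\<close>)
qed

lemma rk_fun_apply:
  assumes "Z \<in> D" "i < dim_row Z" "j < dim_row Z"
  shows "cinner ((rk_fun D Q\<^sub>0 \<xi> Z $$ (i, j)) 1) y = cinner \<xi> (l2_tensor y (kvec (Q\<^sub>0 Z) j i))"
  using assms by (simp add: rk_fun_def scaleC_one cinner_contract)

text \<open>The values of the function are the inner products of \<xi> with the generators of the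
  closed span, and these determine \<xi> there. This is what makes \<open>rk_inner\<close> the
  transported inner product.\<close>

lemma inj_on_rk_fun:
  fixes Q\<^sub>0 :: "'v::complex_vector mat \<Rightarrow> ('r::chilbert_space \<Rightarrow>\<^sub>C\<^sub>L complex) mat"
  shows "inj_on (rk_fun D Q\<^sub>0) (rk_space D Q\<^sub>0 :: ((nat, 'r fock) l2, 'h::chilbert_space) l2 set)"
proof (rule inj_onI)
  fix \<xi> \<eta> :: "((nat, 'r fock) l2, 'h) l2"
  assume M: "\<xi> \<in> rk_space D Q\<^sub>0" "\<eta> \<in> rk_space D Q\<^sub>0" and eq: "rk_fun D Q\<^sub>0 \<xi> = rk_fun D Q\<^sub>0 \<eta>"
  have "\<xi> - \<eta> = 0"
  proof (rule closure_span_unique [of _ "rk_vec D Q\<^sub>0"])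
    show "\<xi> - \<eta> \<in> closure (range (lincomb (rk_vec D Q\<^sub>0)))"
      using M unfolding rk_space_def by (rule closure_span_diff)
    fix s :: "'v mat \<times> nat \<times> nat \<times> 'h"
    obtain W i j y where s: "s = (W, i, j, y)"
      by (cases s)
    have "cinner (\<xi> - \<eta>) (rk_vec D Q\<^sub>0 s) = 0"
    proof (cases "W \<in> D \<and> i < dim_row W \<and> j < dim_row W")
      case True
      then show ?thesis
        using rk_fun_apply [of W D j i Q\<^sub>0 \<xi> y] rk_fun_apply [of W D j i Q\<^sub>0 \<eta> y] eq
        by (simp add: s rk_vec_def cinner_diff_left)
    qed (auto simp: s rk_vec_def)
    then show "cinner (rk_vec D Q\<^sub>0 s) (\<xi> - \<eta>) = 0"
      by (metis cinner_commute complex_cnj_zero)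
  qed
  then show "\<xi> = \<eta>" by simp
qed

lemma rk_inner_fun:
  "\<xi> \<in> rk_space D Q\<^sub>0 \<Longrightarrow> \<eta> \<in> rk_space D Q\<^sub>0 \<Longrightarrow> rk_inner D Q\<^sub>0 (rk_fun D Q\<^sub>0 \<xi>) (rk_fun D Q\<^sub>0 \<eta>) = cinner \<xi> \<eta>"
  by (simp add: rk_inner_def inv_into_f_f [OF inj_on_rk_fun])

lemma rk_space_zero: "0 \<in> rk_space D Q\<^sub>0"
  unfolding rk_space_def by (rule subsetD [OF closure_subset], rule range_eqI [of _ _ "[]"]) simp

lemma rk_space_vec: "rk_vec D Q\<^sub>0 s \<in> rk_space D Q\<^sub>0"
  unfolding rk_space_def
  by (rule subsetD [OF closure_subset], rule range_eqI [of _ _ "[(1, s)]"]) (simp add: scaleC_one)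

lemma rk_space_linear:
  assumes "\<xi> \<in> rk_space D Q\<^sub>0"
  shows rk_space_add: "\<eta> \<in> rk_space D Q\<^sub>0 \<Longrightarrow> \<xi> + \<eta> \<in> rk_space D Q\<^sub>0"
    and rk_space_scale: "c *\<^sub>C \<xi> \<in> rk_space D Q\<^sub>0"
  using assms unfolding rk_space_def by (auto intro: closure_span_add closure_span_scale)

lemma rk_space_sum: "(\<And>i. i \<in> A \<Longrightarrow> f i \<in> rk_space D Q\<^sub>0) \<Longrightarrow> sum f A \<in> rk_space D Q\<^sub>0"
  by (induction A rule: infinite_finite_induct) (auto simp: rk_space_zero rk_space_add)

lemma scaleC_minus_one: "(-1) *\<^sub>C x = - x" for x :: "'a::chilbert_space"
  using scaleR_scaleC [of "-1" x] by simp

lemma fun_dist_rk_inner: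
  assumes "\<xi> \<in> rk_space D Q\<^sub>0" "\<eta> \<in> rk_space D Q\<^sub>0"
  shows "fun_dist D (rk_inner D Q\<^sub>0) (rk_fun D Q\<^sub>0 \<xi>) (rk_fun D Q\<^sub>0 \<eta>) = norm (\<xi> - \<eta>)"
proof -
  have "fun_add D (rk_fun D Q\<^sub>0 \<xi>) (fun_scale D (-1) (rk_fun D Q\<^sub>0 \<eta>)) = rk_fun D Q\<^sub>0 (\<xi> - \<eta>)"
    unfolding rk_fun_scale [symmetric] rk_fun_add [symmetric] scaleC_minus_one by simp
  moreover have "\<xi> - \<eta> \<in> rk_space D Q\<^sub>0"
    using rk_space_add [OF assms(1) rk_space_scale [OF assms(2), of "-1"]] by (simp add: scaleC_minus_one)
  ultimately show ?thesis
    by (simp add: fun_dist_def rk_inner_fun cinner_self Let_def)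
qed

lemma rk_hilbert_space:
  fixes Q\<^sub>0 :: "'v::complex_vector mat \<Rightarrow> ('r::chilbert_space \<Rightarrow>\<^sub>C\<^sub>L complex) mat"
  assumes Q: "\<And>Z. Z \<in> D \<Longrightarrow> strict_row_contraction (dim_row Z) (Q\<^sub>0 Z)" and nc: "nc_function D Q\<^sub>0"
  shows "hilbert_space_of_nc_functions D (rk_fun D Q\<^sub>0 ` (rk_space D Q\<^sub>0 :: ((nat, 'r fock) l2, 'h::chilbert_space) l2 set))
    (rk_inner D Q\<^sub>0)"
proof -
  let ?M = "rk_space D Q\<^sub>0 :: ((nat, 'r fock) l2, 'h) l2 set"
  let ?f = "rk_fun D Q\<^sub>0 :: _ \<Rightarrow> ('v, 'h) nc_fun"
  have complete: "\<exists>f\<in>?f ` ?M. (\<lambda>k. fun_dist D (rk_inner D Q\<^sub>0) (s k) f) \<longlonglongrightarrow> 0"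
    if s: "\<forall>k. s k \<in> ?f ` ?M" "\<forall>e>0. \<exists>N. \<forall>k\<ge>N. \<forall>l\<ge>N. fun_dist D (rk_inner D Q\<^sub>0) (s k) (s l) < e" for s
  proof -
    have "\<forall>k. \<exists>\<xi>. \<xi> \<in> ?M \<and> s k = ?f \<xi>"
      using s(1) by blast
    then obtain \<xi> where \<xi>: "\<And>k. \<xi> k \<in> ?M" "\<And>k. s k = ?f (\<xi> k)"
      unfolding choice_iff by blast
    have "Cauchy \<xi>"
      unfolding Cauchy_def using s(2) by (simp add: \<xi> fun_dist_rk_inner dist_norm)
    then obtain \<eta> where \<eta>: "\<xi> \<longlonglongrightarrow> \<eta>"
      using Cauchy_convergent convergent_def by blast
    \<comment> \<open>Completeness is that of the surrounding \<ell>^2 space, as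
      \<open>rk_space\<close> is closed.\<close>
    have "\<eta> \<in> ?M"
      using closed_sequentially [of ?M \<xi> \<eta>] \<xi>(1) \<eta> by (simp add: rk_space_def)
    moreover have "(\<lambda>k. norm (\<xi> k - \<eta>)) \<longlonglongrightarrow> 0"
      using \<eta> by (simp add: LIM_zero tendsto_norm_zero)
    ultimately show ?thesis
      by (intro bexI [of _ "?f \<eta>"]) (simp_all add: \<xi> fun_dist_rk_inner)
  qed
  show ?thesis
    unfolding hilbert_space_of_nc_functions_def
  proof (intro conjI ballI allI impI; (elim imageE)?)
    show "nc_function D f" if "f = ?f \<xi>" for f \<xi>
      unfolding that by (rule rk_fun_nc_function [OF Q nc])
    show "f \<in> extensional D" if "f = ?f \<xi>" for f \<xi>
      unfolding that rk_fun_def by simp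
    show "fun_zero D \<in> ?f ` ?M"
      unfolding rk_fun_zero [symmetric, where Q\<^sub>0 = Q\<^sub>0] using rk_space_zero by blast
    show "fun_add D f g \<in> ?f ` ?M" if "f = ?f \<xi>" "\<xi> \<in> ?M" "g = ?f \<eta>" "\<eta> \<in> ?M" for f g \<xi> \<eta>
      using that rk_space_add unfolding that rk_fun_add [symmetric] by blast
    show "fun_scale D c f \<in> ?f ` ?M" if "f = ?f \<xi>" "\<xi> \<in> ?M" for c f \<xi>
      using that rk_space_scale unfolding that rk_fun_scale [symmetric] by blast
    show "rk_inner D Q\<^sub>0 (fun_add D f g) h = rk_inner D Q\<^sub>0 f h + rk_inner D Q\<^sub>0 g h"
      if "f = ?f \<xi>" "\<xi> \<in> ?M" "g = ?f \<eta>" "\<eta> \<in> ?M" "h = ?f \<zeta>" "\<zeta> \<in> ?M" for f g h \<xi> \<eta> \<zeta>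
      using that unfolding that(1,3,5) rk_fun_add [symmetric]
      by (simp add: rk_inner_fun rk_space_add cinner_add_left)
    show "rk_inner D Q\<^sub>0 (fun_scale D c f) g = c * rk_inner D Q\<^sub>0 f g"
      if "f = ?f \<xi>" "\<xi> \<in> ?M" "g = ?f \<eta>" "\<eta> \<in> ?M" for c f g \<xi> \<eta>
      using that unfolding that(1,3) rk_fun_scale [symmetric]
      by (simp add: rk_inner_fun rk_space_scale cinner_scaleC_left)
    show "rk_inner D Q\<^sub>0 f g = cnj (rk_inner D Q\<^sub>0 g f)" for f g :: "('v, 'h) nc_fun"
      unfolding rk_inner_def by (rule cinner_commute)
    show "0 \<le> rk_inner D Q\<^sub>0 f f" for f :: "('v, 'h) nc_fun"
      unfolding rk_inner_def by (simp add: cinner_self less_eq_complex_def)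
    show "f = fun_zero D" if "rk_inner D Q\<^sub>0 f f = 0" "f = ?f \<xi>" "\<xi> \<in> ?M" for f \<xi>
      using that by (simp add: rk_inner_fun cinner_self rk_fun_zero [symmetric, where Q\<^sub>0 = Q\<^sub>0])
  qed (use complete in blast)+
qed

text \<open>The argument u v with u the unit vector at \<open>j\<close> is supported on row
  \<open>j\<close>, so the double sum for k collapses to the kernel vectors
  \<open>kvec (Q\<^sub>0 Z) j i\<close>, and contraction against them can be pulled out.\<close>

lemma kernel_fun_eq_rk_fun:
  assumes Q: "\<And>Z. Z \<in> D \<Longrightarrow> strict_row_contraction (dim_row Z) (Q\<^sub>0 Z)"
    and W: "W \<in> D" "dim_row W = m" and v: "v \<in> carrier_mat 1 m" and y: "y \<in> carrier_vec m"
  shows "kernel_fun D (k_kernel_tensor_id Q\<^sub>0) W v y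
    = rk_fun D Q\<^sub>0 (\<Sum>l<m. \<Sum>b<m. v $$ (0, b) *\<^sub>C l2_tensor (y $ l) (kvec (Q\<^sub>0 W) b l))"
  unfolding kernel_fun_def rk_fun_def
proof (rule restrict_ext)
  fix Z assume Z: "Z \<in> D"
  let ?n = "dim_row Z"
  show "mat ?n ?n (\<lambda>(i, j). vector_to_cblinfun (op_apply (k_kernel_tensor_id Q\<^sub>0 Z W (mat_of_cols ?n [unit_vec ?n j] * v)) y $ i))
    = mat ?n ?n (\<lambda>(i, j). vector_to_cblinfun (contract (kvec (Q\<^sub>0 Z) j i)
       (\<Sum>l<m. \<Sum>b<m. v $$ (0, b) *\<^sub>C l2_tensor (y $ l) (kvec (Q\<^sub>0 W) b l))))"
  proof (rule eq_matI; clarsimp)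
    fix i j assume ij: "i < ?n" "j < ?n"
    let ?P = "mat_of_cols ?n [unit_vec ?n j] * v"
    have P: "?P \<in> carrier_mat ?n m"
      using v by auto
    have Pab: "?P $$ (a, b) = (if a = j then v $$ (0, b) else 0)" if "a < ?n" "b < m" for a b
      using that v ij by (simp add: scalar_prod_def mat_of_cols_def)
    have k: "k_kernel Q\<^sub>0 Z W ?P $$ (i, l) = (\<Sum>b<m. v $$ (0, b) * cinner (kvec (Q\<^sub>0 W) b l) (kvec (Q\<^sub>0 Z) j i))"
      if "l < m" for l
    proof -
      have "k_kernel Q\<^sub>0 Z W ?P $$ (i, l)
          = (\<Sum>a<?n. \<Sum>b<m. ?P $$ (a, b) * cinner (kvec (Q\<^sub>0 W) b l) (kvec (Q\<^sub>0 Z) a i))"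
        by (rule k_kernel_index) (use Q [OF Z] Q [OF W(1)] W(2) P that ij in auto)
      also have "\<dots> = (\<Sum>a<?n. if a = j then (\<Sum>b<m. v $$ (0, b) * cinner (kvec (Q\<^sub>0 W) b l) (kvec (Q\<^sub>0 Z) a i)) else 0)"
        by (rule sum.cong [OF refl]) (auto simp: Pab simp del: index_mult_mat)
      finally show ?thesis
        using ij by simp
    qed
    have "op_apply (k_kernel_tensor_id Q\<^sub>0 Z W ?P) y $ i = (\<Sum>l<m. k_kernel Q\<^sub>0 Z W ?P $$ (i, l) *\<^sub>C (y $ l))"
      using ij W(2) by (simp add: k_kernel_tensor_id_def k_kernel_def)
    also have "\<dots> = contract (kvec (Q\<^sub>0 Z) j i) (\<Sum>l<m. \<Sum>b<m. v $$ (0, b) *\<^sub>C l2_tensor (y $ l) (kvec (Q\<^sub>0 W) b l))"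
      by (simp add: k cblinfun_sum cblinfun_scale contract_l2_tensor scaleC_scaleC sum_scaleC_left)
    finally show "vector_to_cblinfun (op_apply (k_kernel_tensor_id Q\<^sub>0 Z W ?P) y $ i)
        = vector_to_cblinfun (contract (kvec (Q\<^sub>0 Z) j i) (\<Sum>l<m. \<Sum>b<m. v $$ (0, b) *\<^sub>C l2_tensor (y $ l) (kvec (Q\<^sub>0 W) b l)))"
      by simp
  qed
qed

definition rk_elem :: "('r::chilbert_space \<Rightarrow>\<^sub>C\<^sub>L complex) mat \<Rightarrow> nat \<Rightarrow> (nat \<Rightarrow> complex) \<Rightarrow> (nat \<Rightarrow> 'h::chilbert_space)
    \<Rightarrow> ((nat, 'r fock) l2, 'h) l2" where
  "rk_elem Q m v y = (\<Sum>l<m. \<Sum>b<m. v b *\<^sub>C l2_tensor (y l) (kvec Q b l))"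

lemma rk_fun_reproducing:
  fixes y :: "'h::chilbert_space vec" and v :: "complex mat"
  assumes W: "W \<in> D" "dim_row W = m" and v: "v \<in> carrier_mat 1 m" and y: "y \<in> carrier_vec m"
  shows "vec_cinner (op_apply (rk_fun D Q\<^sub>0 \<xi> W) (col (conj_transpose v) 0)) y
    = cinner \<xi> (rk_elem (Q\<^sub>0 W) m (\<lambda>b. v $$ (0, b)) (\<lambda>l. y $ l))"
proof -
  have fW: "dim_row (rk_fun D Q\<^sub>0 \<xi> W) = m" "dim_col (rk_fun D Q\<^sub>0 \<xi> W) = m"
    using W by (simp_all add: rk_fun_def)
  have "vec_cinner (op_apply (rk_fun D Q\<^sub>0 \<xi> W) (col (conj_transpose v) 0)) y
      = (\<Sum>i<m. \<Sum>j<m. cnj (v $$ (0, j)) * cinner ((rk_fun D Q\<^sub>0 \<xi> W $$ (i, j)) 1) (y $ i))"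
    using v unfolding vec_cinner_def dim_op fW
    by (intro sum.cong refl)
      (simp add: fW conj_transpose_def cinner_sum_left cinner_scaleC_left
        cblinfun_complex_apply [of "rk_fun D Q\<^sub>0 \<xi> W $$ _" "cnj _"])
  also have "\<dots> = (\<Sum>i<m. \<Sum>j<m. cnj (v $$ (0, j)) * cinner \<xi> (l2_tensor (y $ i) (kvec (Q\<^sub>0 W) j i)))"
    by (intro sum.cong refl) (simp add: rk_fun_apply W)
  finally show ?thesis
    by (simp add: rk_elem_def cinner_sum_right cinner_scaleC_right)
qed

lemma rk_is_nc_rkhs:
  fixes Q\<^sub>0 :: "'v::complex_vector mat \<Rightarrow> ('r::chilbert_space \<Rightarrow>\<^sub>C\<^sub>L complex) mat"
  assumes Q: "\<And>Z. Z \<in> D \<Longrightarrow> strict_row_contraction (dim_row Z) (Q\<^sub>0 Z)" and nc: "nc_function D Q\<^sub>0"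
  shows "is_nc_rkhs D (k_kernel_tensor_id Q\<^sub>0)
    (rk_fun D Q\<^sub>0 ` (rk_space D Q\<^sub>0 :: ((nat, 'r fock) l2, 'h::chilbert_space) l2 set)) (rk_inner D Q\<^sub>0)"
  unfolding is_nc_rkhs_def
proof (intro conjI ballI rk_hilbert_space Q nc)
  fix W and v :: "complex mat" and y :: "'h vec"
  assume W: "W \<in> D" and v: "v \<in> carrier_mat 1 (dim_row W)" and y: "y \<in> carrier_vec (dim_row W)"
  let ?m = "dim_row W"
  define \<eta> where "\<eta> = rk_elem (Q\<^sub>0 W) ?m (\<lambda>b. v $$ (0, b)) (\<lambda>l. y $ l)"
  have kf: "kernel_fun D (k_kernel_tensor_id Q\<^sub>0) W v y = rk_fun D Q\<^sub>0 \<eta>"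
    unfolding \<eta>_def rk_elem_def by (rule kernel_fun_eq_rk_fun [OF Q W refl v y])
  have \<eta>: "\<eta> \<in> rk_space D Q\<^sub>0"
    unfolding \<eta>_def rk_elem_def
  proof (intro rk_space_sum rk_space_scale)
    fix l b assume "l \<in> {..<?m}" "b \<in> {..<?m}"
    then show "l2_tensor (y $ l) (kvec (Q\<^sub>0 W) b l) \<in> rk_space D Q\<^sub>0"
      using rk_space_vec [of D Q\<^sub>0 "(W, b, l, y $ l)"] W by (simp add: rk_vec_def)
  qed
  then show "kernel_fun D (k_kernel_tensor_id Q\<^sub>0) W v y \<in> rk_fun D Q\<^sub>0 ` rk_space D Q\<^sub>0"
    unfolding kf by blast
  fix f :: "('v, 'h) nc_fun" assume "f \<in> rk_fun D Q\<^sub>0 ` rk_space D Q\<^sub>0"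
  then obtain \<xi> where \<xi>: "\<xi> \<in> rk_space D Q\<^sub>0" "f = rk_fun D Q\<^sub>0 \<xi>"
    by blast
  then show "vec_cinner (op_apply (f W) (col (conj_transpose v) 0)) y
      = rk_inner D Q\<^sub>0 f (kernel_fun D (k_kernel_tensor_id Q\<^sub>0) W v y)"
    using rk_fun_reproducing [OF W refl v y, of Q\<^sub>0 \<xi>] \<eta> by (simp add: kf \<eta>_def rk_inner_fun)
qed

section \<open>Transfer functions are contractive multipliers\<close>

lemma transfer_function_column:
  fixes t :: "'r::chilbert_space \<Rightarrow> 'x::chilbert_space \<Rightarrow> 't::chilbert_space"
    and A :: "'x \<Rightarrow>\<^sub>C\<^sub>L 't" and B :: "'u::chilbert_space \<Rightarrow>\<^sub>C\<^sub>L 't"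
    and C :: "'x \<Rightarrow>\<^sub>C\<^sub>L 'y::chilbert_space" and D :: "'u \<Rightarrow>\<^sub>C\<^sub>L 'y"
  assumes t: "hilbert_tensor t" and U: "contractive (colligation A B C D)" and Q: "strict_row_contraction n Q"
    and V: "\<And>i. i < n \<Longrightarrow> colligation_adjoint A B C D (\<Sum>l<n. t (riesz_mat Q l i) (x l), y i) = (x i, u i)"
    and j: "j < n"
  shows "(\<Sum>i<n. cinner ((transfer_function t A B C D Q $$ (i, j)) w) (y i)) = cinner w (u j)"
proof -
  let ?v = "\<lambda>m. if m = j then w else 0"
  have v: "(\<Sum>m<n. (T m) (?v m)) = T j w" for T :: "nat \<Rightarrow> 'u \<Rightarrow>\<^sub>C\<^sub>L 'y"
    using j by simp
  have "(\<Sum>i<n. cinner (\<Sum>m<n. (transfer_function t A B C D Q $$ (i, m)) (?v m)) (y i)) = (\<Sum>i<n. cinner (?v i) (u i))"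
  proof (rule transfer_function_adjoint [OF t contractive_colligation_state [OF U] Q])
    show "cinner (colligation A B C D (z, w)) (\<Sum>l<n. t (riesz_mat Q l i) (x l), y i) = cinner (z, w) (x i, u i)"
      if "i < n" for i z w
      by (simp add: colligation_adjoint(1) [OF U] V that)
  qed
  also have "\<dots> = (\<Sum>i<n. if i = j then cinner w (u i) else 0)"
    by (intro sum.cong refl) simp
  finally show ?thesis
    using j by (simp add: v)
qed

text \<open>In adjoint form: a solution of the state equations at Z', for \<open>y\<close> placed at
  \<open>i\<close>, is pulled back by the conjugated entries of \<alpha> to a solution at Z. By
  \<open>transfer_function_column\<close> any solution computes the adjoint of S, so the two sides
  can be compared.\<close>

lemma transfer_function_nc_function:
  fixes t :: "'r::chilbert_space \<Rightarrow> 'x::chilbert_space \<Rightarrow> 't::chilbert_space"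
    and A :: "'x \<Rightarrow>\<^sub>C\<^sub>L 't" and B :: "'u::chilbert_space \<Rightarrow>\<^sub>C\<^sub>L 't"
    and C :: "'x \<Rightarrow>\<^sub>C\<^sub>L 'y::chilbert_space" and D :: "'u \<Rightarrow>\<^sub>C\<^sub>L 'y"
  assumes t: "hilbert_tensor t" and U: "contractive (colligation A B C D)"
    and Q: "\<And>Z. Z \<in> \<Delta> \<Longrightarrow> strict_row_contraction (dim_row Z) (Q\<^sub>0 Z)" and nc: "nc_function \<Delta> Q\<^sub>0"
  shows "nc_function \<Delta> (\<lambda>Z. transfer_function t A B C D (Q\<^sub>0 Z))"
  unfolding nc_function_def
proof (intro conjI ballI impI)
  note car = transfer_function_apply(1) [OF t contractive_colligation_state [OF U] Q]
  show "graded_function \<Delta> (\<lambda>Z. transfer_function t A B C D (Q\<^sub>0 Z))"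
    unfolding graded_function_def using car by blast
  fix Z Z' \<alpha>
  assume Z: "Z \<in> \<Delta>" "Z' \<in> \<Delta>" and \<alpha>: "\<alpha> \<in> carrier_mat (dim_row Z') (dim_row Z)" "\<alpha> \<bullet>\<^sub>l Z = Z' \<bullet>\<^sub>r \<alpha>"
  let ?n = "dim_row Z" and ?n' = "dim_row Z'"
  let ?S = "transfer_function t A B C D (Q\<^sub>0 Z)" and ?S' = "transfer_function t A B C D (Q\<^sub>0 Z')"
  let ?V = "colligation_adjoint A B C D"
  note pt = pretensor_hilbert_tensor [OF t]
  have eq: "\<alpha> \<bullet>\<^sub>l Q\<^sub>0 Z = Q\<^sub>0 Z' \<bullet>\<^sub>r \<alpha>"
    using nc Z \<alpha> by (auto simp: nc_function_def)
  have Qc: "Q\<^sub>0 Z \<in> carrier_mat ?n ?n" "Q\<^sub>0 Z' \<in> carrier_mat ?n' ?n'"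
    using Q Z by (auto simp: strict_row_contraction_def)
  have S: "?S \<in> carrier_mat ?n ?n" "?S' \<in> carrier_mat ?n' ?n'"
    using car Z by blast+
  show "\<alpha> \<bullet>\<^sub>l ?S = ?S' \<bullet>\<^sub>r \<alpha>"
  proof (rule eq_matI)
    fix i j assume "i < dim_row (?S' \<bullet>\<^sub>r \<alpha>)" "j < dim_col (?S' \<bullet>\<^sub>r \<alpha>)"
    then have ij: "i < ?n'" "j < ?n"
      using S \<alpha> by (auto simp: cmat_times_right_def)
    have "((\<alpha> \<bullet>\<^sub>l ?S) $$ (i, j)) w = ((?S' \<bullet>\<^sub>r \<alpha>) $$ (i, j)) w" for w
    proof (rule cinner_eqI)
      fix y :: 'y
      define y' where "y' k = (if k = i then y else 0)" for k
      obtain x' u' where x': "\<And>k. k < ?n' \<Longrightarrow>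
          ?V (\<Sum>l<?n'. t (riesz_mat (Q\<^sub>0 Z') l k) (x' l), y' k) = (x' k, u' k)"
        by (rule colligation_adjoint_solve [OF t U Q [OF Z(2)], of y']) blast
      define T' where "T' k = (\<Sum>l<?n'. t (riesz_mat (Q\<^sub>0 Z') l k) (x' l))" for k
      define x where "x k = (\<Sum>i'<?n'. cnj (\<alpha> $$ (i', k)) *\<^sub>C x' i')" for k
      define u where "u k = (\<Sum>i'<?n'. cnj (\<alpha> $$ (i', k)) *\<^sub>C u' i')" for k
      \<comment> \<open>Pulling back by \<alpha> commutes with Q^* \<otimes> I, by the intertwining
        of \<open>Q\<^sub>0\<close>.\<close>
      have T: "(\<Sum>l<?n. t (riesz_mat (Q\<^sub>0 Z) l k) (x l)) = (\<Sum>j'<?n'. cnj (\<alpha> $$ (j', k)) *\<^sub>C T' j')"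
        if "k < ?n" for k
      proof -
        have "(\<Sum>l<?n. t (riesz_mat (Q\<^sub>0 Z) l k) (x l))
            = (\<Sum>l<?n. \<Sum>i'<?n'. t (cnj (\<alpha> $$ (i', l)) *\<^sub>C riesz_mat (Q\<^sub>0 Z) l k) (x' i'))"
          by (simp add: x_def pretensor_sum_right [OF pt] pretensor_scale_left [OF pt] pretensor_scale_right [OF pt])
        also have "\<dots> = (\<Sum>i'<?n'. \<Sum>l<?n. t (cnj (\<alpha> $$ (i', l)) *\<^sub>C riesz_mat (Q\<^sub>0 Z) l k) (x' i'))"
          by (rule sum.swap)
        also have "\<dots> = (\<Sum>i'<?n'. t (\<Sum>j'<?n'. cnj (\<alpha> $$ (j', k)) *\<^sub>C riesz_mat (Q\<^sub>0 Z') i' j') (x' i'))"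
          by (intro sum.cong refl)
            (simp add: riesz_mat_intertwine [OF Qc \<alpha>(1) eq that] flip: pretensor_sum_left [OF pt])
        also have "\<dots> = (\<Sum>i'<?n'. \<Sum>j'<?n'. cnj (\<alpha> $$ (j', k)) *\<^sub>C t (riesz_mat (Q\<^sub>0 Z') i' j') (x' i'))"
          by (simp add: pretensor_sum_left [OF pt] pretensor_scale_left [OF pt])
        also have "\<dots> = (\<Sum>j'<?n'. \<Sum>i'<?n'. cnj (\<alpha> $$ (j', k)) *\<^sub>C t (riesz_mat (Q\<^sub>0 Z') i' j') (x' i'))"
          by (rule sum.swap)
        finally show ?thesis
          by (simp add: T'_def sum_scaleC_right)
      qed
      have y'_sum: "(\<Sum>j'<?n'. cnj (\<alpha> $$ (j', k)) *\<^sub>C y' j') = cnj (\<alpha> $$ (i, k)) *\<^sub>C y" for k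
      proof -
        have "(\<Sum>j'<?n'. cnj (\<alpha> $$ (j', k)) *\<^sub>C y' j') = (\<Sum>j'<?n'. if j' = i then cnj (\<alpha> $$ (j', k)) *\<^sub>C y else 0)"
          by (intro sum.cong refl) (simp add: y'_def)
        then show ?thesis using ij by simp
      qed
      have sum_pair: "(\<Sum>s\<in>F. (f s, g s)) = (sum f F, sum g F)"
        for f :: "nat \<Rightarrow> 'e::comm_monoid_add" and g :: "nat \<Rightarrow> 'f::comm_monoid_add" and F
        by (induction F rule: infinite_finite_induct) (auto simp: zero_prod_def)
      have "?V (\<Sum>l<?n. t (riesz_mat (Q\<^sub>0 Z) l k) (x l), cnj (\<alpha> $$ (i, k)) *\<^sub>C y) = (x k, u k)"
        if "k < ?n" for k
      proof -
        have "?V (\<Sum>l<?n. t (riesz_mat (Q\<^sub>0 Z) l k) (x l), cnj (\<alpha> $$ (i, k)) *\<^sub>C y)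
            = ?V (\<Sum>j'<?n'. cnj (\<alpha> $$ (j', k)) *\<^sub>C (T' j', y' j'))"
          unfolding T [OF that] y'_sum [symmetric] sum_pair [symmetric] by (simp add: scaleC_prod_def)
        also have "\<dots> = (\<Sum>j'<?n'. cnj (\<alpha> $$ (j', k)) *\<^sub>C (x' j', u' j'))"
          by (simp add: cblinfun_sum cblinfun_scale x' T'_def)
        finally show ?thesis
          unfolding x_def u_def sum_pair [symmetric] by (simp add: scaleC_prod_def)
      qed
      from transfer_function_column [OF t U Q [OF Z(1)] this ij(2), of w]
      have 1: "(\<Sum>k<?n. cinner ((?S $$ (k, j)) w) (cnj (\<alpha> $$ (i, k)) *\<^sub>C y)) = cinner w (u j)" .
      have 2: "cinner ((?S' $$ (i, l)) w) y = cinner w (u' l)" if "l < ?n'" for l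
      proof -
        have "(\<Sum>k<?n'. cinner ((?S' $$ (k, l)) w) (y' k)) = (\<Sum>k<?n'. if k = i then cinner ((?S' $$ (k, l)) w) y else 0)"
          by (intro sum.cong refl) (simp add: y'_def)
        then show ?thesis
          using transfer_function_column [OF t U Q [OF Z(2)] x' that, of w] ij by simp
      qed
      have "cinner (((\<alpha> \<bullet>\<^sub>l ?S) $$ (i, j)) w) y = (\<Sum>k<?n. cinner ((?S $$ (k, j)) w) (cnj (\<alpha> $$ (i, k)) *\<^sub>C y))"
        using S \<alpha> ij by (simp add: cmat_times_left_def cinner_sum_left cinner_scaleC_left cinner_scaleC_right)
      also have "\<dots> = (\<Sum>l<?n'. \<alpha> $$ (l, j) * cinner w (u' l))"
        unfolding 1 by (simp add: u_def cinner_sum_right cinner_scaleC_right)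
      also have "\<dots> = cinner (((?S' \<bullet>\<^sub>r \<alpha>) $$ (i, j)) w) y"
        using S \<alpha> ij by (simp add: cmat_times_right_def cinner_sum_left cinner_scaleC_left 2)
      finally show "cinner (((\<alpha> \<bullet>\<^sub>l ?S) $$ (i, j)) w) y = cinner (((?S' \<bullet>\<^sub>r \<alpha>) $$ (i, j)) w) y" .
    qed
    then show "(\<alpha> \<bullet>\<^sub>l ?S) $$ (i, j) = (?S' \<bullet>\<^sub>r \<alpha>) $$ (i, j)"
      by (rule cblinfun_eqI)
  qed (use S \<alpha> in \<open>auto simp: cmat_times_left_def cmat_times_right_def\<close>)
qed

text \<open>Second Stein equation with states attached: replacing x by its image under Q^* \<otimes>
  I lowers the Gram form by \<langle>x i, x' k\<rangle>, the part of degree 0.\<close>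

lemma kvec_tensor_pair:
  assumes Q: "strict_row_contraction n Q" and R: "strict_row_contraction m R" and t: "pretensor t"
    and ix: "i < n" "k < m"
  shows "cinner (\<Sum>l<n. l2_tensor (\<Sum>p<n. t (riesz_mat Q p l) (x p)) (kvec Q i l))
      (\<Sum>l<m. l2_tensor (\<Sum>p<m. t (riesz_mat R p l) (x' p)) (kvec R k l))
    = cinner (\<Sum>l<n. l2_tensor (x l) (kvec Q i l)) (\<Sum>l<m. l2_tensor (x' l) (kvec R k l)) - cinner (x i) (x' k)"
proof -
  let ?r = "\<lambda>p l p' l'. cinner (riesz_mat Q p l) (riesz_mat R p' l')"
  let ?k = "\<lambda>l l'. cinner (kvec Q i l) (kvec R k l')"
  let ?x = "\<lambda>p p'. cinner (x p) (x' p')"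
  note pl = pretensor_l2_tensor
  have "cinner (\<Sum>l<n. l2_tensor (\<Sum>p<n. t (riesz_mat Q p l) (x p)) (kvec Q i l))
      (\<Sum>l<m. l2_tensor (\<Sum>p<m. t (riesz_mat R p l) (x' p)) (kvec R k l))
      = (\<Sum>l<n. \<Sum>l'<m. \<Sum>p<n. \<Sum>p'<m. ?x p p' * (?k l l' * ?r p l p' l'))"
    unfolding cinner_pretensor_sum [OF pl] cinner_pretensor_sum [OF t]
    by (intro sum.cong refl) (simp add: sum_distrib_left sum_distrib_right mult_ac)
  also have "\<dots> = (\<Sum>p<n. \<Sum>l<n. \<Sum>l'<m. \<Sum>p'<m. ?x p p' * (?k l l' * ?r p l p' l'))"
    by (rule sum_swap_mult)
  also have "\<dots> = (\<Sum>p<n. \<Sum>p'<m. \<Sum>l<n. \<Sum>l'<m. ?x p p' * (?k l l' * ?r p l p' l'))"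
    by (rule sum.cong [OF refl], rule sum_swap_mult)
  also have "\<dots> = (\<Sum>p<n. \<Sum>p'<m. ?x p p' * ?k p p' - (if p = i then if p' = k then ?x p p' else 0 else 0))"
  proof (intro sum.cong refl)
    fix p p' assume "p \<in> {..<n}" "p' \<in> {..<m}"
    then have "?k p p' = (if i = p \<and> k = p' then 1 else 0) + (\<Sum>l<n. \<Sum>l'<m. ?k l l' * ?r p l p' l')"
      using ix by (intro kvec_Stein(2) [OF Q R]) auto
    then show "(\<Sum>l<n. \<Sum>l'<m. ?x p p' * (?k l l' * ?r p l p' l'))
        = ?x p p' * ?k p p' - (if p = i then if p' = k then ?x p p' else 0 else 0)"
      by (simp add: distrib_left flip: sum_distrib_left)
  qed
  also have "\<dots> = (\<Sum>p<n. \<Sum>p'<m. ?x p p' * ?k p p') - ?x i k"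
    using ix by (simp only: sum_subtractf sum_delta2)
  finally show ?thesis
    by (simp only: cinner_pretensor_sum [OF pl])
qed

lemma norm_sum_l2_tensor_Pair:
  "(norm (\<Sum>s\<in>A. l2_tensor (x s, u s) (g s)))\<^sup>2
    = (norm (\<Sum>s\<in>A. l2_tensor (x s) (g s)))\<^sup>2 + (norm (\<Sum>s\<in>A. l2_tensor (u s) (g s)))\<^sup>2"
proof -
  note pl = pretensor_l2_tensor
  have "cinner (\<Sum>s\<in>A. l2_tensor (x s, u s) (g s)) (\<Sum>s\<in>A. l2_tensor (x s, u s) (g s))
    = cinner (\<Sum>s\<in>A. l2_tensor (x s) (g s)) (\<Sum>s\<in>A. l2_tensor (x s) (g s))
      + cinner (\<Sum>s\<in>A. l2_tensor (u s) (g s)) (\<Sum>s\<in>A. l2_tensor (u s) (g s))"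
    unfolding cinner_pretensor_sum [OF pl] by (simp add: cinner_prod_def distrib_right sum.distrib)
  then have "complex_of_real ((norm (\<Sum>s\<in>A. l2_tensor (x s, u s) (g s)))\<^sup>2)
    = of_real ((norm (\<Sum>s\<in>A. l2_tensor (x s) (g s)))\<^sup>2 + (norm (\<Sum>s\<in>A. l2_tensor (u s) (g s)))\<^sup>2)"
    by (simp only: cinner_self of_real_add)
  then show ?thesis
    using of_real_eq_iff by blast
qed

text \<open>The contraction V amplifies to \<parallel>X\<parallel>^2 + \<parallel>u\<parallel>^2
  \<le> \<parallel>T\<parallel>^2 + \<parallel>y\<parallel>^2 for the tensored sums. By the Stein
  identity \<parallel>T\<parallel> \<le> \<parallel>X\<parallel>, so the state terms drop
  out.\<close>

lemma norm_l2_tensor_multiplier: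
  fixes V :: "('t::chilbert_space \<times> 'y::chilbert_space) \<Rightarrow>\<^sub>C\<^sub>L ('x::chilbert_space \<times> 'u::chilbert_space)"
    and I :: "nat set"
  assumes V: "\<And>z. norm (V z) \<le> norm z" and t: "pretensor t" and I: "finite I"
    and Q: "\<And>s. s \<in> I \<Longrightarrow> strict_row_contraction (m s) (Q s)" "\<And>s. s \<in> I \<Longrightarrow> i s < m s"
    and x: "\<And>s l. s \<in> I \<Longrightarrow> l < m s \<Longrightarrow> V (\<Sum>p<m s. t (riesz_mat (Q s) p l) (x s p), y s l) = (x s l, u s l)"
  shows "norm (\<Sum>s\<in>I. \<Sum>l<m s. l2_tensor (u s l) (kvec (Q s) (i s) l))
    \<le> norm (\<Sum>s\<in>I. \<Sum>l<m s. l2_tensor (y s l) (kvec (Q s) (i s) l))"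
proof -
  define T where "T s l = (\<Sum>p<m s. t (riesz_mat (Q s) p l) (x s p))" for s l
  define A where "A = Sigma I (\<lambda>s. {..<m s})"
  define g where "g = (\<lambda>(s, l). kvec (Q s) (i s) l)"
  have fold: "(\<Sum>s\<in>I. \<Sum>l<m s. l2_tensor (f s l) (kvec (Q s) (i s) l))
      = (\<Sum>a\<in>A. l2_tensor (case_prod f a) (g a))" for f :: "nat \<Rightarrow> nat \<Rightarrow> 'h::chilbert_space"
    unfolding A_def g_def using I by (subst sum.Sigma) (auto simp: case_prod_unfold)
  have "(\<Sum>a\<in>A. l2_tensor (case_prod x a, case_prod u a) (g a))
      = (\<Sum>a\<in>A. l2_tensor (V (case_prod T a, case_prod y a)) (g a))"
    by (rule sum.cong [OF refl]) (auto simp: A_def T_def x)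
  also have "norm \<dots> \<le> norm (\<Sum>a\<in>A. l2_tensor (case_prod T a, case_prod y a) (g a))"
    by (rule norm_tensor_contraction) (simp_all add: cblinfun_add cblinfun_scale V)
  finally have "(norm (\<Sum>a\<in>A. l2_tensor (case_prod x a, case_prod u a) (g a)))\<^sup>2
      \<le> (norm (\<Sum>a\<in>A. l2_tensor (case_prod T a, case_prod y a) (g a)))\<^sup>2"
    by (rule power_mono) simp
  then have 1: "(norm (\<Sum>s\<in>I. \<Sum>l<m s. l2_tensor (x s l) (kvec (Q s) (i s) l)))\<^sup>2
      + (norm (\<Sum>s\<in>I. \<Sum>l<m s. l2_tensor (u s l) (kvec (Q s) (i s) l)))\<^sup>2
    \<le> (norm (\<Sum>s\<in>I. \<Sum>l<m s. l2_tensor (T s l) (kvec (Q s) (i s) l)))\<^sup>2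
      + (norm (\<Sum>s\<in>I. \<Sum>l<m s. l2_tensor (y s l) (kvec (Q s) (i s) l)))\<^sup>2"
    unfolding norm_sum_l2_tensor_Pair fold .
  let ?X = "\<lambda>s. \<Sum>l<m s. l2_tensor (x s l) (kvec (Q s) (i s) l)"
  let ?T = "\<lambda>s. \<Sum>l<m s. l2_tensor (T s l) (kvec (Q s) (i s) l)"
  have "cinner (\<Sum>s\<in>I. ?T s) (\<Sum>s\<in>I. ?T s) = (\<Sum>s\<in>I. \<Sum>s'\<in>I. cinner (?T s) (?T s'))"
    by (subst cinner_sum_left) (simp only: cinner_sum_right)
  also have "\<dots> = (\<Sum>s\<in>I. \<Sum>s'\<in>I. cinner (?X s) (?X s') - cinner (x s (i s)) (x s' (i s')))"
    unfolding T_def by (intro sum.cong refl) (rule kvec_tensor_pair [OF Q(1) Q(1) t Q(2) Q(2)])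
  also have "\<dots> = cinner (\<Sum>s\<in>I. ?X s) (\<Sum>s\<in>I. ?X s) - cinner (\<Sum>s\<in>I. x s (i s)) (\<Sum>s\<in>I. x s (i s))"
    by (subst (1 2) cinner_sum_left) (simp only: cinner_sum_right sum_subtractf)
  finally have "complex_of_real ((norm (\<Sum>s\<in>I. ?T s))\<^sup>2)
      = of_real ((norm (\<Sum>s\<in>I. ?X s))\<^sup>2 - (norm (\<Sum>s\<in>I. x s (i s)))\<^sup>2)"
    by (simp only: cinner_self of_real_diff)
  then have "(norm (\<Sum>s\<in>I. ?T s))\<^sup>2 = (norm (\<Sum>s\<in>I. ?X s))\<^sup>2 - (norm (\<Sum>s\<in>I. x s (i s)))\<^sup>2"
    using of_real_eq_iff by blast
  then have "(norm (\<Sum>s\<in>I. ?T s))\<^sup>2 \<le> (norm (\<Sum>s\<in>I. ?X s))\<^sup>2"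
    using zero_le_power2 [of "norm (\<Sum>s\<in>I. x s (i s))"] by linarith
  with 1 have "(norm (\<Sum>s\<in>I. \<Sum>l<m s. l2_tensor (u s l) (kvec (Q s) (i s) l)))\<^sup>2
      \<le> (norm (\<Sum>s\<in>I. \<Sum>l<m s. l2_tensor (y s l) (kvec (Q s) (i s) l)))\<^sup>2"
    by linarith
  then show ?thesis
    by (rule power2_le_imp_le) simp
qed

text \<open>The adjoint of M_S is prescribed on kernel vectors and shown to be contractive on their
  combinations; M_S \<xi> is then the solution of a moment problem in the closed span of the kernel
  vectors.\<close>

theorem transfer_function_contractive_multiplier:
  fixes Q\<^sub>0 :: "'v::complex_vector mat \<Rightarrow> ('r::chilbert_space \<Rightarrow>\<^sub>C\<^sub>L complex) mat"
    and t :: "'r \<Rightarrow> 'x::chilbert_space \<Rightarrow> 't::chilbert_space"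
    and A :: "'x \<Rightarrow>\<^sub>C\<^sub>L 't" and B :: "'u::chilbert_space \<Rightarrow>\<^sub>C\<^sub>L 't"
    and C :: "'x \<Rightarrow>\<^sub>C\<^sub>L 'y::chilbert_space" and D :: "'u \<Rightarrow>\<^sub>C\<^sub>L 'y"
  assumes t: "hilbert_tensor t" and U: "contractive (colligation A B C D)"
    and Q: "\<And>Z. Z \<in> \<Delta> \<Longrightarrow> strict_row_contraction (dim_row Z) (Q\<^sub>0 Z)" and nc: "nc_function \<Delta> Q\<^sub>0"
  shows "contractive_multiplier \<Delta> (k_kernel_tensor_id Q\<^sub>0) (k_kernel_tensor_id Q\<^sub>0)
    (\<lambda>Z. transfer_function t A B C D (Q\<^sub>0 Z))"
proof -
  define S where "S Z = transfer_function t A B C D (Q\<^sub>0 Z)" for Z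
  let ?V = "colligation_adjoint A B C D"
  have car: "S Z \<in> carrier_mat (dim_row Z) (dim_row Z)" if "Z \<in> \<Delta>" for Z
    unfolding S_def by (rule transfer_function_apply(1) [OF t contractive_colligation_state [OF U] Q [OF that]])
  \<comment> \<open>The value that the adjoint of M_S must take on \<open>rk_vec\<close>: S(W)^* y
    in place of y.\<close>
  define q where "q = (\<lambda>(W, i, j, y). if W \<in> \<Delta> \<and> i < dim_row W \<and> j < dim_row W
     then \<Sum>l<dim_row W. l2_tensor (cadjoint (S W $$ (j, l)) y) (kvec (Q\<^sub>0 W) i l) else 0)"
  have le: "norm (lincomb q cs) \<le> norm (lincomb (rk_vec \<Delta> Q\<^sub>0) cs)" for cs
  proof -
    define W where "W s = fst (snd (cs ! s))" for s
    define i where "i s = fst (snd (snd (cs ! s)))" for s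
    define j where "j s = fst (snd (snd (snd (cs ! s))))" for s
    define y where "y s = fst (cs ! s) *\<^sub>C snd (snd (snd (snd (cs ! s))))" for s
    \<comment> \<open>Labels outside the domain stand for zero vectors and are dropped; the scalar
      coefficient has been absorbed into \<open>y\<close>.\<close>
    define I where "I = {s \<in> {..<length cs}. W s \<in> \<Delta> \<and> i s < dim_row (W s) \<and> j s < dim_row (W s)}"
    define Y where "Y s l = (if l = j s then y s else 0)" for s l
    have "\<exists>x u. s \<in> I \<longrightarrow> (\<forall>l<dim_row (W s). ?V (\<Sum>p<dim_row (W s). t (riesz_mat (Q\<^sub>0 (W s)) p l) (x p), Y s l) = (x l, u l))"
      for s
    proof (cases "s \<in> I")
      case True
      then have "strict_row_contraction (dim_row (W s)) (Q\<^sub>0 (W s))"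
        by (simp add: I_def Q)
      then show ?thesis
        by (rule colligation_adjoint_solve [OF t U, of _ _ "Y s"]) blast
    qed simp
    then obtain x u where xu: "\<And>s l. s \<in> I \<Longrightarrow> l < dim_row (W s) \<Longrightarrow>
        ?V (\<Sum>p<dim_row (W s). t (riesz_mat (Q\<^sub>0 (W s)) p l) (x s p), Y s l) = (x s l, u s l)"
      by metis
    have u: "u s l = cadjoint (S (W s) $$ (j s, l)) (y s)" if s: "s \<in> I" and l: "l < dim_row (W s)" for s l
    proof (rule cinner_eqI_right)
      fix w
      have Qs: "strict_row_contraction (dim_row (W s)) (Q\<^sub>0 (W s))"
        using s by (simp add: I_def Q)
      have "cinner w (u s l) = (\<Sum>k<dim_row (W s). cinner ((S (W s) $$ (k, l)) w) (Y s k))"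
        unfolding S_def by (rule transfer_function_column [OF t U Qs xu [OF s] l, symmetric])
      also have "\<dots> = (\<Sum>k<dim_row (W s). if k = j s then cinner ((S (W s) $$ (k, l)) w) (y s) else 0)"
        by (intro sum.cong refl) (simp add: Y_def)
      also have "\<dots> = cinner w (cadjoint (S (W s) $$ (j s, l)) (y s))"
        using s by (simp add: I_def cinner_cadjoint)
      finally show "cinner w (u s l) = cinner w (cadjoint (S (W s) $$ (j s, l)) (y s))" .
    qed
    note sc = pretensor_scale_left [OF pretensor_l2_tensor]
    have restr: "(\<Sum>s<length cs. f s) = (\<Sum>s\<in>I. f s)" if "\<And>s. s < length cs \<Longrightarrow> s \<notin> I \<Longrightarrow> f s = 0"
      for f :: "nat \<Rightarrow> ((nat, 'r fock) l2, 'h::chilbert_space) l2"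
      by (rule sum.mono_neutral_right) (use that in \<open>auto simp: I_def\<close>)
    have idx: "snd (cs ! s) = (W s, i s, j s, snd (snd (snd (snd (cs ! s)))))" for s
      by (simp add: W_def i_def j_def)
    have 1: "lincomb q cs = (\<Sum>s\<in>I. \<Sum>l<dim_row (W s). l2_tensor (u s l) (kvec (Q\<^sub>0 (W s)) (i s) l))"
    proof -
      have "lincomb q cs = (\<Sum>s\<in>I. fst (cs ! s) *\<^sub>C q (snd (cs ! s)))"
        unfolding lincomb_eq_sum by (rule restr, subst idx) (auto simp: q_def I_def)
      also have "\<dots> = (\<Sum>s\<in>I. \<Sum>l<dim_row (W s). l2_tensor (u s l) (kvec (Q\<^sub>0 (W s)) (i s) l))"
      proof (rule sum.cong [OF refl])
        fix s assume s: "s \<in> I"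
        then show "fst (cs ! s) *\<^sub>C q (snd (cs ! s)) = (\<Sum>l<dim_row (W s). l2_tensor (u s l) (kvec (Q\<^sub>0 (W s)) (i s) l))"
          by (subst idx) (simp add: q_def I_def u [OF s] y_def cblinfun_scale sc flip: sum_scaleC_right)
      qed
      finally show ?thesis .
    qed
    have 2: "lincomb (rk_vec \<Delta> Q\<^sub>0) cs = (\<Sum>s\<in>I. \<Sum>l<dim_row (W s). l2_tensor (Y s l) (kvec (Q\<^sub>0 (W s)) (i s) l))"
    proof -
      have "lincomb (rk_vec \<Delta> Q\<^sub>0) cs = (\<Sum>s\<in>I. fst (cs ! s) *\<^sub>C rk_vec \<Delta> Q\<^sub>0 (snd (cs ! s)))"
        unfolding lincomb_eq_sum by (rule restr, subst idx) (auto simp: rk_vec_def I_def)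
      also have "\<dots> = (\<Sum>s\<in>I. \<Sum>l<dim_row (W s). l2_tensor (Y s l) (kvec (Q\<^sub>0 (W s)) (i s) l))"
      proof (rule sum.cong [OF refl])
        fix s assume s: "s \<in> I"
        have "(\<Sum>l<dim_row (W s). l2_tensor (Y s l) (kvec (Q\<^sub>0 (W s)) (i s) l))
            = (\<Sum>l<dim_row (W s). if l = j s then l2_tensor (y s) (kvec (Q\<^sub>0 (W s)) (i s) l) else 0)"
          by (intro sum.cong refl) (simp add: Y_def pretensor_zero [OF pretensor_l2_tensor])
        also have "\<dots> = l2_tensor (y s) (kvec (Q\<^sub>0 (W s)) (i s) (j s))"
          using s by (simp add: I_def)
        finally show "fst (cs ! s) *\<^sub>C rk_vec \<Delta> Q\<^sub>0 (snd (cs ! s)) = (\<Sum>l<dim_row (W s). l2_tensor (Y s l) (kvec (Q\<^sub>0 (W s)) (i s) l))"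
          using s by (subst idx) (simp add: rk_vec_def I_def y_def sc)
      qed
      finally show ?thesis .
    qed
    show ?thesis
      unfolding 1 2
      by (rule norm_l2_tensor_multiplier [OF colligation_adjoint(2) [OF U] pretensor_hilbert_tensor [OF t] _ _ _ xu])
        (auto simp: I_def Q)
  qed
  have mult: "\<exists>\<eta>\<in>rk_space \<Delta> Q\<^sub>0. (\<lambda>W\<in>\<Delta>. S W \<odot> rk_fun \<Delta> Q\<^sub>0 \<xi> W) = rk_fun \<Delta> Q\<^sub>0 \<eta> \<and> norm \<eta> \<le> norm \<xi>" for \<xi>
  proof -
    have "cmod (lincomb (\<lambda>s. cinner (q s) \<xi>) cs) \<le> norm \<xi> * norm (lincomb (rk_vec \<Delta> Q\<^sub>0) cs)" for cs
      unfolding lincomb_cinner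
      using Cauchy_Schwarz_cinner [of "lincomb q cs" \<xi>] mult_right_mono [OF le [of cs], of "norm \<xi>"]
      by (simp add: mult.commute)
    then obtain \<eta> where \<eta>: "\<eta> \<in> rk_space \<Delta> Q\<^sub>0" "norm \<eta> \<le> norm \<xi>" "\<And>s. cinner (rk_vec \<Delta> Q\<^sub>0 s) \<eta> = cinner (q s) \<xi>"
      using moment_problem [of "norm \<xi>" "\<lambda>s. cinner (q s) \<xi>" "rk_vec \<Delta> Q\<^sub>0"]
      unfolding rk_space_def by (metis norm_ge_zero)
    have "(\<lambda>W\<in>\<Delta>. S W \<odot> rk_fun \<Delta> Q\<^sub>0 \<xi> W) = rk_fun \<Delta> Q\<^sub>0 \<eta>"
    proof (rule ext)
      fix W
      show "(\<lambda>W\<in>\<Delta>. S W \<odot> rk_fun \<Delta> Q\<^sub>0 \<xi> W) W = rk_fun \<Delta> Q\<^sub>0 \<eta> W"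
      proof (cases "W \<in> \<Delta>")
        case W: True
        have d: "dim_row (rk_fun \<Delta> Q\<^sub>0 \<zeta> W) = dim_row W" "dim_col (rk_fun \<Delta> Q\<^sub>0 \<zeta> W) = dim_row W"
          for \<zeta> :: "((nat, 'r fock) l2, 'h::chilbert_space) l2"
          using W by (simp_all add: rk_fun_def)
        have "S W \<odot> rk_fun \<Delta> Q\<^sub>0 \<xi> W = rk_fun \<Delta> Q\<^sub>0 \<eta> W"
        proof (rule eq_matI)
          fix j i assume "j < dim_row (rk_fun \<Delta> Q\<^sub>0 \<eta> W)" "i < dim_col (rk_fun \<Delta> Q\<^sub>0 \<eta> W)"
          then have ij: "j < dim_row W" "i < dim_row W"
            by (simp_all add: d)
          show "(S W \<odot> rk_fun \<Delta> Q\<^sub>0 \<xi> W) $$ (j, i) = rk_fun \<Delta> Q\<^sub>0 \<eta> W $$ (j, i)"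
          proof (rule cblinfun_complex_eqI, rule cinner_eqI)
            fix y
            have "cinner (((S W \<odot> rk_fun \<Delta> Q\<^sub>0 \<xi> W) $$ (j, i)) 1) y
                = (\<Sum>l<dim_row W. cinner ((rk_fun \<Delta> Q\<^sub>0 \<xi> W $$ (l, i)) 1) (cadjoint (S W $$ (j, l)) y))"
              using ij car [OF W] by (simp add: index_op_times d cinner_sum_left cinner_cadjoint)
            also have "\<dots> = (\<Sum>l<dim_row W. cinner \<xi> (l2_tensor (cadjoint (S W $$ (j, l)) y) (kvec (Q\<^sub>0 W) i l)))"
              by (intro sum.cong refl) (simp add: rk_fun_apply W ij)
            also have "\<dots> = cinner \<xi> (q (W, i, j, y))"
              using W ij by (simp add: q_def cinner_sum_right)
            also have "\<dots> = cinner \<eta> (rk_vec \<Delta> Q\<^sub>0 (W, i, j, y))"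
              using \<eta>(3) [of "(W, i, j, y)"] by (metis cinner_commute)
            also have "\<dots> = cinner ((rk_fun \<Delta> Q\<^sub>0 \<eta> W $$ (j, i)) 1) y"
              using W ij by (simp add: rk_vec_def rk_fun_apply)
            finally show "cinner (((S W \<odot> rk_fun \<Delta> Q\<^sub>0 \<xi> W) $$ (j, i)) 1) y = cinner ((rk_fun \<Delta> Q\<^sub>0 \<eta> W $$ (j, i)) 1) y" .
          qed
        qed (use car [OF W] in \<open>auto simp: d\<close>)
        then show ?thesis
          using W by simp
      qed (simp add: rk_fun_def)
    qed
    with \<eta> show ?thesis by blast
  qed
  show ?thesis
    unfolding contractive_multiplier_def S_def [symmetric]
  proof (intro conjI exI)
    show "nc_function \<Delta> S"
      unfolding S_def by (rule transfer_function_nc_function [OF t U Q nc])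
    show "is_nc_rkhs \<Delta> (k_kernel_tensor_id Q\<^sub>0) (rk_fun \<Delta> Q\<^sub>0 ` (rk_space \<Delta> Q\<^sub>0 :: ((nat, 'r fock) l2, 'u) l2 set)) (rk_inner \<Delta> Q\<^sub>0)"
      "is_nc_rkhs \<Delta> (k_kernel_tensor_id Q\<^sub>0) (rk_fun \<Delta> Q\<^sub>0 ` (rk_space \<Delta> Q\<^sub>0 :: ((nat, 'r fock) l2, 'y) l2 set)) (rk_inner \<Delta> Q\<^sub>0)"
      by (rule rk_is_nc_rkhs [OF Q nc], assumption)+
    show "\<forall>f\<in>rk_fun \<Delta> Q\<^sub>0 ` rk_space \<Delta> Q\<^sub>0. (\<lambda>W\<in>\<Delta>. S W \<odot> f W) \<in> rk_fun \<Delta> Q\<^sub>0 ` rk_space \<Delta> Q\<^sub>0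
        \<and> Re (rk_inner \<Delta> Q\<^sub>0 (\<lambda>W\<in>\<Delta>. S W \<odot> f W) (\<lambda>W\<in>\<Delta>. S W \<odot> f W)) \<le> Re (rk_inner \<Delta> Q\<^sub>0 f f)"
    proof
      fix f :: "('v, 'u) nc_fun" assume "f \<in> rk_fun \<Delta> Q\<^sub>0 ` rk_space \<Delta> Q\<^sub>0"
      then obtain \<xi> where \<xi>: "\<xi> \<in> rk_space \<Delta> Q\<^sub>0" "f = rk_fun \<Delta> Q\<^sub>0 \<xi>"
        by blast
      obtain \<eta> where \<eta>: "\<eta> \<in> rk_space \<Delta> Q\<^sub>0" "(\<lambda>W\<in>\<Delta>. S W \<odot> f W) = rk_fun \<Delta> Q\<^sub>0 \<eta>" "norm \<eta> \<le> norm \<xi>"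
        using mult [of \<xi>] \<xi>(2) by blast
      have "(norm \<eta>)\<^sup>2 \<le> (norm \<xi>)\<^sup>2"
        using \<eta>(3) by (rule power_mono) simp
      then show "(\<lambda>W\<in>\<Delta>. S W \<odot> f W) \<in> rk_fun \<Delta> Q\<^sub>0 ` rk_space \<Delta> Q\<^sub>0
        \<and> Re (rk_inner \<Delta> Q\<^sub>0 (\<lambda>W\<in>\<Delta>. S W \<odot> f W) (\<lambda>W\<in>\<Delta>. S W \<odot> f W)) \<le> Re (rk_inner \<Delta> Q\<^sub>0 f f)"
        unfolding \<eta>(2) using \<xi> \<eta>(1) by (simp add: rk_inner_fun cinner_self)
    qed
  qed
qed

section \<open>Contractive multipliers are pointwise contractive\<close>

lemma op_apply_times:
  assumes "dim_col M = dim_row N"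
  shows "op_apply (M \<odot> N) x = op_apply M (op_apply N x)"
proof (rule eq_vecI)
  fix i assume "i < dim_vec (op_apply M (op_apply N x))"
  then have i: "i < dim_row M" by simp
  have "op_apply (M \<odot> N) x $ i = (\<Sum>j<dim_col N. \<Sum>k<dim_row N. (M $$ (i, k)) ((N $$ (k, j)) (x $ j)))"
    using i by (simp add: index_op_times)
  also have "\<dots> = (\<Sum>k<dim_row N. \<Sum>j<dim_col N. (M $$ (i, k)) ((N $$ (k, j)) (x $ j)))"
    by (rule sum.swap)
  also have "\<dots> = op_apply M (op_apply N x) $ i"
    using i assms by (simp add: cblinfun_sum)
  finally show "op_apply (M \<odot> N) x $ i = op_apply M (op_apply N x) $ i" .
qed simp

lemma vec_cinner_op_adjoint:
  assumes "dim_vec x = dim_col M" "dim_vec y = dim_row M"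
  shows "vec_cinner (op_apply M x) y = vec_cinner x (op_apply (op_adjoint M) y)"
  using assms unfolding vec_cinner_def
  by (simp add: sum_cinner_swap [where g = "\<lambda>i j. cadjoint (M $$ (i, j)) (y $ i)"] cinner_cadjoint)

text \<open>These are the entries of I - Q Q^* in terms of Riesz vectors.\<close>

definition defect :: "('r::chilbert_space \<Rightarrow>\<^sub>C\<^sub>L complex) mat \<Rightarrow> nat \<Rightarrow> nat \<Rightarrow> nat \<Rightarrow> complex" where
  "defect Q m i j = (if i = j then 1 else 0) - (\<Sum>c<m. cinner (riesz_mat Q j c) (riesz_mat Q i c))"

lemma sum_defect:
  "(\<Sum>i<m. \<Sum>j<m. f i j * defect Q m i j) = (\<Sum>i<m. f i i)
      - (\<Sum>c<m. \<Sum>i<m. \<Sum>j<m. f i j * cinner (riesz_mat Q j c) (riesz_mat Q i c))"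
proof -
  have "(\<Sum>i<m. \<Sum>j<m. f i j * defect Q m i j) = (\<Sum>i<m. \<Sum>j<m. (if i = j then f i j else 0))
    - (\<Sum>i<m. \<Sum>j<m. \<Sum>c<m. f i j * cinner (riesz_mat Q j c) (riesz_mat Q i c))"
    unfolding sum_subtractf [symmetric]
    by (intro sum.cong refl) (simp add: defect_def right_diff_distrib sum_distrib_left)
  also have "(\<Sum>i<m. \<Sum>j<m. \<Sum>c<m. f i j * cinner (riesz_mat Q j c) (riesz_mat Q i c))
      = (\<Sum>c<m. \<Sum>i<m. \<Sum>j<m. f i j * cinner (riesz_mat Q j c) (riesz_mat Q i c))"
    by (rule sum_swap_mult)
  finally show ?thesis by simp
qed

lemma defect_factorization:
  assumes Q: "strict_row_contraction m Q"
  obtains v :: "nat \<Rightarrow> nat \<Rightarrow> complex"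
  where "\<And>i j. i < m \<Longrightarrow> j < m \<Longrightarrow> defect Q m i j = (\<Sum>s<m. v s j * cnj (v s i))"
proof -
  obtain q where q: "0 \<le> q" "q < 1" "column_bound m (riesz_mat Q) q"
    using Q by (auto simp: strict_row_contraction_def)
  have psd: "0 \<le> (\<Sum>i<m. \<Sum>j<m. c i * cnj (c j) * defect Q m i j)" for c
  proof -
    define N where "N j = (norm (\<Sum>i<m. cnj (c i) *\<^sub>C riesz_mat Q i j))\<^sup>2" for j
    have "(\<Sum>i<m. \<Sum>j<m. c i * cnj (c j) * cinner (riesz_mat Q j k) (riesz_mat Q i k)) = of_real (N k)" for k
    proof -
      have "(\<Sum>i<m. \<Sum>j<m. c i * cnj (c j) * cinner (riesz_mat Q j k) (riesz_mat Q i k))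
          = (\<Sum>j<m. \<Sum>i<m. c i * cnj (c j) * cinner (riesz_mat Q j k) (riesz_mat Q i k))"
        by (rule sum.swap)
      also have "\<dots> = cinner (\<Sum>i<m. cnj (c i) *\<^sub>C riesz_mat Q i k) (\<Sum>i<m. cnj (c i) *\<^sub>C riesz_mat Q i k)"
        unfolding cinner_sum_sum by (simp add: mult_ac)
      finally show ?thesis
        by (simp only: cinner_self N_def)
    qed
    then have "(\<Sum>i<m. \<Sum>j<m. c i * cnj (c j) * defect Q m i j) = (\<Sum>i<m. c i * cnj (c i)) - (\<Sum>k<m. of_real (N k))"
      unfolding sum_defect by simp
    also have "\<dots> = of_real ((\<Sum>i<m. (cmod (c i))\<^sup>2) - (\<Sum>k<m. N k))"
      by (simp add: complex_norm_square del: of_real_power)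
    also have "0 \<le> \<dots>"
    proof -
      have "(\<Sum>k<m. N k) \<le> q\<^sup>2 * (\<Sum>i<m. (cmod (cnj (c i)))\<^sup>2)"
        using q(3) [unfolded column_bound_def, rule_format, of "\<lambda>i. cnj (c i)"] by (simp add: N_def)
      also have "\<dots> \<le> 1 * (\<Sum>i<m. (cmod (cnj (c i)))\<^sup>2)"
        using q by (intro mult_right_mono sum_nonneg) (auto simp: power_le_one)
      finally show ?thesis
        by (simp add: less_eq_complex_def)
    qed
    finally show ?thesis .
  qed
  obtain J where J: "\<And>i j. i < m \<Longrightarrow> j < m \<Longrightarrow> defect Q m i j = (\<Sum>s<m. J i s * cnj (J j s))"
    by (rule psd_factorization [OF psd]) blast
  \<comment> \<open>The conjugate suits \<open>rk_elem\<close>, in which the coefficients enter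
    linearly.\<close>
  show thesis
    by (rule that [of "\<lambda>s b. cnj (J b s)"]) (simp add: J mult.commute)
qed

text \<open>Since \<open>k(Z, Z)(I - Q Q\<^sup>*) = I\<close>.\<close>

lemma sum_norm_rk_elem:
  fixes y :: "nat \<Rightarrow> 'h::chilbert_space"
  assumes Q: "strict_row_contraction m Q"
    and v: "\<And>i j. i < m \<Longrightarrow> j < m \<Longrightarrow> defect Q m i j = (\<Sum>s<m. v s j * cnj (v s i))"
  shows "(\<Sum>s<m. (norm (rk_elem Q m (v s) y))\<^sup>2) = (\<Sum>l<m. (norm (y l))\<^sup>2)"
proof -
  define G where "G b = (\<Sum>l<m. l2_tensor (y l) (kvec Q b l))" for b
  have rk: "rk_elem Q m w y = (\<Sum>b<m. w b *\<^sub>C G b)" for w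
    unfolding rk_elem_def G_def sum_scaleC_right [symmetric] by (rule sum.swap)
  have pairs: "cinner (G b) (G j) = (\<Sum>l<m. \<Sum>i<m. cinner (y l) (y i) * cinner (kvec Q b l) (kvec Q j i))" for b j
    unfolding G_def by (rule cinner_pretensor_sum [OF pretensor_l2_tensor])
  have "of_real (\<Sum>s<m. (norm (rk_elem Q m (v s) y))\<^sup>2)
      = (\<Sum>s<m. cinner (\<Sum>b<m. v s b *\<^sub>C G b) (\<Sum>b<m. v s b *\<^sub>C G b))"
    by (simp add: rk cinner_self)
  also have "\<dots> = (\<Sum>s<m. \<Sum>b<m. \<Sum>j<m. v s b * cnj (v s j) * cinner (G b) (G j))"
    unfolding cinner_sum_sum ..
  also have "\<dots> = (\<Sum>b<m. \<Sum>j<m. \<Sum>s<m. v s b * cnj (v s j) * cinner (G b) (G j))"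
    by (rule sum_swap_mult [symmetric])
  also have "\<dots> = (\<Sum>b<m. \<Sum>j<m. cinner (G b) (G j) * defect Q m j b)"
    by (intro sum.cong refl) (simp add: v sum_distrib_left mult_ac)
  also have "\<dots> = (\<Sum>j<m. \<Sum>b<m. cinner (G b) (G j) * defect Q m j b)"
    by (rule sum.swap)
  also have "\<dots> = (\<Sum>c<m. cinner (G c) (G c)
      - (\<Sum>j<m. \<Sum>b<m. cinner (G b) (G j) * cinner (riesz_mat Q b c) (riesz_mat Q j c)))"
    unfolding sum_defect sum_subtractf ..
  \<comment> \<open>For each c the first Stein equation leaves only \<parallel>y c\<parallel>^2 from
    the squared norm of \<open>G c\<close>.\<close>
  also have "\<dots> = (\<Sum>c<m. cinner (y c) (y c))"
  proof (rule sum.cong [OF refl])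
    fix c assume "c \<in> {..<m}"
    then have c: "c < m" by simp
    have "(\<Sum>j<m. \<Sum>b<m. cinner (G b) (G j) * cinner (riesz_mat Q b c) (riesz_mat Q j c))
        = (\<Sum>j<m. \<Sum>b<m. \<Sum>l<m. \<Sum>i<m. cinner (y l) (y i) * (cinner (riesz_mat Q b c) (riesz_mat Q j c) * cinner (kvec Q b l) (kvec Q j i)))"
      by (simp add: pairs sum_distrib_left sum_distrib_right mult_ac)
    also have "\<dots> = (\<Sum>l<m. \<Sum>j<m. \<Sum>b<m. \<Sum>i<m. cinner (y l) (y i) * (cinner (riesz_mat Q b c) (riesz_mat Q j c) * cinner (kvec Q b l) (kvec Q j i)))"
      by (rule sum_swap_mult)
    also have "\<dots> = (\<Sum>l<m. \<Sum>i<m. \<Sum>j<m. \<Sum>b<m. cinner (y l) (y i) * (cinner (riesz_mat Q b c) (riesz_mat Q j c) * cinner (kvec Q b l) (kvec Q j i)))"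
      by (rule sum.cong [OF refl], rule sum_swap_mult)
    also have "\<dots> = (\<Sum>l<m. \<Sum>i<m. \<Sum>b<m. \<Sum>j<m. cinner (y l) (y i) * (cinner (riesz_mat Q b c) (riesz_mat Q j c) * cinner (kvec Q b l) (kvec Q j i)))"
      by (rule sum.cong [OF refl], rule sum.cong [OF refl], rule sum.swap)
    also have "\<dots> = (\<Sum>l<m. \<Sum>i<m. cinner (y l) (y i) * cinner (kvec Q c l) (kvec Q c i)
        - (if l = c then if i = c then cinner (y l) (y i) else 0 else 0))"
    proof (intro sum.cong refl)
      fix l i assume "l \<in> {..<m}" "i \<in> {..<m}"
      then have "cinner (kvec Q c l) (kvec Q c i) = (if c = l \<and> c = i then 1 else 0)
        + (\<Sum>b<m. \<Sum>j<m. cinner (riesz_mat Q b c) (riesz_mat Q j c) * cinner (kvec Q b l) (kvec Q j i))"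
        using c by (intro kvec_Stein(1) [OF Q Q]) auto
      then show "(\<Sum>b<m. \<Sum>j<m. cinner (y l) (y i) * (cinner (riesz_mat Q b c) (riesz_mat Q j c) * cinner (kvec Q b l) (kvec Q j i)))
        = cinner (y l) (y i) * cinner (kvec Q c l) (kvec Q c i) - (if l = c then if i = c then cinner (y l) (y i) else 0 else 0)"
        by (simp add: distrib_left flip: sum_distrib_left)
    qed
    also have "\<dots> = cinner (G c) (G c) - cinner (y c) (y c)"
      using c by (simp only: sum_subtractf sum_delta2 pairs)
    finally show "cinner (G c) (G c) - (\<Sum>j<m. \<Sum>b<m. cinner (G b) (G j) * cinner (riesz_mat Q b c) (riesz_mat Q j c))
        = cinner (y c) (y c)"
      by simp
  qed
  also have "\<dots> = of_real (\<Sum>l<m. (norm (y l))\<^sup>2)"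
    by (simp add: cinner_self)
  finally show ?thesis
    using of_real_eq_iff by blast
qed

text \<open>The adjoint of M_S takes the kernel function of y to that of S(W)^* y, so contractivity
  compares their norms; summing over the factors v of I - Q Q^* reduces these to \<parallel>S(W)^*
  y\<parallel> and \<parallel>y\<parallel>. The spaces H and H' are only known to exist, so norms
  are evaluated through the reproducing property.\<close>

lemma contractive_multiplier_pointwise:
  fixes S :: "'v::complex_vector mat \<Rightarrow> ('u::chilbert_space \<Rightarrow>\<^sub>C\<^sub>L 'y::chilbert_space) mat"
    and Q\<^sub>0 :: "'v mat \<Rightarrow> ('r::chilbert_space \<Rightarrow>\<^sub>C\<^sub>L complex) mat" and y :: "nat \<Rightarrow> 'y"
  assumes S: "contractive_multiplier D (k_kernel_tensor_id Q\<^sub>0) (k_kernel_tensor_id Q\<^sub>0) S"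
    and Q: "\<And>Z. Z \<in> D \<Longrightarrow> strict_row_contraction (dim_row Z) (Q\<^sub>0 Z)" and W: "W \<in> D" "dim_row W = m"
  shows "(\<Sum>i<m. (norm (\<Sum>k<m. cadjoint (S W $$ (k, i)) (y k)))\<^sup>2) \<le> (\<Sum>k<m. (norm (y k))\<^sup>2)"
proof -
  obtain H' ip' H ip where H': "is_nc_rkhs D (k_kernel_tensor_id Q\<^sub>0) H' ip'"
    and H: "is_nc_rkhs D (k_kernel_tensor_id Q\<^sub>0) H ip"
    and mult: "\<And>f. f \<in> H' \<Longrightarrow> (\<lambda>W\<in>D. S W \<odot> f W) \<in> H
        \<and> Re (ip (\<lambda>W\<in>D. S W \<odot> f W) (\<lambda>W\<in>D. S W \<odot> f W)) \<le> Re (ip' f f)"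
    and nc: "nc_function D S"
    using S unfolding contractive_multiplier_def by blast
  have SW: "S W \<in> carrier_mat m m"
    using nc W by (auto simp: nc_function_def graded_function_def)
  have QW: "strict_row_contraction m (Q\<^sub>0 W)"
    using Q [OF W(1)] W(2) by simp
  define yv where "yv = vec m y"
  define z where "z = op_apply (op_adjoint (S W)) yv"
  have yv: "yv \<in> carrier_vec m" and z: "z \<in> carrier_vec m"
    using SW by (auto simp: yv_def z_def op_apply_def)
  have le: "(norm (rk_elem (Q\<^sub>0 W) m v (\<lambda>l. z $ l)))\<^sup>2 \<le> (norm (rk_elem (Q\<^sub>0 W) m v (\<lambda>l. yv $ l)))\<^sup>2" for v
  proof -
    define vm where "vm = mat 1 m (\<lambda>(i, b). v b)"
    have vm: "vm \<in> carrier_mat 1 m" by (simp add: vm_def)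
    have vm_eq: "rk_elem (Q\<^sub>0 W) m (\<lambda>b. vm $$ (0, b)) w = rk_elem (Q\<^sub>0 W) m v w" for w :: "nat \<Rightarrow> 'h::chilbert_space"
      by (simp add: rk_elem_def vm_def)
    define g where "g = kernel_fun D (k_kernel_tensor_id Q\<^sub>0) W vm yv"
    define g' where "g' = kernel_fun D (k_kernel_tensor_id Q\<^sub>0) W vm z"
    define c where "c = col (conj_transpose vm) 0"
    have g: "g = rk_fun D Q\<^sub>0 (rk_elem (Q\<^sub>0 W) m v (\<lambda>l. yv $ l))"
      unfolding g_def rk_elem_def by (subst kernel_fun_eq_rk_fun [OF Q W vm yv]) (simp_all add: vm_def)
    have g': "g' = rk_fun D Q\<^sub>0 (rk_elem (Q\<^sub>0 W) m v (\<lambda>l. z $ l))"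
      unfolding g'_def rk_elem_def by (subst kernel_fun_eq_rk_fun [OF Q W vm z]) (simp_all add: vm_def)
    have gH: "g \<in> H" "\<And>f. f \<in> H \<Longrightarrow> vec_cinner (op_apply (f W) c) yv = ip f g"
      using H vm yv W unfolding is_nc_rkhs_def g_def c_def by blast+
    have g'H: "g' \<in> H'" "\<And>f. f \<in> H' \<Longrightarrow> vec_cinner (op_apply (f W) c) z = ip' f g'"
      using H' vm z W unfolding is_nc_rkhs_def g'_def c_def by blast+
    have gg: "ip g g = of_real ((norm (rk_elem (Q\<^sub>0 W) m v (\<lambda>l. yv $ l)))\<^sup>2)"
      unfolding gH(2) [OF gH(1), symmetric] c_def
      by (subst g, subst rk_fun_reproducing [OF W vm yv]) (simp only: vm_eq cinner_self)
    have g'g': "ip' g' g' = of_real ((norm (rk_elem (Q\<^sub>0 W) m v (\<lambda>l. z $ l)))\<^sup>2)"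
      unfolding g'H(2) [OF g'H(1), symmetric] c_def
      by (subst g', subst rk_fun_reproducing [OF W vm z]) (simp only: vm_eq cinner_self)
    \<comment> \<open>h = M_S g' satisfies \<langle>h, g\<rangle> = \<parallel>g'\<parallel>^2 and
      \<parallel>h\<parallel> \<le> \<parallel>g'\<parallel>. Expanding \<parallel>h -
      g\<parallel>^2 \<ge> 0 gives \<parallel>g'\<parallel> \<le> \<parallel>g\<parallel> without
      forming an adjoint on the abstract space.\<close>
    define h where "h = (\<lambda>W\<in>D. S W \<odot> g' W)"
    have h: "h \<in> H" "Re (ip h h) \<le> Re (ip' g' g')"
      using mult [OF g'H(1)] by (simp_all add: h_def)
    have hg: "ip h g = ip' g' g'"
    proof -
      have d: "dim_row (g' W) = m" "dim_col (g' W) = m"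
        using W by (simp_all add: g' rk_fun_def)
      have "ip h g = vec_cinner (op_apply (S W) (op_apply (g' W) c)) yv"
        using gH(2) [OF h(1)] W SW by (simp add: h_def op_apply_times d)
      also have "\<dots> = vec_cinner (op_apply (g' W) c) z"
        unfolding z_def by (rule vec_cinner_op_adjoint) (use SW yv d in auto)
      finally show ?thesis
        using g'H by simp
    qed
    have hs: "hilbert_space_of_nc_functions D H ip"
      using H by (simp add: is_nc_rkhs_def)
    have add: "\<And>f g h. f \<in> H \<Longrightarrow> g \<in> H \<Longrightarrow> h \<in> H \<Longrightarrow> ip (fun_add D f g) h = ip f h + ip g h"
      and scale: "\<And>c f g. f \<in> H \<Longrightarrow> g \<in> H \<Longrightarrow> ip (fun_scale D c f) g = c * ip f g"
      and herm: "\<And>f g. f \<in> H \<Longrightarrow> g \<in> H \<Longrightarrow> ip f g = cnj (ip g f)"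
      and pos: "\<And>f. f \<in> H \<Longrightarrow> 0 \<le> ip f f"
      and closed: "\<And>f g. f \<in> H \<Longrightarrow> g \<in> H \<Longrightarrow> fun_add D f g \<in> H" "\<And>c f. f \<in> H \<Longrightarrow> fun_scale D c f \<in> H"
      using hs unfolding hilbert_space_of_nc_functions_def by blast+
    define d where "d = fun_add D h (fun_scale D (-1) g)"
    have d: "d \<in> H"
      using h gH closed by (simp add: d_def)
    have dx: "ip d f = ip h f - ip g f" if "f \<in> H" for f
      using that h gH closed by (simp add: d_def add scale)
    have hd: "ip h d = cnj (ip h h - ip g h)"
      using herm [OF h(1) d] dx [OF h(1)] by simp
    have gd: "ip g d = cnj (ip h g - ip g g)"
      using herm [OF gH(1) d] dx [OF gH(1)] by simp
    have "Re (ip d d) = Re (ip h h) - Re (ip g h) - Re (ip h g) + Re (ip g g)"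
      unfolding dx [OF d] hd gd by simp
    moreover have "Re (ip g h) = Re (ip h g)"
      using herm [OF gH(1) h(1)] by simp
    moreover have "0 \<le> Re (ip d d)"
      using pos [OF d] by (simp add: less_eq_complex_def)
    ultimately have "Re (ip' g' g') \<le> Re (ip g g)"
      using h(2) hg by simp
    then show ?thesis
      by (simp add: gg g'g' del: of_real_power)
  qed
  obtain v :: "nat \<Rightarrow> nat \<Rightarrow> complex"
    where v: "\<And>i j. i < m \<Longrightarrow> j < m \<Longrightarrow> defect (Q\<^sub>0 W) m i j = (\<Sum>s<m. v s j * cnj (v s i))"
    by (rule defect_factorization [OF QW]) blast
  have "(\<Sum>l<m. (norm (z $ l))\<^sup>2) = (\<Sum>s<m. (norm (rk_elem (Q\<^sub>0 W) m (v s) (\<lambda>l. z $ l)))\<^sup>2)"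
    by (rule sum_norm_rk_elem [OF QW v, symmetric])
  also have "\<dots> \<le> (\<Sum>s<m. (norm (rk_elem (Q\<^sub>0 W) m (v s) (\<lambda>l. yv $ l)))\<^sup>2)"
    by (intro sum_mono le)
  also have "\<dots> = (\<Sum>l<m. (norm (yv $ l))\<^sup>2)"
    by (rule sum_norm_rk_elem [OF QW v])
  finally have "(\<Sum>l<m. (norm (z $ l))\<^sup>2) \<le> (\<Sum>l<m. (norm (yv $ l))\<^sup>2)" .
  then show ?thesis
    using SW by (simp add: z_def yv_def)
qed

section \<open>Direct sums and the full nc hull\<close>

lemma sum_lessThan_add: "(\<Sum>i<n + m. f i) = (\<Sum>i<n. f i) + (\<Sum>i<m. f (n + i))"
  for f :: "nat \<Rightarrow> 'a::comm_monoid_add" and m :: nat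
  by (induction m) (auto simp: add.assoc)

lemma dim_cmat_times [simp]:
  "dim_row (\<alpha> \<bullet>\<^sub>l Z) = dim_row \<alpha>" "dim_col (\<alpha> \<bullet>\<^sub>l Z) = dim_col Z"
  "dim_row (Z \<bullet>\<^sub>r \<beta>) = dim_row Z" "dim_col (Z \<bullet>\<^sub>r \<beta>) = dim_col \<beta>"
  by (simp_all add: cmat_times_left_def cmat_times_right_def)

lemma index_cmat_times:
  "i < dim_row \<alpha> \<Longrightarrow> j < dim_col Z \<Longrightarrow> (\<alpha> \<bullet>\<^sub>l Z) $$ (i, j) = (\<Sum>k<dim_row Z. \<alpha> $$ (i, k) *\<^sub>C Z $$ (k, j))"
  "i < dim_row Z \<Longrightarrow> j < dim_col \<beta> \<Longrightarrow> (Z \<bullet>\<^sub>r \<beta>) $$ (i, j) = (\<Sum>k<dim_col Z. \<beta> $$ (k, j) *\<^sub>C Z $$ (i, k))"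
  by (simp_all add: cmat_times_left_def cmat_times_right_def)

lemma dim_direct_sum [simp]:
  "dim_row (direct_sum Z W) = dim_row Z + dim_row W" "dim_col (direct_sum Z W) = dim_col Z + dim_col W"
  by (simp_all add: direct_sum_def)

lemma index_direct_sum:
  "i < dim_row Z + dim_row W \<Longrightarrow> j < dim_col Z + dim_col W \<Longrightarrow> direct_sum Z W $$ (i, j) =
    (if i < dim_row Z then if j < dim_col Z then Z $$ (i, j) else 0
     else if j < dim_col Z then 0 else W $$ (i - dim_row Z, j - dim_col Z))"
  by (auto simp: direct_sum_def)

lemma direct_sum_intertwine:
  assumes "\<alpha> \<bullet>\<^sub>l Z' = Z \<bullet>\<^sub>r \<alpha>" "\<beta> \<bullet>\<^sub>l W' = W \<bullet>\<^sub>r \<beta>"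
    and "\<alpha> \<in> carrier_mat (dim_row Z) (dim_row Z')" "\<beta> \<in> carrier_mat (dim_row W) (dim_row W')"
    and "square_mat Z" "square_mat W" "square_mat Z'" "square_mat W'"
  shows "direct_sum \<alpha> \<beta> \<bullet>\<^sub>l direct_sum Z' W' = direct_sum Z W \<bullet>\<^sub>r direct_sum \<alpha> \<beta>"
proof (rule eq_matI)
  fix i j
  assume "i < dim_row (direct_sum Z W \<bullet>\<^sub>r direct_sum \<alpha> \<beta>)" "j < dim_col (direct_sum Z W \<bullet>\<^sub>r direct_sum \<alpha> \<beta>)"
  then have ij: "i < dim_row Z + dim_row W" "j < dim_row Z' + dim_row W'"
    using assms by auto
  have 1: "(\<Sum>k<dim_row Z'. \<alpha> $$ (i, k) *\<^sub>C Z' $$ (k, j)) = (\<Sum>k<dim_row Z. \<alpha> $$ (k, j) *\<^sub>C Z $$ (i, k))"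
    if "i < dim_row Z" "j < dim_row Z'" for i j
    using arg_cong [OF assms(1), of "\<lambda>M. M $$ (i, j)"] that assms(3-) by (auto simp: index_cmat_times)
  have 2: "(\<Sum>k<dim_row W'. \<beta> $$ (i, k) *\<^sub>C W' $$ (k, j)) = (\<Sum>k<dim_row W. \<beta> $$ (k, j) *\<^sub>C W $$ (i, k))"
    if "i < dim_row W" "j < dim_row W'" for i j
    using arg_cong [OF assms(2), of "\<lambda>M. M $$ (i, j)"] that assms(3-) by (auto simp: index_cmat_times)
  show "(direct_sum \<alpha> \<beta> \<bullet>\<^sub>l direct_sum Z' W') $$ (i, j) = (direct_sum Z W \<bullet>\<^sub>r direct_sum \<alpha> \<beta>) $$ (i, j)"
    using ij assms
    by (cases "i < dim_row Z"; cases "j < dim_row Z'")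
      (simp_all add: index_cmat_times index_direct_sum sum_lessThan_add 1 2)
qed (use assms in auto)

definition incl1 :: "nat \<Rightarrow> nat \<Rightarrow> complex mat" where
  "incl1 n m = mat (n + m) n (\<lambda>(i, j). if i = j then 1 else 0)"

definition incl2 :: "nat \<Rightarrow> nat \<Rightarrow> complex mat" where
  "incl2 n m = mat (n + m) m (\<lambda>(i, j). if i = n + j then 1 else 0)"

lemma incl_carrier [simp]: "incl1 n m \<in> carrier_mat (n + m) n" "incl2 n m \<in> carrier_mat (n + m) m"
  by (simp_all add: incl1_def incl2_def)

lemma scaleC_if: "(if b then 1 else 0) *\<^sub>C x = (if b then x else 0)" for x :: "'a::complex_vector"
  by (simp add: scaleC_one)

lemma incl_times_left:
  assumes "M \<in> carrier_mat n p"
  shows "i < n + m \<Longrightarrow> j < p \<Longrightarrow> (incl1 n m \<bullet>\<^sub>l M) $$ (i, j) = (if i < n then M $$ (i, j) else 0)"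
    and "i < m + n \<Longrightarrow> j < p \<Longrightarrow> (incl2 m n \<bullet>\<^sub>l M) $$ (i, j) = (if i < m then 0 else M $$ (i - m, j))"
proof -
  assume ij: "i < n + m" "j < p"
  have "(incl1 n m \<bullet>\<^sub>l M) $$ (i, j) = (\<Sum>k<n. if i = k then M $$ (k, j) else 0)"
    using assms ij by (simp add: index_cmat_times incl1_def scaleC_if)
  then show "(incl1 n m \<bullet>\<^sub>l M) $$ (i, j) = (if i < n then M $$ (i, j) else 0)" by simp
next
  assume ij: "i < m + n" "j < p"
  have "(incl2 m n \<bullet>\<^sub>l M) $$ (i, j) = (\<Sum>k<n. if i = m + k then M $$ (k, j) else 0)"
    using assms ij by (simp add: index_cmat_times incl2_def scaleC_if)
  also have "\<dots> = (\<Sum>k<n. if k = i - m then if i < m then 0 else M $$ (k, j) else 0)"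
    by (intro sum.cong refl) auto
  finally show "(incl2 m n \<bullet>\<^sub>l M) $$ (i, j) = (if i < m then 0 else M $$ (i - m, j))"
    using ij by auto
qed

lemma times_incl_right:
  assumes "M \<in> carrier_mat p (n + m)" "i < p"
  shows "j < n \<Longrightarrow> (M \<bullet>\<^sub>r incl1 n m) $$ (i, j) = M $$ (i, j)"
    and "j < m \<Longrightarrow> (M \<bullet>\<^sub>r incl2 n m) $$ (i, j) = M $$ (i, n + j)"
  using assms by (simp_all add: index_cmat_times incl1_def incl2_def scaleC_if)

lemma incl_intertwine:
  assumes "square_mat Z" "square_mat W"
  shows "incl1 (dim_row Z) (dim_row W) \<bullet>\<^sub>l Z = direct_sum Z W \<bullet>\<^sub>r incl1 (dim_row Z) (dim_row W)"
    and "incl2 (dim_row Z) (dim_row W) \<bullet>\<^sub>l W = direct_sum Z W \<bullet>\<^sub>r incl2 (dim_row Z) (dim_row W)"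
proof -
  have Z: "Z \<in> carrier_mat (dim_row Z) (dim_row Z)" and W: "W \<in> carrier_mat (dim_row W) (dim_row W)"
    and D: "direct_sum Z W \<in> carrier_mat (dim_row Z + dim_row W) (dim_row Z + dim_row W)"
    using assms by auto
  show "incl1 (dim_row Z) (dim_row W) \<bullet>\<^sub>l Z = direct_sum Z W \<bullet>\<^sub>r incl1 (dim_row Z) (dim_row W)"
  proof (rule eq_matI)
    fix i j assume "i < dim_row (direct_sum Z W \<bullet>\<^sub>r incl1 (dim_row Z) (dim_row W))"
      "j < dim_col (direct_sum Z W \<bullet>\<^sub>r incl1 (dim_row Z) (dim_row W))"
    then have ij: "i < dim_row Z + dim_row W" "j < dim_row Z"
      by (simp_all add: incl1_def)
    then show "(incl1 (dim_row Z) (dim_row W) \<bullet>\<^sub>l Z) $$ (i, j) = (direct_sum Z W \<bullet>\<^sub>r incl1 (dim_row Z) (dim_row W)) $$ (i, j)"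
      using assms by (simp add: incl_times_left(1) [OF Z] times_incl_right(1) [OF D] index_direct_sum)
  qed (use assms in \<open>auto simp: incl1_def\<close>)
  show "incl2 (dim_row Z) (dim_row W) \<bullet>\<^sub>l W = direct_sum Z W \<bullet>\<^sub>r incl2 (dim_row Z) (dim_row W)"
  proof (rule eq_matI)
    fix i j assume "i < dim_row (direct_sum Z W \<bullet>\<^sub>r incl2 (dim_row Z) (dim_row W))"
      "j < dim_col (direct_sum Z W \<bullet>\<^sub>r incl2 (dim_row Z) (dim_row W))"
    then have ij: "i < dim_row Z + dim_row W" "j < dim_row W"
      by (simp_all add: incl2_def)
    then show "(incl2 (dim_row Z) (dim_row W) \<bullet>\<^sub>l W) $$ (i, j) = (direct_sum Z W \<bullet>\<^sub>r incl2 (dim_row Z) (dim_row W)) $$ (i, j)"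
      using assms by (simp add: incl_times_left(2) [OF W] times_incl_right(2) [OF D] index_direct_sum)
  qed (use assms in \<open>auto simp: incl2_def\<close>)
qed

lemma nc_functionD:
  assumes "nc_function D f"
  shows "Z \<in> D \<Longrightarrow> f Z \<in> carrier_mat (dim_row Z) (dim_row Z)"
    and "\<lbrakk>Z \<in> D; Z' \<in> D; \<alpha> \<in> carrier_mat (dim_row Z') (dim_row Z); \<alpha> \<bullet>\<^sub>l Z = Z' \<bullet>\<^sub>r \<alpha>\<rbrakk>
      \<Longrightarrow> \<alpha> \<bullet>\<^sub>l f Z = f Z' \<bullet>\<^sub>r \<alpha>"
  using assms by (auto simp: nc_function_def graded_function_def)

text \<open>The two inclusions intertwine each summand with the direct sum, which forces f to
  respect direct sums, one block of columns at a time.\<close>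

lemma nc_function_direct_sum:
  assumes f: "nc_function D f" and D: "Z \<in> D" "W \<in> D" "direct_sum Z W \<in> D" and sq: "square_mat Z" "square_mat W"
    and i: "i < dim_row Z + dim_row W"
  shows "j < dim_row Z \<Longrightarrow> f (direct_sum Z W) $$ (i, j) = (if i < dim_row Z then f Z $$ (i, j) else 0)"
    and "j < dim_row W \<Longrightarrow> f (direct_sum Z W) $$ (i, dim_row Z + j) = (if i < dim_row Z then 0 else f W $$ (i - dim_row Z, j))"
proof -
  have c: "f (direct_sum Z W) \<in> carrier_mat (dim_row Z + dim_row W) (dim_row Z + dim_row W)"
    using nc_functionD(1) [OF f D(3)] by simp
  have e1: "incl1 (dim_row Z) (dim_row W) \<bullet>\<^sub>l f Z = f (direct_sum Z W) \<bullet>\<^sub>r incl1 (dim_row Z) (dim_row W)"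
    by (rule nc_functionD(2) [OF f D(1) D(3) _ incl_intertwine(1) [OF sq]]) simp
  have e2: "incl2 (dim_row Z) (dim_row W) \<bullet>\<^sub>l f W = f (direct_sum Z W) \<bullet>\<^sub>r incl2 (dim_row Z) (dim_row W)"
    by (rule nc_functionD(2) [OF f D(2) D(3) _ incl_intertwine(2) [OF sq]]) simp
  show "f (direct_sum Z W) $$ (i, j) = (if i < dim_row Z then f Z $$ (i, j) else 0)" if "j < dim_row Z"
    using arg_cong [OF e1, of "\<lambda>M. M $$ (i, j)"] that i
    by (simp add: incl_times_left(1) [OF nc_functionD(1) [OF f D(1)]] times_incl_right(1) [OF c])
  show "f (direct_sum Z W) $$ (i, dim_row Z + j) = (if i < dim_row Z then 0 else f W $$ (i - dim_row Z, j))" if "j < dim_row W"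
    using arg_cong [OF e2, of "\<lambda>M. M $$ (i, j)"] that i
    by (simp add: incl_times_left(2) [OF nc_functionD(1) [OF f D(2)]] times_incl_right(2) [OF c])
qed

text \<open>The blocks decouple, and the larger of the two bounds is still below 1.\<close>

lemma strict_row_contraction_direct_sum:
  assumes f: "nc_function D Q\<^sub>0" and D: "Z \<in> D" "W \<in> D" "direct_sum Z W \<in> D" and sq: "square_mat Z" "square_mat W"
    and Z: "strict_row_contraction (dim_row Z) (Q\<^sub>0 Z)" and W: "strict_row_contraction (dim_row W) (Q\<^sub>0 W)"
  shows "strict_row_contraction (dim_row Z + dim_row W) (Q\<^sub>0 (direct_sum Z W))"
proof -
  let ?n = "dim_row Z" and ?m = "dim_row W"
  obtain p where p: "0 \<le> p" "p < 1" "column_bound ?n (riesz_mat (Q\<^sub>0 Z)) p"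
    using Z by (auto simp: strict_row_contraction_def)
  obtain q where q: "0 \<le> q" "q < 1" "column_bound ?m (riesz_mat (Q\<^sub>0 W)) q"
    using W by (auto simp: strict_row_contraction_def)
  have r0: "riesz 0 = 0"
    using riesz_scale [of 0 0] by simp
  note ent = nc_function_direct_sum [OF f D sq]
  have rho: "riesz_mat (Q\<^sub>0 (direct_sum Z W)) i j = (if i < ?n then riesz_mat (Q\<^sub>0 Z) i j else 0)"
    if "i < ?n + ?m" "j < ?n" for i j
    using ent(1) [OF that] by (simp add: riesz_mat_def r0)
  have rho': "riesz_mat (Q\<^sub>0 (direct_sum Z W)) i (?n + j) = (if i < ?n then 0 else riesz_mat (Q\<^sub>0 W) (i - ?n) j)"
    if "i < ?n + ?m" "j < ?m" for i j
    using ent(2) [OF that] by (simp add: riesz_mat_def r0)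
  have "column_bound (?n + ?m) (riesz_mat (Q\<^sub>0 (direct_sum Z W))) (max p q)"
    unfolding column_bound_def
  proof
    fix c :: "nat \<Rightarrow> complex"
    have mono: "p\<^sup>2 \<le> (max p q)\<^sup>2" "q\<^sup>2 \<le> (max p q)\<^sup>2"
      using p q by (auto intro!: power_mono)
    have "(\<Sum>j<?n + ?m. (norm (\<Sum>i<?n + ?m. c i *\<^sub>C riesz_mat (Q\<^sub>0 (direct_sum Z W)) i j))\<^sup>2)
        = (\<Sum>j<?n. (norm (\<Sum>i<?n. c i *\<^sub>C riesz_mat (Q\<^sub>0 Z) i j))\<^sup>2)
          + (\<Sum>j<?m. (norm (\<Sum>i<?m. c (?n + i) *\<^sub>C riesz_mat (Q\<^sub>0 W) i j))\<^sup>2)"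
      by (simp add: sum_lessThan_add rho rho')
    also have "\<dots> \<le> p\<^sup>2 * (\<Sum>i<?n. (cmod (c i))\<^sup>2) + q\<^sup>2 * (\<Sum>i<?m. (cmod (c (?n + i)))\<^sup>2)"
      using p(3) [unfolded column_bound_def, rule_format, of c]
        q(3) [unfolded column_bound_def, rule_format, of "\<lambda>i. c (?n + i)"] by (rule add_mono)
    also have "\<dots> \<le> (max p q)\<^sup>2 * (\<Sum>i<?n. (cmod (c i))\<^sup>2) + (max p q)\<^sup>2 * (\<Sum>i<?m. (cmod (c (?n + i)))\<^sup>2)"
      by (intro add_mono mult_right_mono mono sum_nonneg) auto
    also have "\<dots> = (max p q)\<^sup>2 * (\<Sum>i<?n + ?m. (cmod (c i))\<^sup>2)"
      by (simp add: sum_lessThan_add distrib_left)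
    finally show "(\<Sum>j<?n + ?m. (norm (\<Sum>i<?n + ?m. c i *\<^sub>C riesz_mat (Q\<^sub>0 (direct_sum Z W)) i j))\<^sup>2)
        \<le> (max p q)\<^sup>2 * (\<Sum>i<?n + ?m. (cmod (c i))\<^sup>2)" .
  qed
  moreover have "Q\<^sub>0 (direct_sum Z W) \<in> carrier_mat (?n + ?m) (?n + ?m)"
    using nc_functionD(1) [OF f D(3)] by simp
  ultimately show ?thesis
    unfolding strict_row_contraction_def using p q by (auto intro!: exI [of _ "max p q"])
qed

lemma nc_ball_iff:
  assumes "nc_function \<Xi> Q\<^sub>0"
  shows "Z \<in> nc_ball \<Xi> Q\<^sub>0 \<longleftrightarrow> Z \<in> \<Xi> \<and> strict_row_contraction (dim_row Z) (Q\<^sub>0 Z)"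
  using strict_row_contractionI [of "Q\<^sub>0 Z" "dim_row Z"] op_norm_less_1 [of "dim_row Z" "Q\<^sub>0 Z"]
    nc_functionD(1) [OF assms] by (auto simp: nc_ball_def)

section \<open>Direct sums of points of \<Omega> and the full nc hull\<close>

inductive_set dsums :: "'v::complex_vector mat set \<Rightarrow> 'v mat set" for \<Omega> where
  base: "Z \<in> \<Omega> \<Longrightarrow> Z \<in> dsums \<Omega>"
| sum: "Z \<in> dsums \<Omega> \<Longrightarrow> W \<in> dsums \<Omega> \<Longrightarrow> direct_sum Z W \<in> dsums \<Omega>"

lemma dsums_subset_full: "full_nc_subset \<Phi> \<Longrightarrow> \<Omega> \<subseteq> \<Phi> \<Longrightarrow> dsums \<Omega> \<subseteq> \<Phi>"
proof
  fix Z assume "full_nc_subset \<Phi>" "\<Omega> \<subseteq> \<Phi>" "Z \<in> dsums \<Omega>"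
  from this(3) show "Z \<in> \<Phi>"
    by induction (use \<open>full_nc_subset \<Phi>\<close> \<open>\<Omega> \<subseteq> \<Phi>\<close> in \<open>auto simp: full_nc_subset_def\<close>)
qed

lemma dsums_subset_hull: "dsums \<Omega> \<subseteq> full_nc_hull \<Xi> \<Omega>"
  unfolding full_nc_hull_def using dsums_subset_full by blast

lemma full_nc_square: "full_nc_subset \<Xi> \<Longrightarrow> Z \<in> \<Xi> \<Longrightarrow> square_mat Z"
  by (auto simp: full_nc_subset_def nc_space_def)

lemma dsums_subset_ball:
  assumes \<Xi>: "full_nc_subset \<Xi>" and nc: "nc_function \<Xi> Q\<^sub>0" and \<Omega>: "\<Omega> \<subseteq> nc_ball \<Xi> Q\<^sub>0"
  shows "dsums \<Omega> \<subseteq> nc_ball \<Xi> Q\<^sub>0"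
proof
  fix Z assume "Z \<in> dsums \<Omega>"
  then show "Z \<in> nc_ball \<Xi> Q\<^sub>0"
  proof induction
    case (sum Z W)
    then have Z: "Z \<in> \<Xi>" "W \<in> \<Xi>" and c: "strict_row_contraction (dim_row Z) (Q\<^sub>0 Z)" "strict_row_contraction (dim_row W) (Q\<^sub>0 W)"
      by (auto simp: nc_ball_iff [OF nc])
    then have "direct_sum Z W \<in> \<Xi>"
      using \<Xi> by (auto simp: full_nc_subset_def)
    then show ?case
      using strict_row_contraction_direct_sum [OF nc Z _ full_nc_square [OF \<Xi> Z(1)] full_nc_square [OF \<Xi> Z(2)] c]
      by (simp add: nc_ball_iff [OF nc])
  qed (use \<Omega> in blast)
qed

text \<open>Injectivity phrased with coefficient functions, ready for scalars obtained by testing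
  operator entries against vectors.\<close>

definition inj_cmat :: "complex mat \<Rightarrow> bool" where
  "inj_cmat \<alpha> \<longleftrightarrow> (\<forall>c. (\<forall>i<dim_row \<alpha>. (\<Sum>k<dim_col \<alpha>. \<alpha> $$ (i, k) * c k) = 0) \<longrightarrow> (\<forall>k<dim_col \<alpha>. c k = 0))"

lemma inj_cmat_iff:
  assumes \<alpha>: "\<alpha> \<in> carrier_mat n m"
  shows "inj_on (\<lambda>x. \<alpha> *\<^sub>v x) (carrier_vec m) \<longleftrightarrow> inj_cmat \<alpha>"
proof -
  have entry: "(\<alpha> *\<^sub>v x) $ i = (\<Sum>k<m. \<alpha> $$ (i, k) * x $ k)" if "i < n" "x \<in> carrier_vec m" for i x
    using \<alpha> that by (auto simp: scalar_prod_def atLeast0LessThan intro!: sum.cong)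
  show ?thesis
  proof
    assume inj: "inj_on (\<lambda>x. \<alpha> *\<^sub>v x) (carrier_vec m)"
    show "inj_cmat \<alpha>"
      unfolding inj_cmat_def
    proof (intro allI impI)
      fix c k assume c: "\<forall>i<dim_row \<alpha>. (\<Sum>k<dim_col \<alpha>. \<alpha> $$ (i, k) * c k) = 0" and k: "k < dim_col \<alpha>"
      have "\<alpha> *\<^sub>v vec m c = \<alpha> *\<^sub>v 0\<^sub>v m"
      proof (rule eq_vecI)
        fix i assume "i < dim_vec (\<alpha> *\<^sub>v 0\<^sub>v m)"
        then have i: "i < n" using \<alpha> by simp
        then show "(\<alpha> *\<^sub>v vec m c) $ i = (\<alpha> *\<^sub>v 0\<^sub>v m) $ i"
          using c \<alpha> by (simp add: entry del: index_mult_mat_vec)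
      qed simp
      then have "vec m c = 0\<^sub>v m"
        using inj by (auto dest!: inj_onD)
      then show "c k = 0"
        using k \<alpha> by (metis carrier_matD(2) index_vec index_zero_vec(1))
    qed
  next
    assume inj: "inj_cmat \<alpha>"
    show "inj_on (\<lambda>x. \<alpha> *\<^sub>v x) (carrier_vec m)"
    proof (rule inj_onI)
      fix x y :: "complex vec"
      assume xy: "x \<in> carrier_vec m" "y \<in> carrier_vec m" and eq: "\<alpha> *\<^sub>v x = \<alpha> *\<^sub>v y"
      have "(\<Sum>k<m. \<alpha> $$ (i, k) * (x $ k - y $ k)) = 0" if "i < n" for i
        using arg_cong [OF eq, of "\<lambda>v. v $ i"] xy that
        by (simp add: entry right_diff_distrib sum_subtractf del: index_mult_mat_vec)
      then have "\<forall>k<m. x $ k - y $ k = 0"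
        using inj [unfolded inj_cmat_def, rule_format, of "\<lambda>k. x $ k - y $ k"] \<alpha> by auto
      then show "x = y"
        using xy by (intro eq_vecI) auto
    qed
  qed
qed

lemma inj_cmat_direct_sum:
  assumes "inj_cmat \<alpha>" "inj_cmat \<beta>"
  shows "inj_cmat (direct_sum \<alpha> \<beta>)"
  unfolding inj_cmat_def
proof (intro allI impI)
  fix c k
  assume c: "\<forall>i<dim_row (direct_sum \<alpha> \<beta>). (\<Sum>k<dim_col (direct_sum \<alpha> \<beta>). direct_sum \<alpha> \<beta> $$ (i, k) * c k) = 0"
    and k: "k < dim_col (direct_sum \<alpha> \<beta>)"
  have "(\<Sum>k<dim_col \<alpha>. \<alpha> $$ (i, k) * c k) = 0" if "i < dim_row \<alpha>" for i
    using c [rule_format, of i] that by (simp add: sum_lessThan_add index_direct_sum)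
  then have 1: "\<forall>k<dim_col \<alpha>. c k = 0"
    using assms(1) unfolding inj_cmat_def by blast
  have "(\<Sum>k<dim_col \<beta>. \<beta> $$ (i, k) * c (dim_col \<alpha> + k)) = 0" if "i < dim_row \<beta>" for i
    using c [rule_format, of "dim_row \<alpha> + i"] that by (simp add: sum_lessThan_add index_direct_sum)
  then have 2: "\<forall>k<dim_col \<beta>. c (dim_col \<alpha> + k) = 0"
    using assms(2) [unfolded inj_cmat_def, rule_format, of "\<lambda>k. c (dim_col \<alpha> + k)"] by blast
  show "c k = 0"
  proof (cases "k < dim_col \<alpha>")
    case False
    then show ?thesis
      using 2 [rule_format, of "k - dim_col \<alpha>"] k by simp
  qed (use 1 in blast)
qed

lemma cmat_times_left_assoc:
  assumes "\<beta> \<in> carrier_mat m n" "dim_row Z = n" and \<alpha>: "\<alpha> \<in> carrier_mat l m"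
  shows "\<alpha> \<bullet>\<^sub>l (\<beta> \<bullet>\<^sub>l Z) = (\<alpha> * \<beta> :: complex mat) \<bullet>\<^sub>l Z"
proof (rule eq_matI)
  fix i j assume "i < dim_row ((\<alpha> * \<beta>) \<bullet>\<^sub>l Z)" "j < dim_col ((\<alpha> * \<beta>) \<bullet>\<^sub>l Z)"
  then have ij: "i < l" "j < dim_col Z" using assms by auto
  have "(\<alpha> \<bullet>\<^sub>l (\<beta> \<bullet>\<^sub>l Z)) $$ (i, j) = (\<Sum>k<m. \<Sum>p<n. \<alpha> $$ (i, k) *\<^sub>C \<beta> $$ (k, p) *\<^sub>C Z $$ (p, j))"
    using assms ij by (simp add: index_cmat_times sum_scaleC_right)
  also have "\<dots> = (\<Sum>p<n. \<Sum>k<m. \<alpha> $$ (i, k) *\<^sub>C \<beta> $$ (k, p) *\<^sub>C Z $$ (p, j))"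
    by (rule sum.swap)
  also have "\<dots> = ((\<alpha> * \<beta>) \<bullet>\<^sub>l Z) $$ (i, j)"
    using assms ij
    by (simp add: index_cmat_times scalar_prod_def atLeast0LessThan scaleC_scaleC sum_scaleC_left)
  finally show "(\<alpha> \<bullet>\<^sub>l (\<beta> \<bullet>\<^sub>l Z)) $$ (i, j) = ((\<alpha> * \<beta>) \<bullet>\<^sub>l Z) $$ (i, j)" .
qed (use assms in auto)

lemma cmat_times_right_assoc:
  assumes "\<alpha> \<in> carrier_mat n m" "dim_col Z = n" and \<beta>: "\<beta> \<in> carrier_mat m l"
  shows "(Z \<bullet>\<^sub>r \<alpha>) \<bullet>\<^sub>r \<beta> = Z \<bullet>\<^sub>r (\<alpha> * \<beta> :: complex mat)"
proof (rule eq_matI)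
  fix i j assume "i < dim_row (Z \<bullet>\<^sub>r (\<alpha> * \<beta>))" "j < dim_col (Z \<bullet>\<^sub>r (\<alpha> * \<beta>))"
  then have ij: "i < dim_row Z" "j < l" using assms by auto
  have "((Z \<bullet>\<^sub>r \<alpha>) \<bullet>\<^sub>r \<beta>) $$ (i, j) = (\<Sum>k<m. \<Sum>p<n. \<beta> $$ (k, j) *\<^sub>C \<alpha> $$ (p, k) *\<^sub>C Z $$ (i, p))"
    using assms ij by (simp add: index_cmat_times sum_scaleC_right)
  also have "\<dots> = (\<Sum>p<n. \<Sum>k<m. \<beta> $$ (k, j) *\<^sub>C \<alpha> $$ (p, k) *\<^sub>C Z $$ (i, p))"
    by (rule sum.swap)
  also have "\<dots> = (Z \<bullet>\<^sub>r (\<alpha> * \<beta>)) $$ (i, j)"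
    using assms ij
    by (simp add: index_cmat_times scalar_prod_def atLeast0LessThan scaleC_scaleC sum_scaleC_left mult.commute)
  finally show "((Z \<bullet>\<^sub>r \<alpha>) \<bullet>\<^sub>r \<beta>) $$ (i, j) = (Z \<bullet>\<^sub>r (\<alpha> * \<beta>)) $$ (i, j)" .
qed (use assms in auto)

lemma cmat_times_left_right:
  assumes "dim_col \<alpha> = dim_row Z" "dim_row \<beta> = dim_col Z"
  shows "(\<alpha> \<bullet>\<^sub>l Z) \<bullet>\<^sub>r \<beta> = \<alpha> \<bullet>\<^sub>l (Z \<bullet>\<^sub>r \<beta>)"
proof (rule eq_matI)
  fix i j assume "i < dim_row (\<alpha> \<bullet>\<^sub>l (Z \<bullet>\<^sub>r \<beta>))" "j < dim_col (\<alpha> \<bullet>\<^sub>l (Z \<bullet>\<^sub>r \<beta>))"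
  then have ij: "i < dim_row \<alpha>" "j < dim_col \<beta>" by auto
  have "((\<alpha> \<bullet>\<^sub>l Z) \<bullet>\<^sub>r \<beta>) $$ (i, j) = (\<Sum>k<dim_col Z. \<Sum>p<dim_row Z. \<beta> $$ (k, j) *\<^sub>C \<alpha> $$ (i, p) *\<^sub>C Z $$ (p, k))"
    using assms ij by (simp add: index_cmat_times sum_scaleC_right)
  also have "\<dots> = (\<Sum>p<dim_row Z. \<Sum>k<dim_col Z. \<beta> $$ (k, j) *\<^sub>C \<alpha> $$ (i, p) *\<^sub>C Z $$ (p, k))"
    by (rule sum.swap)
  also have "\<dots> = (\<alpha> \<bullet>\<^sub>l (Z \<bullet>\<^sub>r \<beta>)) $$ (i, j)"
    using assms ij by (simp add: index_cmat_times sum_scaleC_right [symmetric] scaleC_scaleC mult.commute)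
  finally show "((\<alpha> \<bullet>\<^sub>l Z) \<bullet>\<^sub>r \<beta>) $$ (i, j) = (\<alpha> \<bullet>\<^sub>l (Z \<bullet>\<^sub>r \<beta>)) $$ (i, j)" .
qed auto

lemma one_cmat_times:
  "square_mat Z \<Longrightarrow> dim_row Z = n \<Longrightarrow> 1\<^sub>m n \<bullet>\<^sub>l Z = Z" "square_mat Z \<Longrightarrow> dim_row Z = n \<Longrightarrow> Z \<bullet>\<^sub>r 1\<^sub>m n = Z"
  by (auto intro!: eq_matI simp: index_cmat_times scaleC_if)

lemma inj_cmat_mult:
  assumes "inj_cmat \<alpha>" "inj_cmat \<beta>" "\<alpha> \<in> carrier_mat n m" "\<beta> \<in> carrier_mat m l"
  shows "inj_cmat (\<alpha> * \<beta>)"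
  unfolding inj_cmat_def
proof (intro allI impI)
  fix c k
  assume c: "\<forall>i<dim_row (\<alpha> * \<beta>). (\<Sum>k<dim_col (\<alpha> * \<beta>). (\<alpha> * \<beta>) $$ (i, k) * c k) = 0" and k: "k < dim_col (\<alpha> * \<beta>)"
  define d where "d p = (\<Sum>k<l. \<beta> $$ (p, k) * c k)" for p
  have "(\<Sum>p<m. \<alpha> $$ (i, p) * d p) = 0" if "i < n" for i
  proof -
    have "(\<Sum>p<m. \<alpha> $$ (i, p) * d p) = (\<Sum>k<l. \<Sum>p<m. \<alpha> $$ (i, p) * \<beta> $$ (p, k) * c k)"
      unfolding d_def sum_distrib_left mult.assoc by (rule sum.swap)
    also have "\<dots> = (\<Sum>k<l. (\<alpha> * \<beta>) $$ (i, k) * c k)"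
      using assms that by (simp add: scalar_prod_def atLeast0LessThan sum_distrib_right)
    finally show ?thesis
      using c assms that by simp
  qed
  then have "\<forall>p<m. d p = 0"
    using assms(1,3) unfolding inj_cmat_def by auto
  then have "\<forall>k<l. c k = 0"
    using assms(2,4) unfolding inj_cmat_def d_def by auto
  then show "c k = 0"
    using k assms by simp
qed

lemma inj_cmat_one: "inj_cmat (1\<^sub>m n)"
  unfolding inj_cmat_def
proof (intro allI impI)
  fix c :: "nat \<Rightarrow> complex" and k
  assume c: "\<forall>i<dim_row (1\<^sub>m n). (\<Sum>k<dim_col (1\<^sub>m n). 1\<^sub>m n $$ (i, k) * c k) = 0" and k: "k < dim_col (1\<^sub>m n :: complex mat)"
  have "(\<Sum>j<n. 1\<^sub>m n $$ (k, j) * c j) = (\<Sum>j<n. if k = j then c j else 0)"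
    using k by (intro sum.cong refl) simp
  then show "c k = 0"
    using c k by simp
qed

text \<open>The points of \<Xi> that embed into a direct sum of points of \<Omega> already form a
  full nc set, because embeddings can be added blockwise and composed. It contains \<Omega>, hence
  the hull.\<close>

lemma full_nc_hull_embeds:
  assumes \<Xi>: "full_nc_subset \<Xi>" and \<Omega>: "\<Omega> \<subseteq> \<Xi>" and Z': "Z' \<in> full_nc_hull \<Xi> \<Omega>"
  obtains Z \<alpha> where "Z \<in> dsums \<Omega>" "\<alpha> \<in> carrier_mat (dim_row Z) (dim_row Z')" "inj_cmat \<alpha>" "\<alpha> \<bullet>\<^sub>l Z' = Z \<bullet>\<^sub>r \<alpha>"
proof -
  define \<Phi> where "\<Phi> = {Z' \<in> \<Xi>. \<exists>Z\<in>dsums \<Omega>. \<exists>\<alpha>\<in>carrier_mat (dim_row Z) (dim_row Z'). inj_cmat \<alpha> \<and> \<alpha> \<bullet>\<^sub>l Z' = Z \<bullet>\<^sub>r \<alpha>}"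
  have dsq: "square_mat Z" if "Z \<in> dsums \<Omega>" for Z
    using dsums_subset_full [OF \<Xi> \<Omega>] full_nc_square [OF \<Xi>] that by blast
  have "full_nc_subset \<Phi>"
    unfolding full_nc_subset_def
  proof (intro conjI ballI impI)
    show "\<Phi> \<subseteq> nc_space"
      using \<Xi> by (auto simp: \<Phi>_def full_nc_subset_def)
  next
    fix Z' W' assume "Z' \<in> \<Phi>" "W' \<in> \<Phi>"
    then obtain Z \<alpha> W \<beta> where Z: "Z' \<in> \<Xi>" "Z \<in> dsums \<Omega>" "\<alpha> \<in> carrier_mat (dim_row Z) (dim_row Z')" "inj_cmat \<alpha>" "\<alpha> \<bullet>\<^sub>l Z' = Z \<bullet>\<^sub>r \<alpha>"
      and W: "W' \<in> \<Xi>" "W \<in> dsums \<Omega>" "\<beta> \<in> carrier_mat (dim_row W) (dim_row W')" "inj_cmat \<beta>" "\<beta> \<bullet>\<^sub>l W' = W \<bullet>\<^sub>r \<beta>"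
      unfolding \<Phi>_def by blast
    have "direct_sum \<alpha> \<beta> \<bullet>\<^sub>l direct_sum Z' W' = direct_sum Z W \<bullet>\<^sub>r direct_sum \<alpha> \<beta>"
      by (rule direct_sum_intertwine [OF Z(5) W(5) Z(3) W(3) dsq [OF Z(2)] dsq [OF W(2)]
            full_nc_square [OF \<Xi> Z(1)] full_nc_square [OF \<Xi> W(1)]])
    moreover have "direct_sum Z' W' \<in> \<Xi>"
      using \<Xi> Z W by (auto simp: full_nc_subset_def)
    moreover have "direct_sum \<alpha> \<beta> \<in> carrier_mat (dim_row (direct_sum Z W)) (dim_row (direct_sum Z' W'))"
      using Z(3) W(3) by auto
    ultimately show "direct_sum Z' W' \<in> \<Phi>"
      unfolding \<Phi>_def using inj_cmat_direct_sum [OF Z(4) W(4)] dsums.sum [OF Z(2) W(2)] by blast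
  next
    fix Z' Z'' \<beta> assume "Z' \<in> \<Phi>" and Z'': "Z'' \<in> nc_space" and \<beta>: "\<beta> \<in> carrier_mat (dim_row Z') (dim_row Z'')"
      and i: "inj_on (\<lambda>x. \<beta> *\<^sub>v x) (carrier_vec (dim_row Z'')) \<and> \<beta> \<bullet>\<^sub>l Z'' = Z' \<bullet>\<^sub>r \<beta>"
    then obtain Z \<alpha> where Z: "Z' \<in> \<Xi>" "Z \<in> dsums \<Omega>" "\<alpha> \<in> carrier_mat (dim_row Z) (dim_row Z')" "inj_cmat \<alpha>" "\<alpha> \<bullet>\<^sub>l Z' = Z \<bullet>\<^sub>r \<alpha>"
      unfolding \<Phi>_def by blast
    have "Z'' \<in> \<Xi>"
      using \<Xi> Z(1) Z'' \<beta> i unfolding full_nc_subset_def by blast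
    moreover have "inj_cmat (\<alpha> * \<beta>)"
      using inj_cmat_mult [OF Z(4) _ Z(3) \<beta>] i inj_cmat_iff [OF \<beta>] by blast
    moreover have "(\<alpha> * \<beta>) \<bullet>\<^sub>l Z'' = Z \<bullet>\<^sub>r (\<alpha> * \<beta>)"
    proof -
      have sq: "dim_col Z' = dim_row Z'" "dim_col Z = dim_row Z"
        using full_nc_square [OF \<Xi> Z(1)] dsq [OF Z(2)] by auto
      have "(\<alpha> * \<beta>) \<bullet>\<^sub>l Z'' = \<alpha> \<bullet>\<^sub>l (Z' \<bullet>\<^sub>r \<beta>)"
        using cmat_times_left_assoc [OF \<beta> refl Z(3)] i by simp
      also have "\<dots> = (\<alpha> \<bullet>\<^sub>l Z') \<bullet>\<^sub>r \<beta>"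
        using Z(3) \<beta> sq by (intro cmat_times_left_right [symmetric]) auto
      also have "\<dots> = Z \<bullet>\<^sub>r (\<alpha> * \<beta>)"
        unfolding Z(5) using sq by (intro cmat_times_right_assoc [OF Z(3) _ \<beta>]) auto
      finally show ?thesis .
    qed
    moreover have "\<alpha> * \<beta> \<in> carrier_mat (dim_row Z) (dim_row Z'')"
      using Z(3) \<beta> by (rule mult_carrier_mat)
    ultimately show "Z'' \<in> \<Phi>"
      unfolding \<Phi>_def using Z(2) by blast
  qed
  moreover have "\<Omega> \<subseteq> \<Phi>"
  proof
    fix Z assume Z: "Z \<in> \<Omega>"
    then have "square_mat Z"
      using \<Omega> full_nc_square [OF \<Xi>] by blast
    then show "Z \<in> \<Phi>"
      unfolding \<Phi>_def using Z \<Omega> inj_cmat_one one_cmat_times [of Z "dim_row Z"]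
      by (auto intro!: bexI [of _ Z] bexI [of _ "1\<^sub>m (dim_row Z)"] dsums.base)
  qed
  moreover have "\<Phi> \<subseteq> \<Xi>"
    by (auto simp: \<Phi>_def)
  ultimately have "Z' \<in> \<Phi>"
    using Z' unfolding full_nc_hull_def by blast
  then show thesis
    using that unfolding \<Phi>_def by blast
qed

text \<open>f vanishes on direct sums of points of \<Omega>, which stay in the ball and in the hull.
  At an embedded point \<alpha> f(Z') = f(Z) \<alpha> = 0, and \<alpha> is injective. Applied to a S
  - b this extends the equation to the whole domain.\<close>

lemma nc_function_vanishes:
  fixes f :: "'v::complex_vector mat \<Rightarrow> ('u::chilbert_space \<Rightarrow>\<^sub>C\<^sub>L 'e::chilbert_space) mat"
  assumes \<Xi>: "full_nc_subset \<Xi>" and nc: "nc_function \<Xi> Q\<^sub>0" and \<Omega>: "\<Omega> \<subseteq> nc_ball \<Xi> Q\<^sub>0"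
    and f: "nc_function (full_nc_hull \<Xi> \<Omega> \<inter> nc_ball \<Xi> Q\<^sub>0) f"
    and zero: "\<And>Z i j. Z \<in> \<Omega> \<Longrightarrow> i < dim_row Z \<Longrightarrow> j < dim_row Z \<Longrightarrow> f Z $$ (i, j) = 0"
    and Z': "Z' \<in> full_nc_hull \<Xi> \<Omega> \<inter> nc_ball \<Xi> Q\<^sub>0" and ij: "i < dim_row Z'" "j < dim_row Z'"
  shows "f Z' $$ (i, j) = 0"
proof -
  let ?D = "full_nc_hull \<Xi> \<Omega> \<inter> nc_ball \<Xi> Q\<^sub>0"
  have \<Omega>\<Xi>: "\<Omega> \<subseteq> \<Xi>"
    using \<Omega> by (auto simp: nc_ball_def)
  have dD: "Z \<in> ?D" if "Z \<in> dsums \<Omega>" for Z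
    using dsums_subset_hull dsums_subset_ball [OF \<Xi> nc \<Omega>] that by blast
  have dsq: "square_mat Z" if "Z \<in> dsums \<Omega>" for Z
    using dsums_subset_full [OF \<Xi> \<Omega>\<Xi>] full_nc_square [OF \<Xi>] that by blast
  have d0: "\<forall>i<dim_row Z. \<forall>j<dim_row Z. f Z $$ (i, j) = 0" if "Z \<in> dsums \<Omega>" for Z
    using that
  proof induction
    case (base Z)
    then show ?case using zero by blast
  next
    case (sum Z W)
    note ent = nc_function_direct_sum [OF f dD [OF sum.hyps(1)] dD [OF sum.hyps(2)] dD [OF dsums.sum [OF sum.hyps]]
        dsq [OF sum.hyps(1)] dsq [OF sum.hyps(2)]]
    show ?case
    proof (intro allI impI)
      fix i j assume i: "i < dim_row (direct_sum Z W)" and j: "j < dim_row (direct_sum Z W)"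
      show "f (direct_sum Z W) $$ (i, j) = 0"
      proof (cases "j < dim_row Z")
        case True
        then show ?thesis using ent(1) [of i j] i sum.IH by auto
      next
        case False
        then show ?thesis using ent(2) [of i "j - dim_row Z"] i j sum.IH by auto
      qed
    qed
  qed
  obtain Z \<alpha> where Z: "Z \<in> dsums \<Omega>" and \<alpha>: "\<alpha> \<in> carrier_mat (dim_row Z) (dim_row Z')" "inj_cmat \<alpha>" "\<alpha> \<bullet>\<^sub>l Z' = Z \<bullet>\<^sub>r \<alpha>"
    using full_nc_hull_embeds [OF \<Xi> \<Omega>\<Xi>] Z' by blast
  have eq: "\<alpha> \<bullet>\<^sub>l f Z' = f Z \<bullet>\<^sub>r \<alpha>"
    by (rule nc_functionD(2) [OF f Z' dD [OF Z] \<alpha>(1,3)])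
  have cZ: "f Z \<in> carrier_mat (dim_row Z) (dim_row Z)" and cZ': "f Z' \<in> carrier_mat (dim_row Z') (dim_row Z')"
    using nc_functionD(1) [OF f] dD [OF Z] Z' by blast+
  have col: "(\<Sum>k<dim_row Z'. \<alpha> $$ (p, k) *\<^sub>C f Z' $$ (k, j)) = 0" if "p < dim_row Z" for p
    using arg_cong [OF eq, of "\<lambda>M. M $$ (p, j)"] that ij \<alpha>(1) cZ cZ' d0 [OF Z]
    by (simp add: index_cmat_times)
  have "(f Z' $$ (i, j)) h = 0" for h
  proof (rule cinner_eqI)
    fix e
    \<comment> \<open>Testing the operator entries against fixed \<open>h\<close> and
      \<open>e\<close> reduces the claim to injectivity of \<alpha> on scalars.\<close>
    define c where "c k = cinner ((f Z' $$ (k, j)) h) e" for k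
    have "(\<Sum>k<dim_row Z'. \<alpha> $$ (p, k) * c k) = 0" if "p < dim_row Z" for p
      using arg_cong [OF col [OF that], of "\<lambda>T. cinner (T h) e"]
      by (simp add: c_def cinner_sum_left cinner_scaleC_left)
    then have "\<forall>k<dim_row Z'. c k = 0"
      using \<alpha>(1,2) unfolding inj_cmat_def by auto
    then show "cinner ((f Z' $$ (i, j)) h) e = cinner 0 e"
      using ij by (simp add: c_def)
  qed
  then show ?thesis
    by (intro cblinfun_eqI) simp
qed

section \<open>Pointwise positivity from a multiplier\<close>

text \<open>The quadratic form of a a^* is \<parallel>a^* w\<parallel>^2, so positivity of the
  difference is a comparison of norms, to which a contraction can be applied.\<close>

lemma op_psd_diff_iff:
  fixes a :: "('y::chilbert_space \<Rightarrow>\<^sub>C\<^sub>L 'e::chilbert_space) mat" and b :: "('u::chilbert_space \<Rightarrow>\<^sub>C\<^sub>L 'e) mat"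
  assumes a: "a \<in> carrier_mat n n" and b: "b \<in> carrier_mat n n"
  shows "op_psd (a \<odot> op_adjoint a - b \<odot> op_adjoint b) \<longleftrightarrow> (\<forall>w.
    (\<Sum>s<n. (norm (\<Sum>p<n. cadjoint (b $$ (p, s)) (w p)))\<^sup>2) \<le> (\<Sum>s<n. (norm (\<Sum>p<n. cadjoint (a $$ (p, s)) (w p)))\<^sup>2))"
proof -
  have quad: "vec_cinner (op_apply (c \<odot> op_adjoint c) x) x
      = of_real (\<Sum>s<n. (norm (\<Sum>p<n. cadjoint (c $$ (p, s)) (x $ p)))\<^sup>2)"
    if "c \<in> carrier_mat n n" "x \<in> carrier_vec n" for c :: "('c::chilbert_space \<Rightarrow>\<^sub>C\<^sub>L 'e) mat" and x
  proof -
    have "vec_cinner (op_apply (c \<odot> op_adjoint c) x) x = vec_cinner (op_apply (op_adjoint c) x) (op_apply (op_adjoint c) x)"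
      using that by (subst op_apply_times) (auto intro!: vec_cinner_op_adjoint)
    then show ?thesis
      using that by (simp add: vec_cinner_def cinner_self)
  qed
  have diff: "vec_cinner (op_apply (a \<odot> op_adjoint a - b \<odot> op_adjoint b) x) x
      = vec_cinner (op_apply (a \<odot> op_adjoint a) x) x - vec_cinner (op_apply (b \<odot> op_adjoint b) x) x"
    if "x \<in> carrier_vec n" for x
    using a b that by (simp add: vec_cinner_def cinner_diff_left sum_subtractf)
  show ?thesis
  proof
    assume psd: "op_psd (a \<odot> op_adjoint a - b \<odot> op_adjoint b)"
    show "\<forall>w. (\<Sum>s<n. (norm (\<Sum>p<n. cadjoint (b $$ (p, s)) (w p)))\<^sup>2) \<le> (\<Sum>s<n. (norm (\<Sum>p<n. cadjoint (a $$ (p, s)) (w p)))\<^sup>2)"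
    proof
      fix w
      have "0 \<le> vec_cinner (op_apply (a \<odot> op_adjoint a - b \<odot> op_adjoint b) (vec n w)) (vec n w)"
        using psd a b unfolding op_psd_def by auto
      then show "(\<Sum>s<n. (norm (\<Sum>p<n. cadjoint (b $$ (p, s)) (w p)))\<^sup>2) \<le> (\<Sum>s<n. (norm (\<Sum>p<n. cadjoint (a $$ (p, s)) (w p)))\<^sup>2)"
        by (simp add: diff quad [OF a] quad [OF b] less_eq_complex_def del: of_real_sum)
    qed
  next
    assume w: "\<forall>w. (\<Sum>s<n. (norm (\<Sum>p<n. cadjoint (b $$ (p, s)) (w p)))\<^sup>2) \<le> (\<Sum>s<n. (norm (\<Sum>p<n. cadjoint (a $$ (p, s)) (w p)))\<^sup>2)"
    show "op_psd (a \<odot> op_adjoint a - b \<odot> op_adjoint b)"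
      unfolding op_psd_def
    proof (intro conjI ballI)
      fix x :: "'e vec" assume "x \<in> carrier_vec (dim_row (a \<odot> op_adjoint a - b \<odot> op_adjoint b))"
      then have x: "x \<in> carrier_vec n" using b by simp
      show "0 \<le> vec_cinner (op_apply (a \<odot> op_adjoint a - b \<odot> op_adjoint b) x) x"
        using w [rule_format, of "\<lambda>p. x $ p"]
        by (simp add: diff [OF x] quad [OF a x] quad [OF b x] less_eq_complex_def del: of_real_sum)
    qed (use a b in simp)
  qed
qed

lemma nc_function_op_diff:
  fixes a :: "'v::complex_vector mat \<Rightarrow> ('y::chilbert_space \<Rightarrow>\<^sub>C\<^sub>L 'e::chilbert_space) mat"
    and S :: "'v mat \<Rightarrow> ('u::chilbert_space \<Rightarrow>\<^sub>C\<^sub>L 'y) mat"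
  assumes a: "nc_function D a" and b: "nc_function D b" and S: "nc_function D S"
  shows "nc_function D (\<lambda>Z. a Z \<odot> S Z - b Z)"
  unfolding nc_function_def graded_function_def
proof (intro conjI ballI impI)
  note ca = nc_functionD(1) [OF a] and cb = nc_functionD(1) [OF b] and cS = nc_functionD(1) [OF S]
  show "a Z \<odot> S Z - b Z \<in> carrier_mat (dim_row Z) (dim_row Z)" if "Z \<in> D" for Z
    using ca [OF that] cb [OF that] cS [OF that] by (auto intro!: minus_carrier_mat)
  fix Z Z' \<alpha> assume Z: "Z \<in> D" "Z' \<in> D" and \<alpha>: "\<alpha> \<in> carrier_mat (dim_row Z') (dim_row Z)" "\<alpha> \<bullet>\<^sub>l Z = Z' \<bullet>\<^sub>r \<alpha>"
  let ?n = "dim_row Z" and ?m = "dim_row Z'"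
  note car = ca [OF Z(1)] cb [OF Z(1)] cS [OF Z(1)] ca [OF Z(2)] cb [OF Z(2)] cS [OF Z(2)]
  show "\<alpha> \<bullet>\<^sub>l (a Z \<odot> S Z - b Z) = (a Z' \<odot> S Z' - b Z') \<bullet>\<^sub>r \<alpha>"
  proof (rule eq_matI)
    fix i j assume "i < dim_row ((a Z' \<odot> S Z' - b Z') \<bullet>\<^sub>r \<alpha>)" "j < dim_col ((a Z' \<odot> S Z' - b Z') \<bullet>\<^sub>r \<alpha>)"
    then have ij: "i < ?m" "j < ?n" using car \<alpha> by auto
    have ent: "(\<Sum>k<?n. \<alpha> $$ (i, k) *\<^sub>C f Z $$ (k, j)) = (\<Sum>k<?m. \<alpha> $$ (k, j) *\<^sub>C f Z' $$ (i, k))"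
      if "nc_function D f" "i < ?m" "j < ?n" for f :: "'v mat \<Rightarrow> ('c::chilbert_space \<Rightarrow>\<^sub>C\<^sub>L 'd::chilbert_space) mat" and i j
      using arg_cong [OF nc_functionD(2) [OF that(1) Z \<alpha>], of "\<lambda>M. M $$ (i, j)"] that(2,3) \<alpha>(1)
        nc_functionD(1) [OF that(1) Z(1)] nc_functionD(1) [OF that(1) Z(2)]
      by (simp add: index_cmat_times)
    have app: "(\<Sum>k<?n. \<alpha> $$ (i, k) *\<^sub>C (f Z $$ (k, j)) x) = (\<Sum>k<?m. \<alpha> $$ (k, j) *\<^sub>C (f Z' $$ (i, k)) x)"
      if "nc_function D f" "i < ?m" "j < ?n"
      for f :: "'v mat \<Rightarrow> ('c::chilbert_space \<Rightarrow>\<^sub>C\<^sub>L 'd::chilbert_space) mat" and i j x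
      using arg_cong [OF ent [OF that], of "\<lambda>T. T x"] by simp
    have "((\<alpha> \<bullet>\<^sub>l (a Z \<odot> S Z - b Z)) $$ (i, j)) x = (((a Z' \<odot> S Z' - b Z') \<bullet>\<^sub>r \<alpha>) $$ (i, j)) x" for x
    proof -
      have "((\<alpha> \<bullet>\<^sub>l (a Z \<odot> S Z - b Z)) $$ (i, j)) x
          = (\<Sum>k<?n. \<Sum>p<?n. \<alpha> $$ (i, k) *\<^sub>C (a Z $$ (k, p)) ((S Z $$ (p, j)) x)) - (\<Sum>k<?n. \<alpha> $$ (i, k) *\<^sub>C (b Z $$ (k, j)) x)"
        using car \<alpha> ij by (simp add: index_cmat_times index_op_times scaleC_diff_right sum_subtractf sum_scaleC_right)
      also have "(\<Sum>k<?n. \<Sum>p<?n. \<alpha> $$ (i, k) *\<^sub>C (a Z $$ (k, p)) ((S Z $$ (p, j)) x))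
          = (\<Sum>p<?n. \<Sum>k<?n. \<alpha> $$ (i, k) *\<^sub>C (a Z $$ (k, p)) ((S Z $$ (p, j)) x))"
        by (rule sum.swap)
      also have "\<dots> = (\<Sum>p<?n. \<Sum>k<?m. \<alpha> $$ (k, p) *\<^sub>C (a Z' $$ (i, k)) ((S Z $$ (p, j)) x))"
        by (rule sum.cong [OF refl]) (simp add: app [OF a] ij)
      also have "\<dots> = (\<Sum>k<?m. \<Sum>p<?n. \<alpha> $$ (k, p) *\<^sub>C (a Z' $$ (i, k)) ((S Z $$ (p, j)) x))"
        by (rule sum.swap)
      also have "\<dots> = (\<Sum>k<?m. (a Z' $$ (i, k)) (\<Sum>p<?n. \<alpha> $$ (k, p) *\<^sub>C (S Z $$ (p, j)) x))"
        by (simp add: cblinfun_sum cblinfun_scale)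
      also have "\<dots> = (\<Sum>k<?m. (a Z' $$ (i, k)) (\<Sum>p<?m. \<alpha> $$ (p, j) *\<^sub>C (S Z' $$ (k, p)) x))"
        by (rule sum.cong [OF refl]) (simp add: app [OF S] ij)
      also have "\<dots> = (\<Sum>k<?m. \<Sum>p<?m. \<alpha> $$ (p, j) *\<^sub>C (a Z' $$ (i, k)) ((S Z' $$ (k, p)) x))"
        by (simp add: cblinfun_sum cblinfun_scale)
      also have "\<dots> = (\<Sum>p<?m. \<Sum>k<?m. \<alpha> $$ (p, j) *\<^sub>C (a Z' $$ (i, k)) ((S Z' $$ (k, p)) x))"
        by (rule sum.swap)
      also have "(\<Sum>k<?n. \<alpha> $$ (i, k) *\<^sub>C (b Z $$ (k, j)) x) = (\<Sum>k<?m. \<alpha> $$ (k, j) *\<^sub>C (b Z' $$ (i, k)) x)"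
        by (rule app [OF b ij])
      also have "(\<Sum>p<?m. \<Sum>k<?m. \<alpha> $$ (p, j) *\<^sub>C (a Z' $$ (i, k)) ((S Z' $$ (k, p)) x)) - (\<Sum>k<?m. \<alpha> $$ (k, j) *\<^sub>C (b Z' $$ (i, k)) x)
          = (((a Z' \<odot> S Z' - b Z') \<bullet>\<^sub>r \<alpha>) $$ (i, j)) x"
        using car \<alpha> ij by (simp add: index_cmat_times index_op_times scaleC_diff_right sum_subtractf sum_scaleC_right)
      finally show ?thesis .
    qed
    then show "(\<alpha> \<bullet>\<^sub>l (a Z \<odot> S Z - b Z)) $$ (i, j) = ((a Z' \<odot> S Z' - b Z') \<bullet>\<^sub>r \<alpha>) $$ (i, j)"
      by (rule cblinfun_eqI)
  qed (use car \<alpha> in auto)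
qed

lemma nc_function_subset: "nc_function D f \<Longrightarrow> D' \<subseteq> D \<Longrightarrow> nc_function D' f"
  unfolding nc_function_def graded_function_def by blast

text \<open>Once b = a S holds on the whole domain, \<parallel>b^* w\<parallel> = \<parallel>S^* a^*
  w\<parallel> \<le> \<parallel>a^* w\<parallel> by pointwise contractivity.\<close>

theorem multiplier_imp_psd:
  fixes a :: "'v::complex_vector mat \<Rightarrow> ('y::chilbert_space \<Rightarrow>\<^sub>C\<^sub>L 'e::chilbert_space) mat"
    and b :: "'v mat \<Rightarrow> ('u::chilbert_space \<Rightarrow>\<^sub>C\<^sub>L 'e) mat"
  assumes \<Xi>: "full_nc_subset \<Xi>" and nc: "nc_function \<Xi> Q\<^sub>0" and \<Omega>: "\<Omega> \<subseteq> nc_ball \<Xi> Q\<^sub>0"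
    and a: "nc_function (full_nc_hull \<Xi> \<Omega> \<inter> nc_ball \<Xi> Q\<^sub>0) a" and b: "nc_function (full_nc_hull \<Xi> \<Omega> \<inter> nc_ball \<Xi> Q\<^sub>0) b"
    and mult: "has_multiplier_solution (nc_ball \<Xi> Q\<^sub>0) \<Omega> Q\<^sub>0 a b"
    and Z: "Z \<in> full_nc_hull \<Xi> \<Omega> \<inter> nc_ball \<Xi> Q\<^sub>0"
  shows "op_psd (a Z \<odot> op_adjoint (a Z) - b Z \<odot> op_adjoint (b Z))"
proof -
  let ?D = "full_nc_hull \<Xi> \<Omega> \<inter> nc_ball \<Xi> Q\<^sub>0" and ?n = "dim_row Z"
  obtain S where S: "contractive_multiplier (nc_ball \<Xi> Q\<^sub>0) (k_kernel_tensor_id Q\<^sub>0) (k_kernel_tensor_id Q\<^sub>0) S"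
    and eq: "\<And>Z. Z \<in> \<Omega> \<Longrightarrow> a Z \<odot> S Z = b Z"
    using mult by (auto simp: has_multiplier_solution_def)
  have ncS: "nc_function ?D S"
    using S nc_function_subset unfolding contractive_multiplier_def by blast
  note car = nc_functionD(1) [OF a Z] nc_functionD(1) [OF b Z] nc_functionD(1) [OF ncS Z]
  have \<Omega>D: "\<Omega> \<subseteq> ?D"
    using \<Omega> by (auto simp: full_nc_hull_def)
  have ent: "(a Z \<odot> S Z - b Z) $$ (i, j) = 0" if "i < ?n" "j < ?n" for i j
  proof (rule nc_function_vanishes [OF \<Xi> nc \<Omega> nc_function_op_diff [OF a b ncS] _ Z that])
    fix W i j assume W: "W \<in> \<Omega>" "i < dim_row W" "j < dim_row W"
    then have "b W \<in> carrier_mat (dim_row W) (dim_row W)"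
      using nc_functionD(1) [OF b] \<Omega>D by blast
    then show "(a W \<odot> S W - b W) $$ (i, j) = 0"
      using W eq [of W] by simp
  qed
  have bS: "b Z $$ (p, s) = (\<Sum>k<?n. a Z $$ (p, k) o\<^sub>C\<^sub>L S Z $$ (k, s))" if "p < ?n" "s < ?n" for p s
    using ent [OF that] that car by (simp add: index_op_times)
  have adj_comp: "cadjoint (A o\<^sub>C\<^sub>L B) = cadjoint B o\<^sub>C\<^sub>L cadjoint A"
    for A :: "'y \<Rightarrow>\<^sub>C\<^sub>L 'e" and B :: "'u \<Rightarrow>\<^sub>C\<^sub>L 'y"
    by (rule cadjoint_eqI) (simp add: cinner_cadjoint)
  show ?thesis
    unfolding op_psd_diff_iff [OF car(1,2)]
  proof
    fix w
    have "(\<Sum>p<?n. cadjoint (b Z $$ (p, s)) (w p))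
        = (\<Sum>k<?n. cadjoint (S Z $$ (k, s)) (\<Sum>p<?n. cadjoint (a Z $$ (p, k)) (w p)))" if "s < ?n" for s
    proof -
      have "(\<Sum>p<?n. cadjoint (b Z $$ (p, s)) (w p))
          = (\<Sum>p<?n. \<Sum>k<?n. cadjoint (S Z $$ (k, s)) (cadjoint (a Z $$ (p, k)) (w p)))"
        by (rule sum.cong [OF refl]) (simp add: bS that cadjoint_sum adj_comp)
      also have "\<dots> = (\<Sum>k<?n. \<Sum>p<?n. cadjoint (S Z $$ (k, s)) (cadjoint (a Z $$ (p, k)) (w p)))"
        by (rule sum.swap)
      finally show ?thesis
        by (simp add: cblinfun_sum)
    qed
    then have "(\<Sum>s<?n. (norm (\<Sum>p<?n. cadjoint (b Z $$ (p, s)) (w p)))\<^sup>2)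
        = (\<Sum>s<?n. (norm (\<Sum>k<?n. cadjoint (S Z $$ (k, s)) (\<Sum>p<?n. cadjoint (a Z $$ (p, k)) (w p))))\<^sup>2)"
      by simp
    also have "\<dots> \<le> (\<Sum>k<?n. (norm (\<Sum>p<?n. cadjoint (a Z $$ (p, k)) (w p)))\<^sup>2)"
      by (rule contractive_multiplier_pointwise [OF S _ _ refl]) (use Z in \<open>auto simp: nc_ball_iff [OF nc]\<close>)
    finally show "(\<Sum>s<?n. (norm (\<Sum>p<?n. cadjoint (b Z $$ (p, s)) (w p)))\<^sup>2)
        \<le> (\<Sum>s<?n. (norm (\<Sum>p<?n. cadjoint (a Z $$ (p, s)) (w p)))\<^sup>2)" .
  qed
qed

section \<open>The de Branges-Rovnyak kernel as an nc kernel\<close>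

text \<open>In the Gram form of \<open>dBR_kernel_expand\<close> the kernel property reduces to the intertwining
  relation \<open>tensor_kvec_intertwine\<close> between the vectors.\<close>

definition tensor_kvec :: "('r::chilbert_space \<Rightarrow>\<^sub>C\<^sub>L complex) mat \<Rightarrow> ('h::chilbert_space \<Rightarrow>\<^sub>C\<^sub>L 'e::chilbert_space) mat
    \<Rightarrow> 'e \<Rightarrow> nat \<Rightarrow> nat \<Rightarrow> ((nat, 'r fock) l2, 'h) l2" where
  "tensor_kvec Q c e i l = (\<Sum>p<dim_row c. l2_tensor (cadjoint (c $$ (l, p)) e) (kvec Q i p))"

lemma tensor_kvec_sum: "(\<Sum>x\<in>A. \<gamma> x *\<^sub>C tensor_kvec Q c (e x) i l) = tensor_kvec Q c (\<Sum>x\<in>A. \<gamma> x *\<^sub>C e x) i l"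
proof -
  have "(\<Sum>x\<in>A. \<gamma> x *\<^sub>C tensor_kvec Q c (e x) i l)
      = (\<Sum>x\<in>A. \<Sum>p<dim_row c. l2_tensor (cadjoint (c $$ (l, p)) (\<gamma> x *\<^sub>C e x)) (kvec Q i p))"
    by (simp add: tensor_kvec_def sum_scaleC_right cblinfun_scale pretensor_scale_left [OF pretensor_l2_tensor])
  also have "\<dots> = (\<Sum>p<dim_row c. \<Sum>x\<in>A. l2_tensor (cadjoint (c $$ (l, p)) (\<gamma> x *\<^sub>C e x)) (kvec Q i p))"
    by (rule sum.swap)
  finally show ?thesis
    by (simp add: tensor_kvec_def cblinfun_sum pretensor_sum_left [OF pretensor_l2_tensor])
qed

lemma tensor_kvec_intertwine:
  fixes c :: "('h::chilbert_space \<Rightarrow>\<^sub>C\<^sub>L 'e::chilbert_space) mat"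
  assumes Q: "strict_row_contraction n Q" and R: "strict_row_contraction m R"
    and \<alpha>: "\<alpha> \<in> carrier_mat m n" "\<alpha> \<bullet>\<^sub>l Q = R \<bullet>\<^sub>r \<alpha>"
    and c: "c \<in> carrier_mat n n" "d \<in> carrier_mat m m" "\<alpha> \<bullet>\<^sub>l c = d \<bullet>\<^sub>r \<alpha>" and ix: "k < n" "i < m"
  shows "(\<Sum>l<n. cnj (\<alpha> $$ (i, l)) *\<^sub>C tensor_kvec Q c e k l) = (\<Sum>j<m. cnj (\<alpha> $$ (j, k)) *\<^sub>C tensor_kvec R d e j i)"
proof -
  note lin = pretensor_scale_left [OF pretensor_l2_tensor] pretensor_scale_right [OF pretensor_l2_tensor]
    pretensor_sum_left [OF pretensor_l2_tensor] pretensor_sum_right [OF pretensor_l2_tensor]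
  \<comment> \<open>The relation for c, in adjoint form, moves \<alpha> to the index p that is
    shared with the kernel vector; from there \<open>kvec_intertwine\<close> takes over.\<close>
  have adj: "(\<Sum>l<n. cnj (\<alpha> $$ (i, l)) *\<^sub>C cadjoint (c $$ (l, p)) e) = (\<Sum>s<m. cnj (\<alpha> $$ (s, p)) *\<^sub>C cadjoint (d $$ (i, s)) e)"
    if p: "p < n" for p
  proof -
    have "(\<Sum>l<n. \<alpha> $$ (i, l) *\<^sub>C c $$ (l, p)) = (\<Sum>s<m. \<alpha> $$ (s, p) *\<^sub>C d $$ (i, s))"
      using arg_cong [OF c(3), of "\<lambda>M. M $$ (i, p)"] c(1,2) \<alpha>(1) ix p by (simp add: index_cmat_times)
    from arg_cong [OF this, of "\<lambda>T. (cadjoint T) e"] show ?thesis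
      by (simp add: cadjoint_sum cadjoint_scale)
  qed
  have "(\<Sum>l<n. cnj (\<alpha> $$ (i, l)) *\<^sub>C tensor_kvec Q c e k l)
      = (\<Sum>l<n. \<Sum>p<n. l2_tensor (cnj (\<alpha> $$ (i, l)) *\<^sub>C cadjoint (c $$ (l, p)) e) (kvec Q k p))"
    using c by (simp add: tensor_kvec_def sum_scaleC_right lin)
  also have "\<dots> = (\<Sum>p<n. \<Sum>l<n. l2_tensor (cnj (\<alpha> $$ (i, l)) *\<^sub>C cadjoint (c $$ (l, p)) e) (kvec Q k p))"
    by (rule sum.swap)
  also have "\<dots> = (\<Sum>p<n. l2_tensor (\<Sum>s<m. cnj (\<alpha> $$ (s, p)) *\<^sub>C cadjoint (d $$ (i, s)) e) (kvec Q k p))"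
    by (intro sum.cong refl) (simp add: adj flip: lin(3))
  also have "\<dots> = (\<Sum>p<n. \<Sum>s<m. l2_tensor (cadjoint (d $$ (i, s)) e) (cnj (\<alpha> $$ (s, p)) *\<^sub>C kvec Q k p))"
    by (simp add: lin)
  also have "\<dots> = (\<Sum>s<m. \<Sum>p<n. l2_tensor (cadjoint (d $$ (i, s)) e) (cnj (\<alpha> $$ (s, p)) *\<^sub>C kvec Q k p))"
    by (rule sum.swap)
  also have "\<dots> = (\<Sum>s<m. l2_tensor (cadjoint (d $$ (i, s)) e) (\<Sum>j<m. cnj (\<alpha> $$ (j, k)) *\<^sub>C kvec R j s))"
    by (intro sum.cong refl) (simp add: kvec_intertwine [OF Q R \<alpha> ix(1)] flip: lin(4))
  also have "\<dots> = (\<Sum>s<m. \<Sum>j<m. cnj (\<alpha> $$ (j, k)) *\<^sub>C l2_tensor (cadjoint (d $$ (i, s)) e) (kvec R j s))"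
    by (simp add: lin)
  also have "\<dots> = (\<Sum>j<m. \<Sum>s<m. cnj (\<alpha> $$ (j, k)) *\<^sub>C l2_tensor (cadjoint (d $$ (i, s)) e) (kvec R j s))"
    by (rule sum.swap)
  also have "\<dots> = (\<Sum>j<m. cnj (\<alpha> $$ (j, k)) *\<^sub>C tensor_kvec R d e j i)"
    using c by (simp add: tensor_kvec_def sum_scaleC_right)
  finally show ?thesis .
qed

lemma cinner_tensor_kvec:
  "cinner (tensor_kvec Q c e i j) (tensor_kvec R d f k l)
    = (\<Sum>p<dim_row d. \<Sum>q<dim_row c. cinner (kvec Q i q) (kvec R k p) * cinner (cadjoint (c $$ (j, q)) e) (cadjoint (d $$ (l, p)) f))"
proof -
  have "cinner (tensor_kvec Q c e i j) (tensor_kvec R d f k l)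
    = (\<Sum>q<dim_row c. \<Sum>p<dim_row d. cinner (kvec Q i q) (kvec R k p) * cinner (cadjoint (c $$ (j, q)) e) (cadjoint (d $$ (l, p)) f))"
    by (simp add: tensor_kvec_def cinner_pretensor_sum [OF pretensor_l2_tensor] mult.commute)
  also have "\<dots> = (\<Sum>p<dim_row d. \<Sum>q<dim_row c. cinner (kvec Q i q) (kvec R k p) * cinner (cadjoint (c $$ (j, q)) e) (cadjoint (d $$ (l, p)) f))"
    by (rule sum.swap)
  finally show ?thesis .
qed

lemma sum_swap2: "(\<Sum>x\<in>I. \<Sum>y\<in>I'. \<Sum>i\<in>A. \<Sum>j\<in>B. f x y i j) = (\<Sum>i\<in>A. \<Sum>j\<in>B. \<Sum>x\<in>I. \<Sum>y\<in>I'. f x y i j)"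
  by (subst sum_swap_mult, intro sum.cong refl, rule sum_swap_mult)

lemma dBR_kernel_expand:
  assumes Z: "strict_row_contraction (dim_row Z) (Q\<^sub>0 Z)" "a Z \<in> carrier_mat (dim_row Z) (dim_row Z)" "b Z \<in> carrier_mat (dim_row Z) (dim_row Z)"
    and W: "strict_row_contraction (dim_row W) (Q\<^sub>0 W)" "a W \<in> carrier_mat (dim_row W) (dim_row W)" "b W \<in> carrier_mat (dim_row W) (dim_row W)"
    and P: "P \<in> carrier_mat (dim_row Z) (dim_row W)" and ix: "l < dim_row Z" "j < dim_row W"
  shows "cinner ((dBR_kernel Q\<^sub>0 a b Z W P $$ (l, j)) e) f
    = (\<Sum>i<dim_row Z. \<Sum>k<dim_row W. P $$ (i, k)
        * (cinner (tensor_kvec (Q\<^sub>0 W) (a W) e k j) (tensor_kvec (Q\<^sub>0 Z) (a Z) f i l)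
           - cinner (tensor_kvec (Q\<^sub>0 W) (b W) e k j) (tensor_kvec (Q\<^sub>0 Z) (b Z) f i l)))"
proof -
  let ?g = "\<lambda>p q. cinner (cadjoint (a W $$ (j, q)) e) (cadjoint (a Z $$ (l, p)) f)
           - cinner (cadjoint (b W $$ (j, q)) e) (cadjoint (b Z $$ (l, p)) f)"
  have "cinner ((dBR_kernel Q\<^sub>0 a b Z W P $$ (l, j)) e) f
      = (\<Sum>p<dim_row Z. \<Sum>q<dim_row W. (\<Sum>i<dim_row Z. \<Sum>k<dim_row W. P $$ (i, k) * cinner (kvec (Q\<^sub>0 W) k q) (kvec (Q\<^sub>0 Z) i p)) * ?g p q)"
    unfolding dBR_kernel_form [OF refl Z(2,3) refl W(2,3) ix]
    by (intro sum.cong refl) (simp add: k_kernel_index [OF Z(1) refl W(1) refl P])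
  also have "\<dots> = (\<Sum>p<dim_row Z. \<Sum>q<dim_row W. \<Sum>i<dim_row Z. \<Sum>k<dim_row W.
      P $$ (i, k) * (cinner (kvec (Q\<^sub>0 W) k q) (kvec (Q\<^sub>0 Z) i p) * ?g p q))"
    by (simp add: sum_distrib_right mult.assoc)
  also have "\<dots> = (\<Sum>i<dim_row Z. \<Sum>k<dim_row W. \<Sum>p<dim_row Z. \<Sum>q<dim_row W.
      P $$ (i, k) * (cinner (kvec (Q\<^sub>0 W) k q) (kvec (Q\<^sub>0 Z) i p) * ?g p q))"
    by (rule sum_swap2)
  also have "\<dots> = (\<Sum>i<dim_row Z. \<Sum>k<dim_row W. P $$ (i, k)
        * (cinner (tensor_kvec (Q\<^sub>0 W) (a W) e k j) (tensor_kvec (Q\<^sub>0 Z) (a Z) f i l)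
           - cinner (tensor_kvec (Q\<^sub>0 W) (b W) e k j) (tensor_kvec (Q\<^sub>0 Z) (b Z) f i l)))"
    using Z(2,3) W(2,3) by (simp add: cinner_tensor_kvec sum_distrib_left right_diff_distrib sum_subtractf)
  finally show ?thesis .
qed

text \<open>Congruence: combining the vectors with coefficients \<xi> and \<eta> replaces the matrix
  p by \<xi>^T p times the conjugate of \<eta>.\<close>

lemma sum_cinner_transform:
  "(\<Sum>x\<in>I. \<Sum>y\<in>I'. p x y * cinner (\<Sum>j\<in>B. cnj (\<eta> y j) *\<^sub>C v j) (\<Sum>i\<in>A. cnj (\<xi> x i) *\<^sub>C u i))
    = (\<Sum>i\<in>A. \<Sum>j\<in>B. (\<Sum>x\<in>I. \<Sum>y\<in>I'. \<xi> x i * p x y * cnj (\<eta> y j)) * cinner (v j) (u i))"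
  for \<xi> \<eta> p :: "_ \<Rightarrow> _ \<Rightarrow> complex"
proof -
  have "cinner (\<Sum>j\<in>B. cnj (\<eta> y j) *\<^sub>C v j) (\<Sum>i\<in>A. cnj (\<xi> x i) *\<^sub>C u i)
      = (\<Sum>i\<in>A. \<Sum>j\<in>B. \<xi> x i * cnj (\<eta> y j) * cinner (v j) (u i))" for x y
    by (simp add: cinner_sum_left cinner_sum_right cinner_scaleC_left cinner_scaleC_right sum_distrib_left mult_ac)
  then have "(\<Sum>x\<in>I. \<Sum>y\<in>I'. p x y * cinner (\<Sum>j\<in>B. cnj (\<eta> y j) *\<^sub>C v j) (\<Sum>i\<in>A. cnj (\<xi> x i) *\<^sub>C u i))
      = (\<Sum>x\<in>I. \<Sum>y\<in>I'. \<Sum>i\<in>A. \<Sum>j\<in>B. \<xi> x i * p x y * cnj (\<eta> y j) * cinner (v j) (u i))"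
    by (simp add: sum_distrib_left mult_ac)
  also have "\<dots> = (\<Sum>i\<in>A. \<Sum>j\<in>B. \<Sum>x\<in>I. \<Sum>y\<in>I'. \<xi> x i * p x y * cnj (\<eta> y j) * cinner (v j) (u i))"
    by (rule sum_swap2)
  finally show ?thesis
    by (simp add: sum_distrib_right)
qed

lemma index_mat_conj:
  assumes "\<alpha> \<in> carrier_mat m n" "P \<in> carrier_mat n n'" "\<beta> \<in> carrier_mat m' n'" "i < m" "j < m'"
  shows "(\<alpha> * P * conj_transpose \<beta>) $$ (i, j) = (\<Sum>x<n. \<Sum>y<n'. \<alpha> $$ (i, x) * P $$ (x, y) * cnj (\<beta> $$ (j, y)))"
  using assms by (simp add: scalar_prod_def atLeast0LessThan conj_transpose_def sum_distrib_left mult.assoc)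

text \<open>Both terms of the kernel are Gram sums of \<open>tensor_kvec\<close> weighted by P. The
  multiplications by \<alpha> and \<beta> move onto the vectors, cross by the intertwining relation,
  and return as a congruence of P.\<close>

lemma nc_kernel_dBR:
  fixes Q\<^sub>0 :: "'v::complex_vector mat \<Rightarrow> ('r::chilbert_space \<Rightarrow>\<^sub>C\<^sub>L complex) mat"
    and a :: "'v mat \<Rightarrow> ('y::chilbert_space \<Rightarrow>\<^sub>C\<^sub>L 'e::chilbert_space) mat"
    and b :: "'v mat \<Rightarrow> ('u::chilbert_space \<Rightarrow>\<^sub>C\<^sub>L 'e) mat"
  assumes Q: "\<And>Z. Z \<in> D \<Longrightarrow> strict_row_contraction (dim_row Z) (Q\<^sub>0 Z)" and nc: "nc_function D Q\<^sub>0"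
    and a: "nc_function D a" and b: "nc_function D b"
  shows "nc_kernel D (dBR_kernel Q\<^sub>0 a b)"
proof -
  note ca = nc_functionD(1) [OF a] and cb = nc_functionD(1) [OF b]
  note expand = dBR_kernel_expand [OF Q ca cb Q ca cb]
  have car: "dBR_kernel Q\<^sub>0 a b Z W P \<in> carrier_mat (dim_row Z) (dim_row W)" if "Z \<in> D" "W \<in> D" for Z W P
    using ca cb that by (intro dBR_kernel_carrier) auto
  have dims: "dim_row (dBR_kernel Q\<^sub>0 a b Z W P) = dim_row Z" "dim_col (dBR_kernel Q\<^sub>0 a b Z W P) = dim_row W" if "Z \<in> D" "W \<in> D" for Z W P
    using car [OF that] by blast+
  have add: "dBR_kernel Q\<^sub>0 a b Z W (P + P') = dBR_kernel Q\<^sub>0 a b Z W P + dBR_kernel Q\<^sub>0 a b Z W P'"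
    if D: "Z \<in> D" "W \<in> D" and P: "P \<in> carrier_mat (dim_row Z) (dim_row W)" "P' \<in> carrier_mat (dim_row Z) (dim_row W)" for Z W P P'
  proof (rule eq_matI)
    fix i j assume "i < dim_row (dBR_kernel Q\<^sub>0 a b Z W P + dBR_kernel Q\<^sub>0 a b Z W P')"
      "j < dim_col (dBR_kernel Q\<^sub>0 a b Z W P + dBR_kernel Q\<^sub>0 a b Z W P')"
    then have ij: "i < dim_row Z" "j < dim_row W" by (simp_all add: dims D)
    have s: "P + P' \<in> carrier_mat (dim_row Z) (dim_row W)" using P by simp
    show "dBR_kernel Q\<^sub>0 a b Z W (P + P') $$ (i, j) = (dBR_kernel Q\<^sub>0 a b Z W P + dBR_kernel Q\<^sub>0 a b Z W P') $$ (i, j)"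
    proof (rule cblinfun_eqI, rule cinner_eqI)
      fix e f
      have "cinner ((dBR_kernel Q\<^sub>0 a b Z W (P + P') $$ (i, j)) e) f
          = cinner ((dBR_kernel Q\<^sub>0 a b Z W P $$ (i, j)) e) f + cinner ((dBR_kernel Q\<^sub>0 a b Z W P' $$ (i, j)) e) f"
        using P ij by (simp add: expand [OF D(1) D(1) D(1) D(2) D(2) D(2) s ij] expand [OF D(1) D(1) D(1) D(2) D(2) D(2) P(1) ij]
            expand [OF D(1) D(1) D(1) D(2) D(2) D(2) P(2) ij] distrib_right sum.distrib)
      then show "cinner ((dBR_kernel Q\<^sub>0 a b Z W (P + P') $$ (i, j)) e) f
          = cinner (((dBR_kernel Q\<^sub>0 a b Z W P + dBR_kernel Q\<^sub>0 a b Z W P') $$ (i, j)) e) f"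
        using ij D by (simp add: dims cinner_add_left)
    qed
  qed (simp_all add: dims D)
  have scale: "dBR_kernel Q\<^sub>0 a b Z W (c \<cdot>\<^sub>m P) = map_mat ((*\<^sub>C) c) (dBR_kernel Q\<^sub>0 a b Z W P)"
    if D: "Z \<in> D" "W \<in> D" and P: "P \<in> carrier_mat (dim_row Z) (dim_row W)" for Z W P c
  proof (rule eq_matI)
    fix i j assume "i < dim_row (map_mat ((*\<^sub>C) c) (dBR_kernel Q\<^sub>0 a b Z W P))"
      "j < dim_col (map_mat ((*\<^sub>C) c) (dBR_kernel Q\<^sub>0 a b Z W P))"
    then have ij: "i < dim_row Z" "j < dim_row W" by (simp_all add: dims D)
    have s: "c \<cdot>\<^sub>m P \<in> carrier_mat (dim_row Z) (dim_row W)" using P by simp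
    show "dBR_kernel Q\<^sub>0 a b Z W (c \<cdot>\<^sub>m P) $$ (i, j) = map_mat ((*\<^sub>C) c) (dBR_kernel Q\<^sub>0 a b Z W P) $$ (i, j)"
    proof (rule cblinfun_eqI, rule cinner_eqI)
      fix e f
      have "cinner ((dBR_kernel Q\<^sub>0 a b Z W (c \<cdot>\<^sub>m P) $$ (i, j)) e) f = c * cinner ((dBR_kernel Q\<^sub>0 a b Z W P $$ (i, j)) e) f"
        using P ij by (simp add: expand [OF D(1) D(1) D(1) D(2) D(2) D(2) s ij] expand [OF D(1) D(1) D(1) D(2) D(2) D(2) P ij]
            sum_distrib_left mult.assoc)
      then show "cinner ((dBR_kernel Q\<^sub>0 a b Z W (c \<cdot>\<^sub>m P) $$ (i, j)) e) f
          = cinner ((map_mat ((*\<^sub>C) c) (dBR_kernel Q\<^sub>0 a b Z W P) $$ (i, j)) e) f"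
        using ij D by (simp add: dims cinner_scaleC_left)
    qed
  qed (simp_all add: dims D)
  have inter: "\<alpha> \<bullet>\<^sub>l dBR_kernel Q\<^sub>0 a b Z W P \<bullet>\<^sub>r conj_transpose \<beta> = dBR_kernel Q\<^sub>0 a b Z' W' (\<alpha> * P * conj_transpose \<beta>)"
    if D: "Z \<in> D" "Z' \<in> D" "W \<in> D" "W' \<in> D"
      and \<alpha>: "\<alpha> \<in> carrier_mat (dim_row Z') (dim_row Z)" "\<alpha> \<bullet>\<^sub>l Z = Z' \<bullet>\<^sub>r \<alpha>"
      and \<beta>: "\<beta> \<in> carrier_mat (dim_row W') (dim_row W)" "\<beta> \<bullet>\<^sub>l W = W' \<bullet>\<^sub>r \<beta>"
      and P: "P \<in> carrier_mat (dim_row Z) (dim_row W)"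
    for Z Z' W W' \<alpha> \<beta> P
  proof (rule eq_matI)
    fix i j assume "i < dim_row (dBR_kernel Q\<^sub>0 a b Z' W' (\<alpha> * P * conj_transpose \<beta>))"
      "j < dim_col (dBR_kernel Q\<^sub>0 a b Z' W' (\<alpha> * P * conj_transpose \<beta>))"
    then have ij: "i < dim_row Z'" "j < dim_row W'" by (simp_all add: dims D)
    have P': "\<alpha> * P * conj_transpose \<beta> \<in> carrier_mat (dim_row Z') (dim_row W')"
      using \<alpha> \<beta> by (auto simp: conj_transpose_def)
    have gram: "(\<Sum>l<dim_row Z. \<Sum>m<dim_row W. \<alpha> $$ (i, l) * cnj (\<beta> $$ (j, m)) * (\<Sum>x<dim_row Z. \<Sum>y<dim_row W. P $$ (x, y)
          * cinner (tensor_kvec (Q\<^sub>0 W) (h W) e y m) (tensor_kvec (Q\<^sub>0 Z) (h Z) f x l)))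
        = (\<Sum>k<dim_row Z'. \<Sum>k'<dim_row W'. (\<alpha> * P * conj_transpose \<beta>) $$ (k, k')
          * cinner (tensor_kvec (Q\<^sub>0 W') (h W') e k' j) (tensor_kvec (Q\<^sub>0 Z') (h Z') f k i))"
      if h: "nc_function D h" for h :: "'v mat \<Rightarrow> ('h::chilbert_space \<Rightarrow>\<^sub>C\<^sub>L 'e) mat" and e f
    proof -
      note ch = nc_functionD(1) [OF h]
      have "(\<Sum>l<dim_row Z. \<Sum>m<dim_row W. \<alpha> $$ (i, l) * cnj (\<beta> $$ (j, m)) * (\<Sum>x<dim_row Z. \<Sum>y<dim_row W. P $$ (x, y)
          * cinner (tensor_kvec (Q\<^sub>0 W) (h W) e y m) (tensor_kvec (Q\<^sub>0 Z) (h Z) f x l)))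
        = (\<Sum>l<dim_row Z. \<Sum>m<dim_row W. \<Sum>x<dim_row Z. \<Sum>y<dim_row W. P $$ (x, y) * (\<alpha> $$ (i, l) * cnj (\<beta> $$ (j, m))
          * cinner (tensor_kvec (Q\<^sub>0 W) (h W) e y m) (tensor_kvec (Q\<^sub>0 Z) (h Z) f x l)))"
        by (simp add: sum_distrib_left mult_ac)
      also have "\<dots> = (\<Sum>x<dim_row Z. \<Sum>y<dim_row W. \<Sum>l<dim_row Z. \<Sum>m<dim_row W. P $$ (x, y) * (\<alpha> $$ (i, l) * cnj (\<beta> $$ (j, m))
          * cinner (tensor_kvec (Q\<^sub>0 W) (h W) e y m) (tensor_kvec (Q\<^sub>0 Z) (h Z) f x l)))"
        by (rule sum_swap2)
      also have "\<dots> = (\<Sum>x<dim_row Z. \<Sum>y<dim_row W. P $$ (x, y) * cinner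
          (\<Sum>m<dim_row W. cnj (\<beta> $$ (j, m)) *\<^sub>C tensor_kvec (Q\<^sub>0 W) (h W) e y m)
          (\<Sum>l<dim_row Z. cnj (\<alpha> $$ (i, l)) *\<^sub>C tensor_kvec (Q\<^sub>0 Z) (h Z) f x l))"
      proof (intro sum.cong refl)
        fix x y
        show "(\<Sum>l<dim_row Z. \<Sum>m<dim_row W. P $$ (x, y) * (\<alpha> $$ (i, l) * cnj (\<beta> $$ (j, m))
            * cinner (tensor_kvec (Q\<^sub>0 W) (h W) e y m) (tensor_kvec (Q\<^sub>0 Z) (h Z) f x l)))
          = P $$ (x, y) * cinner (\<Sum>m<dim_row W. cnj (\<beta> $$ (j, m)) *\<^sub>C tensor_kvec (Q\<^sub>0 W) (h W) e y m)
            (\<Sum>l<dim_row Z. cnj (\<alpha> $$ (i, l)) *\<^sub>C tensor_kvec (Q\<^sub>0 Z) (h Z) f x l)"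
          by (simp add: cinner_sum_left cinner_sum_right cinner_scaleC_left cinner_scaleC_right sum_distrib_left mult_ac)
      qed
      also have "\<dots> = (\<Sum>x<dim_row Z. \<Sum>y<dim_row W. P $$ (x, y) * cinner
          (\<Sum>k'<dim_row W'. cnj (\<beta> $$ (k', y)) *\<^sub>C tensor_kvec (Q\<^sub>0 W') (h W') e k' j)
          (\<Sum>k<dim_row Z'. cnj (\<alpha> $$ (k, x)) *\<^sub>C tensor_kvec (Q\<^sub>0 Z') (h Z') f k i))"
        using tensor_kvec_intertwine [OF Q [OF D(1)] Q [OF D(2)] \<alpha>(1) nc_functionD(2) [OF nc D(1,2) \<alpha>] ch [OF D(1)] ch [OF D(2)]
            nc_functionD(2) [OF h D(1,2) \<alpha>] _ ij(1)]
          tensor_kvec_intertwine [OF Q [OF D(3)] Q [OF D(4)] \<beta>(1) nc_functionD(2) [OF nc D(3,4) \<beta>] ch [OF D(3)] ch [OF D(4)]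
            nc_functionD(2) [OF h D(3,4) \<beta>] _ ij(2)]
        by (intro sum.cong refl) simp
      also have "\<dots> = (\<Sum>k<dim_row Z'. \<Sum>k'<dim_row W'. (\<alpha> * P * conj_transpose \<beta>) $$ (k, k')
          * cinner (tensor_kvec (Q\<^sub>0 W') (h W') e k' j) (tensor_kvec (Q\<^sub>0 Z') (h Z') f k i))"
        unfolding sum_cinner_transform by (intro sum.cong refl) (simp add: index_mat_conj [OF \<alpha>(1) P \<beta>(1)])
      finally show ?thesis .
    qed
    show "(\<alpha> \<bullet>\<^sub>l dBR_kernel Q\<^sub>0 a b Z W P \<bullet>\<^sub>r conj_transpose \<beta>) $$ (i, j) = dBR_kernel Q\<^sub>0 a b Z' W' (\<alpha> * P * conj_transpose \<beta>) $$ (i, j)"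
    proof (rule cblinfun_eqI, rule cinner_eqI)
      fix e f
      have "cinner (((\<alpha> \<bullet>\<^sub>l dBR_kernel Q\<^sub>0 a b Z W P \<bullet>\<^sub>r conj_transpose \<beta>) $$ (i, j)) e) f
          = (\<Sum>l<dim_row Z. \<Sum>m<dim_row W. \<alpha> $$ (i, l) * cnj (\<beta> $$ (j, m)) * cinner ((dBR_kernel Q\<^sub>0 a b Z W P $$ (l, m)) e) f)"
        using D \<alpha>(1) \<beta>(1) ij
        by (simp add: dims index_cmat_times conj_transpose_def cinner_sum_left cinner_scaleC_left sum_distrib_left mult_ac)
      also have "\<dots> = (\<Sum>l<dim_row Z. \<Sum>m<dim_row W. \<alpha> $$ (i, l) * cnj (\<beta> $$ (j, m)) * (\<Sum>x<dim_row Z. \<Sum>y<dim_row W. P $$ (x, y)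
            * cinner (tensor_kvec (Q\<^sub>0 W) (a W) e y m) (tensor_kvec (Q\<^sub>0 Z) (a Z) f x l)))
          - (\<Sum>l<dim_row Z. \<Sum>m<dim_row W. \<alpha> $$ (i, l) * cnj (\<beta> $$ (j, m)) * (\<Sum>x<dim_row Z. \<Sum>y<dim_row W. P $$ (x, y)
            * cinner (tensor_kvec (Q\<^sub>0 W) (b W) e y m) (tensor_kvec (Q\<^sub>0 Z) (b Z) f x l)))"
        by (simp add: expand [OF D(1) D(1) D(1) D(3) D(3) D(3) P] right_diff_distrib sum_subtractf)
      also have "\<dots> = cinner ((dBR_kernel Q\<^sub>0 a b Z' W' (\<alpha> * P * conj_transpose \<beta>) $$ (i, j)) e) f"
        unfolding gram [OF a] gram [OF b]
        by (simp add: expand [OF D(2) D(2) D(2) D(4) D(4) D(4) P' ij] right_diff_distrib sum_subtractf del: index_mult_mat)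
      finally show "cinner (((\<alpha> \<bullet>\<^sub>l dBR_kernel Q\<^sub>0 a b Z W P \<bullet>\<^sub>r conj_transpose \<beta>) $$ (i, j)) e) f
          = cinner ((dBR_kernel Q\<^sub>0 a b Z' W' (\<alpha> * P * conj_transpose \<beta>) $$ (i, j)) e) f" .
    qed
  qed (use \<alpha> \<beta> in \<open>auto simp: conj_transpose_def dims D\<close>)
  show ?thesis
    unfolding nc_kernel_def
    by (intro conjI ballI allI impI) (auto simp: add scale intro!: car inter)
qed

section \<open>Pointwise positivity implies complete positivity\<close>

text \<open>Called for because the kernel pairs the entry P(a, b) with the inner product of the
  vectors of b and a, in this order.\<close>

lemma psd_transpose:
  fixes \<kappa> :: "nat \<Rightarrow> nat \<Rightarrow> complex"
  assumes "\<And>c. 0 \<le> (\<Sum>i<n. \<Sum>j<n. c i * cnj (c j) * \<kappa> i j)"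
  shows "0 \<le> (\<Sum>i<n. \<Sum>j<n. c i * cnj (c j) * \<kappa> j i)"
proof -
  have "0 \<le> (\<Sum>i<n. \<Sum>j<n. cnj (c i) * c j * \<kappa> i j)"
    using assms [of "\<lambda>i. cnj (c i)"] by simp
  also have "\<dots> = (\<Sum>j<n. \<Sum>i<n. cnj (c i) * c j * \<kappa> i j)"
    by (rule sum.swap)
  finally show ?thesis
    by (simp add: mult_ac)
qed

text \<open>The second Stein equation summed against P: K = P + Q (K \<otimes> I) Q^* for K = k(Z,
  Z)(P), written in entries.\<close>

lemma k_kernel_Stein:
  assumes Q: "strict_row_contraction n (Q\<^sub>0 Z)" "dim_row Z = n" and P: "P \<in> carrier_mat n n" and ix: "p < n" "q < n"
  shows "k_kernel Q\<^sub>0 Z Z P $$ (p, q) = P $$ (p, q)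
    + (\<Sum>l<n. \<Sum>l'<n. k_kernel Q\<^sub>0 Z Z P $$ (l', l) * cinner (riesz_mat (Q\<^sub>0 Z) q l) (riesz_mat (Q\<^sub>0 Z) p l'))"
proof -
  let ?\<kappa> = "kvec (Q\<^sub>0 Z)" and ?\<rho> = "riesz_mat (Q\<^sub>0 Z)"
  note k = k_kernel_index [of n Q\<^sub>0 Z n Z, OF Q Q P]
  have "k_kernel Q\<^sub>0 Z Z P $$ (p, q)
      = (\<Sum>a<n. \<Sum>b<n. (if a = p then if b = q then P $$ (a, b) else 0 else 0)
          + (\<Sum>l<n. \<Sum>l'<n. P $$ (a, b) * cinner (?\<kappa> b l) (?\<kappa> a l') * cinner (?\<rho> q l) (?\<rho> p l')))"
    unfolding k [OF ix]
    by (intro sum.cong refl) (simp add: kvec_Stein(2) [OF Q(1) Q(1) _ ix(2) _ ix(1)] distrib_left sum_distrib_left mult_ac)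
  also have "\<dots> = P $$ (p, q) + (\<Sum>a<n. \<Sum>b<n. \<Sum>l<n. \<Sum>l'<n.
      P $$ (a, b) * cinner (?\<kappa> b l) (?\<kappa> a l') * cinner (?\<rho> q l) (?\<rho> p l'))"
    by (simp only: sum.distrib sum_delta2 [OF ix])
  also have "(\<Sum>a<n. \<Sum>b<n. \<Sum>l<n. \<Sum>l'<n. P $$ (a, b) * cinner (?\<kappa> b l) (?\<kappa> a l') * cinner (?\<rho> q l) (?\<rho> p l'))
      = (\<Sum>l<n. \<Sum>l'<n. \<Sum>a<n. \<Sum>b<n. P $$ (a, b) * cinner (?\<kappa> b l) (?\<kappa> a l') * cinner (?\<rho> q l) (?\<rho> p l'))"
    by (rule sum_swap2)
  also have "\<dots> = (\<Sum>l<n. \<Sum>l'<n. k_kernel Q\<^sub>0 Z Z P $$ (l', l) * cinner (?\<rho> q l) (?\<rho> p l'))"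
    by (intro sum.cong refl) (simp add: k sum_distrib_right)
  finally show ?thesis .
qed

lemma k_kernel_psd:
  assumes Q: "strict_row_contraction n (Q\<^sub>0 Z)" "dim_row Z = n" and P: "P \<in> carrier_mat n n"
    and psd: "\<And>c. 0 \<le> (\<Sum>i<n. \<Sum>j<n. c i * cnj (c j) * P $$ (i, j))"
  shows "0 \<le> (\<Sum>p<n. \<Sum>q<n. c p * cnj (c q) * k_kernel Q\<^sub>0 Z Z P $$ (p, q))"
proof -
  define G where "G i = (\<Sum>p<n. cnj (c p) *\<^sub>C kvec (Q\<^sub>0 Z) i p)" for i
  have "0 \<le> (\<Sum>b<n. \<Sum>a<n. P $$ (a, b) * cinner (G b) (G a))"
    by (rule psd_sum_cinner) (rule psd_transpose [OF psd])
  also have "\<dots> = (\<Sum>a<n. \<Sum>b<n. P $$ (a, b) * cinner (G b) (G a))"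
    by (rule sum.swap)
  also have "\<dots> = (\<Sum>a<n. \<Sum>b<n. \<Sum>p<n. \<Sum>q<n. c p * cnj (c q) * (P $$ (a, b) * cinner (kvec (Q\<^sub>0 Z) b q) (kvec (Q\<^sub>0 Z) a p)))"
    by (simp add: G_def cinner_sum_left cinner_sum_right cinner_scaleC_left cinner_scaleC_right sum_distrib_left mult_ac)
  also have "\<dots> = (\<Sum>p<n. \<Sum>q<n. \<Sum>a<n. \<Sum>b<n. c p * cnj (c q) * (P $$ (a, b) * cinner (kvec (Q\<^sub>0 Z) b q) (kvec (Q\<^sub>0 Z) a p)))"
    by (rule sum_swap2)
  also have "\<dots> = (\<Sum>p<n. \<Sum>q<n. c p * cnj (c q) * k_kernel Q\<^sub>0 Z Z P $$ (p, q))"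
    by (intro sum.cong refl) (simp add: k_kernel_index [of n Q\<^sub>0 Z n Z, OF Q Q P] sum_distrib_left)
  finally show ?thesis .
qed

text \<open>The second conclusion is the quadratic form of K - Q (K \<otimes> I) Q^* = P \<ge>
  \<epsilon> I with K = J J^* inserted. It yields the invertibility of J and, after conjugation, a
  strict contraction.\<close>

lemma k_kernel_factorization:
  assumes Q: "strict_row_contraction n (Q\<^sub>0 Z)" "dim_row Z = n" and P: "P \<in> carrier_mat n n" and \<epsilon>: "0 < \<epsilon>"
    and coercive: "\<And>c. complex_of_real (\<epsilon> * (\<Sum>i<n. (cmod (c i))\<^sup>2)) \<le> (\<Sum>i<n. \<Sum>j<n. c i * cnj (c j) * P $$ (i, j))"
  obtains J where "\<And>p q. p < n \<Longrightarrow> q < n \<Longrightarrow> k_kernel Q\<^sub>0 Z Z P $$ (p, q) = (\<Sum>s<n. J p s * cnj (J q s))"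
    and "\<And>c. (\<Sum>s<n. (norm (\<Sum>l<n. cnj (J l s) *\<^sub>C (\<Sum>q<n. cnj (c q) *\<^sub>C riesz_mat (Q\<^sub>0 Z) q l)))\<^sup>2)
        + \<epsilon> * (\<Sum>i<n. (cmod (c i))\<^sup>2) \<le> (\<Sum>s<n. (cmod (\<Sum>p<n. J p s * c p))\<^sup>2)"
proof -
  let ?T = "\<lambda>p q. k_kernel Q\<^sub>0 Z Z P $$ (p, q)" and ?\<rho> = "riesz_mat (Q\<^sub>0 Z)"
  have psd: "0 \<le> (\<Sum>i<n. \<Sum>j<n. c i * cnj (c j) * P $$ (i, j))" for c
  proof -
    have "0 \<le> complex_of_real (\<epsilon> * (\<Sum>i<n. (cmod (c i))\<^sup>2))"
      using \<epsilon> by (auto simp: less_eq_complex_def intro!: mult_nonneg_nonneg sum_nonneg)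
    then show ?thesis
      using coercive [of c] by (rule order_trans)
  qed
  obtain J where J: "\<And>p q. p < n \<Longrightarrow> q < n \<Longrightarrow> ?T p q = (\<Sum>s<n. J p s * cnj (J q s))"
    by (rule psd_factorization [OF k_kernel_psd [of n Q\<^sub>0 Z, OF Q P psd]]) blast
  show thesis
  proof (rule that [OF J])
    fix c
    define g where "g l = (\<Sum>q<n. cnj (c q) *\<^sub>C ?\<rho> q l)" for l
    have "complex_of_real (\<Sum>s<n. (norm (\<Sum>p<n. J p s *\<^sub>C c p))\<^sup>2) = (\<Sum>p<n. \<Sum>q<n. ?T p q * cinner (c p) (c q))"
      by (rule factorized_sum_cinner [symmetric]) (rule J)
    also have "\<dots> = (\<Sum>p<n. \<Sum>q<n. c p * cnj (c q) * P $$ (p, q)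
        + (\<Sum>l<n. \<Sum>l'<n. ?T l' l * cinner (cnj (c q) *\<^sub>C ?\<rho> q l) (cnj (c p) *\<^sub>C ?\<rho> p l')))"
      by (intro sum.cong refl, subst k_kernel_Stein [of n Q\<^sub>0 Z, OF Q P])
        (simp_all add: cinner_complex_def cinner_scaleC_left cinner_scaleC_right distrib_right distrib_left sum_distrib_left sum_distrib_right mult_ac)
    also have "\<dots> = (\<Sum>p<n. \<Sum>q<n. c p * cnj (c q) * P $$ (p, q))
        + (\<Sum>p<n. \<Sum>q<n. \<Sum>l<n. \<Sum>l'<n. ?T l' l * cinner (cnj (c q) *\<^sub>C ?\<rho> q l) (cnj (c p) *\<^sub>C ?\<rho> p l'))"
      by (simp add: sum.distrib)
    also have "(\<Sum>p<n. \<Sum>q<n. \<Sum>l<n. \<Sum>l'<n. ?T l' l * cinner (cnj (c q) *\<^sub>C ?\<rho> q l) (cnj (c p) *\<^sub>C ?\<rho> p l'))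
        = (\<Sum>l<n. \<Sum>l'<n. \<Sum>p<n. \<Sum>q<n. ?T l' l * cinner (cnj (c q) *\<^sub>C ?\<rho> q l) (cnj (c p) *\<^sub>C ?\<rho> p l'))"
      by (rule sum_swap2)
    also have "\<dots> = (\<Sum>l<n. \<Sum>l'<n. ?T l' l * cinner (g l) (g l'))"
      by (simp add: g_def cinner_sum_left cinner_sum_right sum_distrib_left)
    also have "\<dots> = complex_of_real (\<Sum>s<n. (norm (\<Sum>l<n. cnj (J l s) *\<^sub>C g l))\<^sup>2)"
      by (rule factorized_sum_cinner) (simp add: J mult.commute)
    finally have "complex_of_real (\<Sum>s<n. (norm (\<Sum>l<n. cnj (J l s) *\<^sub>C g l))\<^sup>2) + of_real (\<epsilon> * (\<Sum>i<n. (cmod (c i))\<^sup>2))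
        \<le> complex_of_real (\<Sum>s<n. (norm (\<Sum>p<n. J p s *\<^sub>C c p))\<^sup>2)"
      using coercive [of c] by simp
    then show "(\<Sum>s<n. (norm (\<Sum>l<n. cnj (J l s) *\<^sub>C (\<Sum>q<n. cnj (c q) *\<^sub>C ?\<rho> q l)))\<^sup>2) + \<epsilon> * (\<Sum>i<n. (cmod (c i))\<^sup>2)
        \<le> (\<Sum>s<n. (cmod (\<Sum>p<n. J p s * c p))\<^sup>2)"
      unfolding g_def of_real_add [symmetric] by (simp add: less_eq_complex_def scaleC_complex_def del: of_real_add of_real_sum)
  qed
qed

text \<open>Injectivity is asked of the transpose because the coercive estimate controls
  combinations of the rows of J.\<close>

lemma matrix_inverse_exists:
  fixes J :: "complex mat"
  assumes J: "J \<in> carrier_mat n n"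
    and inj: "\<And>c. (\<And>s. s < n \<Longrightarrow> (\<Sum>p<n. J $$ (p, s) * c p) = 0) \<Longrightarrow> \<forall>p<n. c p = 0"
  obtains J' where "J' \<in> carrier_mat n n" "J * J' = 1\<^sub>m n" "J' * J = 1\<^sub>m n"
proof -
  have "det J\<^sup>T \<noteq> 0"
  proof
    assume "det J\<^sup>T = 0"
    then obtain v where v: "v \<in> carrier_vec n" "v \<noteq> 0\<^sub>v n" "J\<^sup>T *\<^sub>v v = 0\<^sub>v n"
      using det_0_iff_vec_prod_zero_field [of "J\<^sup>T" n] J by auto
    have "(\<Sum>p<n. J $$ (p, s) * v $ p) = 0" if "s < n" for s
      using arg_cong [OF v(3), of "\<lambda>w. w $ s"] that J v(1) by (simp add: scalar_prod_def atLeast0LessThan)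
    then have "\<forall>p<n. v $ p = 0"
      by (rule inj)
    then show False
      using v by (auto intro: eq_vecI)
  qed
  then have "J \<in> Units (ring_mat TYPE(complex) n ())"
    using det_non_zero_imp_unit [OF J] det_transpose [OF J] by simp
  then show thesis
    using that by (auto simp: Units_def ring_mat_def)
qed

text \<open>A Gram factor \<open>J\<close> of \<open>k(Z, Z)(P)\<close> is invertible and conjugates \<open>Z\<close> into another point of the
  ball: by the Stein equation \<open>k(Z, Z)(P) - Q\<^sub>0(Z) (k(Z, Z)(P) \<otimes> I) Q\<^sub>0(Z)\<^sup>* = P\<close>, strict positivity
  of \<open>P\<close> says that \<open>Q\<^sub>0(J\<^sup>-\<^sup>1 Z J) = J\<^sup>-\<^sup>1 Q\<^sub>0(Z) (J \<otimes> I)\<close> is a strict contraction.\<close>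

lemma similar_point:
  fixes Q\<^sub>0 :: "'v::complex_vector mat \<Rightarrow> ('r::chilbert_space \<Rightarrow>\<^sub>C\<^sub>L complex) mat"
  assumes \<Xi>: "full_nc_subset \<Xi>" and nc: "nc_function \<Xi> Q\<^sub>0" and Z: "Z \<in> nc_ball \<Xi> Q\<^sub>0" and n: "dim_row Z = n"
    and P: "P \<in> carrier_mat n n" and \<epsilon>: "0 < \<epsilon>"
    and coercive: "\<And>c. complex_of_real (\<epsilon> * (\<Sum>i<n. (cmod (c i))\<^sup>2)) \<le> (\<Sum>i<n. \<Sum>j<n. c i * cnj (c j) * P $$ (i, j))"
  obtains J Z' where "J \<in> carrier_mat n n" "Z' \<in> nc_ball \<Xi> Q\<^sub>0" "dim_row Z' = n" "J \<bullet>\<^sub>l Z' = Z \<bullet>\<^sub>r J"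
    and "\<And>\<Phi>. full_nc_subset \<Phi> \<Longrightarrow> Z \<in> \<Phi> \<Longrightarrow> Z' \<in> \<Phi>"
    and "\<And>p q. p < n \<Longrightarrow> q < n \<Longrightarrow> k_kernel Q\<^sub>0 Z Z P $$ (p, q) = (\<Sum>s<n. J $$ (p, s) * cnj (J $$ (q, s)))"
proof -
  have Z\<Xi>: "Z \<in> \<Xi>" and Q: "strict_row_contraction n (Q\<^sub>0 Z)"
    using Z n by (auto simp: nc_ball_iff [OF nc])
  have sq: "square_mat Z" and n1: "1 \<le> n"
    using \<Xi> Z\<Xi> n by (auto simp: full_nc_subset_def nc_space_def)
  obtain j where jT: "\<And>p q. p < n \<Longrightarrow> q < n \<Longrightarrow> k_kernel Q\<^sub>0 Z Z P $$ (p, q) = (\<Sum>s<n. j p s * cnj (j q s))"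
    and jb: "\<And>c. (\<Sum>s<n. (norm (\<Sum>l<n. cnj (j l s) *\<^sub>C (\<Sum>q<n. cnj (c q) *\<^sub>C riesz_mat (Q\<^sub>0 Z) q l)))\<^sup>2)
        + \<epsilon> * (\<Sum>i<n. (cmod (c i))\<^sup>2) \<le> (\<Sum>s<n. (cmod (\<Sum>p<n. j p s * c p))\<^sup>2)"
    by (rule k_kernel_factorization [of n Q\<^sub>0 Z, OF Q n P \<epsilon> coercive]) blast
  define J where "J = mat n n (\<lambda>(p, s). j p s)"
  have J: "J \<in> carrier_mat n n" and Jj: "\<And>p s. p < n \<Longrightarrow> s < n \<Longrightarrow> J $$ (p, s) = j p s"
    by (simp_all add: J_def)
  obtain J' where J': "J' \<in> carrier_mat n n" "J * J' = 1\<^sub>m n" "J' * J = 1\<^sub>m n"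
  proof (rule matrix_inverse_exists [OF J])
    fix c assume c: "\<And>s. s < n \<Longrightarrow> (\<Sum>p<n. J $$ (p, s) * c p) = 0"
    \<comment> \<open>If the transpose of J kills c, the estimate leaves \<epsilon>
      \<parallel>c\<parallel>^2 \<le> 0.\<close>
    have "\<epsilon> * (\<Sum>i<n. (cmod (c i))\<^sup>2) \<le> (\<Sum>s<n. (cmod (\<Sum>p<n. j p s * c p))\<^sup>2)"
      using jb [of c] sum_nonneg [of "{..<n}" "\<lambda>s. (norm (\<Sum>l<n. cnj (j l s) *\<^sub>C (\<Sum>q<n. cnj (c q) *\<^sub>C riesz_mat (Q\<^sub>0 Z) q l)))\<^sup>2"] by simp
    also have "\<dots> = 0"
      using c by (simp add: Jj)
    finally have "(\<Sum>i<n. (cmod (c i))\<^sup>2) \<le> 0"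
      using \<epsilon> by (simp add: mult_le_0_iff)
    then have "(\<Sum>i<n. (cmod (c i))\<^sup>2) = 0"
      by (intro antisym sum_nonneg) auto
    then show "\<forall>p<n. c p = 0"
      by (simp add: sum_nonneg_eq_0_iff)
  qed
  define Z' where "Z' = J' \<bullet>\<^sub>l (Z \<bullet>\<^sub>r J)"
  have Z'c: "dim_row Z' = n" "dim_col Z' = n"
    using J J' by (simp_all add: Z'_def)
  have eq: "J \<bullet>\<^sub>l Z' = Z \<bullet>\<^sub>r J"
  proof -
    have "J \<bullet>\<^sub>l Z' = (J * J') \<bullet>\<^sub>l (Z \<bullet>\<^sub>r J)"
      unfolding Z'_def by (rule cmat_times_left_assoc [OF J'(1) _ J]) (simp add: n)
    also have "\<dots> = Z \<bullet>\<^sub>r J"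
      unfolding J'(2) using n J by (intro one_cmat_times) auto
    finally show ?thesis .
  qed
  have full: "Z' \<in> \<Phi>" if \<Phi>: "full_nc_subset \<Phi>" "Z \<in> \<Phi>" for \<Phi>
  proof -
    have "inj_on (\<lambda>x. J *\<^sub>v x) (carrier_vec n)"
    proof (rule inj_on_inverseI)
      fix x :: "complex vec" assume "x \<in> carrier_vec n"
      then show "J' *\<^sub>v (J *\<^sub>v x) = x"
        using J J' by (simp flip: assoc_mult_mat_vec)
    qed
    moreover have "Z' \<in> nc_space"
      using Z'c n1 by (simp add: nc_space_def)
    moreover have "\<forall>Z'\<in>nc_space. \<forall>\<I>\<in>carrier_mat (dim_row Z) (dim_row Z').
        inj_on (\<lambda>x. \<I> *\<^sub>v x) (carrier_vec (dim_row Z')) \<and> \<I> \<bullet>\<^sub>l Z' = Z \<bullet>\<^sub>r \<I> \<longrightarrow> Z' \<in> \<Phi>"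
      using \<Phi> by (simp add: full_nc_subset_def)
    ultimately show ?thesis
      using J eq unfolding Z'c(1) n by (metis Z'c(1))
  qed
  have Z'\<Xi>: "Z' \<in> \<Xi>"
    by (rule full [OF \<Xi> Z\<Xi>])
  have Qc: "Q\<^sub>0 Z \<in> carrier_mat n n" and Q'c: "Q\<^sub>0 Z' \<in> carrier_mat n n"
    using nc_functionD(1) [OF nc Z\<Xi>] nc_functionD(1) [OF nc Z'\<Xi>] n Z'c by auto
  have "J \<bullet>\<^sub>l Q\<^sub>0 Z' = Q\<^sub>0 Z \<bullet>\<^sub>r J"
    using nc_functionD(2) [OF nc Z'\<Xi> Z\<Xi> _ eq] J n Z'c by simp
  note rho = riesz_mat_intertwine [OF Q'c Qc J this]
  \<comment> \<open>The squared Frobenius norm of J bounds its squared operator norm, whence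
    \<parallel>e\<parallel>^2 \<le> M \<parallel>c\<parallel>^2 below. The summand \<epsilon> makes
    M positive and \<epsilon> / M at most 1, so the square root has a nonnegative argument.\<close>
  define M where "M = \<epsilon> + (\<Sum>l<n. \<Sum>q<n. (cmod (j q l))\<^sup>2)"
  have M: "0 < M" "\<epsilon> \<le> M"
    using \<epsilon> by (auto simp: M_def intro!: add_pos_nonneg sum_nonneg)
  have "column_bound n (riesz_mat (Q\<^sub>0 Z')) (sqrt (1 - \<epsilon> / M))"
    unfolding column_bound_def
  proof
    fix e :: "nat \<Rightarrow> complex"
    \<comment> \<open>Chosen so that the transpose of J maps c to the conjugate of e; the estimate
      at c then speaks about the adjoint of \<open>Q\<^sub>0 Z'\<close> at e.\<close>
    define c where "c q = (\<Sum>l<n. J' $$ (l, q) * cnj (e l))" for q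
    have d: "(\<Sum>p<n. j p l * c p) = cnj (e l)" if l: "l < n" for l
    proof -
      have "(\<Sum>p<n. j p l * c p) = (\<Sum>p<n. \<Sum>m<n. J' $$ (m, p) * j p l * cnj (e m))"
        by (simp add: c_def sum_distrib_left mult_ac)
      also have "\<dots> = (\<Sum>m<n. \<Sum>p<n. J' $$ (m, p) * j p l * cnj (e m))"
        by (rule sum.swap)
      also have "\<dots> = (\<Sum>m<n. (J' * J) $$ (m, l) * cnj (e m))"
        using J J'(1) l by (intro sum.cong refl) (simp add: scalar_prod_def atLeast0LessThan sum_distrib_right Jj)
      also have "\<dots> = (\<Sum>m<n. if m = l then cnj (e m) else 0)"
        unfolding J'(3) using l by (intro sum.cong refl) simp
      finally show ?thesis
        using l by simp
    qed
    have de: "(\<Sum>s<n. (cmod (\<Sum>p<n. j p s * c p))\<^sup>2) = (\<Sum>i<n. (cmod (e i))\<^sup>2)"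
      by (simp add: d)
    have row: "(\<Sum>l<n. cnj (j l s) *\<^sub>C (\<Sum>q<n. cnj (c q) *\<^sub>C riesz_mat (Q\<^sub>0 Z) q l)) = (\<Sum>l<n. e l *\<^sub>C riesz_mat (Q\<^sub>0 Z') l s)"
      if s: "s < n" for s
    proof -
      have "(\<Sum>l<n. cnj (j l s) *\<^sub>C (\<Sum>q<n. cnj (c q) *\<^sub>C riesz_mat (Q\<^sub>0 Z) q l))
          = (\<Sum>l<n. \<Sum>q<n. cnj (c q) *\<^sub>C cnj (j l s) *\<^sub>C riesz_mat (Q\<^sub>0 Z) q l)"
        by (simp add: scaleC_scaleC mult.commute flip: sum_scaleC_right)
      also have "\<dots> = (\<Sum>q<n. \<Sum>l<n. cnj (c q) *\<^sub>C cnj (j l s) *\<^sub>C riesz_mat (Q\<^sub>0 Z) q l)"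
        by (rule sum.swap)
      also have "\<dots> = (\<Sum>q<n. cnj (c q) *\<^sub>C (\<Sum>l<n. cnj (j q l) *\<^sub>C riesz_mat (Q\<^sub>0 Z') l s))"
        using rho [OF s] s by (intro sum.cong refl) (simp add: Jj flip: sum_scaleC_right)
      also have "\<dots> = (\<Sum>q<n. \<Sum>l<n. (cnj (j q l) * cnj (c q)) *\<^sub>C riesz_mat (Q\<^sub>0 Z') l s)"
        by (simp add: scaleC_scaleC mult.commute flip: sum_scaleC_right)
      also have "\<dots> = (\<Sum>l<n. \<Sum>q<n. (cnj (j q l) * cnj (c q)) *\<^sub>C riesz_mat (Q\<^sub>0 Z') l s)"
        by (rule sum.swap)
      also have "\<dots> = (\<Sum>l<n. cnj (\<Sum>q<n. j q l * c q) *\<^sub>C riesz_mat (Q\<^sub>0 Z') l s)"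
        by (simp add: sum_scaleC_left)
      finally show ?thesis
        by (simp add: d)
    qed
    have "(\<Sum>i<n. (cmod (e i))\<^sup>2) \<le> M * (\<Sum>i<n. (cmod (c i))\<^sup>2)"
    proof -
      have "(cmod (\<Sum>p<n. j p s * c p))\<^sup>2 \<le> (\<Sum>q<n. (cmod (j q s))\<^sup>2) * (\<Sum>i<n. (cmod (c i))\<^sup>2)" for s
      proof -
        have "cmod (\<Sum>p<n. j p s * c p) \<le> (\<Sum>p<n. \<bar>cmod (j p s)\<bar> * \<bar>cmod (c p)\<bar>)"
          by (rule order_trans [OF norm_sum]) (simp add: norm_mult)
        also have "\<dots> \<le> L2_set (\<lambda>p. cmod (j p s)) {..<n} * L2_set (\<lambda>p. cmod (c p)) {..<n}"
          by (rule L2_set_mult_ineq)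
        finally have "(cmod (\<Sum>p<n. j p s * c p))\<^sup>2 \<le> (L2_set (\<lambda>p. cmod (j p s)) {..<n} * L2_set (\<lambda>p. cmod (c p)) {..<n})\<^sup>2"
          by (intro power_mono) auto
        then show ?thesis
          by (simp add: power_mult_distrib L2_set_power2)
      qed
      then have "(\<Sum>i<n. (cmod (e i))\<^sup>2) \<le> (\<Sum>s<n. (\<Sum>q<n. (cmod (j q s))\<^sup>2) * (\<Sum>i<n. (cmod (c i))\<^sup>2))"
        unfolding de [symmetric] by (rule sum_mono)
      also have "\<dots> \<le> M * (\<Sum>i<n. (cmod (c i))\<^sup>2)"
        unfolding sum_distrib_right [symmetric] using \<epsilon> by (intro mult_right_mono sum_nonneg) (auto simp: M_def)
      finally show ?thesis .
    qed
    then have lower: "(\<epsilon> / M) * (\<Sum>i<n. (cmod (e i))\<^sup>2) \<le> \<epsilon> * (\<Sum>i<n. (cmod (c i))\<^sup>2)"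
      using M \<epsilon> by (simp add: field_simps)
    have "(\<Sum>s<n. (norm (\<Sum>l<n. e l *\<^sub>C riesz_mat (Q\<^sub>0 Z') l s))\<^sup>2) + \<epsilon> * (\<Sum>i<n. (cmod (c i))\<^sup>2) \<le> (\<Sum>i<n. (cmod (e i))\<^sup>2)"
      using jb [of c] unfolding de by (simp add: row)
    then show "(\<Sum>s<n. (norm (\<Sum>l<n. e l *\<^sub>C riesz_mat (Q\<^sub>0 Z') l s))\<^sup>2) \<le> (sqrt (1 - \<epsilon> / M))\<^sup>2 * (\<Sum>i<n. (cmod (e i))\<^sup>2)"
      using M lower by (simp add: left_diff_distrib)
  qed
  then have "strict_row_contraction n (Q\<^sub>0 Z')"
    unfolding strict_row_contraction_def using Q'c M \<epsilon> by (intro conjI exI [of _ "sqrt (1 - \<epsilon> / M)"]) auto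
  then have "Z' \<in> nc_ball \<Xi> Q\<^sub>0"
    using Z'\<Xi> Z'c by (simp add: nc_ball_iff [OF nc])
  then show thesis
    using that [OF J _ Z'c(1) eq full] jT Jj by simp
qed

text \<open>Nonnegative complex numbers are real: two values of \<epsilon> already force Im F = 0,
  and the real part follows by a one-sided limit.\<close>

lemma nonneg_limit:
  fixes F G :: complex
  assumes "\<And>\<epsilon>. 0 < \<epsilon> \<Longrightarrow> 0 \<le> F + of_real \<epsilon> * G"
  shows "0 \<le> F"
proof -
  have im: "Im F + \<epsilon> * Im G = 0" and re: "0 \<le> Re F + \<epsilon> * Re G" if "0 < \<epsilon>" for \<epsilon>
    using assms [OF that] by (auto simp: less_eq_complex_def)
  have "Im F = 0"
    using im [of 1] im [of 2] by simp
  moreover have "0 \<le> Re F"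
  proof (rule tendsto_lowerbound)
    show "((\<lambda>\<epsilon>. Re F + \<epsilon> * Re G) \<longlongrightarrow> Re F) (at_right 0)"
      by (auto intro!: tendsto_eq_intros)
    show "\<forall>\<^sub>F \<epsilon> in at_right 0. 0 \<le> Re F + \<epsilon> * Re G"
      using re by (simp add: eventually_at_filter)
  qed simp
  ultimately show ?thesis
    by (simp add: less_eq_complex_def)
qed

text \<open>For strictly positive R the factor J of k(Z, Z)(R) satisfies h(Z) J = J h(Z') for h = a,
  b. So the form becomes \<parallel>a(Z')^* w\<parallel>^2 - \<parallel>b(Z')^* w\<parallel>^2 with
  w = J^* X, which is nonnegative by positivity at Z'. As the form is linear in P, positive
  semidefinite P follow from P + \<epsilon> I.\<close>

lemma dBR_form_nonneg:
  fixes Q\<^sub>0 :: "'v::complex_vector mat \<Rightarrow> ('r::chilbert_space \<Rightarrow>\<^sub>C\<^sub>L complex) mat"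
    and a :: "'v mat \<Rightarrow> ('y::chilbert_space \<Rightarrow>\<^sub>C\<^sub>L 'e::chilbert_space) mat"
    and b :: "'v mat \<Rightarrow> ('u::chilbert_space \<Rightarrow>\<^sub>C\<^sub>L 'e) mat"
  assumes \<Xi>: "full_nc_subset \<Xi>" and nc: "nc_function \<Xi> Q\<^sub>0"
    and a: "nc_function (full_nc_hull \<Xi> \<Omega> \<inter> nc_ball \<Xi> Q\<^sub>0) a" and b: "nc_function (full_nc_hull \<Xi> \<Omega> \<inter> nc_ball \<Xi> Q\<^sub>0) b"
    and pos: "\<And>Z. Z \<in> full_nc_hull \<Xi> \<Omega> \<inter> nc_ball \<Xi> Q\<^sub>0 \<Longrightarrow> op_psd (a Z \<odot> op_adjoint (a Z) - b Z \<odot> op_adjoint (b Z))"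
    and Z: "Z \<in> full_nc_hull \<Xi> \<Omega> \<inter> nc_ball \<Xi> Q\<^sub>0" and n: "dim_row Z = n" and P: "P \<in> carrier_mat n n"
    and psd: "\<And>c. 0 \<le> (\<Sum>i<n. \<Sum>j<n. c i * cnj (c j) * P $$ (i, j))"
  shows "0 \<le> (\<Sum>l<n. \<Sum>j<n. cinner ((dBR_kernel Q\<^sub>0 a b Z Z P $$ (l, j)) (X j)) (X l))"
proof -
  let ?D = "full_nc_hull \<Xi> \<Omega> \<inter> nc_ball \<Xi> Q\<^sub>0"
  have Q: "strict_row_contraction n (Q\<^sub>0 Z)"
    using Z n by (auto simp: nc_ball_iff [OF nc])
  have caZ: "a Z \<in> carrier_mat n n" and cbZ: "b Z \<in> carrier_mat n n"
    using nc_functionD(1) [OF a Z] nc_functionD(1) [OF b Z] n by auto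
  define A where "A q = (\<Sum>l<n. cadjoint (a Z $$ (l, q)) (X l))" for q
  define B where "B q = (\<Sum>l<n. cadjoint (b Z $$ (l, q)) (X l))" for q
  define F where "F R = (\<Sum>p<n. \<Sum>q<n. k_kernel Q\<^sub>0 Z Z R $$ (p, q) * (cinner (A q) (A p) - cinner (B q) (B p)))" for R
  have form: "(\<Sum>l<n. \<Sum>j<n. cinner ((dBR_kernel Q\<^sub>0 a b Z Z P $$ (l, j)) (X j)) (X l)) = F P"
  proof -
    have "(\<Sum>l<n. \<Sum>j<n. cinner ((dBR_kernel Q\<^sub>0 a b Z Z P $$ (l, j)) (X j)) (X l))
      = (\<Sum>l<n. \<Sum>j<n. \<Sum>p<n. \<Sum>q<n. k_kernel Q\<^sub>0 Z Z P $$ (p, q)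
        * (cinner (cadjoint (a Z $$ (j, q)) (X j)) (cadjoint (a Z $$ (l, p)) (X l))
           - cinner (cadjoint (b Z $$ (j, q)) (X j)) (cadjoint (b Z $$ (l, p)) (X l))))"
      by (intro sum.cong refl) (simp add: dBR_kernel_form [of Z n a b Z n, OF n caZ cbZ n caZ cbZ])
    also have "\<dots> = (\<Sum>p<n. \<Sum>q<n. \<Sum>l<n. \<Sum>j<n. k_kernel Q\<^sub>0 Z Z P $$ (p, q)
        * (cinner (cadjoint (a Z $$ (j, q)) (X j)) (cadjoint (a Z $$ (l, p)) (X l))
           - cinner (cadjoint (b Z $$ (j, q)) (X j)) (cadjoint (b Z $$ (l, p)) (X l))))"
      by (rule sum_swap2)
    also have "\<dots> = F P"
      by (simp add: F_def A_def B_def cinner_sum_left cinner_sum_right sum_subtractf flip: sum_distrib_left)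
    finally show ?thesis .
  qed
  have strict: "0 \<le> F R" if R: "R \<in> carrier_mat n n" and \<epsilon>: "0 < \<epsilon>"
    and coercive: "\<And>c. complex_of_real (\<epsilon> * (\<Sum>i<n. (cmod (c i))\<^sup>2)) \<le> (\<Sum>i<n. \<Sum>j<n. c i * cnj (c j) * R $$ (i, j))" for R \<epsilon>
  proof -
    have Zb: "Z \<in> nc_ball \<Xi> Q\<^sub>0" using Z by blast
    obtain J Z' where J: "J \<in> carrier_mat n n" and Z': "Z' \<in> nc_ball \<Xi> Q\<^sub>0" "dim_row Z' = n" and eq: "J \<bullet>\<^sub>l Z' = Z \<bullet>\<^sub>r J"
      and full: "\<And>\<Phi>. full_nc_subset \<Phi> \<Longrightarrow> Z \<in> \<Phi> \<Longrightarrow> Z' \<in> \<Phi>"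
      and T: "\<And>p q. p < n \<Longrightarrow> q < n \<Longrightarrow> k_kernel Q\<^sub>0 Z Z R $$ (p, q) = (\<Sum>s<n. J $$ (p, s) * cnj (J $$ (q, s)))"
      by (rule similar_point [OF \<Xi> nc Zb n R \<epsilon> coercive]) blast
    \<comment> \<open>Every full nc set that contains Z contains Z', so Z' lies in the hull as well
      as in the ball. This is where positivity on all of \<Omega>' enters, beyond the points of
      \<Omega>.\<close>
    have Z'D: "Z' \<in> ?D"
      using Z Z'(1) full unfolding full_nc_hull_def by blast
    define w where "w k = (\<Sum>l<n. cnj (J $$ (l, k)) *\<^sub>C X l)" for k
    have quad: "(\<Sum>p<n. \<Sum>q<n. k_kernel Q\<^sub>0 Z Z R $$ (p, q) * cinner (\<Sum>l<n. cadjoint (h Z $$ (l, q)) (X l)) (\<Sum>l<n. cadjoint (h Z $$ (l, p)) (X l)))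
        = of_real (\<Sum>s<n. (norm (\<Sum>k<n. cadjoint (h Z' $$ (k, s)) (w k)))\<^sup>2)"
      if h: "nc_function ?D h" for h :: "'v mat \<Rightarrow> ('h::chilbert_space \<Rightarrow>\<^sub>C\<^sub>L 'e) mat"
    proof -
      define H where "H q = (\<Sum>l<n. cadjoint (h Z $$ (l, q)) (X l))" for q
      have ch: "h Z \<in> carrier_mat n n" "h Z' \<in> carrier_mat n n"
        using nc_functionD(1) [OF h Z] nc_functionD(1) [OF h Z'D] n Z'(2) by auto
      have hJ: "J \<bullet>\<^sub>l h Z' = h Z \<bullet>\<^sub>r J"
        using nc_functionD(2) [OF h Z'D Z _ eq] J n Z'(2) by simp
      have ent: "(\<Sum>q<n. cnj (J $$ (q, s)) *\<^sub>C cadjoint (h Z $$ (l, q)) x) = (\<Sum>k<n. cnj (J $$ (l, k)) *\<^sub>C cadjoint (h Z' $$ (k, s)) x)"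
        if ls: "l < n" "s < n" for l s x
      proof -
        have "(\<Sum>q<n. J $$ (q, s) *\<^sub>C h Z $$ (l, q)) = (\<Sum>k<n. J $$ (l, k) *\<^sub>C h Z' $$ (k, s))"
          using arg_cong [OF hJ, of "\<lambda>M. M $$ (l, s)"] ch J ls by (simp add: index_cmat_times)
        from arg_cong [OF this, of "\<lambda>T. (cadjoint T) x"] show ?thesis
          by (simp add: cadjoint_sum cadjoint_scale)
      qed
      have row: "(\<Sum>q<n. cnj (J $$ (q, s)) *\<^sub>C H q) = (\<Sum>k<n. cadjoint (h Z' $$ (k, s)) (w k))" if s: "s < n" for s
      proof -
        have "(\<Sum>q<n. cnj (J $$ (q, s)) *\<^sub>C H q) = (\<Sum>q<n. \<Sum>l<n. cnj (J $$ (q, s)) *\<^sub>C cadjoint (h Z $$ (l, q)) (X l))"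
          by (simp add: H_def flip: sum_scaleC_right)
        also have "\<dots> = (\<Sum>l<n. \<Sum>q<n. cnj (J $$ (q, s)) *\<^sub>C cadjoint (h Z $$ (l, q)) (X l))"
          by (rule sum.swap)
        also have "\<dots> = (\<Sum>l<n. \<Sum>k<n. cnj (J $$ (l, k)) *\<^sub>C cadjoint (h Z' $$ (k, s)) (X l))"
          by (intro sum.cong refl ent) (use s in auto)
        also have "\<dots> = (\<Sum>k<n. \<Sum>l<n. cnj (J $$ (l, k)) *\<^sub>C cadjoint (h Z' $$ (k, s)) (X l))"
          by (rule sum.swap)
        finally show ?thesis
          by (simp add: w_def cblinfun_sum cblinfun_scale)
      qed
      have "(\<Sum>p<n. \<Sum>q<n. k_kernel Q\<^sub>0 Z Z R $$ (p, q) * cinner (H q) (H p))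
          = (\<Sum>q<n. \<Sum>p<n. k_kernel Q\<^sub>0 Z Z R $$ (p, q) * cinner (H q) (H p))"
        by (rule sum.swap)
      also have "\<dots> = of_real (\<Sum>s<n. (norm (\<Sum>q<n. cnj (J $$ (q, s)) *\<^sub>C H q))\<^sup>2)"
        by (rule factorized_sum_cinner) (simp add: T mult.commute)
      also have "\<dots> = of_real (\<Sum>s<n. (norm (\<Sum>k<n. cadjoint (h Z' $$ (k, s)) (w k)))\<^sup>2)"
        by (intro arg_cong [where f = of_real] sum.cong refl) (simp add: row)
      finally show ?thesis
        unfolding H_def .
    qed
    have "(\<Sum>s<n. (norm (\<Sum>k<n. cadjoint (b Z' $$ (k, s)) (w k)))\<^sup>2) \<le> (\<Sum>s<n. (norm (\<Sum>k<n. cadjoint (a Z' $$ (k, s)) (w k)))\<^sup>2)"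
      using pos [OF Z'D] nc_functionD(1) [OF a Z'D] nc_functionD(1) [OF b Z'D] Z'(2) by (simp add: op_psd_diff_iff)
    moreover have "F R = of_real (\<Sum>s<n. (norm (\<Sum>k<n. cadjoint (a Z' $$ (k, s)) (w k)))\<^sup>2)
        - of_real (\<Sum>s<n. (norm (\<Sum>k<n. cadjoint (b Z' $$ (k, s)) (w k)))\<^sup>2)"
      unfolding F_def A_def B_def right_diff_distrib sum_subtractf quad [OF a] quad [OF b] ..
    ultimately show ?thesis
      by (simp add: less_eq_complex_def del: of_real_sum)
  qed
  have "0 \<le> F P + of_real \<epsilon> * F (1\<^sub>m n)" if \<epsilon>: "0 < \<epsilon>" for \<epsilon>
  proof -
    let ?R = "P + of_real \<epsilon> \<cdot>\<^sub>m 1\<^sub>m n"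
    have R: "?R \<in> carrier_mat n n" using P by simp
    have k: "k_kernel Q\<^sub>0 Z Z ?R $$ (p, q) = k_kernel Q\<^sub>0 Z Z P $$ (p, q) + of_real \<epsilon> * k_kernel Q\<^sub>0 Z Z (1\<^sub>m n) $$ (p, q)"
      if pq: "p < n" "q < n" for p q
    proof -
      have "k_kernel Q\<^sub>0 Z Z ?R $$ (p, q) = (\<Sum>a<n. \<Sum>b<n. P $$ (a, b) * cinner (kvec (Q\<^sub>0 Z) b q) (kvec (Q\<^sub>0 Z) a p)
          + of_real \<epsilon> * (1\<^sub>m n $$ (a, b) * cinner (kvec (Q\<^sub>0 Z) b q) (kvec (Q\<^sub>0 Z) a p)))"
        unfolding k_kernel_index [of n Q\<^sub>0 Z n Z, OF Q n Q n R pq]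
        using P by (intro sum.cong refl) (simp add: distrib_right)
      then show ?thesis
        unfolding k_kernel_index [of n Q\<^sub>0 Z n Z, OF Q n Q n P pq] k_kernel_index [of n Q\<^sub>0 Z n Z, OF Q n Q n one_carrier_mat pq]
        by (simp only: sum.distrib sum_distrib_left)
    qed
    have "complex_of_real (\<epsilon> * (\<Sum>i<n. (cmod (c i))\<^sup>2)) \<le> (\<Sum>i<n. \<Sum>j<n. c i * cnj (c j) * ?R $$ (i, j))" for c
    proof -
      have "(\<Sum>i<n. \<Sum>j<n. c i * cnj (c j) * ?R $$ (i, j))
          = (\<Sum>i<n. \<Sum>j<n. c i * cnj (c j) * P $$ (i, j) + (if j = i then of_real \<epsilon> * (c i * cnj (c j)) else 0))"
        using P by (intro sum.cong refl) (auto simp: algebra_simps)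
      also have "\<dots> = (\<Sum>i<n. \<Sum>j<n. c i * cnj (c j) * P $$ (i, j)) + of_real (\<epsilon> * (\<Sum>i<n. (cmod (c i))\<^sup>2))"
        by (simp add: sum.distrib sum_distrib_left flip: complex_norm_square)
      finally show ?thesis
        using psd [of c] by simp
    qed
    then have "0 \<le> F ?R"
      by (rule strict [OF R \<epsilon>])
    also have "F ?R = F P + of_real \<epsilon> * F (1\<^sub>m n)"
      by (simp add: F_def k distrib_right sum.distrib sum_distrib_left mult.assoc)
    finally show ?thesis .
  qed
  then show ?thesis
    unfolding form by (rule nonneg_limit)
qed

section \<open>Several points through their direct sum\<close>

lemma incl_mult_index:
  assumes "M \<in> carrier_mat N r" "p < N + m" "k < r"
  shows "(incl1 N m * M) $$ (p, k) = (if p < N then M $$ (p, k) else 0)"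
proof -
  have "(incl1 N m * M) $$ (p, k) = (\<Sum>i<N. if p = i then M $$ (i, k) else 0)"
    using assms by (simp add: incl1_def scalar_prod_def atLeast0LessThan if_distrib [of "\<lambda>x. x * _"] cong: if_cong)
  then show ?thesis by simp
qed

text \<open>The indices run up to and including n because there is no empty direct sum. The
  embeddings are isometric with mutually orthogonal ranges, so a family of test vectors can be
  recovered from a single vector at W.\<close>

lemma dsums_blocks:
  fixes n :: nat
  assumes Z: "\<And>i. i \<le> n \<Longrightarrow> Z i \<in> \<Omega>" and sq: "\<And>W. W \<in> dsums \<Omega> \<Longrightarrow> square_mat W"
  shows "\<exists>W\<in>dsums \<Omega>. \<exists>\<iota>.
    (\<forall>i\<le>n. \<iota> i \<in> carrier_mat (dim_row W) (dim_row (Z i)) \<and> \<iota> i \<bullet>\<^sub>l Z i = W \<bullet>\<^sub>r \<iota> i)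
    \<and> (\<forall>i\<le>n. \<forall>j\<le>n. \<forall>k<dim_row (Z i). \<forall>l<dim_row (Z j).
        (\<Sum>p<dim_row W. cnj (\<iota> i $$ (p, k)) * \<iota> j $$ (p, l)) = (if i = j \<and> k = l then 1 else 0))"
  using Z
proof (induction n)
  case 0
  have Z0: "Z 0 \<in> dsums \<Omega>"
    using 0 [of 0] dsums.base by blast
  let ?m = "dim_row (Z 0)"
  have "(\<Sum>p<?m. cnj (1\<^sub>m ?m $$ (p, k)) * 1\<^sub>m ?m $$ (p, l)) = (if k = l then 1 else 0)"
    if "k < ?m" "l < ?m" for k l
  proof -
    have "(\<Sum>p<?m. cnj (1\<^sub>m ?m $$ (p, k)) * 1\<^sub>m ?m $$ (p, l)) = (\<Sum>p<?m. if p = k then if k = l then 1 else 0 else 0)"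
      using that by (intro sum.cong refl) auto
    then show ?thesis using that by simp
  qed
  then show ?case
    using Z0 one_cmat_times [OF sq [OF Z0] refl]
    by (intro bexI [of _ "Z 0"] exI [of _ "\<lambda>_. 1\<^sub>m ?m"]) auto
next
  case (Suc n)
  obtain W \<iota> where W: "W \<in> dsums \<Omega>"
    and \<iota>: "\<forall>i\<le>n. \<iota> i \<in> carrier_mat (dim_row W) (dim_row (Z i)) \<and> \<iota> i \<bullet>\<^sub>l Z i = W \<bullet>\<^sub>r \<iota> i"
    and orth: "\<forall>i\<le>n. \<forall>j\<le>n. \<forall>k<dim_row (Z i). \<forall>l<dim_row (Z j).
        (\<Sum>p<dim_row W. cnj (\<iota> i $$ (p, k)) * \<iota> j $$ (p, l)) = (if i = j \<and> k = l then 1 else 0)"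
    using Suc.IH [OF Suc.prems [OF le_SucI]] by blast
  have V: "Z (Suc n) \<in> dsums \<Omega>"
    using Suc.prems dsums.base by blast
  let ?N = "dim_row W" and ?m = "dim_row (Z (Suc n))" and ?W = "direct_sum W (Z (Suc n))"
  note inter = incl_intertwine [OF sq [OF W] sq [OF V]]
  define \<theta> where "\<theta> i = (if i \<le> n then incl1 ?N ?m * \<iota> i else incl2 ?N ?m)" for i
  have 1: "\<theta> i \<in> carrier_mat (dim_row ?W) (dim_row (Z i)) \<and> \<theta> i \<bullet>\<^sub>l Z i = ?W \<bullet>\<^sub>r \<theta> i" if "i \<le> Suc n" for i
  proof (cases "i \<le> n")
    case True
    then have \<iota>i: "\<iota> i \<in> carrier_mat ?N (dim_row (Z i))" "\<iota> i \<bullet>\<^sub>l Z i = W \<bullet>\<^sub>r \<iota> i"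
      using \<iota> by auto
    have "(incl1 ?N ?m * \<iota> i) \<bullet>\<^sub>l Z i = incl1 ?N ?m \<bullet>\<^sub>l (\<iota> i \<bullet>\<^sub>l Z i)"
      by (rule cmat_times_left_assoc [symmetric, OF \<iota>i(1) refl incl_carrier(1)])
    also have "\<dots> = (incl1 ?N ?m \<bullet>\<^sub>l W) \<bullet>\<^sub>r \<iota> i"
      unfolding \<iota>i(2) using \<iota>i(1) sq [OF W] by (intro cmat_times_left_right [symmetric]) (auto simp: incl1_def)
    also have "\<dots> = ?W \<bullet>\<^sub>r (incl1 ?N ?m * \<iota> i)"
      unfolding inter(1) using sq [OF W] sq [OF V] by (intro cmat_times_right_assoc [OF _ _ \<iota>i(1)]) auto
    finally show ?thesis
      using True \<iota>i(1) by (auto simp: \<theta>_def intro!: mult_carrier_mat)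
  next
    case False
    then show ?thesis
      using that inter(2) by (simp add: \<theta>_def le_Suc_eq)
  qed
  have ent: "\<theta> i $$ (p, k) = (if i \<le> n then if p < ?N then \<iota> i $$ (p, k) else 0 else if p = ?N + k then 1 else 0)"
    if "i \<le> Suc n" "p < ?N + ?m" "k < dim_row (Z i)" for i p k
    using that \<iota> by (auto simp: \<theta>_def incl_mult_index incl2_def le_Suc_eq simp del: index_mult_mat)
  have 2: "(\<Sum>p<dim_row ?W. cnj (\<theta> i $$ (p, k)) * \<theta> j $$ (p, l)) = (if i = j \<and> k = l then 1 else 0)"
    if ij: "i \<le> Suc n" "j \<le> Suc n" and kl: "k < dim_row (Z i)" "l < dim_row (Z j)" for i j k l
  proof -
    have "(\<Sum>p<dim_row ?W. cnj (\<theta> i $$ (p, k)) * \<theta> j $$ (p, l))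
        = (\<Sum>p<?N. cnj (\<theta> i $$ (p, k)) * \<theta> j $$ (p, l)) + (\<Sum>p<?m. cnj (\<theta> i $$ (?N + p, k)) * \<theta> j $$ (?N + p, l))"
      by (simp add: sum_lessThan_add)
    moreover have "(\<Sum>p<?N. cnj (\<theta> i $$ (p, k)) * \<theta> j $$ (p, l))
        = (\<Sum>p<?N. if i \<le> n \<and> j \<le> n then cnj (\<iota> i $$ (p, k)) * \<iota> j $$ (p, l) else 0)"
      using ij kl by (intro sum.cong refl) (auto simp: ent)
    moreover have "(\<Sum>p<?m. cnj (\<theta> i $$ (?N + p, k)) * \<theta> j $$ (?N + p, l))
        = (\<Sum>p<?m. if p = k then if \<not> i \<le> n \<and> \<not> j \<le> n \<and> k = l then 1 else 0 else 0)"
      using ij kl by (intro sum.cong refl) (auto simp: ent)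
    moreover have "k < ?m" if "\<not> i \<le> n"
      using that ij kl by (simp add: le_Suc_eq)
    ultimately show ?thesis
      using ij kl orth by (auto simp: le_Suc_eq)
  qed
  show ?case
    using dsums.sum [OF W V] 1 2 by blast
qed

lemma dBR_kernel_quadratic:
  fixes x y :: "nat \<Rightarrow> 'e::chilbert_space"
  assumes Z: "strict_row_contraction (dim_row Z) (Q\<^sub>0 Z)" "a Z \<in> carrier_mat (dim_row Z) (dim_row Z)" "b Z \<in> carrier_mat (dim_row Z) (dim_row Z)"
    and W: "strict_row_contraction (dim_row W) (Q\<^sub>0 W)" "a W \<in> carrier_mat (dim_row W) (dim_row W)" "b W \<in> carrier_mat (dim_row W) (dim_row W)"
    and P: "P \<in> carrier_mat (dim_row Z) (dim_row W)"
  shows "(\<Sum>l<dim_row Z. \<Sum>j<dim_row W. cinner ((dBR_kernel Q\<^sub>0 a b Z W P $$ (l, j)) (y j)) (x l))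
    = (\<Sum>i<dim_row Z. \<Sum>k<dim_row W. P $$ (i, k)
        * (cinner (\<Sum>j<dim_row W. tensor_kvec (Q\<^sub>0 W) (a W) (y j) k j) (\<Sum>l<dim_row Z. tensor_kvec (Q\<^sub>0 Z) (a Z) (x l) i l)
           - cinner (\<Sum>j<dim_row W. tensor_kvec (Q\<^sub>0 W) (b W) (y j) k j) (\<Sum>l<dim_row Z. tensor_kvec (Q\<^sub>0 Z) (b Z) (x l) i l)))"
proof -
  have "(\<Sum>l<dim_row Z. \<Sum>j<dim_row W. cinner ((dBR_kernel Q\<^sub>0 a b Z W P $$ (l, j)) (y j)) (x l))
    = (\<Sum>l<dim_row Z. \<Sum>j<dim_row W. \<Sum>i<dim_row Z. \<Sum>k<dim_row W. P $$ (i, k)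
        * (cinner (tensor_kvec (Q\<^sub>0 W) (a W) (y j) k j) (tensor_kvec (Q\<^sub>0 Z) (a Z) (x l) i l)
           - cinner (tensor_kvec (Q\<^sub>0 W) (b W) (y j) k j) (tensor_kvec (Q\<^sub>0 Z) (b Z) (x l) i l)))"
    by (intro sum.cong refl) (simp add: dBR_kernel_expand [of Z Q\<^sub>0 a b W, OF Z W P])
  also have "\<dots> = (\<Sum>i<dim_row Z. \<Sum>k<dim_row W. \<Sum>l<dim_row Z. \<Sum>j<dim_row W. P $$ (i, k)
        * (cinner (tensor_kvec (Q\<^sub>0 W) (a W) (y j) k j) (tensor_kvec (Q\<^sub>0 Z) (a Z) (x l) i l)
           - cinner (tensor_kvec (Q\<^sub>0 W) (b W) (y j) k j) (tensor_kvec (Q\<^sub>0 Z) (b Z) (x l) i l)))"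
    by (rule sum_swap2)
  finally show ?thesis
    by (simp add: cinner_sum_left cinner_sum_right sum_subtractf flip: sum_distrib_left)
qed

text \<open>With W the direct sum of the points and \<iota> its embeddings, the block form of the
  \<open>P i j\<close> at the vectors \<open>x i\<close> becomes the form at the single point W for
  the matrix R, the sum of the \<iota> i (P i j) \<iota> j^* , and for the vector X, the sum of the
  \<iota> k (x k).\<close>

theorem psd_imp_cp:
  fixes Q\<^sub>0 :: "'v::complex_vector mat \<Rightarrow> ('r::chilbert_space \<Rightarrow>\<^sub>C\<^sub>L complex) mat"
    and a :: "'v mat \<Rightarrow> ('y::chilbert_space \<Rightarrow>\<^sub>C\<^sub>L 'e::chilbert_space) mat"
    and b :: "'v mat \<Rightarrow> ('u::chilbert_space \<Rightarrow>\<^sub>C\<^sub>L 'e) mat"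
  assumes \<Xi>: "full_nc_subset \<Xi>" and nc: "nc_function \<Xi> Q\<^sub>0" and \<Omega>: "\<Omega> \<subseteq> nc_ball \<Xi> Q\<^sub>0"
    and a: "nc_function (full_nc_hull \<Xi> \<Omega> \<inter> nc_ball \<Xi> Q\<^sub>0) a" and b: "nc_function (full_nc_hull \<Xi> \<Omega> \<inter> nc_ball \<Xi> Q\<^sub>0) b"
    and pos: "\<And>Z. Z \<in> full_nc_hull \<Xi> \<Omega> \<inter> nc_ball \<Xi> Q\<^sub>0 \<Longrightarrow> op_psd (a Z \<odot> op_adjoint (a Z) - b Z \<odot> op_adjoint (b Z))"
  shows "cp_nc_kernel \<Omega> (dBR_kernel Q\<^sub>0 a b)"
proof -
  let ?D = "full_nc_hull \<Xi> \<Omega> \<inter> nc_ball \<Xi> Q\<^sub>0" and ?K = "dBR_kernel Q\<^sub>0 a b"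
  have dD: "dsums \<Omega> \<subseteq> ?D"
    using dsums_subset_hull dsums_subset_ball [OF \<Xi> nc \<Omega>] by blast
  have \<Omega>D: "\<Omega> \<subseteq> ?D"
    using dD dsums.base by blast
  have D\<Xi>: "?D \<subseteq> \<Xi>"
    by (auto simp: nc_ball_def)
  have Q: "strict_row_contraction (dim_row Z) (Q\<^sub>0 Z)" if "Z \<in> ?D" for Z
    using that by (simp add: nc_ball_iff [OF nc])
  note ncD = nc_function_subset [OF nc D\<Xi>]
  note ca = nc_functionD(1) [OF a] and cb = nc_functionD(1) [OF b]
  have "nc_kernel ?D ?K"
    by (rule nc_kernel_dBR [OF Q ncD a b])
  then have "nc_kernel \<Omega> ?K"
    using \<Omega>D unfolding nc_kernel_def by (meson subsetD)
  moreover have "block_psd n (\<lambda>i. dim_row (Z i)) (\<lambda>i j. ?K (Z i) (Z j) (P i j))"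
    if Z: "\<forall>i<n. Z i \<in> \<Omega>" and P: "\<forall>i<n. \<forall>j<n. P i j \<in> carrier_mat (dim_row (Z i)) (dim_row (Z j))"
      and psd: "block_psd n (\<lambda>i. dim_row (Z i)) (\<lambda>i j. mat_tensor_id (P i j) :: (complex \<Rightarrow>\<^sub>C\<^sub>L complex) mat)" for n Z P
  proof -
    let ?d = "\<lambda>i. dim_row (Z i)"
    have ZD: "Z i \<in> ?D" if "i < n" for i
      using Z that \<Omega>D by blast
    have Kc: "?K (Z i) (Z j) (P i j) \<in> carrier_mat (?d i) (?d j)" if "i < n" "j < n" for i j
      using ca cb ZD that by (intro dBR_kernel_carrier) auto
    have "0 \<le> (\<Sum>i<n. \<Sum>j<n. vec_cinner (op_apply (?K (Z i) (Z j) (P i j)) (x j)) (x i))"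
      if x: "\<forall>i<n. x i \<in> carrier_vec (?d i)" for x
    proof (cases n)
      case (Suc m)
      have "\<exists>W\<in>dsums \<Omega>. \<exists>\<iota>. (\<forall>i\<le>m. \<iota> i \<in> carrier_mat (dim_row W) (?d i) \<and> \<iota> i \<bullet>\<^sub>l Z i = W \<bullet>\<^sub>r \<iota> i)
        \<and> (\<forall>i\<le>m. \<forall>j\<le>m. \<forall>k<?d i. \<forall>l<?d j.
          (\<Sum>p<dim_row W. cnj (\<iota> i $$ (p, k)) * \<iota> j $$ (p, l)) = (if i = j \<and> k = l then 1 else 0))"
        by (rule dsums_blocks) (use Z Suc dD D\<Xi> full_nc_square [OF \<Xi>] in auto)
      then obtain W \<iota> where W: "W \<in> dsums \<Omega>"
        and \<iota>: "\<And>i. i < n \<Longrightarrow> \<iota> i \<in> carrier_mat (dim_row W) (?d i)" "\<And>i. i < n \<Longrightarrow> \<iota> i \<bullet>\<^sub>l Z i = W \<bullet>\<^sub>r \<iota> i"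
        and orth: "\<And>i j k l. \<lbrakk>i < n; j < n; k < ?d i; l < ?d j\<rbrakk> \<Longrightarrow>
          (\<Sum>p<dim_row W. cnj (\<iota> i $$ (p, k)) * \<iota> j $$ (p, l)) = (if i = j \<and> k = l then 1 else 0)"
        unfolding Suc less_Suc_eq_le by blast
      have WD: "W \<in> ?D"
        using W dD by blast
      let ?N = "dim_row W"
      define R where "R = mat ?N ?N (\<lambda>(s, t). \<Sum>i<n. \<Sum>j<n. \<Sum>p<?d i. \<Sum>q<?d j. \<iota> i $$ (s, p) * P i j $$ (p, q) * cnj (\<iota> j $$ (t, q)))"
      have R: "R \<in> carrier_mat ?N ?N"
        by (simp add: R_def)
      have agg: "(\<Sum>i<n. \<Sum>j<n. \<Sum>p<?d i. \<Sum>q<?d j. P i j $$ (p, q)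
            * cinner (\<Sum>t<?N. cnj (\<iota> j $$ (t, q)) *\<^sub>C v t) (\<Sum>s<?N. cnj (\<iota> i $$ (s, p)) *\<^sub>C v s))
          = (\<Sum>s<?N. \<Sum>t<?N. R $$ (s, t) * cinner (v t) (v s))" for v :: "nat \<Rightarrow> 'h::chilbert_space"
      proof -
        have "(\<Sum>i<n. \<Sum>j<n. \<Sum>p<?d i. \<Sum>q<?d j. P i j $$ (p, q)
            * cinner (\<Sum>t<?N. cnj (\<iota> j $$ (t, q)) *\<^sub>C v t) (\<Sum>s<?N. cnj (\<iota> i $$ (s, p)) *\<^sub>C v s))
          = (\<Sum>i<n. \<Sum>j<n. \<Sum>s<?N. \<Sum>t<?N. (\<Sum>p<?d i. \<Sum>q<?d j. \<iota> i $$ (s, p) * P i j $$ (p, q) * cnj (\<iota> j $$ (t, q))) * cinner (v t) (v s))"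
          by (rule sum.cong [OF refl], rule sum.cong [OF refl], rule sum_cinner_transform)
        also have "\<dots> = (\<Sum>s<?N. \<Sum>t<?N. \<Sum>i<n. \<Sum>j<n. (\<Sum>p<?d i. \<Sum>q<?d j. \<iota> i $$ (s, p) * P i j $$ (p, q) * cnj (\<iota> j $$ (t, q))) * cinner (v t) (v s))"
          by (rule sum_swap2)
        also have "\<dots> = (\<Sum>s<?N. \<Sum>t<?N. R $$ (s, t) * cinner (v t) (v s))"
          by (intro sum.cong refl) (simp add: R_def sum_distrib_right)
        finally show ?thesis .
      qed
      \<comment> \<open>The form of R at c is the block form of the \<open>P i j\<close> at the
        vectors \<open>z i\<close>, the images of the conjugate of c under \<iota> i^* .\<close>
      have Rpsd: "0 \<le> (\<Sum>s<?N. \<Sum>t<?N. c s * cnj (c t) * R $$ (s, t))" for c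
      proof -
        define z where "z i = vec (?d i) (\<lambda>p. \<Sum>t<?N. cnj (\<iota> i $$ (t, p)) *\<^sub>C cnj (c t))" for i
        have "0 \<le> (\<Sum>i<n. \<Sum>j<n. vec_cinner (op_apply (mat_tensor_id (P i j)) (z j)) (z i))"
          using psd unfolding block_psd_def by (simp add: z_def)
        also have "\<dots> = (\<Sum>i<n. \<Sum>j<n. \<Sum>p<?d i. \<Sum>q<?d j. P i j $$ (p, q)
            * cinner (\<Sum>t<?N. cnj (\<iota> j $$ (t, q)) *\<^sub>C cnj (c t)) (\<Sum>s<?N. cnj (\<iota> i $$ (s, p)) *\<^sub>C cnj (c s)))"
        proof (intro sum.cong refl)
          fix i j assume "i \<in> {..<n}" "j \<in> {..<n}"
          then have c: "dim_row (P i j) = ?d i" "dim_col (P i j) = ?d j"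
            using P by auto
          show "vec_cinner (op_apply (mat_tensor_id (P i j)) (z j)) (z i) = (\<Sum>p<?d i. \<Sum>q<?d j. P i j $$ (p, q)
            * cinner (\<Sum>t<?N. cnj (\<iota> j $$ (t, q)) *\<^sub>C cnj (c t)) (\<Sum>s<?N. cnj (\<iota> i $$ (s, p)) *\<^sub>C cnj (c s)))"
            unfolding vec_cinner_def by (rule sum.cong)
              (simp_all add: c z_def cinner_sum_left [of "\<lambda>q. P i j $$ (_, q) *\<^sub>C _ q"] cinner_scaleC_left)
        qed
        also have "\<dots> = (\<Sum>s<?N. \<Sum>t<?N. R $$ (s, t) * cinner (cnj (c t)) (cnj (c s)))"
          by (rule agg)
        finally show ?thesis
          by (simp add: cinner_complex_def mult_ac)
      qed
      define X where "X p = (\<Sum>k<n. \<Sum>q<?d k. \<iota> k $$ (p, q) *\<^sub>C x k $ q)" for p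
      \<comment> \<open>Compressing X by \<iota> i^* returns \<open>x i\<close>, by orthogonality of
        the ranges.\<close>
      have ortho: "(\<Sum>p<?N. cnj (\<iota> i $$ (p, l)) *\<^sub>C X p) = x i $ l" if il: "i < n" "l < ?d i" for i l
      proof -
        have "(\<Sum>p<?N. cnj (\<iota> i $$ (p, l)) *\<^sub>C X p)
            = (\<Sum>p<?N. \<Sum>k<n. \<Sum>q<?d k. (cnj (\<iota> i $$ (p, l)) * \<iota> k $$ (p, q)) *\<^sub>C x k $ q)"
          by (simp add: X_def scaleC_scaleC flip: sum_scaleC_right)
        also have "\<dots> = (\<Sum>k<n. \<Sum>p<?N. \<Sum>q<?d k. (cnj (\<iota> i $$ (p, l)) * \<iota> k $$ (p, q)) *\<^sub>C x k $ q)"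
          by (rule sum.swap)
        also have "\<dots> = (\<Sum>k<n. \<Sum>q<?d k. \<Sum>p<?N. (cnj (\<iota> i $$ (p, l)) * \<iota> k $$ (p, q)) *\<^sub>C x k $ q)"
          by (rule sum.cong [OF refl], rule sum.swap)
        also have "\<dots> = (\<Sum>k<n. if k = i then \<Sum>q<?d k. if q = l then x k $ q else 0 else 0)"
        proof (intro sum.cong refl)
          fix k assume k: "k \<in> {..<n}"
          have "(\<Sum>p<?N. (cnj (\<iota> i $$ (p, l)) * \<iota> k $$ (p, q)) *\<^sub>C x k $ q) = (if i = k \<and> l = q then x k $ q else 0)" if "q < ?d k" for q
            unfolding sum_scaleC_left using orth [of i k l q] il k that by (simp add: scaleC_one)
          then show "(\<Sum>q<?d k. \<Sum>p<?N. (cnj (\<iota> i $$ (p, l)) * \<iota> k $$ (p, q)) *\<^sub>C x k $ q)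
              = (if k = i then \<Sum>q<?d k. if q = l then x k $ q else 0 else 0)"
            by (auto intro!: sum.cong sum.neutral)
        qed
        finally show ?thesis
          using il by simp
      qed
      \<comment> \<open>Intertwining expresses the summed kernel vectors at \<open>Z i\<close> for
        \<open>x i\<close> through those at W for X; the vectors at W do not depend on i.\<close>
      have tk: "(\<Sum>l<?d i. tensor_kvec (Q\<^sub>0 (Z i)) (h (Z i)) (x i $ l) p l) = (\<Sum>j<?N. cnj (\<iota> i $$ (j, p)) *\<^sub>C (\<Sum>q<?N. tensor_kvec (Q\<^sub>0 W) (h W) (X q) j q))"
        if h: "nc_function ?D h" and ip: "i < n" "p < ?d i" for h :: "'v mat \<Rightarrow> ('h::chilbert_space \<Rightarrow>\<^sub>C\<^sub>L 'e) mat" and i p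
      proof -
        note I = tensor_kvec_intertwine [OF Q [OF ZD [OF ip(1)]] Q [OF WD] \<iota>(1) [OF ip(1)]
            nc_functionD(2) [OF ncD ZD [OF ip(1)] WD \<iota>(1) [OF ip(1)] \<iota>(2) [OF ip(1)]]
            nc_functionD(1) [OF h ZD [OF ip(1)]] nc_functionD(1) [OF h WD]
            nc_functionD(2) [OF h ZD [OF ip(1)] WD \<iota>(1) [OF ip(1)] \<iota>(2) [OF ip(1)]] ip(2)]
        have "(\<Sum>j<?N. cnj (\<iota> i $$ (j, p)) *\<^sub>C (\<Sum>q<?N. tensor_kvec (Q\<^sub>0 W) (h W) (X q) j q))
            = (\<Sum>j<?N. \<Sum>q<?N. cnj (\<iota> i $$ (j, p)) *\<^sub>C tensor_kvec (Q\<^sub>0 W) (h W) (X q) j q)"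
          by (simp flip: sum_scaleC_right)
        also have "\<dots> = (\<Sum>q<?N. \<Sum>j<?N. cnj (\<iota> i $$ (j, p)) *\<^sub>C tensor_kvec (Q\<^sub>0 W) (h W) (X q) j q)"
          by (rule sum.swap)
        also have "\<dots> = (\<Sum>q<?N. \<Sum>l<?d i. cnj (\<iota> i $$ (q, l)) *\<^sub>C tensor_kvec (Q\<^sub>0 (Z i)) (h (Z i)) (X q) p l)"
          by (rule sum.cong [OF refl], rule I [symmetric]) simp
        also have "\<dots> = (\<Sum>l<?d i. \<Sum>q<?N. cnj (\<iota> i $$ (q, l)) *\<^sub>C tensor_kvec (Q\<^sub>0 (Z i)) (h (Z i)) (X q) p l)"
          by (rule sum.swap)
        also have "\<dots> = (\<Sum>l<?d i. tensor_kvec (Q\<^sub>0 (Z i)) (h (Z i)) (x i $ l) p l)"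
          by (intro sum.cong refl) (simp add: tensor_kvec_sum ortho ip)
        finally show ?thesis ..
      qed
      let ?va = "\<lambda>j. \<Sum>q<?N. tensor_kvec (Q\<^sub>0 W) (a W) (X q) j q" and ?vb = "\<lambda>j. \<Sum>q<?N. tensor_kvec (Q\<^sub>0 W) (b W) (X q) j q"
      have "(\<Sum>i<n. \<Sum>j<n. vec_cinner (op_apply (?K (Z i) (Z j) (P i j)) (x j)) (x i))
          = (\<Sum>i<n. \<Sum>j<n. \<Sum>p<?d i. \<Sum>q<?d j. P i j $$ (p, q)
            * (cinner (\<Sum>t<?N. cnj (\<iota> j $$ (t, q)) *\<^sub>C ?va t) (\<Sum>s<?N. cnj (\<iota> i $$ (s, p)) *\<^sub>C ?va s)
              - cinner (\<Sum>t<?N. cnj (\<iota> j $$ (t, q)) *\<^sub>C ?vb t) (\<Sum>s<?N. cnj (\<iota> i $$ (s, p)) *\<^sub>C ?vb s)))"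
      proof (intro sum.cong refl)
        fix i j assume "i \<in> {..<n}" "j \<in> {..<n}"
        then have ij: "i < n" "j < n" by auto
        have Pij: "P i j \<in> carrier_mat (?d i) (?d j)"
          using P ij by blast
        have "vec_cinner (op_apply (?K (Z i) (Z j) (P i j)) (x j)) (x i)
            = (\<Sum>l<?d i. \<Sum>k<?d j. cinner ((?K (Z i) (Z j) (P i j) $$ (l, k)) (x j $ k)) (x i $ l))"
          using Kc [OF ij] by (simp add: vec_cinner_def cinner_sum_left)
        also have "\<dots> = (\<Sum>p<?d i. \<Sum>q<?d j. P i j $$ (p, q)
            * (cinner (\<Sum>t<?N. cnj (\<iota> j $$ (t, q)) *\<^sub>C ?va t) (\<Sum>s<?N. cnj (\<iota> i $$ (s, p)) *\<^sub>C ?va s)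
              - cinner (\<Sum>t<?N. cnj (\<iota> j $$ (t, q)) *\<^sub>C ?vb t) (\<Sum>s<?N. cnj (\<iota> i $$ (s, p)) *\<^sub>C ?vb s)))"
          unfolding dBR_kernel_quadratic [of "Z i" Q\<^sub>0 a b "Z j", OF Q [OF ZD [OF ij(1)]] ca [OF ZD [OF ij(1)]] cb [OF ZD [OF ij(1)]]
              Q [OF ZD [OF ij(2)]] ca [OF ZD [OF ij(2)]] cb [OF ZD [OF ij(2)]] Pij]
          by (intro sum.cong refl) (simp add: tk [OF a] tk [OF b] ij)
        finally show "vec_cinner (op_apply (?K (Z i) (Z j) (P i j)) (x j)) (x i)
            = (\<Sum>p<?d i. \<Sum>q<?d j. P i j $$ (p, q)
            * (cinner (\<Sum>t<?N. cnj (\<iota> j $$ (t, q)) *\<^sub>C ?va t) (\<Sum>s<?N. cnj (\<iota> i $$ (s, p)) *\<^sub>C ?va s)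
              - cinner (\<Sum>t<?N. cnj (\<iota> j $$ (t, q)) *\<^sub>C ?vb t) (\<Sum>s<?N. cnj (\<iota> i $$ (s, p)) *\<^sub>C ?vb s)))" .
      qed
      also have "\<dots> = (\<Sum>s<?N. \<Sum>t<?N. R $$ (s, t) * (cinner (?va t) (?va s) - cinner (?vb t) (?vb s)))"
        unfolding right_diff_distrib sum_subtractf agg ..
      also have "\<dots> = (\<Sum>l<?N. \<Sum>j<?N. cinner ((?K W W R $$ (l, j)) (X j)) (X l))"
        by (rule dBR_kernel_quadratic [symmetric]) (use Q ca cb WD R in auto)
      finally show ?thesis
        using dBR_form_nonneg [OF \<Xi> nc a b pos WD refl R Rpsd] by simp
    qed simp
    then show ?thesis
      using Kc unfolding block_psd_def by blast
  qed
  ultimately show ?thesis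
    unfolding cp_nc_kernel_def by blast
qed

section \<open>The equivalence\<close>

lemma realization_imp_multiplier:
  fixes Q\<^sub>0 :: "'v::complex_vector mat \<Rightarrow> ('r::chilbert_space \<Rightarrow>\<^sub>C\<^sub>L complex) mat"
    and a :: "'v mat \<Rightarrow> ('y::chilbert_space \<Rightarrow>\<^sub>C\<^sub>L 'e::chilbert_space) mat"
    and b :: "'v mat \<Rightarrow> ('u::chilbert_space \<Rightarrow>\<^sub>C\<^sub>L 'e) mat"
  assumes nc: "nc_function \<Xi> Q\<^sub>0"
    and real: "contractive_realization TYPE('x::chilbert_space) TYPE('t::chilbert_space) \<Omega> Q\<^sub>0 a b"
  shows "has_multiplier_solution (nc_ball \<Xi> Q\<^sub>0) \<Omega> Q\<^sub>0 a b"
proof -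
  obtain t :: "'r \<Rightarrow> 'x \<Rightarrow> 't" and A B C D where t: "hilbert_tensor t" and U: "contractive (colligation A B C D)"
    and sol: "\<forall>Z\<in>\<Omega>. a Z \<odot> transfer_function t A B C D (Q\<^sub>0 Z) = b Z"
    using real unfolding contractive_realization_def by blast
  have "nc_function (nc_ball \<Xi> Q\<^sub>0) Q\<^sub>0"
    by (rule nc_function_subset [OF nc]) (auto simp: nc_ball_def)
  then have "contractive_multiplier (nc_ball \<Xi> Q\<^sub>0) (k_kernel_tensor_id Q\<^sub>0) (k_kernel_tensor_id Q\<^sub>0)
      (\<lambda>Z. transfer_function t A B C D (Q\<^sub>0 Z))"
    by (intro transfer_function_contractive_multiplier [OF t U]) (simp add: nc_ball_iff [OF nc])
  then show ?thesis
    using sol unfolding has_multiplier_solution_def by blast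
qed

lemma unitary_imp_contractive_realization:
  "unitary_realization TYPE('x::chilbert_space) TYPE('t::chilbert_space) \<Omega> Q\<^sub>0 a b
    \<Longrightarrow> contractive_realization TYPE('x) TYPE('t) \<Omega> Q\<^sub>0 a b"
  unfolding unitary_realization_def contractive_realization_def using unitary_contractive by blast

theorem theorem5p5:
  fixes \<Xi> \<Omega> :: "'v::complex_vector mat set"
    and Q\<^sub>0 :: "'v mat \<Rightarrow> ('r::chilbert_space \<Rightarrow>\<^sub>C\<^sub>L complex) mat"
  assumes "full_nc_subset \<Xi>"
    and "nc_function \<Xi> Q\<^sub>0"
    and "\<Omega> \<subseteq> nc_ball \<Xi> Q\<^sub>0"
  shows
    "(\<forall>(a :: 'v mat \<Rightarrow> ('y::chilbert_space \<Rightarrow>\<^sub>C\<^sub>L 'e::chilbert_space) mat)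
       (b :: 'v mat \<Rightarrow> ('u::chilbert_space \<Rightarrow>\<^sub>C\<^sub>L 'e) mat).
       nc_function (full_nc_hull \<Xi> \<Omega> \<inter> nc_ball \<Xi> Q\<^sub>0) a
       \<and> nc_function (full_nc_hull \<Xi> \<Omega> \<inter> nc_ball \<Xi> Q\<^sub>0) b \<longrightarrow>
         (has_multiplier_solution (nc_ball \<Xi> Q\<^sub>0) \<Omega> Q\<^sub>0 a b \<longleftrightarrow>
            (\<forall>Z \<in> full_nc_hull \<Xi> \<Omega> \<inter> nc_ball \<Xi> Q\<^sub>0.
               op_psd (a Z \<odot> op_adjoint (a Z) - b Z \<odot> op_adjoint (b Z))))
       \<and> (has_multiplier_solution (nc_ball \<Xi> Q\<^sub>0) \<Omega> Q\<^sub>0 a b \<longleftrightarrow>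
            cp_nc_kernel \<Omega> (dBR_kernel Q\<^sub>0 a b))
       \<and> (has_multiplier_solution (nc_ball \<Xi> Q\<^sub>0) \<Omega> Q\<^sub>0 a b \<longleftrightarrow>
            contractive_realization TYPE(('v, 'e, 'r, 'u, 'y) state_space)
              TYPE(('v, 'e, 'r, 'u, 'y) tensor_state_space) \<Omega> Q\<^sub>0 a b)
       \<and> ((\<exists>r::'r. r \<noteq> 0) \<longrightarrow>
           (has_multiplier_solution (nc_ball \<Xi> Q\<^sub>0) \<Omega> Q\<^sub>0 a b \<longleftrightarrow>
              unitary_realization TYPE(('v, 'e, 'r, 'u, 'y) state_space)
                TYPE(('v, 'e, 'r, 'u, 'y) tensor_state_space) \<Omega> Q\<^sub>0 a b))
       \<and> (contractive_realization TYPE('x::chilbert_space) TYPE('t::chilbert_space) \<Omega> Q\<^sub>0 a b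
            \<longrightarrow> has_multiplier_solution (nc_ball \<Xi> Q\<^sub>0) \<Omega> Q\<^sub>0 a b))
   \<and> (\<forall>(a :: 'v mat \<Rightarrow> ('y \<Rightarrow>\<^sub>C\<^sub>L 'e) mat) (b :: 'v mat \<Rightarrow> ('u \<Rightarrow>\<^sub>C\<^sub>L 'e) mat).
       graded_function \<Omega> a \<and> graded_function \<Omega> b \<longrightarrow>
         (cp_nc_kernel \<Omega> (dBR_kernel Q\<^sub>0 a b) \<longrightarrow>
            contractive_realization TYPE(('v, 'e, 'r, 'u, 'y) state_space)
              TYPE(('v, 'e, 'r, 'u, 'y) tensor_state_space) \<Omega> Q\<^sub>0 a b)
       \<and> ((\<exists>r::'r. r \<noteq> 0) \<longrightarrow> cp_nc_kernel \<Omega> (dBR_kernel Q\<^sub>0 a b) \<longrightarrow>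
            unitary_realization TYPE(('v, 'e, 'r, 'u, 'y) state_space)
              TYPE(('v, 'e, 'r, 'u, 'y) tensor_state_space) \<Omega> Q\<^sub>0 a b)
       \<and> (contractive_realization TYPE('x) TYPE('t) \<Omega> Q\<^sub>0 a b
            \<longrightarrow> has_multiplier_solution (nc_ball \<Xi> Q\<^sub>0) \<Omega> Q\<^sub>0 a b))"
proof -
  have Q: "strict_row_contraction (dim_row Z) (Q\<^sub>0 Z)" if "Z \<in> \<Omega>" for Z
    using assms(3) that by (auto simp: nc_ball_iff [OF assms(2)])
  have "\<Omega> \<subseteq> full_nc_hull \<Xi> \<Omega> \<inter> nc_ball \<Xi> Q\<^sub>0"
    using assms(3) by (auto simp: full_nc_hull_def)
  then have graded_\<Omega>: "graded_function \<Omega> f" if "nc_function (full_nc_hull \<Xi> \<Omega> \<inter> nc_ball \<Xi> Q\<^sub>0) f"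
    for f :: "'v mat \<Rightarrow> 'w::complex_vector mat"
    using that unfolding nc_function_def graded_function_def by blast
  let ?M = "\<lambda>(a :: 'v mat \<Rightarrow> ('y \<Rightarrow>\<^sub>C\<^sub>L 'e) mat) (b :: 'v mat \<Rightarrow> ('u \<Rightarrow>\<^sub>C\<^sub>L 'e) mat). has_multiplier_solution (nc_ball \<Xi> Q\<^sub>0) \<Omega> Q\<^sub>0 a b"
    and ?P = "\<lambda>(a :: 'v mat \<Rightarrow> ('y \<Rightarrow>\<^sub>C\<^sub>L 'e) mat) (b :: 'v mat \<Rightarrow> ('u \<Rightarrow>\<^sub>C\<^sub>L 'e) mat). \<forall>Z \<in> full_nc_hull \<Xi> \<Omega> \<inter> nc_ball \<Xi> Q\<^sub>0.
      op_psd (a Z \<odot> op_adjoint (a Z) - b Z \<odot> op_adjoint (b Z))"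
    and ?K = "\<lambda>(a :: 'v mat \<Rightarrow> ('y \<Rightarrow>\<^sub>C\<^sub>L 'e) mat) (b :: 'v mat \<Rightarrow> ('u \<Rightarrow>\<^sub>C\<^sub>L 'e) mat). cp_nc_kernel \<Omega> (dBR_kernel Q\<^sub>0 a b)"
    and ?C = "\<lambda>(a :: 'v mat \<Rightarrow> ('y \<Rightarrow>\<^sub>C\<^sub>L 'e) mat) (b :: 'v mat \<Rightarrow> ('u \<Rightarrow>\<^sub>C\<^sub>L 'e) mat).
      contractive_realization TYPE(('v, 'e, 'r, 'u, 'y) state_space) TYPE(('v, 'e, 'r, 'u, 'y) tensor_state_space) \<Omega> Q\<^sub>0 a b"
    and ?U = "\<lambda>(a :: 'v mat \<Rightarrow> ('y \<Rightarrow>\<^sub>C\<^sub>L 'e) mat) (b :: 'v mat \<Rightarrow> ('u \<Rightarrow>\<^sub>C\<^sub>L 'e) mat).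
      unitary_realization TYPE(('v, 'e, 'r, 'u, 'y) state_space) TYPE(('v, 'e, 'r, 'u, 'y) tensor_state_space) \<Omega> Q\<^sub>0 a b"
    and ?D = "full_nc_hull \<Xi> \<Omega> \<inter> nc_ball \<Xi> Q\<^sub>0"
  \<comment> \<open>Stated for fresh types, so that it serves both the arbitrary state spaces
    \<open>'x\<close>, \<open>'t\<close> and the fixed state space.\<close>
  have CM: "?M a b" if "contractive_realization TYPE('c::chilbert_space) TYPE('d::chilbert_space) \<Omega> Q\<^sub>0 a b" for a b
    by (rule realization_imp_multiplier [OF assms(2) that])
  have graded: "(?K a b \<longrightarrow> ?C a b) \<and> ((\<exists>r::'r. r \<noteq> 0) \<longrightarrow> ?K a b \<longrightarrow> ?U a b)
      \<and> (contractive_realization TYPE('x) TYPE('t) \<Omega> Q\<^sub>0 a b \<longrightarrow> ?M a b)"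
    if "graded_function \<Omega> a" "graded_function \<Omega> b" for a b
    by (intro conjI impI cp_imp_realization [OF _ that Q] CM)
  have nc: "(?M a b \<longleftrightarrow> ?P a b) \<and> (?M a b \<longleftrightarrow> ?K a b) \<and> (?M a b \<longleftrightarrow> ?C a b) \<and> ((\<exists>r::'r. r \<noteq> 0) \<longrightarrow> (?M a b \<longleftrightarrow> ?U a b))
      \<and> (contractive_realization TYPE('x) TYPE('t) \<Omega> Q\<^sub>0 a b \<longrightarrow> ?M a b)"
    if ab: "nc_function ?D a" "nc_function ?D b" for a b
  proof -
    \<comment> \<open>The cycle runs through M, P, K, C and back to M; U is reached from K and leads
      to C.\<close>
    have "?M a b \<longrightarrow> ?P a b"
      using multiplier_imp_psd [OF assms ab] by blast
    moreover have "?P a b \<longrightarrow> ?K a b"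
      using psd_imp_cp [OF assms ab] by blast
    moreover have "?C a b \<longrightarrow> ?M a b"
      by (intro impI CM)
    moreover have "?U a b \<longrightarrow> ?C a b"
      by (intro impI unitary_imp_contractive_realization)
    ultimately show ?thesis
      using graded [OF graded_\<Omega> [OF ab(1)] graded_\<Omega> [OF ab(2)]] by argo
  qed
  show ?thesis
    by (rule conjI; intro allI impI; elim conjE; rule nc graded; assumption)
qed

end
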